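(* Let ${}_3Q$ be the queue length process of a renewal Mittag-Leffler queue with orders $\alpha,\beta\in(0,1)$ and rates $\lambda,\mu>0$. For $\delta>0$ let ${}_3\mathbf{Q}_n(t)=n^{-\delta}\,{}_3Q(nm_nt)$, where, with $\gamma=\max\{1,(\alpha+\beta)^{-1}\}$, $$m_n=\begin{cases}n^{\gamma-1}&\alpha+\beta\ne1,\\ \dfrac{n\sin(\pi\alpha)}{2\lambda\mu}\,\mathbb{E}\left[\sin\left(\dfrac{2\lambda\mu Y_1}{n\sin(\pi\alpha)}\right)\right]&\alpha+\beta=1.\end{cases}$$ Let $\mathbf{W}$ be a standard Brownian motion, and let $L_{\alpha+\beta}$ be an independent inverse $(\alpha+\beta)$-stable subordinator if $\alpha+\beta<1$, while $L_{\alpha+\beta}\equiv\iota$ if $\alpha+\beta\ge1$. Define $$\mathcal{K}=\begin{cases}\left(\dfrac{\lambda\mu\Gamma(1-\alpha)\Gamma(1-\beta)}{\Gamma(1-\alpha-\beta)}\right)^{\frac1{\alpha+\beta}}&\alpha+\beta<1,\\ 1&\alpha+\beta=1,\\ \dfrac{1}{\mathbb{E}[Y_1]}&\alpha+\beta>1.\end{cases}$$ Then, as $n\to+\infty$: (i) if $p>\frac12$, then for $\delta=1$ it holds ${}_3\mathbf{Q}_n\overset{\mathsf U}{\Rightarrow}(2p-1)L_{\alpha+\beta}\circ\iota_{\mathcal K}$; (ii) if $p=\frac12$, then for $\delta=\frac12$ it holds ${}_3\mathbf{Q}_n\overset{\mathsf U}{\Rightarrow}\Phi(\mathbf{W})\circ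 L_{\alpha+\beta}\circ\iota_{\mathcal K}$; (iii) if $p<\frac12$, then for any $\delta>0$ it holds $\lim_{n\to+\infty}\sup_{t\ge0}{}_3\mathbf{Q}_n(t)=0$ almost surely.
   Context: $E_\alpha(x)=\sum_{k\ge0} x^k/\Gamma(\alpha k+1)$ is the Mittag-Leffler function; $X\sim\mathsf{ML}_\alpha(\lambda)$ means $X\ge0$ and $\mathbb{P}(X>t)=E_\alpha(-\lambda t^\alpha)$ for $t\ge 0$. Let $p=\mathbb{P}(X^{(1)}<X^{(2)})$ with $X^{(1)}\sim \mathsf{ML}_\alpha(\lambda)$ and $X^{(2)}\sim\mathsf{ML}_\beta(\mu)$ independent. The renewal Mittag-Leffler queue: let $(\chi_k)_{k\ge1}$ be i.i.d. with $\mathbb{P}(\chi_k=1)=p$, $\mathbb{P}(\chi_k=-1)=1-p$, and $r_0=0$, $r_k=\sum_{j=1}^k\chi_j$. Let $(Y_k)_{k\ge1}$ be i.i.d. with $\mathbb{P}(Y_k>t)=E_\alpha(-\lambda t^\alpha)E_\beta(-\mu t^\beta)$, independent of $(\chi_k)$, $\widetilde N(t)=\max\{k\ge0:\sum_{j=1}^kY_j\le t\}$ and $R(t)=r_{\widetilde N(t)}$. The queue length process is ${}_3Q=\Phi(R)$, where $\Phi(f)(t)=f(t)+\sup_{0\le s\le t}\max\{-f(s),0\}$ is the Skorokhod reflection map. An $a$-stable subordinator $\sigma_a$ ($a\in(0,1)$) is the L\'evy process with $\mathbb{E}[e^{-z\sigma_a(t)}]=e^{-tz^a}$; its inverse is $L_a(t)=\min\{s\ge0:\sigma_a(s)\ge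 t\}$. $\iota_c(t)=ct$ and $\iota=\iota_1$. $\overset{\mathsf U}{\Rightarrow}$ denotes convergence in distribution of processes in the space $\mathbb{D}$ of c\`adl\`ag functions $[0,+\infty)\to\mathbb{R}$ with the topology of uniform convergence on compact sets.
   Formalization: In (iii) the supremum over all t≥0 is replaced by the supremum over [0,T], for every T≥0 simultaneously almost surely; as printed (iii) is false, since p>0 gives arbitrarily long runs of up-steps, so the supremum over all t≥0 is almost surely infinite for all large n. *)

theory Defs
  imports "HOL-Probability.Probability"
begin

section \<open>Mittag-Leffler distributions\<close>

definition mittag_leffler :: "real \<Rightarrow> real \<Rightarrow> real" where
  "mittag_leffler a x = (\<Sum>k. x ^ k / Gamma (a * real k + 1))"

definition mittag_leffler_distributed :: "'a measure \<Rightarrow> ('a \<Rightarrow> real) \<Rightarrow> real \<Rightarrow> real \<Rightarrow> bool" where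
  "mittag_leffler_distributed M X a l \<longleftrightarrow>
     X \<in> borel_measurable M \<and> (AE \<omega> in M. 0 \<le> X \<omega>) \<and>
     (\<forall>t\<ge>0. measure M {\<omega> \<in> space M. t < X \<omega>} = mittag_leffler a (- l * t powr a))"


section \<open>The renewal Mittag-Leffler queue\<close>

text \<open>Sequences are indexed from 1; the variables with index 0 are not used.
  A process is a map from outcomes to paths; only path values at times \<open>t \<ge> 0\<close> matter.\<close>

definition reflection :: "(real \<Rightarrow> real) \<Rightarrow> real \<Rightarrow> real" where
  "reflection f t = f t + (SUP s\<in>{0..t}. max (- f s) 0)"

definition renewal_mittag_leffler_input ::
    "'a measure \<Rightarrow> real \<Rightarrow> real \<Rightarrow> real \<Rightarrow> real \<Rightarrow> real \<Rightarrow>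
     (nat \<Rightarrow> 'a \<Rightarrow> real) \<Rightarrow> (nat \<Rightarrow> 'a \<Rightarrow> real) \<Rightarrow> bool" where
  "renewal_mittag_leffler_input M \<alpha> \<beta> lam mu p \<xi> Y \<longleftrightarrow>
     prob_space M \<and>
     prob_space.indep_vars M (\<lambda>_. borel) \<xi> {1..} \<and>
     (\<forall>k\<ge>1. measure M {\<omega> \<in> space M. \<xi> k \<omega> = 1} = p \<and>
             measure M {\<omega> \<in> space M. \<xi> k \<omega> = - 1} = 1 - p) \<and>
     prob_space.indep_vars M (\<lambda>_. borel) Y {1..} \<and>
     (\<forall>k\<ge>1. \<forall>t\<ge>0. measure M {\<omega> \<in> space M. t < Y k \<omega>} =
        mittag_leffler \<alpha> (- lam * t powr \<alpha>) * mittag_leffler \<beta> (- mu * t powr \<beta>)) \<and>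
     prob_space.indep_var M
       (PiM {1..} (\<lambda>_. borel)) (\<lambda>\<omega>. \<lambda>k\<in>{1..}. \<xi> k \<omega>)
       (PiM {1..} (\<lambda>_. borel)) (\<lambda>\<omega>. \<lambda>k\<in>{1..}. Y k \<omega>)"

definition renewal_count :: "(nat \<Rightarrow> 'a \<Rightarrow> real) \<Rightarrow> 'a \<Rightarrow> real \<Rightarrow> nat" where
  "renewal_count Y \<omega> t = Max {k. (\<Sum>j=1..k. Y j \<omega>) \<le> t}"

definition renewal_walk ::
    "(nat \<Rightarrow> 'a \<Rightarrow> real) \<Rightarrow> (nat \<Rightarrow> 'a \<Rightarrow> real) \<Rightarrow> 'a \<Rightarrow> real \<Rightarrow> real" where
  "renewal_walk \<xi> Y \<omega> t = (\<Sum>j=1..renewal_count Y \<omega> t. \<xi> j \<omega>)"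

definition renewal_queue ::
    "(nat \<Rightarrow> 'a \<Rightarrow> real) \<Rightarrow> (nat \<Rightarrow> 'a \<Rightarrow> real) \<Rightarrow> 'a \<Rightarrow> real \<Rightarrow> real" where
  "renewal_queue \<xi> Y \<omega> = reflection (renewal_walk \<xi> Y \<omega>)"

definition time_scale ::
    "'a measure \<Rightarrow> real \<Rightarrow> real \<Rightarrow> real \<Rightarrow> real \<Rightarrow> (nat \<Rightarrow> 'a \<Rightarrow> real) \<Rightarrow> nat \<Rightarrow> real" where
  "time_scale M \<alpha> \<beta> lam mu Y n =
     (if \<alpha> + \<beta> \<noteq> 1 then real n powr (max 1 (1 / (\<alpha> + \<beta>)) - 1)
      else real n * sin (pi * \<alpha>) / (2 * lam * mu) *
           (\<integral>\<omega>. sin (2 * lam * mu * Y 1 \<omega> / (real n * sin (pi * \<alpha>))) \<partial>M))"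

definition scaled_queue ::
    "'a measure \<Rightarrow> real \<Rightarrow> real \<Rightarrow> real \<Rightarrow> real \<Rightarrow> (nat \<Rightarrow> 'a \<Rightarrow> real) \<Rightarrow> (nat \<Rightarrow> 'a \<Rightarrow> real) \<Rightarrow>
     real \<Rightarrow> nat \<Rightarrow> 'a \<Rightarrow> real \<Rightarrow> real" where
  "scaled_queue M \<alpha> \<beta> lam mu \<xi> Y \<delta> n \<omega> t =
     real n powr (- \<delta>) * renewal_queue \<xi> Y \<omega> (real n * time_scale M \<alpha> \<beta> lam mu Y n * t)"

definition limit_rate ::
    "'a measure \<Rightarrow> real \<Rightarrow> real \<Rightarrow> real \<Rightarrow> real \<Rightarrow> (nat \<Rightarrow> 'a \<Rightarrow> real) \<Rightarrow> real" where
  "limit_rate M \<alpha> \<beta> lam mu Y =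
     (if \<alpha> + \<beta> < 1 then
        (lam * mu * Gamma (1 - \<alpha>) * Gamma (1 - \<beta>) / Gamma (1 - \<alpha> - \<beta>)) powr (1 / (\<alpha> + \<beta>))
      else if \<alpha> + \<beta> = 1 then 1
      else 1 / (\<integral>\<omega>. Y 1 \<omega> \<partial>M))"


section \<open>Convergence in distribution in \<open>D\<close> with the topology of uniform convergence on compacts\<close>

definition cadlag :: "(real \<Rightarrow> real) set" where
  "cadlag = {f. (\<forall>t\<ge>0. (f \<longlongrightarrow> f t) (at_right t)) \<and> (\<forall>t>0. \<exists>l. (f \<longlongrightarrow> l) (at_left t))}"

text \<open>Two functions that agree on \<open>[0,\<infinity>)\<close> are not separated by this topology, so its
  continuous functionals depend only on the restriction to \<open>[0,\<infinity>)\<close>.\<close>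

definition locally_uniform_topology :: "(real \<Rightarrow> real) topology" where
  "locally_uniform_topology = topology (\<lambda>U. U \<subseteq> cadlag \<and>
     (\<forall>f\<in>U. \<exists>T\<ge>0. \<exists>e>0. \<forall>g\<in>cadlag. (\<forall>t\<in>{0..T}. \<bar>g t - f t\<bar> < e) \<longrightarrow> g \<in> U))"

lemma openin_locally_uniform_topology:
  "openin locally_uniform_topology U \<longleftrightarrow> U \<subseteq> cadlag \<and>
     (\<forall>f\<in>U. \<exists>T\<ge>0. \<exists>e>0. \<forall>g\<in>cadlag. (\<forall>t\<in>{0..T}. \<bar>g t - f t\<bar> < e) \<longrightarrow> g \<in> U)"
proof -
  define P where "P = (\<lambda>U. U \<subseteq> cadlag \<and>
     (\<forall>f\<in>U. \<exists>T\<ge>0. \<exists>e>0. \<forall>g\<in>cadlag. (\<forall>t\<in>{0..T}. \<bar>g t - f t\<bar> < (e::real)) \<longrightarrow> g \<in> U))"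
  have "P (S \<inter> S')" if PS: "P S" "P S'" for S S'
    unfolding P_def
  proof (intro conjI ballI)
    show "S \<inter> S' \<subseteq> cadlag"
      using PS unfolding P_def by blast
    fix f assume f: "f \<in> S \<inter> S'"
    obtain T e where T: "T \<ge> 0" "e > 0"
        "\<And>g. g \<in> cadlag \<Longrightarrow> (\<forall>t\<in>{0..T}. \<bar>g t - f t\<bar> < (e::real)) \<Longrightarrow> g \<in> S"
      using PS(1) f unfolding P_def by blast
    obtain T' e' where T': "T' \<ge> 0" "e' > 0"
        "\<And>g. g \<in> cadlag \<Longrightarrow> (\<forall>t\<in>{0..T'}. \<bar>g t - f t\<bar> < (e'::real)) \<Longrightarrow> g \<in> S'"
      using PS(2) f unfolding P_def by blast
    show "\<exists>T\<ge>0. \<exists>e>0. \<forall>g\<in>cadlag. (\<forall>t\<in>{0..T}. \<bar>g t - f t\<bar> < (e::real)) \<longrightarrow> g \<in> S \<inter> S'"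
    proof (rule exI[of _ "max T T'"], intro conjI exI[of _ "min e e'"] ballI impI IntI)
      show "0 \<le> max T T'" "0 < min e e'" using T T' by auto
      fix g assume g: "g \<in> cadlag" "\<forall>t\<in>{0..max T T'}. \<bar>g t - f t\<bar> < min e e'"
      have "\<forall>t\<in>{0..T}. \<bar>g t - f t\<bar> < e" "\<forall>t\<in>{0..T'}. \<bar>g t - f t\<bar> < e'"
        using g(2) by auto
      with g(1) T(3) T'(3) show "g \<in> S" "g \<in> S'" by blast+
    qed
  qed
  moreover have "P (\<Union>K)" if PK: "\<And>S. S \<in> K \<Longrightarrow> P S" for K
    unfolding P_def
  proof (intro conjI ballI)
    show "\<Union>K \<subseteq> cadlag"
      using PK unfolding P_def by blast
    fix f assume "f \<in> \<Union>K"
    then obtain S where S: "S \<in> K" "f \<in> S" by blast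
    then obtain T e where T: "T \<ge> 0" "e > 0"
        "\<And>g. g \<in> cadlag \<Longrightarrow> (\<forall>t\<in>{0..T}. \<bar>g t - f t\<bar> < (e::real)) \<Longrightarrow> g \<in> S"
      using PK[OF S(1)] unfolding P_def by blast
    show "\<exists>T\<ge>0. \<exists>e>0. \<forall>g\<in>cadlag. (\<forall>t\<in>{0..T}. \<bar>g t - f t\<bar> < (e::real)) \<longrightarrow> g \<in> \<Union>K"
      using T S by blast
  qed
  ultimately have "istopology P"
    unfolding istopology_def by blast
  then show ?thesis
    unfolding locally_uniform_topology_def P_def by (simp add: topology_inverse')
qed

lemma topspace_locally_uniform_topology: "topspace locally_uniform_topology = cadlag"
proof
  show "topspace locally_uniform_topology \<subseteq> cadlag"
    using openin_topspace[of locally_uniform_topology]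
    unfolding openin_locally_uniform_topology by blast
  have "openin locally_uniform_topology cadlag"
    unfolding openin_locally_uniform_topology by (auto intro: exI[of _ "0::real"] exI[of _ "1::real"])
  then show "cadlag \<subseteq> topspace locally_uniform_topology"
    by (rule openin_subset)
qed

definition outer_expectation :: "'a measure \<Rightarrow> ('a \<Rightarrow> real) \<Rightarrow> real" where
  "outer_expectation M f =
     (INF g\<in>{g. integrable M g \<and> (AE \<omega> in M. f \<omega> \<le> g \<omega>)}. \<integral>\<omega>. g \<omega> \<partial>M)"

text \<open>This topology is not separable, and a jump process is in general not a Borel measurable
  random element, so \<open>E F(X\<^sub>n)\<close> need not exist for a continuous \<open>F\<close>. Convergence in
  distribution is therefore taken in the sense of Hoffmann-Jorgensen: the limit is a genuine random
  element (all bounded continuous functionals of it are measurable, up to null sets), and outer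
  expectations along the sequence converge to the expectation of the limit, for every bounded
  continuous \<open>F\<close>. Applied to \<open>- F\<close> this gives inner expectations too, and
  \<open>E F(X\<^sub>n) \<longlonglongrightarrow> E F(X)\<close> whenever \<open>F(X\<^sub>n)\<close> is measurable.\<close>

definition converges_in_distribution_U ::
    "'a measure \<Rightarrow> (nat \<Rightarrow> 'a \<Rightarrow> real \<Rightarrow> real) \<Rightarrow> 'b measure \<Rightarrow> ('b \<Rightarrow> real \<Rightarrow> real) \<Rightarrow> bool" where
  "converges_in_distribution_U M X N Z \<longleftrightarrow>
     (\<forall>\<^sub>F n in sequentially. AE \<omega> in M. X n \<omega> \<in> cadlag) \<and>
     (AE \<omega> in N. Z \<omega> \<in> cadlag) \<and>
     (\<forall>F. continuous_map locally_uniform_topology euclideanreal F \<and> bounded (F ` cadlag) \<longrightarrow>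
        (\<lambda>\<omega>. F (Z \<omega>)) \<in> borel_measurable (completion N) \<and>
        (\<lambda>n. outer_expectation M (\<lambda>\<omega>. F (X n \<omega>)))
          \<longlonglongrightarrow> (\<integral>\<omega>. F (Z \<omega>) \<partial>completion N))"


section \<open>Brownian motion and inverse stable subordinators\<close>

definition independent_increments :: "'b measure \<Rightarrow> ('b \<Rightarrow> real \<Rightarrow> real) \<Rightarrow> bool" where
  "independent_increments N X \<longleftrightarrow>
     (\<forall>(s :: nat \<Rightarrow> real) n. 0 \<le> s 0 \<and> (\<forall>i<n. s i \<le> s (Suc i)) \<longrightarrow>
        prob_space.indep_vars N (\<lambda>_. borel) (\<lambda>i \<omega>. X \<omega> (s (Suc i)) - X \<omega> (s i)) {..<n})"

definition standard_brownian_motion :: "'b measure \<Rightarrow> ('b \<Rightarrow> real \<Rightarrow> real) \<Rightarrow> bool" where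
  "standard_brownian_motion N W \<longleftrightarrow>
     (\<forall>t\<ge>0. (\<lambda>\<omega>. W \<omega> t) \<in> borel_measurable N) \<and>
     (AE \<omega> in N. W \<omega> 0 = 0) \<and>
     (AE \<omega> in N. continuous_on {0..} (W \<omega>)) \<and>
     independent_increments N W \<and>
     (\<forall>s\<ge>0. \<forall>t>s. distributed N lborel (\<lambda>\<omega>. W \<omega> t - W \<omega> s) (normal_density 0 (sqrt (t - s))))"

definition levy_process :: "'b measure \<Rightarrow> ('b \<Rightarrow> real \<Rightarrow> real) \<Rightarrow> bool" where
  "levy_process N X \<longleftrightarrow>
     (\<forall>t\<ge>0. (\<lambda>\<omega>. X \<omega> t) \<in> borel_measurable N) \<and>
     (AE \<omega> in N. X \<omega> 0 = 0) \<and>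
     (AE \<omega> in N. X \<omega> \<in> cadlag) \<and>
     independent_increments N X \<and>
     (\<forall>s\<ge>0. \<forall>h\<ge>0. distr N borel (\<lambda>\<omega>. X \<omega> (s + h) - X \<omega> s) = distr N borel (\<lambda>\<omega>. X \<omega> h))"

definition stable_subordinator :: "'b measure \<Rightarrow> real \<Rightarrow> ('b \<Rightarrow> real \<Rightarrow> real) \<Rightarrow> bool" where
  "stable_subordinator N a \<sigma> \<longleftrightarrow>
     levy_process N \<sigma> \<and>
     (AE \<omega> in N. mono_on {0..} (\<sigma> \<omega>)) \<and>
     (\<forall>t\<ge>0. \<forall>z\<ge>0. (\<integral>\<omega>. exp (- z * \<sigma> \<omega> t) \<partial>N) = exp (- t * z powr a))"

definition inverse_stable_subordinator :: "'b measure \<Rightarrow> real \<Rightarrow> ('b \<Rightarrow> real \<Rightarrow> real) \<Rightarrow> bool" where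
  "inverse_stable_subordinator N a L \<longleftrightarrow>
     (\<exists>\<sigma>. stable_subordinator N a \<sigma> \<and>
        (AE \<omega> in N. \<forall>t\<ge>0. L \<omega> t = (LEAST s. 0 \<le> s \<and> t \<le> \<sigma> \<omega> s)))"

definition independent_processes ::
    "'b measure \<Rightarrow> ('b \<Rightarrow> real \<Rightarrow> real) \<Rightarrow> ('b \<Rightarrow> real \<Rightarrow> real) \<Rightarrow> bool" where
  "independent_processes N X Z \<longleftrightarrow>
     prob_space.indep_var N
       (PiM {0..} (\<lambda>_. borel)) (\<lambda>\<omega>. restrict (X \<omega>) {0..})
       (PiM {0..} (\<lambda>_. borel)) (\<lambda>\<omega>. restrict (Z \<omega>) {0..})"


section \<open>Almost sure convergence to 0\<close>

text \<open>Convergence to 0 holds uniformly on compact time sets, in accordance with the topology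
  above. Uniformity over all of \<open>[0,\<infinity>)\<close> would be false for the queue: its upward step
  probability \<open>p\<close> is positive, so almost surely there are arbitrarily long runs of
  upward steps, and \<open>sup\<^bsub>t \<ge> 0\<^esub> Q(t) = \<infinity>\<close>. The supremum is taken in the extended
  reals, so that an unbounded path does not get a spurious real supremum.\<close>

definition AE_locally_uniformly_vanishing ::
    "'a measure \<Rightarrow> (nat \<Rightarrow> 'a \<Rightarrow> real \<Rightarrow> real) \<Rightarrow> bool" where
  "AE_locally_uniformly_vanishing M X \<longleftrightarrow>
     (AE \<omega> in M. \<forall>T\<ge>0. (\<lambda>n. SUP t\<in>{0..T}. ereal (X n \<omega> t)) \<longlonglongrightarrow> 0)"

end

theory Submission
  imports Defs "HOL-Real_Asymp.Real_Asymp"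
begin

text \<open>Cut the indices \<open>1, 2, \<dots>\<close> of the steps into blocks of about \<open>n / (m + 1)\<close> consecutive ones. For fixed \<open>m\<close>
  the block sums of the steps and of the waiting times converge jointly as \<open>n\<close> grows, because the two
  families are independent: the former, for \<open>p = 1/2\<close>, to Brownian increments by the central limit
  theorem, the latter to increments of the stable subordinator (of the identity if
  \<open>\<alpha> + \<beta> \<ge> 1\<close>) by convergence of Laplace transforms, the asymptotics of which follow from the tail
  \<open>P(Y > t) \<sim> A t powr (- (\<alpha> + \<beta>))\<close>. A continuous function of the block sums (Lindley's recursion in space,
  linear interpolation in time) approximates the path of the queue, uniformly on compact time sets and outside
  an event whose probability vanishes as \<open>m\<close> grows, and the same function of the limiting
  increments approximates the path of the limit. The approximations take values in continuous paths
  and depend on finitely many random variables, so no measurability of the queue itself is needed.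
  For \<open>p < 1/2\<close> the reflected walk has exponential tails, and the Borel-Cantelli lemma applies.\<close>

section \<open>Convergence in distribution from approximation of paths\<close>

text \<open>The space of paths is not separable, so neither tightness nor a representation theorem
  can be applied to the queue itself. Hence two limits are kept apart: for fixed \<open>m\<close>
  weak convergence is needed only on countable products of real lines, and the error of the
  approximation is small in probability when \<open>n\<close> tends to infinity before
  \<open>m\<close>. Time increments enter through their logarithms, so that the time nodes built
  from them are always strictly increasing and interpolation is jointly continuous in time and
  increments. The three regimes of \<alpha> + \<beta> meet in a single limit:
  \<open>real n * (1 - \<L> (z / scale n))\<close> tends to \<open>(z / rate) powr index\<close>,
  where \<open>index\<close> is the minimum of \<alpha> + \<beta> and 1. From there on the identity
  is treated as the subordinator of index 1. The sine in the critical time scale works because its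
  mean and the Laplace transform differ from a common truncated mean by bounded amounts, while that
  mean diverges. For p > 1/2 the normalized space increments diverge, but the walk is nearly a
  straight line in the number of steps; they are multiplied by 0 and only the time increments stay
  random.\<close>

definition uniformly_close :: "real \<Rightarrow> (real \<Rightarrow> real) \<Rightarrow> (real \<Rightarrow> real) \<Rightarrow> bool" where
  "uniformly_close \<rho> f g \<longleftrightarrow> (\<forall>t\<in>{0..1/\<rho>}. \<bar>f t - g t\<bar> \<le> \<rho>)"

lemma uniformly_close_sym: "uniformly_close \<rho> f g \<longleftrightarrow> uniformly_close \<rho> g f"
  unfolding uniformly_close_def by (simp add: abs_minus_commute)

lemma uniformly_close_refl: "0 \<le> \<rho> \<Longrightarrow> uniformly_close \<rho> f f"
  unfolding uniformly_close_def by simp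

text \<open>The parameter is at once the tolerance and the reciprocal of the time horizon: a larger
  radius also shortens the window, so radii add as in a metric.\<close>

lemma uniformly_close_trans:
  assumes "uniformly_close \<rho> f g" "uniformly_close \<eta> g h" "0 < \<rho>" "0 < \<eta>"
  shows "uniformly_close (\<rho> + \<eta>) f h"
  unfolding uniformly_close_def
proof
  fix t assume t: "t \<in> {0..1 / (\<rho> + \<eta>)}"
  have "1 / (\<rho> + \<eta>) \<le> 1 / \<rho>" "1 / (\<rho> + \<eta>) \<le> 1 / \<eta>"
    using assms(3,4) by (auto intro!: divide_left_mono)
  then have "\<bar>f t - g t\<bar> \<le> \<rho>" "\<bar>g t - h t\<bar> \<le> \<eta>"
    using t assms(1,2) unfolding uniformly_close_def by auto
  then show "\<bar>f t - h t\<bar> \<le> \<rho> + \<eta>" by linarith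
qed

lemma uniformly_close_mono:
  assumes "uniformly_close \<rho> f g" "0 < \<rho>" "\<rho> \<le> \<eta>"
  shows "uniformly_close \<eta> f g"
proof -
  have "1 / \<eta> \<le> 1 / \<rho>" using assms(2,3) by (intro divide_left_mono) auto
  then have "t \<in> {0..1/\<rho>}" if "t \<in> {0..1/\<eta>}" for t using that by auto
  then show ?thesis using assms unfolding uniformly_close_def by (meson order_trans)
qed

lemma continuous_on_imp_cadlag:
  assumes "continuous_on {0..} f"
  shows "f \<in> cadlag"
  unfolding cadlag_def
proof (intro CollectI conjI allI impI)
  fix t :: real assume t: "0 \<le> t"
  have "(f \<longlongrightarrow> f t) (at t within {0..})"
    using assms t by (auto simp: continuous_on_def)
  then show "(f \<longlongrightarrow> f t) (at_right t)"
    by (rule tendsto_within_subset) (use t in auto)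
next
  fix t :: real assume t: "0 < t"
  have "(f \<longlongrightarrow> f t) (at t within {0..})"
    using assms t by (auto simp: continuous_on_def)
  then have "(f \<longlongrightarrow> f t) (at t)"
    using t at_within_interior[of t "{0..}"] by (simp add: interior_real_atLeast)
  then show "\<exists>l. (f \<longlongrightarrow> l) (at_left t)"
    using tendsto_within_subset by (metis UNIV_I subsetI)
qed

lemma continuous_functionalD:
  assumes F: "continuous_map locally_uniform_topology euclideanreal F"
    and f: "f \<in> cadlag" and e: "0 < (e::real)"
  shows "\<exists>\<rho>>0. \<rho> \<le> 1 \<and> (\<forall>g\<in>cadlag. uniformly_close \<rho> f g \<longrightarrow> \<bar>F g - F f\<bar> < e)"
proof -
  let ?U = "{x \<in> topspace locally_uniform_topology. F x \<in> ball (F f) e}"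
  have "openin locally_uniform_topology ?U"
    using F by (intro openin_continuous_map_preimage[of _ euclideanreal]) auto
  moreover have "f \<in> ?U" using f e by (simp add: topspace_locally_uniform_topology)
  ultimately obtain T d where Td: "T \<ge> 0" "d > 0"
    "\<And>g. g \<in> cadlag \<Longrightarrow> (\<forall>t\<in>{0..T}. \<bar>g t - f t\<bar> < d) \<Longrightarrow> g \<in> ?U"
    unfolding openin_locally_uniform_topology by blast
  \<comment> \<open>Half of \<open>d\<close> turns the non-strict bound of
    \<open>uniformly_close\<close> into a strict one, and \<open>1 / (T + 1)\<close> makes the
    window reach beyond \<open>T\<close>.\<close>
  define \<rho> where "\<rho> = min 1 (min (d/2) (1 / (T + 1)))"
  have \<rho>: "0 < \<rho>" "\<rho> \<le> 1" "\<rho> < d" "T \<le> 1 / \<rho>"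
  proof -
    show "0 < \<rho>" "\<rho> \<le> 1" "\<rho> < d" using Td by (auto simp: \<rho>_def)
    have "\<rho> \<le> 1 / (T + 1)" by (simp add: \<rho>_def)
    then have "T + 1 \<le> 1 / \<rho>" using \<open>0 < \<rho>\<close> Td(1)
      by (simp add: field_simps)
    then show "T \<le> 1 / \<rho>" by simp
  qed
  have "\<bar>F g - F f\<bar> < e" if g: "g \<in> cadlag" "uniformly_close \<rho> f g" for g
  proof -
    have "\<bar>g t - f t\<bar> < d" if "t \<in> {0..T}" for t
    proof -
      have "t \<in> {0..1/\<rho>}" using that \<rho>(4) by auto
      then have "\<bar>f t - g t\<bar> \<le> \<rho>" using g(2) unfolding uniformly_close_def by blast
      then show ?thesis using \<rho>(3) by linarith
    qed
    then have "g \<in> ?U" using Td(3) g(1) by blast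
    then show ?thesis by (simp add: dist_real_def abs_minus_commute)
  qed
  then show ?thesis using \<rho> by blast
qed

text \<open>Continuity in metric form, so that auxiliary functionals such as the oscillation radius
  and its cutoffs can be handled like the given one without exhibiting open sets.\<close>

definition path_continuous :: "((real \<Rightarrow> real) \<Rightarrow> real) \<Rightarrow> bool" where
  "path_continuous F \<longleftrightarrow> (\<forall>f\<in>cadlag. \<forall>e>0. \<exists>\<rho>>0. \<forall>g\<in>cadlag. uniformly_close \<rho> f g \<longrightarrow> \<bar>F g - F f\<bar> < e)"

text \<open>This radius replaces tightness, which is not available without separability: it is a continuous
  functional that is positive on \<open>cadlag\<close>, hence unlikely to be small.\<close>

definition oscillation_radius :: "((real \<Rightarrow> real) \<Rightarrow> real) \<Rightarrow> real \<Rightarrow> (real \<Rightarrow> real) \<Rightarrow> real" where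
  "oscillation_radius F e f = Sup (insert 0 {\<rho>. 0 < \<rho> \<and> \<rho> \<le> 1 \<and>
     (\<forall>g\<in>cadlag. \<forall>h\<in>cadlag. uniformly_close \<rho> f g \<longrightarrow> uniformly_close \<rho> f h \<longrightarrow> \<bar>F g - F h\<bar> \<le> e)})"

lemma oscillation_radius_bdd:
  "bdd_above (insert 0 {\<rho>::real. 0 < \<rho> \<and> \<rho> \<le> 1 \<and> Q \<rho>})"
  by (rule bdd_aboveI[of _ 1]) auto

lemma oscillation_radius_bounds: "0 \<le> oscillation_radius F e f" "oscillation_radius F e f \<le> 1"
  unfolding oscillation_radius_def
  by (rule cSup_upper[OF _ oscillation_radius_bdd], simp) (rule cSup_least, auto)

text \<open>The ball of radius \<rho> - \<eta> about \<open>f'\<close> lies in the ball of radius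
  \<rho> about \<open>f\<close>, so the admissible radius shrinks by at most \<eta>.\<close>

lemma oscillation_radius_lipschitz:
  assumes "uniformly_close \<eta> f f'" "0 < \<eta>"
  shows "oscillation_radius F e f \<le> oscillation_radius F e f' + \<eta>"
  unfolding oscillation_radius_def[of F e f]
proof (rule cSup_least)
  fix \<rho> assume "\<rho> \<in> insert 0 {\<rho>. 0 < \<rho> \<and> \<rho> \<le> 1 \<and>
     (\<forall>g\<in>cadlag. \<forall>h\<in>cadlag. uniformly_close \<rho> f g \<longrightarrow> uniformly_close \<rho> f h \<longrightarrow> \<bar>F g - F h\<bar> \<le> e)}"
  then consider "\<rho> \<le> \<eta>" | "\<eta> < \<rho>" "\<rho> \<le> 1"
    "\<And>g h. g \<in> cadlag \<Longrightarrow> h \<in> cadlag \<Longrightarrow> uniformly_close \<rho> f g \<Longrightarrow> uniformly_close \<rho> f h \<Longrightarrow> \<bar>F g - F h\<bar> \<le> e"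
    using assms(2) by force
  then show "\<rho> \<le> oscillation_radius F e f' + \<eta>"
  proof cases
    case 1 then show ?thesis using oscillation_radius_bounds(1)[of F e f'] by linarith
  next
    case 2
    have "\<rho> - \<eta> \<le> oscillation_radius F e f'"
      unfolding oscillation_radius_def
    proof (rule cSup_upper[OF _ oscillation_radius_bdd], intro insertI2 CollectI conjI ballI impI)
      fix g h assume gh: "g \<in> cadlag" "h \<in> cadlag"
        "uniformly_close (\<rho> - \<eta>) f' g" "uniformly_close (\<rho> - \<eta>) f' h"
      have "uniformly_close (\<eta> + (\<rho> - \<eta>)) f g" "uniformly_close (\<eta> + (\<rho> - \<eta>)) f h"
        using gh(3,4) assms 2(1) by (intro uniformly_close_trans[of _ f f']; simp)+
      then show "\<bar>F g - F h\<bar> \<le> e" using 2(3) gh by simp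
    qed (use 2 assms(2) in auto)
    then show ?thesis by simp
  qed
qed simp

text \<open>The centre \<open>f\<close> will be the approximating path, whose oscillation radius is
  a random variable; \<open>g\<close> will be the queue path, which need not be measurable.\<close>

lemma oscillation_radiusD:
  assumes "\<rho> < oscillation_radius F e f" "0 < \<rho>" "f \<in> cadlag" "g \<in> cadlag" "uniformly_close \<rho> f g"
  shows "\<bar>F f - F g\<bar> \<le> e"
proof -
  obtain \<eta> where \<eta>: "\<eta> \<in> insert 0 {\<rho>. 0 < \<rho> \<and> \<rho> \<le> 1 \<and>
     (\<forall>g\<in>cadlag. \<forall>h\<in>cadlag. uniformly_close \<rho> f g \<longrightarrow> uniformly_close \<rho> f h \<longrightarrow> \<bar>F g - F h\<bar> \<le> e)}" "\<rho> < \<eta>"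
    using assms(1) unfolding oscillation_radius_def by (rule less_cSupE) blast
  have close: "uniformly_close \<eta> f g" "uniformly_close \<eta> f f"
    using assms(2,5) \<eta>(2) by (auto intro: uniformly_close_mono[of \<rho>] uniformly_close_refl)
  have "\<eta> \<noteq> 0" using \<eta>(2) assms(2) by simp
  then show ?thesis using \<eta>(1) close assms(3,4) by blast
qed

lemma oscillation_radius_pos:
  assumes F: "path_continuous F" and f: "f \<in> cadlag" and e: "0 < e"
  shows "0 < oscillation_radius F e f"
proof -
  obtain \<rho> where \<rho>: "0 < \<rho>" "\<And>g. g \<in> cadlag \<Longrightarrow> uniformly_close \<rho> f g \<Longrightarrow> \<bar>F g - F f\<bar> < e/2"
    using F f e unfolding path_continuous_def by (meson half_gt_zero)
  define \<eta> where "\<eta> = min \<rho> 1"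
  have \<eta>: "0 < \<eta>" "\<eta> \<le> 1" using \<rho> by (auto simp: \<eta>_def)
  have close: "\<bar>F g - F f\<bar> < e/2" if "g \<in> cadlag" "uniformly_close \<eta> f g" for g
    using \<rho>(2)[OF that(1)] uniformly_close_mono[OF that(2) \<eta>(1), of \<rho>] by (simp add: \<eta>_def)
  have "\<eta> \<le> oscillation_radius F e f"
    unfolding oscillation_radius_def
  proof (rule cSup_upper[OF _ oscillation_radius_bdd], intro insertI2 CollectI conjI ballI impI \<eta>)
    fix g h assume "g \<in> cadlag" "h \<in> cadlag" "uniformly_close \<eta> f g" "uniformly_close \<eta> f h"
    then have "\<bar>F g - F f\<bar> < e/2" "\<bar>F h - F f\<bar> < e/2" using close by auto
    then show "\<bar>F g - F h\<bar> \<le> e" by linarith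
  qed
  then show ?thesis using \<eta> by linarith
qed

lemma path_continuous_oscillation_radius: "path_continuous (oscillation_radius F e)"
  unfolding path_continuous_def
proof (intro ballI allI impI)
  fix f and d :: real assume "0 < d"
  moreover have "\<bar>oscillation_radius F e g - oscillation_radius F e f\<bar> < d"
    if "uniformly_close (d/2) f g" for g
    using oscillation_radius_lipschitz[OF that, of F e] that \<open>0 < d\<close>
      oscillation_radius_lipschitz[OF that[unfolded uniformly_close_sym[of _ f]], of F e] by auto
  ultimately show "\<exists>\<rho>>0. \<forall>g\<in>cadlag. uniformly_close \<rho> f g \<longrightarrow> \<bar>oscillation_radius F e g - oscillation_radius F e f\<bar> < d"
    by (intro exI[of _ "d/2"]) auto
qed

lemma path_continuous_compose:
  assumes F: "path_continuous F" and h: "continuous_on UNIV (h :: real \<Rightarrow> real)"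
  shows "path_continuous (\<lambda>f. h (F f))"
  unfolding path_continuous_def
proof (intro ballI allI impI)
  fix f and e :: real assume f: "f \<in> cadlag" and e: "0 < e"
  have "isCont h (F f)" using h by (simp add: continuous_on_eq_continuous_at)
  then obtain d where d: "d > 0" "\<And>y. \<bar>y - F f\<bar> < d \<Longrightarrow> \<bar>h y - h (F f)\<bar> < e"
    using e by (auto simp: continuous_at_eps_delta dist_real_def)
  then show "\<exists>\<rho>>0. \<forall>g\<in>cadlag. uniformly_close \<rho> f g \<longrightarrow> \<bar>h (F g) - h (F f)\<bar> < e"
    using F f unfolding path_continuous_def by meson
qed

text \<open>Completeness turns equality almost everywhere into measurability; functionals of the
  limit become measurable for \<open>completion N\<close> in this way.\<close>

lemma (in complete_measure) borel_measurable_AE_eq: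
  assumes ae: "AE x in M. f x = g x" and f: "f \<in> borel_measurable M"
  shows "g \<in> borel_measurable M"
proof (rule measurableI)
  fix A :: "'b set" assume "A \<in> sets borel"
  then have "f -` A \<inter> space M \<in> sets M" using f by (rule measurable_sets[rotated])
  moreover have "AE x in M. x \<in> f -` A \<inter> space M \<longleftrightarrow> x \<in> g -` A \<inter> space M"
    using ae AE_space by eventually_elim auto
  ultimately show "g -` A \<inter> space M \<in> sets M"
    using in_sets_AE by blast
qed simp

text \<open>The law of \<open>Z\<close> and that of \<open>X\<^sub>n\<close> are both compared with random elements \<open>G\<^sub>m U\<close> that
  depend continuously on a random element \<open>U\<close> of a nice space; the distance of \<open>X\<^sub>n\<close> from its
  approximation needs to be controlled in outer probability only.\<close>

locale path_approximation =
  M: prob_space M + N: prob_space N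
  for M :: "'a measure" and N :: "'b measure" +
  fixes X :: "nat \<Rightarrow> 'a \<Rightarrow> real \<Rightarrow> real" and Z :: "'b \<Rightarrow> real \<Rightarrow> real"
    and U :: "nat \<Rightarrow> nat \<Rightarrow> 'a \<Rightarrow> 's::second_countable_topology" and V :: "nat \<Rightarrow> 'b \<Rightarrow> 's"
    and G :: "nat \<Rightarrow> 's \<Rightarrow> real \<Rightarrow> real"
  assumes U_meas [measurable]: "\<And>m n. U m n \<in> borel_measurable M"
    and V_meas [measurable]: "\<And>m. V m \<in> borel_measurable N"
    and U_conv: "\<And>m \<phi>. continuous_on UNIV \<phi> \<Longrightarrow> bounded (range \<phi>) \<Longrightarrow>
       (\<lambda>n. \<integral>\<omega>. \<phi> (U m n \<omega>) \<partial>M) \<longlonglongrightarrow> (\<integral>\<omega>. (\<phi> (V m \<omega>) :: real) \<partial>N)"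
    and G_cont: "\<And>m. continuous_on (UNIV \<times> {0..}) (\<lambda>(u, t). G m u t)"
    and X_cadlag: "\<forall>\<^sub>F n in sequentially. AE \<omega> in M. X n \<omega> \<in> cadlag"
    and X_close: "\<And>\<rho>. 0 < \<rho> \<Longrightarrow> \<forall>\<^sub>F m in sequentially. \<forall>\<^sub>F n in sequentially.
       \<exists>E\<in>sets M. measure M E \<le> \<rho> \<and> (\<forall>\<omega>\<in>space M - E. uniformly_close \<rho> (X n \<omega>) (G m (U m n \<omega>)))"
    and Z_close: "AE \<omega> in N. \<forall>\<rho>>0. \<forall>\<^sub>F m in sequentially. uniformly_close \<rho> (Z \<omega>) (G m (V m \<omega>))"
begin

lemma G_cadlag: "G m u \<in> cadlag"
proof (rule continuous_on_imp_cadlag)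
  have "continuous_on {0..} ((\<lambda>(u, t). G m u t) \<circ> (\<lambda>t. (u, t)))"
    by (rule continuous_on_compose) (auto intro!: continuous_intros continuous_on_subset[OF G_cont])
  then show "continuous_on {0..} (G m u)" by (simp add: o_def)
qed

text \<open>Almost every path of \<open>Z\<close> is a locally uniform limit of the continuous paths
  \<open>G m (V m \<omega>)\<close>, hence itself continuous.\<close>

lemma Z_cadlag: "AE \<omega> in N. Z \<omega> \<in> cadlag"
  using Z_close
proof eventually_elim
  case (elim \<omega>)
  have "continuous_on {0..} (Z \<omega>)"
  proof -
    have "continuous (at t within {0..}) (Z \<omega>)" if t: "t \<in> {0..}" for t
    proof -
      have "uniform_limit {0..t+1} (\<lambda>m. G m (V m \<omega>)) (Z \<omega>) sequentially"
        unfolding uniform_limit_iff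
      proof (intro allI impI)
        fix e :: real assume e: "0 < e"
        define \<rho> where "\<rho> = min (e/2) (1 / (t + 1))"
        have \<rho>: "0 < \<rho>" using e t by (auto simp: \<rho>_def)
        have "\<rho> \<le> 1 / (t + 1)" by (simp add: \<rho>_def)
        then have tr: "t + 1 \<le> 1 / \<rho>" using \<rho> t by (simp add: field_simps)
        have "\<forall>\<^sub>F m in sequentially. uniformly_close \<rho> (Z \<omega>) (G m (V m \<omega>))"
          using elim \<rho> by blast
        then show "\<forall>\<^sub>F m in sequentially. \<forall>x\<in>{0..t + 1}. dist (G m (V m \<omega>) x) (Z \<omega> x) < e"
        proof eventually_elim
          case (elim m)
          show ?case
          proof
            fix x assume "x \<in> {0..t + 1}"
            then have "x \<in> {0..1/\<rho>}" using tr by auto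
            then have "\<bar>Z \<omega> x - G m (V m \<omega>) x\<bar> \<le> \<rho>"
              using elim unfolding uniformly_close_def by blast
            moreover have "\<rho> < e" using e by (auto simp: \<rho>_def)
            ultimately show "dist (G m (V m \<omega>) x) (Z \<omega> x) < e" by (simp add: dist_real_def)
          qed
        qed
      qed
      moreover have "continuous_on {0..t+1} (G m (V m \<omega>))" for m
      proof -
        have "continuous_on {0..t+1} ((\<lambda>(u, t). G m u t) \<circ> (\<lambda>t. (V m \<omega>, t)))"
          by (rule continuous_on_compose) (auto intro!: continuous_intros continuous_on_subset[OF G_cont])
        then show ?thesis by (simp add: o_def)
      qed
      ultimately have "continuous_on {0..t+1} (Z \<omega>)"
        by (intro uniform_limit_theorem[OF always_eventually]) auto
      then have "continuous (at t within {0..t+1}) (Z \<omega>)"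
        using t by (auto simp: continuous_on_eq_continuous_within)
      moreover have "at t within {0..t+1} = at t within {0..}"
        by (rule at_within_nhd[of _ "{t-1<..<t+1}"]) (use t in auto)
      ultimately show ?thesis by (simp add: continuous_within)
    qed
    then show ?thesis by (simp add: continuous_on_eq_continuous_within)
  qed
  then show ?case by (rule continuous_on_imp_cadlag)
qed

text \<open>Tube lemma: joint continuity over the compact window \<open>{0..1/\<rho>}\<close> makes
  \<open>G m u\<close> uniformly close to \<open>G m u0\<close> for all \<open>u\<close> near
  \<open>u0\<close>.\<close>

lemma continuous_functional_G:
  assumes F: "path_continuous F"
  shows "continuous_on UNIV (\<lambda>u. F (G m u))"
proof -
  have "((\<lambda>u. F (G m u)) \<longlongrightarrow> F (G m u0)) (at u0)" for u0
  proof (rule tendstoI)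
    fix e :: real assume "0 < e"
    then obtain \<rho> where \<rho>: "0 < \<rho>"
      "\<And>g. g \<in> cadlag \<Longrightarrow> uniformly_close \<rho> (G m u0) g \<Longrightarrow> \<bar>F g - F (G m u0)\<bar> < e"
      using F G_cadlag unfolding path_continuous_def by blast
    have "continuous_on (UNIV \<times> {0..1/\<rho>}) (\<lambda>(u, t). G m u t)"
      by (rule continuous_on_subset[OF G_cont]) auto
    then obtain X0 where X0: "u0 \<in> X0" "open X0"
      "\<forall>x\<in>X0 \<inter> UNIV. \<forall>t\<in>{0..1/\<rho>}. dist ((\<lambda>(u, t). G m u t) (x, t)) ((\<lambda>(u, t). G m u t) (u0, t)) \<le> \<rho>"
      using \<rho>(1) by (elim continuous_on_prod_compactE[where e=\<rho> and ?x0.0=u0]) auto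
    have "\<bar>F (G m u) - F (G m u0)\<bar> < e" if "u \<in> X0" for u
      using X0(3) that by (intro \<rho>(2) G_cadlag) (auto simp: uniformly_close_def dist_real_def abs_minus_commute)
    then show "\<forall>\<^sub>F u in at u0. dist (F (G m u)) (F (G m u0)) < e"
      unfolding eventually_at_topological dist_real_def using X0 by blast
  qed
  then show ?thesis by (simp add: continuous_on_def)
qed

lemma measurable_functional_G:
  assumes "path_continuous F"
  shows "(\<lambda>u. F (G m u)) \<in> borel_measurable borel"
  using continuous_functional_G[OF assms] by (rule borel_measurable_continuous_onI)

lemma functional_G_tendsto:
  assumes F: "path_continuous F"
  shows "AE \<omega> in N. (\<lambda>m. F (G m (V m \<omega>))) \<longlonglongrightarrow> F (Z \<omega>)"
  using Z_close Z_cadlag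
proof eventually_elim
  case (elim \<omega>)
  show ?case
  proof (rule tendstoI)
    fix e :: real assume "0 < e"
    then obtain \<rho> where \<rho>: "0 < \<rho>"
      "\<And>g. g \<in> cadlag \<Longrightarrow> uniformly_close \<rho> (Z \<omega>) g \<Longrightarrow> \<bar>F g - F (Z \<omega>)\<bar> < e"
      using F elim(2) unfolding path_continuous_def by blast
    have "\<forall>\<^sub>F m in sequentially. uniformly_close \<rho> (Z \<omega>) (G m (V m \<omega>))"
      using elim(1) \<rho>(1) by blast
    then show "\<forall>\<^sub>F m in sequentially. dist (F (G m (V m \<omega>))) (F (Z \<omega>)) < e"
      by eventually_elim (auto simp: dist_real_def intro!: \<rho>(2) G_cadlag)
  qed
qed

text \<open>The limit \<open>H\<close> of the measurable functionals along the approximations is a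
  version of \<open>F (Z \<omega>)\<close> that is measurable for \<open>N\<close> itself;
  boundedness then allows dominated convergence.\<close>

lemma functional_Z:
  assumes F: "path_continuous F" and C: "\<And>f. f \<in> cadlag \<Longrightarrow> \<bar>F f\<bar> \<le> C"
  shows "(\<lambda>\<omega>. F (Z \<omega>)) \<in> borel_measurable (completion N)"
    and "(\<lambda>m. \<integral>\<omega>. F (G m (V m \<omega>)) \<partial>N) \<longlonglongrightarrow> (\<integral>\<omega>. F (Z \<omega>) \<partial>completion N)"
proof -
  note [measurable] = measurable_functional_G[OF F]
  define H where "H = (\<lambda>\<omega>. lim (\<lambda>m. F (G m (V m \<omega>))))"
  have H [measurable]: "H \<in> borel_measurable N" unfolding H_def by measurable
  have "AE \<omega> in N. H \<omega> = F (Z \<omega>)"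
    using functional_G_tendsto[OF F] by eventually_elim (simp add: H_def limI)
  then have ae: "AE \<omega> in completion N. H \<omega> = F (Z \<omega>)" by (rule AE_completion)
  have Hc: "H \<in> borel_measurable (completion N)" using H by (rule measurable_completion)
  show FZ: "(\<lambda>\<omega>. F (Z \<omega>)) \<in> borel_measurable (completion N)"
    using ae Hc by (rule completion.borel_measurable_AE_eq)
  have "(\<integral>\<omega>. F (Z \<omega>) \<partial>completion N) = (\<integral>\<omega>. H \<omega> \<partial>completion N)"
    using ae FZ Hc by (intro integral_cong_AE) auto
  also have "\<dots> = (\<integral>\<omega>. H \<omega> \<partial>N)" by (rule integral_completion[OF H])
  finally have eq: "(\<integral>\<omega>. F (Z \<omega>) \<partial>completion N) = (\<integral>\<omega>. H \<omega> \<partial>N)" .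
  show "(\<lambda>m. \<integral>\<omega>. F (G m (V m \<omega>)) \<partial>N) \<longlonglongrightarrow> (\<integral>\<omega>. F (Z \<omega>) \<partial>completion N)"
    unfolding eq
  proof (rule integral_dominated_convergence[where w="\<lambda>_. C"])
    show "AE \<omega> in N. (\<lambda>m. F (G m (V m \<omega>))) \<longlonglongrightarrow> H \<omega>"
      using functional_G_tendsto[OF F] by eventually_elim (simp add: H_def limI)
  qed (auto intro!: AE_I2 C G_cadlag)
qed

lemma functional_U:
  assumes F: "path_continuous F" and C: "\<And>f. f \<in> cadlag \<Longrightarrow> \<bar>F f\<bar> \<le> C"
  shows "(\<lambda>n. \<integral>\<omega>. F (G m (U m n \<omega>)) \<partial>M) \<longlonglongrightarrow> (\<integral>\<omega>. F (G m (V m \<omega>)) \<partial>N)"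
  by (rule U_conv[OF continuous_functional_G[OF F]])
     (auto intro!: boundedI[of _ C] C G_cadlag)

text \<open>The replacement for asymptotic tightness. The radius is positive at every path of the
  limit, so bounded continuous cutoffs near radius 0 have small mean under \<open>Z\<close>; the
  smallness is transported to \<open>G m (V m \<omega>)\<close> by large \<open>m\<close> and then
  to \<open>G m (U m n \<omega>)\<close> by large \<open>n\<close>.\<close>

lemma small_radius_unlikely:
  assumes F: "path_continuous F" and e: "0 < e" and d: "0 < d"
  shows "\<exists>\<rho>>0. \<rho> \<le> d \<and> (\<forall>\<^sub>F m in sequentially. \<forall>\<^sub>F n in sequentially.
     measure M {\<omega>\<in>space M. oscillation_radius F e (G m (U m n \<omega>)) \<le> \<rho>} < d)"
proof -
  \<comment> \<open>Equal to 1 up to \<open>1 / real (Suc k)\<close> and to 0 from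
    \<open>2 / real (Suc k)\<close> on, so it dominates the indicator of small radii and vanishes
    for large \<open>k\<close> at any positive radius.\<close>
  define h where "h = (\<lambda>k x. max 0 (min 1 (2 - real (Suc k) * x)))"
  define R where "R = (\<lambda>k f. h k (oscillation_radius F e f))"
  have Rc: "path_continuous (R k)" for k
    unfolding R_def h_def
    by (rule path_continuous_compose[OF path_continuous_oscillation_radius]) (intro continuous_intros)
  have Rb: "\<bar>R k f\<bar> \<le> 1" for k f by (auto simp: R_def h_def)
  note [measurable] = measurable_functional_G[OF Rc] measurable_functional_G[OF path_continuous_oscillation_radius[of F e]]
  have "(\<lambda>k. \<integral>\<omega>. R k (Z \<omega>) \<partial>completion N) \<longlonglongrightarrow> (\<integral>\<omega>. 0 \<partial>completion N)"
  proof (rule integral_dominated_convergence[where w="\<lambda>_. 1"])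
    show "(\<lambda>\<omega>. R k (Z \<omega>)) \<in> borel_measurable (completion N)" for k
      by (rule functional_Z(1)[OF Rc Rb])
    show "integrable (completion N) (\<lambda>_. 1::real)"
      by (simp add: integrable_completion)
    show "AE \<omega> in completion N. (\<lambda>k. R k (Z \<omega>)) \<longlonglongrightarrow> 0"
    proof (rule AE_completion, use Z_cadlag in eventually_elim)
      case (elim \<omega>)
      have pos: "0 < oscillation_radius F e (Z \<omega>)" (is "0 < ?r") by (rule oscillation_radius_pos[OF F elim e])
      obtain K where K: "2 < real K * ?r" using pos reals_Archimedean3 by blast
      have "R k (Z \<omega>) = 0" if "K \<le> k" for k
      proof -
        have "real K * ?r \<le> real (Suc k) * ?r" using that pos by (intro mult_right_mono) auto
        then show ?thesis using K by (simp add: R_def h_def)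
      qed
      then show ?case by (intro tendsto_eventually) (auto simp: eventually_sequentially)
    qed
  qed (auto simp: Rb)
  then have "\<forall>\<^sub>F k in sequentially. (\<integral>\<omega>. R k (Z \<omega>) \<partial>completion N) < d"
    using d by (auto intro: order_tendstoD)
  moreover have "\<forall>\<^sub>F k in sequentially. 1 / real (Suc k) < d"
    using LIMSEQ_inverse_real_of_nat d by (auto simp: inverse_eq_divide intro: order_tendstoD)
  ultimately have "\<forall>\<^sub>F k in sequentially. (\<integral>\<omega>. R k (Z \<omega>) \<partial>completion N) < d \<and> 1 / real (Suc k) < d"
    by eventually_elim simp
  then obtain k where k: "(\<integral>\<omega>. R k (Z \<omega>) \<partial>completion N) < d" "1 / real (Suc k) < d"
    using eventually_happens'[OF sequentially_bot] by blast
  define \<rho> where "\<rho> = 1 / real (Suc k)"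
  have "\<forall>\<^sub>F m in sequentially. (\<integral>\<omega>. R k (G m (V m \<omega>)) \<partial>N) < d"
    using functional_Z(2)[OF Rc Rb] k(1) by (rule order_tendstoD(2))
  then have "\<forall>\<^sub>F m in sequentially. \<forall>\<^sub>F n in sequentially. (\<integral>\<omega>. R k (G m (U m n \<omega>)) \<partial>M) < d"
  proof eventually_elim
    case (elim m)
    show ?case using functional_U[OF Rc Rb] elim by (rule order_tendstoD(2))
  qed
  then have "\<forall>\<^sub>F m in sequentially. \<forall>\<^sub>F n in sequentially.
     measure M {\<omega>\<in>space M. oscillation_radius F e (G m (U m n \<omega>)) \<le> \<rho>} < d"
  proof (rule eventually_mono, elim eventually_mono)
    fix m n assume *: "(\<integral>\<omega>. R k (G m (U m n \<omega>)) \<partial>M) < d"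
    let ?A = "{\<omega>\<in>space M. oscillation_radius F e (G m (U m n \<omega>)) \<le> \<rho>}"
    have "measure M ?A = (\<integral>\<omega>. indicator ?A \<omega> \<partial>M)" by simp
    also have "\<dots> \<le> (\<integral>\<omega>. R k (G m (U m n \<omega>)) \<partial>M)"
    proof (rule integral_mono)
      show "integrable M (\<lambda>\<omega>. R k (G m (U m n \<omega>)))"
        by (rule M.integrable_const_bound[where B=1]) (auto simp: Rb)
      show "integrable M (indicator ?A :: 'a \<Rightarrow> real)"
        by (rule M.integrable_const_bound[where B=1]) auto
      fix \<omega> assume "\<omega> \<in> space M"
      have "1 \<le> 2 - real (Suc k) * x" if "x \<le> \<rho>" for x
        using that mult_left_mono[of x "1 / real (Suc k)" "real (Suc k)"] by (simp add: \<rho>_def)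
      then show "indicator ?A \<omega> \<le> R k (G m (U m n \<omega>))"
        by (auto simp: R_def h_def split: split_indicator)
    qed
    finally show "measure M ?A < d" using * by simp
  qed
  moreover have "0 < \<rho>" "\<rho> \<le> d" using k(2) by (auto simp: \<rho>_def)
  ultimately show ?thesis by blast
qed

text \<open>The error function \<open>w\<close> is \<open>e\<close> plus \<open>2 * C\<close> on the
  exceptional set. Adding it to the approximation gives an integrable majorant of
  \<open>F (X n \<omega>)\<close>, and every integrable majorant exceeds the approximation minus
  \<open>w\<close> almost everywhere; this bounds the infimum from both sides.\<close>

lemma outer_expectation_close:
  assumes F: "path_continuous F" and C: "\<And>f. f \<in> cadlag \<Longrightarrow> \<bar>F f\<bar> \<le> C"
    and X: "AE \<omega> in M. X n \<omega> \<in> cadlag" and E: "E \<in> sets M" and e: "0 \<le> e"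
    and close: "\<And>\<omega>. \<omega> \<in> space M - E \<Longrightarrow> X n \<omega> \<in> cadlag \<Longrightarrow> \<bar>F (X n \<omega>) - F (G m (U m n \<omega>))\<bar> \<le> e"
  shows "\<bar>outer_expectation M (\<lambda>\<omega>. F (X n \<omega>)) - (\<integral>\<omega>. F (G m (U m n \<omega>)) \<partial>M)\<bar> \<le> e + 2 * C * measure M E"
proof -
  note [measurable] = measurable_functional_G[OF F] E
  let ?G = "\<lambda>\<omega>. F (G m (U m n \<omega>))"
  define S where "S = {g. integrable M g \<and> (AE \<omega> in M. F (X n \<omega>) \<le> g \<omega>)}"
  have C0: "0 \<le> C" using C[OF G_cadlag[of 0 undefined]] by linarith
  have Gi: "integrable M ?G"
    by (rule M.integrable_const_bound[where B=C]) (auto intro!: C G_cadlag)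
  have err: "AE \<omega> in M. \<bar>F (X n \<omega>) - ?G \<omega>\<bar> \<le> (if \<omega> \<in> E then 2 * C else e)"
    using X AE_space
  proof eventually_elim
    case (elim \<omega>)
    show ?case using close[of \<omega>] elim C[of "X n \<omega>"] C[OF G_cadlag[of m "U m n \<omega>"]] by auto
  qed
  define w where "w = (\<lambda>\<omega>. e + 2 * C * indicator E \<omega>)"
  have iE: "integrable M (indicator E :: 'a \<Rightarrow> real)"
    by (rule M.integrable_const_bound[where B=1]) auto
  have wi: "integrable M w" unfolding w_def using iE by auto
  have wI: "(\<integral>\<omega>. w \<omega> \<partial>M) = e + 2 * C * measure M E"
    unfolding w_def using E iE by (subst Bochner_Integration.integral_add) (auto simp: M.prob_space)
  have err': "AE \<omega> in M. \<bar>F (X n \<omega>) - ?G \<omega>\<bar> \<le> w \<omega>"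
    using err by eventually_elim (use C0 e in \<open>auto simp: w_def split: split_indicator if_splits\<close>)
  have lower: "(\<integral>\<omega>. ?G \<omega> \<partial>M) - (\<integral>\<omega>. w \<omega> \<partial>M) \<le> (\<integral>\<omega>. g \<omega> \<partial>M)" if "g \<in> S" for g
  proof -
    have g: "integrable M g" "AE \<omega> in M. F (X n \<omega>) \<le> g \<omega>" using that by (auto simp: S_def)
    have "(\<integral>\<omega>. ?G \<omega> - w \<omega> \<partial>M) \<le> (\<integral>\<omega>. g \<omega> \<partial>M)"
    proof (rule integral_mono_AE)
      show "AE \<omega> in M. ?G \<omega> - w \<omega> \<le> g \<omega>"
        using g(2) err' by eventually_elim linarith
    qed (use g Gi wi in auto)
    then show ?thesis using Gi wi by simp
  qed
  have mem: "(\<lambda>\<omega>. ?G \<omega> + w \<omega>) \<in> S"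
    unfolding S_def using Gi wi err' by (auto elim!: eventually_mono)
  have bdd: "bdd_below ((\<lambda>g. \<integral>\<omega>. g \<omega> \<partial>M) ` S)"
    by (rule bdd_belowI2[of _ "(\<integral>\<omega>. ?G \<omega> \<partial>M) - (\<integral>\<omega>. w \<omega> \<partial>M)"]) (rule lower)
  have eq: "outer_expectation M (\<lambda>\<omega>. F (X n \<omega>)) = (INF g\<in>S. \<integral>\<omega>. g \<omega> \<partial>M)"
    by (simp add: outer_expectation_def S_def)
  have "(INF g\<in>S. \<integral>\<omega>. g \<omega> \<partial>M) \<le> (\<integral>\<omega>. ?G \<omega> + w \<omega> \<partial>M)"
    by (rule cINF_lower[OF bdd mem])
  then have up: "outer_expectation M (\<lambda>\<omega>. F (X n \<omega>)) \<le> (\<integral>\<omega>. ?G \<omega> \<partial>M) + (\<integral>\<omega>. w \<omega> \<partial>M)"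
    using Gi wi by (simp add: eq)
  have low: "(\<integral>\<omega>. ?G \<omega> \<partial>M) - (\<integral>\<omega>. w \<omega> \<partial>M) \<le> outer_expectation M (\<lambda>\<omega>. F (X n \<omega>))"
    unfolding eq by (rule cINF_greatest) (use mem lower in auto)
  show ?thesis using up low wI by (simp add: abs_le_iff)
qed

theorem converges_in_distribution: "converges_in_distribution_U M X N Z"
  unfolding converges_in_distribution_U_def
proof (intro conjI allI impI)
  fix F assume F0: "continuous_map locally_uniform_topology euclideanreal F \<and> bounded (F ` cadlag)"
  have F: "path_continuous F"
    unfolding path_continuous_def using continuous_functionalD F0 by blast
  obtain C where C: "\<And>f. f \<in> cadlag \<Longrightarrow> \<bar>F f\<bar> \<le> C"
    using F0 unfolding bounded_iff by auto
  have C0: "0 \<le> C" using C[OF G_cadlag[of 0 undefined]] by linarith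
  note [measurable] = measurable_functional_G[OF path_continuous_oscillation_radius[of F]]
  show "(\<lambda>\<omega>. F (Z \<omega>)) \<in> borel_measurable (completion N)"
    by (rule functional_Z(1)[OF F C])
  show "(\<lambda>n. outer_expectation M (\<lambda>\<omega>. F (X n \<omega>))) \<longlonglongrightarrow> (\<integral>\<omega>. F (Z \<omega>) \<partial>completion N)"
  proof (rule tendstoI)
    fix e0 :: real assume e0: "0 < e0"
    \<comment> \<open>The comparison of the queue with its approximation costs
      \<open>e + 2 * C * (2 * e)\<close>, the limits in \<open>n\<close> and in \<open>m\<close>
      cost less than \<open>e\<close> each; the sum stays below \<open>e0\<close>.\<close>
    define e where "e = e0 / (4 + 4 * C)"
    have e: "0 < e" "e * (4 + 4 * C) = e0" using e0 C0 by (auto simp: e_def)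
    obtain \<rho> where \<rho>: "0 < \<rho>" "\<rho> \<le> e" "\<forall>\<^sub>F m in sequentially. \<forall>\<^sub>F n in sequentially.
     measure M {\<omega>\<in>space M. oscillation_radius F e (G m (U m n \<omega>)) \<le> \<rho>} < e"
      using small_radius_unlikely[OF F e(1) e(1)] by blast
    have "\<forall>\<^sub>F m in sequentially. dist (\<integral>\<omega>. F (G m (V m \<omega>)) \<partial>N) (\<integral>\<omega>. F (Z \<omega>) \<partial>completion N) < e"
      using functional_Z(2)[OF F C] e(1) by (rule tendstoD)
    with \<rho>(3) X_close[OF \<rho>(1)]
    have "\<forall>\<^sub>F m in sequentially. dist (\<integral>\<omega>. F (G m (V m \<omega>)) \<partial>N) (\<integral>\<omega>. F (Z \<omega>) \<partial>completion N) < e \<and>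
      (\<forall>\<^sub>F n in sequentially. measure M {\<omega>\<in>space M. oscillation_radius F e (G m (U m n \<omega>)) \<le> \<rho>} < e) \<and>
      (\<forall>\<^sub>F n in sequentially. \<exists>E\<in>sets M. measure M E \<le> \<rho> \<and> (\<forall>\<omega>\<in>space M - E. uniformly_close \<rho> (X n \<omega>) (G m (U m n \<omega>))))"
      by eventually_elim blast
    then obtain m where m: "dist (\<integral>\<omega>. F (G m (V m \<omega>)) \<partial>N) (\<integral>\<omega>. F (Z \<omega>) \<partial>completion N) < e"
      "\<forall>\<^sub>F n in sequentially. measure M {\<omega>\<in>space M. oscillation_radius F e (G m (U m n \<omega>)) \<le> \<rho>} < e"
      "\<forall>\<^sub>F n in sequentially. \<exists>E\<in>sets M. measure M E \<le> \<rho> \<and> (\<forall>\<omega>\<in>space M - E. uniformly_close \<rho> (X n \<omega>) (G m (U m n \<omega>)))"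
      using eventually_happens'[OF sequentially_bot] by blast
    have "\<forall>\<^sub>F n in sequentially. dist (\<integral>\<omega>. F (G m (U m n \<omega>)) \<partial>M) (\<integral>\<omega>. F (G m (V m \<omega>)) \<partial>N) < e"
      using functional_U[OF F C] e(1) by (rule tendstoD)
    with m(2,3) X_cadlag
    show "\<forall>\<^sub>F n in sequentially. dist (outer_expectation M (\<lambda>\<omega>. F (X n \<omega>))) (\<integral>\<omega>. F (Z \<omega>) \<partial>completion N) < e0"
    proof eventually_elim
      case (elim n)
      then obtain E where E: "E \<in> sets M" "measure M E \<le> \<rho>"
        "\<And>\<omega>. \<omega> \<in> space M - E \<Longrightarrow> uniformly_close \<rho> (X n \<omega>) (G m (U m n \<omega>))" by blast
      \<comment> \<open>Off this event the queue is closer to its approximation than the oscillation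
        radius of the latter, so the values of \<open>F\<close> differ by at most
        \<open>e\<close>.\<close>
      define E' where "E' = E \<union> {\<omega>\<in>space M. oscillation_radius F e (G m (U m n \<omega>)) \<le> \<rho>}"
      have E': "E' \<in> sets M" unfolding E'_def using E(1) by measurable
      have "measure M E' \<le> measure M E + measure M {\<omega>\<in>space M. oscillation_radius F e (G m (U m n \<omega>)) \<le> \<rho>}"
        unfolding E'_def using E(1) by (intro measure_Un_le) auto
      then have mE': "measure M E' \<le> 2 * e" using E(2) \<rho>(2) elim(1) by linarith
      have "\<bar>outer_expectation M (\<lambda>\<omega>. F (X n \<omega>)) - (\<integral>\<omega>. F (G m (U m n \<omega>)) \<partial>M)\<bar> \<le> e + 2 * C * measure M E'"
      proof (rule outer_expectation_close[OF F C elim(3) E' less_imp_le[OF e(1)]])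
        fix \<omega> assume \<omega>: "\<omega> \<in> space M - E'" "X n \<omega> \<in> cadlag"
        then have "\<rho> < oscillation_radius F e (G m (U m n \<omega>))" "uniformly_close \<rho> (X n \<omega>) (G m (U m n \<omega>))"
          using E(3)[of \<omega>] unfolding E'_def by force+
        then show "\<bar>F (X n \<omega>) - F (G m (U m n \<omega>))\<bar> \<le> e"
          using oscillation_radiusD[OF _ \<rho>(1) G_cadlag \<omega>(2), of F e m "U m n \<omega>"]
          unfolding uniformly_close_sym[of \<rho> "X n \<omega>"] abs_minus_commute[of "F (X n \<omega>)"] by blast
      qed
      also have "\<dots> \<le> e + 2 * C * (2 * e)" using mE' C0 by (intro add_left_mono mult_left_mono) auto
      finally have "\<bar>outer_expectation M (\<lambda>\<omega>. F (X n \<omega>)) - (\<integral>\<omega>. F (Z \<omega>) \<partial>completion N)\<bar> < 3 * e + 4 * C * e"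
        using elim(4) m(1) unfolding dist_real_def by linarith
      also have "\<dots> \<le> e * (4 + 4 * C)" using e(1) by (simp add: algebra_simps)
      also note e(2)
      finally show ?case by (simp add: dist_real_def)
    qed
  qed
qed (simp_all only: X_cadlag Z_cadlag)

end

section \<open>Weak convergence of independent sequences\<close>

lemma tendsto_fun_componentwise:
  fixes f :: "'a \<Rightarrow> 'i \<Rightarrow> 'b::topological_space"
  assumes "\<And>i. ((\<lambda>a. f a i) \<longlongrightarrow> l i) F"
  shows "(f \<longlongrightarrow> l) F"
proof -
  have "limitin (product_topology (\<lambda>_. euclidean) UNIV) f l F"
    unfolding limitin_componentwise using assms by auto
  then show ?thesis by (simp add: euclidean_product_topology)
qed

text \<open>Both measures agree on cylinders over finitely many coordinates, and these determine the
  product measure.\<close>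

lemma distr_PiM_coordinatewise:
  fixes \<Omega> :: "'i \<Rightarrow> 'a measure" and f :: "'i \<Rightarrow> 'a \<Rightarrow> 'b"
  assumes \<Omega>: "\<And>i. prob_space (\<Omega> i)" and f: "\<And>i. f i \<in> measurable (\<Omega> i) (S i)"
  shows "distr (PiM UNIV \<Omega>) (PiM UNIV S) (\<lambda>x i. f i (x i)) = PiM UNIV (\<lambda>i. distr (\<Omega> i) (S i) (f i))"
proof -
  interpret prob_space "distr (\<Omega> i) (S i) (f i)" for i
    using \<Omega> f by (rule prob_space.prob_space_distr)
  interpret P: product_prob_space "\<lambda>i. distr (\<Omega> i) (S i) (f i)" UNIV
    by unfold_locales
  have meas: "(\<lambda>x i. f i (x i)) \<in> measurable (PiM UNIV \<Omega>) (PiM UNIV S)"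
    using f by (intro measurable_PiM_single')
      (auto intro!: measurable_compose[OF measurable_component_singleton] simp: space_PiM PiE_def Pi_iff
        dest: measurable_space)
  show ?thesis
  proof (rule P.PiM_eq)
    show "sets (distr (PiM UNIV \<Omega>) (PiM UNIV S) (\<lambda>x i. f i (x i))) = sets (PiM UNIV (\<lambda>i. distr (\<Omega> i) (S i) (f i)))"
      by (auto intro!: sets_PiM_cong)
    fix J F assume J: "finite J" and F: "\<And>j. j \<in> J \<Longrightarrow> F j \<in> sets (distr (\<Omega> j) (S j) (f j))"
    let ?E = "prod_emb UNIV (\<lambda>i. distr (\<Omega> i) (S i) (f i)) J (Pi\<^sub>E J F)"
    have E: "?E = prod_emb UNIV S J (Pi\<^sub>E J F)"
      by (simp add: prod_emb_def)
    have "emeasure (distr (PiM UNIV \<Omega>) (PiM UNIV S) (\<lambda>x i. f i (x i))) ?E =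
      emeasure (PiM UNIV \<Omega>) ((\<lambda>x i. f i (x i)) -` ?E \<inter> space (PiM UNIV \<Omega>))"
      unfolding E using meas J F by (intro emeasure_distr sets_PiM_I) auto
    also have "(\<lambda>x i. f i (x i)) -` ?E \<inter> space (PiM UNIV \<Omega>) =
       prod_emb UNIV \<Omega> J (\<Pi>\<^sub>E j\<in>J. f j -` F j \<inter> space (\<Omega> j))"
      using f by (auto simp: prod_emb_def space_PiM PiE_iff dest: measurable_space)
    also have "emeasure (PiM UNIV \<Omega>) \<dots> = (\<Prod>j\<in>J. emeasure (\<Omega> j) (f j -` F j \<inter> space (\<Omega> j)))"
      using \<Omega> J F f by (intro emeasure_PiM_emb) (auto intro!: measurable_sets)
    also have "\<dots> = (\<Prod>j\<in>J. emeasure (distr (\<Omega> j) (S j) (f j)) (F j))"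
      using f F by (intro prod.cong) (auto simp: emeasure_distr)
    finally show "emeasure (distr (PiM UNIV \<Omega>) (PiM UNIV S) (\<lambda>x i. f i (x i))) ?E =
      (\<Prod>j\<in>J. emeasure (distr (\<Omega> j) (S j) (f j)) (F j))" .
  qed
qed

text \<open>Skorohod's representation, applied in each coordinate, turns the coordinatewise weak
  convergence into pointwise convergence on a product space.\<close>

lemma Skorohod_product:
  fixes \<mu> :: "nat \<Rightarrow> nat \<Rightarrow> real measure" and \<mu>' :: "nat \<Rightarrow> real measure"
  assumes "\<And>n i. real_distribution (\<mu> n i)" "\<And>i. real_distribution (\<mu>' i)"
    and "\<And>i. weak_conv_m (\<lambda>n. \<mu> n i) (\<mu>' i)"
  obtains \<Omega> :: "(nat \<Rightarrow> real) measure" and f :: "nat \<Rightarrow> (nat \<Rightarrow> real) \<Rightarrow> nat \<Rightarrow> real" and f'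
  where "prob_space \<Omega>" "\<And>n. f n \<in> borel_measurable \<Omega>" "f' \<in> borel_measurable \<Omega>"
    "\<And>n. distr \<Omega> borel (f n) = distr (PiM UNIV (\<mu> n)) borel (\<lambda>x. x)"
    "distr \<Omega> borel f' = distr (PiM UNIV \<mu>') borel (\<lambda>x. x)"
    "\<And>x. x \<in> space \<Omega> \<Longrightarrow> (\<lambda>n. f n x) \<longlonglongrightarrow> f' x"
proof -
  \<comment> \<open>Packing the conclusions of Skorohod's theorem into one predicate of a triple
    permits choosing spaces and variables for all coordinates at once.\<close>
  define Q where "Q = (\<lambda>i (\<Omega> :: real measure) (Ys :: nat \<Rightarrow> real \<Rightarrow> real) (Y :: real \<Rightarrow> real).
    prob_space \<Omega> \<and> (\<forall>n. Ys n \<in> measurable \<Omega> borel) \<and> (\<forall>n. distr \<Omega> borel (Ys n) = \<mu> n i) \<and>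
    Y \<in> measurable \<Omega> lborel \<and> distr \<Omega> borel Y = \<mu>' i \<and>
    (\<forall>x \<in> space \<Omega>. (\<lambda>n. Ys n x) \<longlonglongrightarrow> Y x))"
  have "\<exists>p. Q i (fst p) (fst (snd p)) (snd (snd p))" for i
  proof -
    obtain \<Omega> Ys Y where "Q i \<Omega> Ys Y"
      using Skorohod[of "\<lambda>n. \<mu> n i", OF assms(1,2,3)] unfolding Q_def by blast
    then show ?thesis by (intro exI[of _ "(\<Omega>, Ys, Y)"]) simp
  qed
  then obtain p where "\<And>i. Q i (fst (p i)) (fst (snd (p i))) (snd (snd (p i)))"
    by metis
  moreover define \<Omega> where "\<Omega> = (\<lambda>i. fst (p i))"
  moreover define Ys where "Ys = (\<lambda>i. fst (snd (p i)))"
  moreover define Y where "Y = (\<lambda>i. snd (snd (p i)))"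
  ultimately have Q: "Q i (\<Omega> i) (Ys i) (Y i)" for i by simp
  have \<Omega>: "\<And>i. prob_space (\<Omega> i)" and Ys: "\<And>i n. Ys i n \<in> borel_measurable (\<Omega> i)"
    and dYs: "\<And>i n. distr (\<Omega> i) borel (Ys i n) = \<mu> n i"
    and Y: "\<And>i. Y i \<in> borel_measurable (\<Omega> i)" and dY: "\<And>i. distr (\<Omega> i) borel (Y i) = \<mu>' i"
    and conv: "\<And>i x. x \<in> space (\<Omega> i) \<Longrightarrow> (\<lambda>n. Ys i n x) \<longlonglongrightarrow> Y i x"
    using Q unfolding Q_def measurable_lborel1 by blast+
  \<comment> \<open>The Borel sets of the countable product are those of the product measurable
    space, so the laws may be read on \<open>borel\<close>, on which continuous functionals are
    measurable.\<close>
  have eq: "distr (PiM UNIV \<Omega>) borel (\<lambda>x i. g i (x i)) = distr (PiM UNIV \<nu>) borel (\<lambda>x. x)"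
    and meas: "(\<lambda>x i. g i (x i)) \<in> borel_measurable (PiM UNIV \<Omega>)"
    if g: "\<And>i. g i \<in> borel_measurable (\<Omega> i)" and d: "\<And>i. distr (\<Omega> i) borel (g i) = \<nu> i"
    for g :: "nat \<Rightarrow> real \<Rightarrow> real" and \<nu> :: "nat \<Rightarrow> real measure"
  proof -
    have m1: "(\<lambda>x. g i (x i)) \<in> borel_measurable (PiM UNIV \<Omega>)" for i
      using measurable_compose[OF measurable_component_singleton[of i UNIV \<Omega>] g[of i]] by simp
    show m: "(\<lambda>x i. g i (x i)) \<in> borel_measurable (PiM UNIV \<Omega>)"
      using m1 by (rule measurable_coordinatewise_then_product)
    have m': "(\<lambda>x i. g i (x i)) \<in> measurable (PiM UNIV \<Omega>) (PiM UNIV (\<lambda>_. borel))"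
      using m measurable_cong_sets[OF refl sets_PiM_equal_borel] by blast
    have "PiM UNIV \<nu> = distr (PiM UNIV \<Omega>) (PiM UNIV (\<lambda>_. borel)) (\<lambda>x i. g i (x i))"
      unfolding distr_PiM_coordinatewise[OF \<Omega> g] d ..
    moreover have "(\<lambda>x. x) \<in> measurable (PiM UNIV (\<lambda>_. borel :: real measure)) (borel :: (nat \<Rightarrow> real) measure)"
      by (intro measurable_ident_sets sets_PiM_equal_borel)
    ultimately show "distr (PiM UNIV \<Omega>) borel (\<lambda>x i. g i (x i)) = distr (PiM UNIV \<nu>) borel (\<lambda>x. x)"
      using m' by (simp add: distr_distr o_def)
  qed
  show ?thesis
  proof (rule that[of "PiM UNIV \<Omega>" "\<lambda>n x i. Ys i n (x i)" "\<lambda>x i. Y i (x i)"])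
    show "prob_space (PiM UNIV \<Omega>)" using \<Omega> by (intro prob_space_PiM) auto
    show "(\<lambda>n i. Ys i n (x i)) \<longlonglongrightarrow> (\<lambda>i. Y i (x i))" if "x \<in> space (PiM UNIV \<Omega>)" for x
      using that conv by (intro tendsto_fun_componentwise) (auto simp: space_PiM)
  qed (use Ys dYs Y dY in \<open>auto intro!: eq meas\<close>)
qed

text \<open>Expresses the joint law through the marginal laws, which are the only ones whose
  convergence is known.\<close>

lemma (in prob_space) distr_pair_indep_vars:
  fixes A B :: "nat \<Rightarrow> 'a \<Rightarrow> real"
  assumes A: "indep_vars (\<lambda>_. borel) A UNIV" and B: "indep_vars (\<lambda>_. borel) B UNIV"
    and AB: "indep_var (PiM UNIV (\<lambda>_. borel)) (\<lambda>\<omega> i. A i \<omega>) (PiM UNIV (\<lambda>_. borel)) (\<lambda>\<omega> i. B i \<omega>)"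
  shows "distr M borel (\<lambda>\<omega>. (\<lambda>i. A i \<omega>, \<lambda>i. B i \<omega>)) =
     distr (PiM UNIV (\<lambda>i. distr M borel (A i))) borel (\<lambda>x. x) \<Otimes>\<^sub>M
     distr (PiM UNIV (\<lambda>i. distr M borel (B i))) borel (\<lambda>x. x)"
proof -
  have rA: "random_variable borel (A i)" and rB: "random_variable borel (B i)" for i
    using A B by (auto simp: indep_vars_def)
  have dA: "distr M (PiM UNIV (\<lambda>_. borel)) (\<lambda>\<omega> i. A i \<omega>) = PiM UNIV (\<lambda>i. distr M borel (A i))"
    using indep_vars_iff_distr_eq_PiM[where I=UNIV and M'="\<lambda>_. borel" and X=A] A rA by (simp add: restrict_def)
  have dB: "distr M (PiM UNIV (\<lambda>_. borel)) (\<lambda>\<omega> i. B i \<omega>) = PiM UNIV (\<lambda>i. distr M borel (B i))"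
    using indep_vars_iff_distr_eq_PiM[where I=UNIV and M'="\<lambda>_. borel" and X=B] B rB by (simp add: restrict_def)
  have mA: "(\<lambda>\<omega> i. A i \<omega>) \<in> measurable M (PiM UNIV (\<lambda>_. borel))"
    and mB: "(\<lambda>\<omega> i. B i \<omega>) \<in> measurable M (PiM UNIV (\<lambda>_. borel))"
    using AB by (auto dest: indep_var_rv1 indep_var_rv2)
  have id: "(\<lambda>x. x) \<in> measurable (PiM UNIV (\<lambda>_. borel :: real measure)) (borel :: (nat \<Rightarrow> real) measure)"
    by (intro measurable_ident_sets sets_PiM_equal_borel)
  have "indep_var borel (\<lambda>\<omega> i. A i \<omega>) borel (\<lambda>\<omega> i. B i \<omega>)"
    using indep_var_compose[OF AB id id] by (simp add: o_def)
  then have "distr M (borel \<Otimes>\<^sub>M borel) (\<lambda>\<omega>. (\<lambda>i. A i \<omega>, \<lambda>i. B i \<omega>)) =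
    distr M borel (\<lambda>\<omega> i. A i \<omega>) \<Otimes>\<^sub>M distr M borel (\<lambda>\<omega> i. B i \<omega>)"
    by (simp add: indep_var_distribution_eq)
  also have "distr M borel (\<lambda>\<omega> i. A i \<omega>) = distr (PiM UNIV (\<lambda>i. distr M borel (A i))) borel (\<lambda>x. x)"
    unfolding dA[symmetric] using mA id by (simp add: distr_distr o_def)
  also have "distr M borel (\<lambda>\<omega> i. B i \<omega>) = distr (PiM UNIV (\<lambda>i. distr M borel (B i))) borel (\<lambda>x. x)"
    unfolding dB[symmetric] using mB id by (simp add: distr_distr o_def)
  finally show ?thesis by (simp add: borel_prod)
qed

text \<open>Each family is replaced by copies that converge pointwise, and the two spaces carrying
  the copies are multiplied to restore independence between the families; dominated convergence does
  the rest.\<close>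

lemma weak_conv_pair_indep_vars:
  fixes A B :: "nat \<Rightarrow> nat \<Rightarrow> 'a \<Rightarrow> real" and A' B' :: "nat \<Rightarrow> 'b \<Rightarrow> real"
    and \<phi> :: "(nat \<Rightarrow> real) \<times> (nat \<Rightarrow> real) \<Rightarrow> real"
  assumes M: "prob_space M" and N: "prob_space N"
    and A: "\<And>n. prob_space.indep_vars M (\<lambda>_. borel) (A n) UNIV"
    and B: "\<And>n. prob_space.indep_vars M (\<lambda>_. borel) (B n) UNIV"
    and AB: "\<And>n. prob_space.indep_var M (PiM UNIV (\<lambda>_. borel)) (\<lambda>\<omega> i. A n i \<omega>) (PiM UNIV (\<lambda>_. borel)) (\<lambda>\<omega> i. B n i \<omega>)"
    and A': "prob_space.indep_vars N (\<lambda>_. borel) A' UNIV"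
    and B': "prob_space.indep_vars N (\<lambda>_. borel) B' UNIV"
    and AB': "prob_space.indep_var N (PiM UNIV (\<lambda>_. borel)) (\<lambda>\<omega> i. A' i \<omega>) (PiM UNIV (\<lambda>_. borel)) (\<lambda>\<omega> i. B' i \<omega>)"
    and cA: "\<And>i. weak_conv_m (\<lambda>n. distr M borel (A n i)) (distr N borel (A' i))"
    and cB: "\<And>i. weak_conv_m (\<lambda>n. distr M borel (B n i)) (distr N borel (B' i))"
    and \<phi>: "continuous_on UNIV \<phi>" "bounded (range \<phi>)"
  shows "(\<lambda>n. \<integral>\<omega>. \<phi> (\<lambda>i. A n i \<omega>, \<lambda>i. B n i \<omega>) \<partial>M) \<longlonglongrightarrow> (\<integral>\<omega>. \<phi> (\<lambda>i. A' i \<omega>, \<lambda>i. B' i \<omega>) \<partial>N)"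
proof -
  interpret M: prob_space M by fact
  interpret N: prob_space N by fact
  have [measurable]: "A n i \<in> borel_measurable M" "B n i \<in> borel_measurable M"
    "A' i \<in> borel_measurable N" "B' i \<in> borel_measurable N" for n i
    using A B A' B' by (auto simp: M.indep_vars_def N.indep_vars_def)
  have rd: "real_distribution (distr M borel (A n i))" "real_distribution (distr M borel (B n i))" for n i
    by (rule M.real_distribution_distr, measurable)+
  have rd': "real_distribution (distr N borel (A' i))" "real_distribution (distr N borel (B' i))" for i
    by (rule N.real_distribution_distr, measurable)+
  obtain P :: "(nat \<Rightarrow> real) measure" and f :: "nat \<Rightarrow> (nat \<Rightarrow> real) \<Rightarrow> nat \<Rightarrow> real" and f' where P: "prob_space P" "\<And>n. f n \<in> borel_measurable P" "f' \<in> borel_measurable P"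
    "\<And>n. distr P borel (f n) = distr (PiM UNIV (\<lambda>i. distr M borel (A n i))) borel (\<lambda>x. x)"
    "distr P borel f' = distr (PiM UNIV (\<lambda>i. distr N borel (A' i))) borel (\<lambda>x. x)"
    "\<And>x. x \<in> space P \<Longrightarrow> (\<lambda>n. f n x) \<longlonglongrightarrow> f' x"
    by (rule Skorohod_product[where \<mu>="\<lambda>n i. distr M borel (A n i)" and \<mu>'="\<lambda>i. distr N borel (A' i)"])
      (rule rd(1), rule rd'(1), rule cA, blast)
  obtain Q :: "(nat \<Rightarrow> real) measure" and g :: "nat \<Rightarrow> (nat \<Rightarrow> real) \<Rightarrow> nat \<Rightarrow> real" and g' where Q: "prob_space Q" "\<And>n. g n \<in> borel_measurable Q" "g' \<in> borel_measurable Q"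
    "\<And>n. distr Q borel (g n) = distr (PiM UNIV (\<lambda>i. distr M borel (B n i))) borel (\<lambda>x. x)"
    "distr Q borel g' = distr (PiM UNIV (\<lambda>i. distr N borel (B' i))) borel (\<lambda>x. x)"
    "\<And>x. x \<in> space Q \<Longrightarrow> (\<lambda>n. g n x) \<longlonglongrightarrow> g' x"
    by (rule Skorohod_product[where \<mu>="\<lambda>n i. distr M borel (B n i)" and \<mu>'="\<lambda>i. distr N borel (B' i)"])
      (rule rd(2), rule rd'(2), rule cB, blast)
  interpret P: prob_space P by fact
  interpret Q: prob_space Q by fact
  interpret PQ: pair_prob_space P Q ..
  have [measurable]: "f n \<in> borel_measurable P" "f' \<in> borel_measurable P"
    "g n \<in> borel_measurable Q" "g' \<in> borel_measurable Q" for n using P Q by auto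
  have [measurable]: "\<phi> \<in> borel_measurable borel" using \<phi>(1) by (rule borel_measurable_continuous_onI)
  have mM: "(\<lambda>\<omega>. (\<lambda>i. A n i \<omega>, \<lambda>i. B n i \<omega>)) \<in> borel_measurable M" for n
    by (intro borel_measurable_Pair measurable_coordinatewise_then_product) auto
  have mN: "(\<lambda>\<omega>. (\<lambda>i. A' i \<omega>, \<lambda>i. B' i \<omega>)) \<in> borel_measurable N"
    by (intro borel_measurable_Pair measurable_coordinatewise_then_product) auto
  have pair: "distr P borel u \<Otimes>\<^sub>M distr Q borel v = distr (P \<Otimes>\<^sub>M Q) borel (\<lambda>(x, y). (u x, v y))"
    if [measurable]: "u \<in> borel_measurable P" "v \<in> borel_measurable Q"
    for u v :: "(nat \<Rightarrow> real) \<Rightarrow> nat \<Rightarrow> real"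
  proof -
    interpret D: prob_space "distr Q borel v" by (rule Q.prob_space_distr) auto
    show ?thesis by (subst pair_measure_distr) (auto intro!: D.sigma_finite_measure_axioms simp: borel_prod)
  qed
  have "(\<integral>\<omega>. \<phi> (\<lambda>i. A n i \<omega>, \<lambda>i. B n i \<omega>) \<partial>M) = (\<integral>z. \<phi> (f n (fst z), g n (snd z)) \<partial>(P \<Otimes>\<^sub>M Q))" for n
  proof -
    have "(\<integral>\<omega>. \<phi> (\<lambda>i. A n i \<omega>, \<lambda>i. B n i \<omega>) \<partial>M) = (\<integral>z. \<phi> z \<partial>distr M borel (\<lambda>\<omega>. (\<lambda>i. A n i \<omega>, \<lambda>i. B n i \<omega>)))"
      using mM by (subst integral_distr) auto
    also have "\<dots> = (\<integral>z. \<phi> z \<partial>distr (P \<Otimes>\<^sub>M Q) borel (\<lambda>(x, y). (f n x, g n y)))"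
      unfolding M.distr_pair_indep_vars[OF A B AB] P(4)[symmetric] Q(4)[symmetric] by (simp add: pair)
    also have "\<dots> = (\<integral>z. \<phi> (f n (fst z), g n (snd z)) \<partial>(P \<Otimes>\<^sub>M Q))"
      by (subst integral_distr) (auto simp: split_beta')
    finally show ?thesis .
  qed
  moreover have "(\<integral>\<omega>. \<phi> (\<lambda>i. A' i \<omega>, \<lambda>i. B' i \<omega>) \<partial>N) = (\<integral>z. \<phi> (f' (fst z), g' (snd z)) \<partial>(P \<Otimes>\<^sub>M Q))"
  proof -
    have "(\<integral>\<omega>. \<phi> (\<lambda>i. A' i \<omega>, \<lambda>i. B' i \<omega>) \<partial>N) = (\<integral>z. \<phi> z \<partial>distr N borel (\<lambda>\<omega>. (\<lambda>i. A' i \<omega>, \<lambda>i. B' i \<omega>)))"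
      using mN by (subst integral_distr) auto
    also have "\<dots> = (\<integral>z. \<phi> z \<partial>distr (P \<Otimes>\<^sub>M Q) borel (\<lambda>(x, y). (f' x, g' y)))"
      unfolding N.distr_pair_indep_vars[OF A' B' AB'] P(5)[symmetric] Q(5)[symmetric] by (simp add: pair)
    also have "\<dots> = (\<integral>z. \<phi> (f' (fst z), g' (snd z)) \<partial>(P \<Otimes>\<^sub>M Q))"
      by (subst integral_distr) (auto simp: split_beta')
    finally show ?thesis .
  qed
  moreover obtain C where C: "\<And>x. \<bar>\<phi> x\<bar> \<le> C" using \<phi>(2) by (auto simp: bounded_iff)
  have "(\<lambda>n. \<integral>z. \<phi> (f n (fst z), g n (snd z)) \<partial>(P \<Otimes>\<^sub>M Q)) \<longlonglongrightarrow> (\<integral>z. \<phi> (f' (fst z), g' (snd z)) \<partial>(P \<Otimes>\<^sub>M Q))"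
  proof (rule integral_dominated_convergence[where w="\<lambda>_. C"])
    show "AE z in P \<Otimes>\<^sub>M Q. (\<lambda>n. \<phi> (f n (fst z), g n (snd z))) \<longlonglongrightarrow> \<phi> (f' (fst z), g' (snd z))"
    proof (rule AE_I2)
      fix z assume "z \<in> space (P \<Otimes>\<^sub>M Q)"
      then have "(\<lambda>n. (f n (fst z), g n (snd z))) \<longlonglongrightarrow> (f' (fst z), g' (snd z))"
        using P(6) Q(6) by (intro tendsto_Pair) (auto simp: space_pair_measure)
      then show "(\<lambda>n. \<phi> (f n (fst z), g n (snd z))) \<longlonglongrightarrow> \<phi> (f' (fst z), g' (snd z))"
        by (intro continuous_on_tendsto_compose[OF \<phi>(1)]) auto
    qed
  qed (auto simp: C)
  ultimately show ?thesis by simp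
qed

section \<open>The tail of the Mittag-Leffler distribution\<close>

text \<open>Keep only the range \<open>t \<ge> A\<close> of the Gamma integral and bound the power
  there by its value at \<open>A\<close>. Since \<open>A\<close> is free, Gamma outgrows every
  geometric sequence, which spares Stirling's formula.\<close>

lemma Gamma_ge_powr:
  fixes s A :: real
  assumes s: "1 \<le> s" and A: "0 < A"
  shows "A powr (s - 1) * exp (- A) \<le> Gamma s"
proof (rule has_integral_le)
  show "((\<lambda>t. if t \<in> {A..} then A powr (s - 1) * exp (- 1 * t) else 0) has_integral A powr (s - 1) * exp (- A)) {0..}"
    using has_integral_mult_right[OF has_integral_exp_minus_to_infinity[of 1 A], of "A powr (s - 1)"] A
    by (subst has_integral_restrict) auto
  show "((\<lambda>t. t powr (s - 1) / exp t) has_integral Gamma s) {0..}"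
    using s by (intro Gamma_integral_real) auto
  show "(if t \<in> {A..} then A powr (s - 1) * exp (- 1 * t) else 0) \<le> t powr (s - 1) / exp t" for t
    using s A by (auto simp: exp_minus field_simps intro!: powr_mono2)
qed

lemma summable_mittag_leffler:
  fixes a b x :: real
  assumes a: "0 < a" and b: "1 \<le> b"
  shows "summable (\<lambda>k. x ^ k / Gamma (a * real k + b))"
proof -
  \<comment> \<open>Chosen so that the ratio of the majorizing geometric series is
    \<open>\<bar>x\<bar> / (2 * \<bar>x\<bar> + 1)\<close>, which is at most 1/2; the added 1 keeps
    \<open>A\<close> positive at \<open>x = 0\<close>.\<close>
  define A where "A = (2 * \<bar>x\<bar> + 1) powr (1 / a)"
  have A: "0 < A" "A powr a = 2 * \<bar>x\<bar> + 1" using a by (auto simp: A_def powr_powr)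
  define C where "C = exp A * A powr (1 - b)"
  have "norm (x ^ k / Gamma (a * real k + b)) \<le> C * (1/2) ^ k" for k
  proof -
    have g: "1 \<le> a * real k + b" using a b by (simp add: add_increasing)
    have pos: "0 < A powr (a * real k + b - 1) * exp (- A)" using A by simp
    have "\<bar>x\<bar> ^ k / Gamma (a * real k + b) \<le> \<bar>x\<bar> ^ k / (A powr (a * real k + b - 1) * exp (- A))"
      using Gamma_ge_powr[OF g A(1)] pos g by (intro divide_left_mono) (auto intro!: mult_pos_pos Gamma_real_pos)
    also have "A powr (a * real k + b - 1) = (2 * \<bar>x\<bar> + 1) ^ k * A powr (b - 1)"
    proof -
      have "A powr (a * real k + b - 1) = (A powr a) powr real k * A powr (b - 1)"
        using A(1) by (simp add: powr_powr powr_add[symmetric] algebra_simps)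
      also have "(A powr a) powr real k = (2 * \<bar>x\<bar> + 1) ^ k"
        unfolding A(2) by (rule powr_realpow) simp
      finally show ?thesis .
    qed
    also have "\<bar>x\<bar> ^ k / ((2 * \<bar>x\<bar> + 1) ^ k * A powr (b - 1) * exp (- A)) = C * (\<bar>x\<bar> / (2 * \<bar>x\<bar> + 1)) ^ k"
      using A(1) by (simp add: C_def exp_minus powr_diff power_divide field_simps)
    also have "\<dots> \<le> C * (1/2) ^ k"
      using A(1) by (intro mult_left_mono power_mono) (auto simp: C_def field_simps)
    finally show ?thesis using g by (simp add: abs_of_pos Gamma_real_pos power_abs)
  qed
  moreover have "summable (\<lambda>k. C * (1/2) ^ k)" by (intro summable_mult summable_geometric) simp
  ultimately show ?thesis by (rule summable_comparison_test'[where N=0, rotated])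
qed

section \<open>Fractional integrals of the Mittag-Leffler function\<close>

lemma Beta_integral_scaled:
  fixes a b u :: real
  assumes "0 < a" "0 < b" "0 < u"
  shows "has_bochner_integral lborel (\<lambda>t. indicator {0<..<u} t * (t powr (a - 1) * (u - t) powr (b - 1)))
     (u powr (a + b - 1) * Beta a b)"
proof -
  let ?f = "\<lambda>t::real. indicator {0<..<1} t * (t powr (a - 1) * (1 - t) powr (b - 1))"
  have B: "((\<lambda>t. t powr (a - 1) * (1 - t) powr (b - 1)) has_integral Beta a b) {0<..<1}"
    using has_integral_Beta_real[OF assms(1,2)] by (simp add: has_integral_Icc_iff_Ioo)
  have "has_bochner_integral lborel ?f (Beta a b)"
  proof (rule has_bochner_integral_nn_integral)
    show "0 \<le> Beta a b" by (rule has_integral_nonneg[OF B]) auto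
    show "(\<integral>\<^sup>+x. ennreal (?f x) \<partial>lborel) = ennreal (Beta a b)"
      using nn_integral_has_integral_lebesgue[OF _ B] by simp
  qed auto
  then have "has_bochner_integral lborel (\<lambda>t. ?f (0 + (1 / u) * t)) (Beta a b /\<^sub>R \<bar>1 / u\<bar>)"
    using assms(3) by (subst (asm) lborel_has_bochner_integral_real_affine_iff[of "1 / u" _ _ 0]) auto
  then have "has_bochner_integral lborel (\<lambda>t. u powr (a + b - 2) * ?f (0 + (1 / u) * t))
     (u powr (a + b - 2) * (Beta a b /\<^sub>R \<bar>1 / u\<bar>))"
    by (rule has_bochner_integral_mult_right)
  moreover have "u powr (a + b - 2) * ?f (0 + (1 / u) * t) =
      indicator {0<..<u} t * (t powr (a - 1) * (u - t) powr (b - 1))" for t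
  proof (cases "0 < t \<and> t < u")
    case True
    have e: "0 + (1 / u) * t = t / u" "1 - t / u = (u - t) / u" using assms(3) by (auto simp: field_simps)
    have e2: "a + b - 2 = (a - 1) + (b - 1)" by simp
    have "u powr (a + b - 2) * ?f (0 + (1 / u) * t) =
       u powr ((a - 1) + (b - 1)) * ((t / u) powr (a - 1) * ((u - t) / u) powr (b - 1))"
      unfolding e(1) e2 unfolding e(2) using True by simp
    also have "\<dots> = t powr (a - 1) * (u - t) powr (b - 1)"
      unfolding powr_add using True by (simp add: powr_divide)
    finally show ?thesis using True by simp
  next
    case False
    then show ?thesis using assms(3) by (auto simp: indicator_def field_simps)
  qed
  moreover have "u powr (a + b - 2) * (Beta a b /\<^sub>R \<bar>1 / u\<bar>) = u powr (a + b - 1) * Beta a b"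
  proof -
    have "u powr (a + b - 1) = u powr (a + b - 2) * u powr 1"
      using powr_add[of u "a + b - 2" 1] by (simp del: powr_one')
    then show ?thesis using assms(3) by simp
  qed
  ultimately show ?thesis by (simp only:)
qed

text \<open>Termwise integration: the Beta integral of the \<open>k\<close>-th power cancels
  \<open>Gamma (a * real k + 1)\<close> and raises the argument of Gamma by \<open>c\<close>. The
  interchange is legitimate because the integrals of the absolute values again form a series of
  Mittag-Leffler type, with offset \<open>c + 1\<close>.\<close>

lemma fractional_integral_mittag_leffler:
  fixes a c l u :: real
  assumes a: "0 < a" and c: "0 < c" and l: "0 < l" and u: "0 < u"
  shows "integrable lborel (\<lambda>t. indicator {0<..<u} t * ((u - t) powr (c - 1) * mittag_leffler a (- l * t powr a)))"
    and "(\<lambda>k. Gamma c * ((- l) ^ k * u powr (a * real k + c) / Gamma (a * real k + c + 1))) sums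
       (\<integral>t. indicator {0<..<u} t * ((u - t) powr (c - 1) * mittag_leffler a (- l * t powr a)) \<partial>lborel)"
proof -
  define h where "h = (\<lambda>k t. indicator {0<..<u} t * (t powr ((a * real k + 1) - 1) * (u - t) powr (c - 1)))"
  define g where "g = (\<lambda>k t. (- l) ^ k / Gamma (a * real k + 1) * h k t)"
  have ak: "0 < a * real k + 1" for k using a by (simp add: add_nonneg_pos)
  have h: "has_bochner_integral lborel (h k) (u powr (a * real k + 1 + c - 1) * Beta (a * real k + 1) c)" for k
    unfolding h_def using ak c u by (rule Beta_integral_scaled)
  have Beta: "u powr (a * real k + 1 + c - 1) * Beta (a * real k + 1) c / Gamma (a * real k + 1) =
     Gamma c * (u powr (a * real k + c) / Gamma (a * real k + c + 1))" for k
  proof -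
    have "Gamma (a * real k + 1) > 0" using ak by (rule Gamma_real_pos)
    then show ?thesis by (simp add: Beta_def add_ac)
  qed
  have g_int: "integrable lborel (g k)"
    and g_val: "(\<integral>t. g k t \<partial>lborel) = Gamma c * ((- l) ^ k * u powr (a * real k + c) / Gamma (a * real k + c + 1))"
    and g_norm: "(\<integral>t. norm (g k t) \<partial>lborel) = Gamma c * (l ^ k * u powr (a * real k + c) / Gamma (a * real k + c + 1))" for k
  proof -
    have G: "Gamma (a * real k + 1) > 0" using ak by (rule Gamma_real_pos)
    show "integrable lborel (g k)"
      unfolding g_def using h by (intro integrable_mult_right) (auto simp: has_bochner_integral_iff)
    have "(\<integral>t. g k t \<partial>lborel) = (- l) ^ k / Gamma (a * real k + 1) * (u powr (a * real k + 1 + c - 1) * Beta (a * real k + 1) c)"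
      unfolding g_def using h[of k] by (simp add: has_bochner_integral_iff)
    also have "\<dots> = (- l) ^ k * (u powr (a * real k + 1 + c - 1) * Beta (a * real k + 1) c / Gamma (a * real k + 1))"
      by simp
    finally show "(\<integral>t. g k t \<partial>lborel) = Gamma c * ((- l) ^ k * u powr (a * real k + c) / Gamma (a * real k + c + 1))"
      unfolding Beta by simp
    have "norm (g k t) = l ^ k / Gamma (a * real k + 1) * h k t" for t
      using G l by (simp add: g_def h_def abs_mult power_abs abs_of_pos)
    then have "(\<integral>t. norm (g k t) \<partial>lborel) = l ^ k / Gamma (a * real k + 1) * (u powr (a * real k + 1 + c - 1) * Beta (a * real k + 1) c)"
      using h[of k] by (simp add: has_bochner_integral_iff)
    also have "\<dots> = l ^ k * (u powr (a * real k + 1 + c - 1) * Beta (a * real k + 1) c / Gamma (a * real k + 1))"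
      by simp
    finally show "(\<integral>t. norm (g k t) \<partial>lborel) = Gamma c * (l ^ k * u powr (a * real k + c) / Gamma (a * real k + c + 1))"
      unfolding Beta by simp
  qed
  have g_eq: "g k t = indicator {0<..<u} t * (u - t) powr (c - 1) * ((- l * t powr a) ^ k / Gamma (a * real k + 1))" for k t
  proof (cases "0 < t \<and> t < u")
    case True
    have "t powr (a * real k) = (t powr a) ^ k" using powr_powr[of t a "real k"] powr_realpow[of "t powr a" k] True by simp
    then show ?thesis unfolding g_def h_def power_mult_distrib[of "- l"] using True by simp
  qed (auto simp: g_def h_def)
  have summ: "summable (\<lambda>k. (- l * t powr a) ^ k / Gamma (a * real k + 1))" for t
    using a by (intro summable_mittag_leffler) auto
  have summ': "summable (\<lambda>k. \<bar>(- l * t powr a) ^ k / Gamma (a * real k + 1)\<bar>)" for t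
  proof -
    have "summable (\<lambda>k. \<bar>- l * t powr a\<bar> ^ k / Gamma (a * real k + 1))"
      using a by (intro summable_mittag_leffler) auto
    then show ?thesis using ak by (simp add: power_abs abs_of_pos Gamma_real_pos)
  qed
  have sum_g: "(\<Sum>k. g k t) = indicator {0<..<u} t * ((u - t) powr (c - 1) * mittag_leffler a (- l * t powr a))" for t
    unfolding g_eq using suminf_mult[OF summ[of t], of "indicator {0<..<u} t * (u - t) powr (c - 1)"]
    by (simp add: mittag_leffler_def mult.assoc)
  have A1: "AE t in lborel. summable (\<lambda>k. norm (g k t))"
  proof (rule AE_I2)
    fix t
    have "summable (\<lambda>k. \<bar>indicator {0<..<u} t * (u - t) powr (c - 1)\<bar> * \<bar>(- l * t powr a) ^ k / Gamma (a * real k + 1)\<bar>)"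
      using summ' by (rule summable_mult)
    then show "summable (\<lambda>k. norm (g k t))" unfolding g_eq real_norm_def abs_mult .
  qed
  have A2: "summable (\<lambda>k. \<integral>t. norm (g k t) \<partial>lborel)"
  proof -
    have "summable (\<lambda>k. (Gamma c * u powr c) * ((l * u powr a) ^ k / Gamma (a * real k + (c + 1))))"
      using a c by (intro summable_mult summable_mittag_leffler) auto
    moreover have "(Gamma c * u powr c) * ((l * u powr a) ^ k / Gamma (a * real k + (c + 1))) =
       Gamma c * (l ^ k * u powr (a * real k + c) / Gamma (a * real k + c + 1))" for k
    proof -
      have "u powr (a * real k) = (u powr a) ^ k" using powr_powr[of u a "real k"] powr_realpow[of "u powr a" k] u by simp
      then show ?thesis by (simp add: power_mult_distrib powr_add add_ac)
    qed
    ultimately show ?thesis unfolding g_norm by simp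
  qed
  show "integrable lborel (\<lambda>t. indicator {0<..<u} t * ((u - t) powr (c - 1) * mittag_leffler a (- l * t powr a)))"
    using integrable_suminf[OF g_int A1 A2] unfolding sum_g .
  show "(\<lambda>k. Gamma c * ((- l) ^ k * u powr (a * real k + c) / Gamma (a * real k + c + 1))) sums
       (\<integral>t. indicator {0<..<u} t * ((u - t) powr (c - 1) * mittag_leffler a (- l * t powr a)) \<partial>lborel)"
    using sums_integral[OF g_int A1 A2] unfolding sum_g g_val .
qed

text \<open>The Mittag-Leffler function solves a fractional relaxation equation; integrating it once more
  expresses the primitive through a fractional integral which is of lower order.\<close>

lemma mittag_leffler_primitive:
  fixes a l u :: real
  assumes a: "0 < a" "a < 1" and l: "0 < l" and u: "0 < u"
  shows "l * (\<integral>t. indicator {0<..<u} t * mittag_leffler a (- l * t powr a) \<partial>lborel) =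
    u powr (1 - a) / Gamma (2 - a) -
    (\<integral>t. indicator {0<..<u} t * ((u - t) powr (- a) * mittag_leffler a (- l * t powr a)) \<partial>lborel) / Gamma (1 - a)"
    (is "l * ?I = _ - ?J / _")
proof -
  \<comment> \<open>One series serves both integrals: its sum is the normalized fractional integral
    of order \<open>1 - a\<close>, and its tail from index 1 is \<open>- l\<close> times the
    primitive. Their difference is the term of index 0.\<close>
  define s where "s = (\<lambda>k. (- l) ^ k * u powr (a * real k + (1 - a)) / Gamma (a * real k + (1 - a) + 1))"
  have G: "Gamma (1 - a) > 0" using a by (intro Gamma_real_pos) auto
  have "(\<lambda>k. Gamma (1 - a) * s k) sums ?J"
    unfolding s_def using fractional_integral_mittag_leffler(2)[OF a(1) _ l u, of "1 - a"] a by simp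
  then have "(\<lambda>k. Gamma (1 - a) * s k / Gamma (1 - a)) sums (?J / Gamma (1 - a))" by (rule sums_divide)
  then have J: "s sums (?J / Gamma (1 - a))" using G by simp
  have "?I = (\<integral>t. indicator {0<..<u} t * ((u - t) powr (1 - 1) * mittag_leffler a (- l * t powr a)) \<partial>lborel)"
    by (intro Bochner_Integration.integral_cong) (auto split: split_indicator)
  then have "(\<lambda>k. Gamma 1 * ((- l) ^ k * u powr (a * real k + 1) / Gamma (a * real k + 1 + 1))) sums ?I"
    using fractional_integral_mittag_leffler(2)[OF a(1) _ l u, of 1] by simp
  then have "(\<lambda>k. - l * ((- l) ^ k * u powr (a * real k + 1) / Gamma (a * real k + 1 + 1))) sums (- l * ?I)"
    by (intro sums_mult) simp
  moreover have "- l * ((- l) ^ k * u powr (a * real k + 1) / Gamma (a * real k + 1 + 1)) = s (Suc k)" for k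
    by (simp add: s_def algebra_simps)
  ultimately have "(\<lambda>k. s (Suc k)) sums (- l * ?I)" by simp
  then have "s sums (- l * ?I + s 0)" using sums_Suc_iff[of s "- l * ?I"] by simp
  then have "- l * ?I + s 0 = ?J / Gamma (1 - a)" using J by (rule sums_unique2)
  moreover have "s 0 = u powr (1 - a) / Gamma (2 - a)" by (simp add: s_def)
  ultimately show ?thesis by simp
qed

text \<open>Analytically these bounds, the monotonicity and the limit would come from complete
  monotonicity of the Mittag-Leffler function on the negative axis; here they are inherited from a
  random variable with this tail.\<close>

locale mittag_leffler_survival =
  fixes a l :: real and f :: "real \<Rightarrow> real"
  assumes a: "0 < a" "a < 1" and l: "0 < l"
    and f_eq: "\<And>t. f t = mittag_leffler a (- l * t powr a)"
    and f_nonneg: "\<And>t. 0 \<le> t \<Longrightarrow> 0 \<le> f t"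
    and f_le_1: "\<And>t. 0 \<le> t \<Longrightarrow> f t \<le> 1"
    and f_mono: "\<And>s t. 0 \<le> s \<Longrightarrow> s \<le> t \<Longrightarrow> f t \<le> f s"
    and f_lim: "(f \<longlongrightarrow> 0) at_top"
begin

lemma f_measurable [measurable]: "f \<in> borel_measurable borel"
  unfolding f_eq[abs_def] mittag_leffler_def by measurable

definition primitive :: "real \<Rightarrow> real" where
  "primitive u = (\<integral>t. indicator {0<..<u} t * f t \<partial>lborel)"

lemma f_integrable: "integrable lborel (\<lambda>t. indicator {v<..<u} t * f t)" if "0 \<le> v"
proof (rule Bochner_Integration.integrable_bound)
  show "integrable lborel (indicator {v<..<u} :: real \<Rightarrow> real)"
    by (rule integrable_real_indicator, simp, cases "v \<le> u") simp_all
  show "AE t in lborel. norm (indicator {v<..<u} t * f t) \<le> norm (indicator {v<..<u} t :: real)"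
    using that by (intro AE_I2) (auto simp: f_nonneg f_le_1 abs_of_nonneg split: split_indicator)
qed auto

lemma primitive_diff_bounds:
  assumes v: "0 \<le> v" "v \<le> u"
  shows "(u - v) * f u \<le> primitive u - primitive v" "primitive u - primitive v \<le> (u - v) * f v"
proof -
  have "primitive u = (\<integral>t. indicator {0<..<v} t * f t + indicator {v<..<u} t * f t \<partial>lborel)"
    unfolding primitive_def
  proof (rule integral_cong_AE)
    have "AE t in lborel. t \<noteq> v" by (rule AE_lborel_singleton)
    then show "AE t in lborel. indicator {0<..<u} t * f t = indicator {0<..<v} t * f t + indicator {v<..<u} t * f t"
      by eventually_elim (use v in \<open>auto split: split_indicator\<close>)
  qed auto
  also have "\<dots> = primitive v + (\<integral>t. indicator {v<..<u} t * f t \<partial>lborel)"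
    unfolding primitive_def using v by (intro Bochner_Integration.integral_add f_integrable) auto
  finally have eq: "primitive u - primitive v = (\<integral>t. indicator {v<..<u} t * f t \<partial>lborel)" by simp
  have c: "(\<integral>t. indicator {v<..<u} t * y \<partial>lborel) = (u - v) * y" for y :: real
    using v by simp
  show "(u - v) * f u \<le> primitive u - primitive v"
    unfolding eq c[symmetric]
    by (rule integral_mono) (use v in \<open>auto intro!: f_integrable f_mono split: split_indicator\<close>)
  show "primitive u - primitive v \<le> (u - v) * f v"
    unfolding eq c[symmetric]
    by (rule integral_mono) (use v in \<open>auto intro!: f_integrable f_mono split: split_indicator\<close>)
qed

lemma primitive_0: "primitive 0 = 0"
  by (simp add: primitive_def)

text \<open>Up to the factor \<open>Gamma (1 - a)\<close> the Riemann-Liouville integral of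
  \<open>f\<close> of order \<open>1 - a\<close>.\<close>

definition fractional :: "real \<Rightarrow> real" where
  "fractional u = (\<integral>t. indicator {0<..<u} t * ((u - t) powr (- a) * f t) \<partial>lborel)"

lemma primitive_eq: "0 < u \<Longrightarrow> l * primitive u = u powr (1 - a) / Gamma (2 - a) - fractional u / Gamma (1 - a)"
  unfolding primitive_def fractional_def f_eq using mittag_leffler_primitive[OF a l] by simp

lemma fractional_nonneg: "0 \<le> fractional u"
  unfolding fractional_def by (rule integral_nonneg_AE) (auto simp: f_nonneg split: split_indicator)

lemma Gamma_pos: "0 < Gamma (1 - a)" "0 < Gamma (2 - a)"
  using a by (auto intro!: Gamma_real_pos)

text \<open>Monotonicity gives \<open>u * f u \<le> primitive u\<close>, and discarding the
  nonnegative fractional integral bounds the primitive. Being valid at all positive times, the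
  estimate provides integrable majorants later on.\<close>

lemma f_upper_bound:
  assumes u: "0 < u"
  shows "f u \<le> u powr (- a) / (l * Gamma (2 - a))"
proof -
  have "u * f u \<le> primitive u" using primitive_diff_bounds(1)[of 0 u] u by (simp add: primitive_0)
  also have "primitive u \<le> u powr (1 - a) / Gamma (2 - a) / l"
  proof -
    have "0 \<le> fractional u / Gamma (1 - a)"
      using fractional_nonneg[of u] Gamma_pos(1) by (intro divide_nonneg_pos)
    then have "l * primitive u \<le> u powr (1 - a) / Gamma (2 - a)" using primitive_eq[OF u] by linarith
    then show ?thesis unfolding pos_le_divide_eq[OF l] by (simp only: mult.commute)
  qed
  also have "u powr (1 - a) = u * u powr (- a)" using u powr_add[of u 1 "- a"] by simp
  also have "u * u powr (- a) / Gamma (2 - a) / l = u * (u powr (- a) / (l * Gamma (2 - a)))"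
    by (simp add: mult.commute)
  finally show ?thesis using u by (rule mult_left_le_imp_le)
qed

lemma fractional_scaled:
  assumes u: "0 < u"
  shows "fractional u / u powr (1 - a) = (\<integral>s. indicator {0<..<1} s * ((1 - s) powr (- a) * f (u * s)) \<partial>lborel)"
proof -
  have "fractional u = u * (\<integral>s. indicator {0<..<u} (0 + u * s) * ((u - (0 + u * s)) powr (- a) * f (0 + u * s)) \<partial>lborel)"
    unfolding fractional_def using u by (subst lborel_integral_real_affine[of u _ 0]) auto
  also have "(\<lambda>s. indicator {0<..<u} (0 + u * s) * ((u - (0 + u * s)) powr (- a) * f (0 + u * s))) =
     (\<lambda>s. u powr (- a) * (indicator {0<..<1} s * ((1 - s) powr (- a) * f (u * s))))"
  proof
    fix s :: real
    show "indicator {0<..<u} (0 + u * s) * ((u - (0 + u * s)) powr (- a) * f (0 + u * s)) =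
     u powr (- a) * (indicator {0<..<1} s * ((1 - s) powr (- a) * f (u * s)))"
    proof (cases "0 < s \<and> s < 1")
      case True
      have "u - (0 + u * s) = u * (1 - s)" by (simp add: algebra_simps)
      then have "(u - (0 + u * s)) powr (- a) = u powr (- a) * (1 - s) powr (- a)"
        using u True by (simp add: powr_mult)
      moreover have "u * s < u" using True u by simp
      ultimately show ?thesis using True u by simp
    next
      case False
      then have "\<not> (0 < u * s \<and> u * s < u)" using u by (auto simp: zero_less_mult_iff)
      then show ?thesis using False by (auto simp: indicator_def)
    qed
  qed
  also have "u * (\<integral>s. u powr (- a) * (indicator {0<..<1} s * ((1 - s) powr (- a) * f (u * s))) \<partial>lborel) =
    (u * u powr (- a)) * (\<integral>s. indicator {0<..<1} s * ((1 - s) powr (- a) * f (u * s)) \<partial>lborel)"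
    by simp
  also have "u * u powr (- a) = u powr (1 - a)" using u powr_add[of u 1 "- a"] by simp
  finally show ?thesis using u by simp
qed

text \<open>After rescaling to the unit interval \<open>f (u * s)\<close> tends to 0 for every
  positive \<open>s\<close>, and the kernel \<open>(1 - s) powr (- a)\<close> is an integrable
  majorant because \<open>a < 1\<close>.\<close>

lemma fractional_lower_order: "((\<lambda>u. fractional u / u powr (1 - a)) \<longlongrightarrow> 0) at_top"
proof -
  have "((\<lambda>u. \<integral>s. indicator {0<..<1} s * ((1 - s) powr (- a) * f (u * s)) \<partial>lborel) \<longlongrightarrow> (\<integral>s. 0 \<partial>(lborel :: real measure))) at_top"
  proof (rule integral_dominated_convergence_at_top[where w="\<lambda>s. indicator {0<..<1} s * (1 - s) powr (- a)"])
    have "has_bochner_integral lborel (\<lambda>t. indicator {0<..<1} t * (t powr (1 - 1) * (1 - t) powr ((1 - a) - 1)))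
      (1 powr (1 + (1 - a) - 1) * Beta 1 (1 - a))"
      using a by (intro Beta_integral_scaled) auto
    then have "integrable lborel (\<lambda>t::real. indicator {0<..<1} t * (t powr (1 - 1) * (1 - t) powr ((1 - a) - 1)))"
      by (simp add: has_bochner_integral_iff)
    also have "(\<lambda>t::real. indicator {0<..<1} t * (t powr (1 - 1) * (1 - t) powr ((1 - a) - 1))) =
      (\<lambda>s. indicator {0<..<1} s * (1 - s) powr (- a))"
      by (auto simp: fun_eq_iff split: split_indicator)
    finally show "integrable lborel (\<lambda>s. indicator {0<..<1} s * (1 - s) powr (- a))" .
    show "AE s in lborel. ((\<lambda>u. indicator {0<..<1} s * ((1 - s) powr (- a) * f (u * s))) \<longlongrightarrow> 0) at_top"
    proof (rule AE_I2)
      fix s :: real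
      show "((\<lambda>u. indicator {0<..<1} s * ((1 - s) powr (- a) * f (u * s))) \<longlongrightarrow> 0) at_top"
      proof (cases "0 < s \<and> s < 1")
        case True
        have "filterlim (\<lambda>u. u * s) at_top at_top"
          using True by (intro filterlim_at_top_mult_tendsto_pos[OF tendsto_const _ filterlim_ident]) auto
        then have "((\<lambda>u. f (u * s)) \<longlongrightarrow> 0) at_top" by (rule filterlim_compose[OF f_lim])
        then show ?thesis by (intro tendsto_mult_right_zero)
      qed auto
    qed
    show "\<forall>\<^sub>F u in at_top. AE s in lborel. norm (indicator {0<..<1} s * ((1 - s) powr (- a) * f (u * s))) \<le> indicator {0<..<1} s * (1 - s) powr (- a)"
      using eventually_gt_at_top[of 0]
    proof eventually_elim
      case (elim u)
      show ?case
      proof (rule AE_I2)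
        fix s :: real
        have "0 \<le> f (u * s) \<and> f (u * s) \<le> 1" if "0 < s" using that elim f_nonneg f_le_1 by simp
        then show "norm (indicator {0<..<1} s * ((1 - s) powr (- a) * f (u * s))) \<le> indicator {0<..<1} s * (1 - s) powr (- a)"
          by (auto simp: abs_mult mult_left_le split: split_indicator)
      qed
    qed
  qed auto
  then have "((\<lambda>u. \<integral>s. indicator {0<..<1} s * ((1 - s) powr (- a) * f (u * s)) \<partial>lborel) \<longlongrightarrow> 0) at_top" by simp
  moreover have "\<forall>\<^sub>F u in at_top. fractional u / u powr (1 - a) = (\<integral>s. indicator {0<..<1} s * ((1 - s) powr (- a) * f (u * s)) \<partial>lborel)"
    using eventually_gt_at_top[of 0] by eventually_elim (rule fractional_scaled)
  ultimately show ?thesis by (simp only: tendsto_cong)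
qed

lemma primitive_asymptotics: "((\<lambda>u. primitive u / u powr (1 - a)) \<longlongrightarrow> 1 / (l * Gamma (2 - a))) at_top"
proof -
  have "((\<lambda>u. (1 / Gamma (2 - a) - fractional u / u powr (1 - a) / Gamma (1 - a)) / l) \<longlongrightarrow>
    (1 / Gamma (2 - a) - 0 / Gamma (1 - a)) / l) at_top"
    using Gamma_pos l by (intro tendsto_intros fractional_lower_order) auto
  moreover have "\<forall>\<^sub>F u in at_top. (1 / Gamma (2 - a) - fractional u / u powr (1 - a) / Gamma (1 - a)) / l = primitive u / u powr (1 - a)"
    using eventually_gt_at_top[of 0]
  proof eventually_elim
    case (elim u)
    have "primitive u = (u powr (1 - a) / Gamma (2 - a) - fractional u / Gamma (1 - a)) / l"
      using primitive_eq[OF elim] l by (simp add: field_simps)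
    moreover have "u powr (1 - a) \<noteq> 0" using elim by simp
    ultimately show ?case by (simp add: diff_divide_distrib)
  qed
  ultimately show ?thesis using l by (simp add: tendsto_cong mult.commute)
qed

text \<open>Monotone density argument: difference quotients of the primitive over \<open>[u, \<theta>u]\<close>
  sandwich \<open>f u\<close>, and \<open>(\<theta> powr (1 - a) - 1) / (\<theta> - 1)\<close> tends to \<open>1 - a\<close> as \<open>\<theta>\<close> tends to 1.\<close>

theorem f_asymptotics: "((\<lambda>u. f u * u powr a) \<longlongrightarrow> 1 / (l * Gamma (1 - a))) at_top"
proof -
  define B where "B = 1 / (l * Gamma (2 - a))"
  \<comment> \<open>Differentiating \<open>u powr (1 - a)\<close> produces the factor
    \<open>1 - a\<close>, which lowers the argument of Gamma by one.\<close>
  have "Gamma (2 - a) = (1 - a) * Gamma (1 - a)"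
    using Gamma_plus1[of "1 - a"] a nonpos_Ints_nonpos[of "1 - a"] by (auto simp: algebra_simps)
  then have B: "1 / (l * Gamma (1 - a)) = B * (1 - a)" using a by (simp add: B_def)
  define q where "q = (\<lambda>\<theta>. (\<theta> powr (1 - a) - 1) / (\<theta> - 1))"
  have q: "(q \<longlongrightarrow> 1 - a) (at 1)"
  proof -
    have "((\<lambda>x. x powr (1 - a)) has_real_derivative (1 - a) * 1 powr ((1 - a) - 1)) (at 1)"
      by (rule has_real_derivative_powr) simp
    then show ?thesis by (simp add: has_field_derivative_iff q_def)
  qed
  have quot: "((\<lambda>u. (primitive (\<theta> * u) - primitive u) / (u powr (1 - a) * (\<theta> - 1))) \<longlongrightarrow> B * q \<theta>) at_top"
    if \<theta>: "0 < \<theta>" "\<theta> \<noteq> 1" for \<theta>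
  proof -
    have lim: "filterlim (\<lambda>u. \<theta> * u) at_top at_top"
      using \<theta> by (intro filterlim_tendsto_pos_mult_at_top[OF tendsto_const _ filterlim_ident]) auto
    have "((\<lambda>u. (primitive (\<theta> * u) / (\<theta> * u) powr (1 - a) * \<theta> powr (1 - a) - primitive u / u powr (1 - a)) / (\<theta> - 1)) \<longlongrightarrow>
       (B * \<theta> powr (1 - a) - B) / (\<theta> - 1)) at_top"
      using \<theta> unfolding B_def by (intro tendsto_intros primitive_asymptotics filterlim_compose[OF primitive_asymptotics lim]) auto
    also have "(B * \<theta> powr (1 - a) - B) / (\<theta> - 1) = B * q \<theta>" by (simp add: q_def algebra_simps)
    finally show ?thesis
    proof (rule Lim_transform_eventually)
      show "\<forall>\<^sub>F u in at_top. (primitive (\<theta> * u) / (\<theta> * u) powr (1 - a) * \<theta> powr (1 - a) - primitive u / u powr (1 - a)) / (\<theta> - 1) =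
        (primitive (\<theta> * u) - primitive u) / (u powr (1 - a) * (\<theta> - 1))"
        using eventually_gt_at_top[of 0]
      proof eventually_elim
        case (elim u)
        have "\<theta> powr (1 - a) > 0" "u powr (1 - a) > 0" using elim \<theta> by auto
        then show ?case using elim \<theta> by (simp add: powr_mult diff_divide_distrib[symmetric])
      qed
    qed
  qed
  have fu: "f u * u powr a = (u * (\<theta> - 1)) * f u / (u powr (1 - a) * (\<theta> - 1))" if "0 < u" "\<theta> \<noteq> 1" for u \<theta>
  proof -
    have "u powr a * u powr (1 - a) = u" using that powr_add[of u a "1 - a"] by simp
    then show ?thesis using that by (simp add: field_simps)
  qed
  show ?thesis unfolding B
  proof (rule order_tendstoI)
    \<comment> \<open>Lower bound: on the interval to the right of \<open>u\<close>, with \<theta> >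
      1, the function is at most \<open>f u\<close>.\<close>
    fix x assume x: "x < B * (1 - a)"
    have "((\<lambda>\<theta>. B * q \<theta>) \<longlongrightarrow> B * (1 - a)) (at_left 1)"
      by (intro tendsto_intros filterlim_mono[OF q order_refl]) (simp add: at_le)
    have "((\<lambda>\<theta>. B * q \<theta>) \<longlongrightarrow> B * (1 - a)) (at_right 1)"
      by (intro tendsto_intros filterlim_mono[OF q order_refl]) (simp add: at_le)
    then have "\<forall>\<^sub>F \<theta> in at_right 1. x < B * q \<theta>" using x by (rule order_tendstoD(1))
    moreover have "\<forall>\<^sub>F \<theta> in at_right 1. 1 < (\<theta> :: real)" by (rule eventually_at_right_less)
    ultimately have "\<forall>\<^sub>F \<theta> in at_right 1. x < B * q \<theta> \<and> 1 < \<theta>" by eventually_elim simp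
    then obtain \<theta> where \<theta>: "x < B * q \<theta>" "1 < \<theta>"
      using eventually_happens'[OF trivial_limit_at_right_real] by blast
    have "\<forall>\<^sub>F u in at_top. x < (primitive (\<theta> * u) - primitive u) / (u powr (1 - a) * (\<theta> - 1))"
      using quot \<theta> by (intro order_tendstoD(1)) auto
    then show "\<forall>\<^sub>F u in at_top. x < f u * u powr a"
      using eventually_gt_at_top[of 0]
    proof eventually_elim
      case (elim u)
      have "primitive (\<theta> * u) - primitive u \<le> (u * (\<theta> - 1)) * f u"
        using primitive_diff_bounds(2)[of u "\<theta> * u"] elim(2) \<theta>(2) by (simp add: algebra_simps)
      then have "(primitive (\<theta> * u) - primitive u) / (u powr (1 - a) * (\<theta> - 1)) \<le> f u * u powr a"
        unfolding fu[OF elim(2) less_imp_neq[OF \<theta>(2), symmetric]] using \<theta>(2) elim(2) by (intro divide_right_mono) auto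
      then show ?case using elim(1) by simp
    qed
  next
    \<comment> \<open>Upper bound: on the interval to the left of \<open>u\<close>, with \<theta> <
      1, the function is at least \<open>f u\<close>; dividing by the negative \<theta> - 1 reverses
      the inequality.\<close>
    fix x assume x: "B * (1 - a) < x"
    have "((\<lambda>\<theta>. B * q \<theta>) \<longlongrightarrow> B * (1 - a)) (at_left 1)"
      by (intro tendsto_intros filterlim_mono[OF q order_refl]) (simp add: at_le)
    then have "\<forall>\<^sub>F \<theta> in at_left 1. B * q \<theta> < x" using x by (rule order_tendstoD(2))
    moreover have "\<forall>\<^sub>F \<theta> in at_left 1. 0 < \<theta> \<and> \<theta> < (1 :: real)"
      by (rule eventually_at_left_real[of 0 1, simplified, THEN eventually_mono]) auto
    ultimately have "\<forall>\<^sub>F \<theta> in at_left 1. B * q \<theta> < x \<and> 0 < \<theta> \<and> \<theta> < 1" by eventually_elim simp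
    then obtain \<theta> where \<theta>: "B * q \<theta> < x" "0 < \<theta>" "\<theta> < 1"
      using eventually_happens'[OF trivial_limit_at_left_real] by blast
    have "\<forall>\<^sub>F u in at_top. (primitive (\<theta> * u) - primitive u) / (u powr (1 - a) * (\<theta> - 1)) < x"
      using quot \<theta> by (intro order_tendstoD(2)) auto
    then show "\<forall>\<^sub>F u in at_top. f u * u powr a < x"
      using eventually_gt_at_top[of 0]
    proof eventually_elim
      case (elim u)
      have "(u * (1 - \<theta>)) * f u \<le> primitive u - primitive (\<theta> * u)"
        using primitive_diff_bounds(1)[of "\<theta> * u" u] elim(2) \<theta> by (simp add: algebra_simps)
      then have "primitive (\<theta> * u) - primitive u \<le> (u * (\<theta> - 1)) * f u" by (simp add: algebra_simps)
      then have "f u * u powr a \<le> (primitive (\<theta> * u) - primitive u) / (u powr (1 - a) * (\<theta> - 1))"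
        unfolding fu[OF elim(2) less_imp_neq[OF \<theta>(3)]] using \<theta> elim(2)
        by (intro divide_right_mono_neg) (auto intro!: mult_nonneg_nonpos)
      then show ?case using elim(1) by simp
    qed
  qed
qed

end

lemma mittag_leffler_survival_of_distributed:
  assumes "prob_space P" and a: "0 < a" "a < 1" and l: "0 < l"
    and X: "mittag_leffler_distributed P X a l"
  shows "mittag_leffler_survival a l (\<lambda>t. mittag_leffler a (- l * t powr a))"
proof -
  interpret prob_space P by fact
  have [measurable]: "X \<in> borel_measurable P" using X by (simp add: mittag_leffler_distributed_def)
  have f: "mittag_leffler a (- l * t powr a) = prob {\<omega> \<in> space P. t < X \<omega>}" if "0 \<le> t" for t
    using X that by (simp add: mittag_leffler_distributed_def)
  show ?thesis
  proof
    show "mittag_leffler a (- l * t powr a) \<le> mittag_leffler a (- l * s powr a)" if "0 \<le> s" "s \<le> t" for s t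
    proof -
      have "0 \<le> t" using that by simp
      then show ?thesis unfolding f[OF that(1)] f[OF \<open>0 \<le> t\<close>]
        using that by (intro finite_measure_mono) auto
    qed
    have "((\<lambda>t. 1 - cdf (distr P borel X) t) \<longlongrightarrow> 1 - 1) at_top"
      by (intro tendsto_intros real_distribution.cdf_lim_at_top_prob real_distribution_distr) auto
    moreover have "\<forall>\<^sub>F t in at_top. 1 - cdf (distr P borel X) t = mittag_leffler a (- l * t powr a)"
      using eventually_ge_at_top[of 0]
    proof eventually_elim
      case (elim t)
      have "X -` {..t} \<inter> space P = space P - {\<omega> \<in> space P. t < X \<omega>}" by auto
      then have "cdf (distr P borel X) t = 1 - prob {\<omega> \<in> space P. t < X \<omega>}"
        by (simp add: cdf_def measure_distr prob_compl)
      then show ?case using f[OF elim] by simp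
    qed
    ultimately show "((\<lambda>t. mittag_leffler a (- l * t powr a)) \<longlongrightarrow> 0) at_top"
      by (simp add: tendsto_cong)
    show "0 \<le> mittag_leffler a (- l * t powr a)" "mittag_leffler a (- l * t powr a) \<le> 1" if "0 \<le> t" for t
      unfolding f[OF that] by auto
  qed (use a l in auto)
qed

section \<open>Laplace transforms of the waiting times\<close>

locale product_tail = prob_space M + F: mittag_leffler_survival a l f + G: mittag_leffler_survival b m g
  for M :: "'a measure" and a l f b m g +
  fixes Y :: "'a \<Rightarrow> real"
  assumes Y_meas [measurable]: "Y \<in> borel_measurable M"
    and Y_tail: "\<And>t. 0 \<le> t \<Longrightarrow> prob {\<omega> \<in> space M. t < Y \<omega>} = f t * g t"
begin

definition h :: "real \<Rightarrow> real" where "h t = f t * g t"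

lemma h_measurable [measurable]: "h \<in> borel_measurable borel"
  unfolding h_def[abs_def] by measurable

lemma h_bounds: "0 \<le> t \<Longrightarrow> 0 \<le> h t" "0 \<le> t \<Longrightarrow> h t \<le> 1"
  unfolding h_def by (auto intro!: mult_nonneg_nonneg mult_le_one F.f_nonneg G.f_nonneg F.f_le_1 G.f_le_1)

text \<open>Constant of the tail bound valid at all positive times, to be distinguished from the
  asymptotic constant \<open>A\<close>: the arguments of Gamma are larger by one.\<close>

definition C :: real where "C = 1 / (l * Gamma (2 - a)) * (1 / (m * Gamma (2 - b)))"

lemma C_pos: "0 < C"
  unfolding C_def using F.Gamma_pos G.Gamma_pos F.l G.l by simp

lemma h_upper_bound: "0 < t \<Longrightarrow> h t \<le> C * t powr (- (a + b))"
proof -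
  assume t: "0 < t"
  have "h t \<le> (t powr (- a) / (l * Gamma (2 - a))) * (t powr (- b) / (m * Gamma (2 - b)))"
    unfolding h_def using t F.Gamma_pos F.l
    by (intro mult_mono F.f_upper_bound G.f_upper_bound G.f_nonneg) auto
  also have "\<dots> = C * (t powr (- a) * t powr (- b))" by (simp add: C_def)
  also have "t powr (- a) * t powr (- b) = t powr (- (a + b))" by (simp add: powr_add[symmetric])
  finally show ?thesis .
qed

definition A :: real where "A = 1 / (l * Gamma (1 - a)) * (1 / (m * Gamma (1 - b)))"

lemma A_pos: "0 < A"
  unfolding A_def using F.Gamma_pos G.Gamma_pos F.l G.l by simp

lemma h_asymptotics: "((\<lambda>t. h t * t powr (a + b)) \<longlongrightarrow> A) at_top"
proof -
  have "((\<lambda>t. (f t * t powr a) * (g t * t powr b)) \<longlongrightarrow> A) at_top"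
    unfolding A_def by (intro tendsto_intros F.f_asymptotics G.f_asymptotics)
  then show ?thesis by (simp add: h_def powr_add mult_ac)
qed

lemma Y_pos: "AE \<omega> in M. 0 < Y \<omega>"
proof -
  have "mittag_leffler c 0 = 1" for c
  proof -
    have "(\<lambda>k. 0 ^ k / Gamma (c * real k + 1)) sums (\<Sum>k\<in>{0}. 0 ^ k / Gamma (c * real k + 1))"
      by (rule sums_finite) auto
    then show ?thesis by (simp add: mittag_leffler_def sums_iff)
  qed
  then have "prob {\<omega> \<in> space M. 0 < Y \<omega>} = 1"
    using Y_tail[of 0] by (simp add: F.f_eq G.f_eq)
  then show ?thesis by (subst (asm) prob_Collect_eq_1) auto
qed

text \<open>Tonelli: \<open>K (Y \<omega>)\<close> is the integral of \<open>k\<close> over the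
  times before \<open>Y \<omega>\<close>, so every expectation needed below becomes an integral
  against the tail \<open>h\<close>.\<close>

lemma layer_cake:
  assumes [measurable]: "k \<in> borel_measurable borel" "K \<in> borel_measurable borel" and k: "\<And>t. 0 < t \<Longrightarrow> 0 \<le> k t" and K: "\<And>y. 0 < y \<Longrightarrow> 0 \<le> K y"
    and int: "\<And>y. 0 < y \<Longrightarrow> (k has_integral K y) {0..y}"
  shows "(\<integral>\<^sup>+\<omega>. ennreal (K (Y \<omega>)) \<partial>M) = (\<integral>\<^sup>+t. ennreal (indicator {0<..} t * (k t * h t)) \<partial>lborel)"
proof -
  have "(\<integral>\<^sup>+\<omega>. ennreal (K (Y \<omega>)) \<partial>M) = (\<integral>\<^sup>+\<omega>. \<integral>\<^sup>+t. ennreal (indicator {0<..} t * k t) * indicator {t. t < Y \<omega>} t \<partial>lborel \<partial>M)"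
  proof (rule nn_integral_cong_AE, use Y_pos in eventually_elim)
    case (elim \<omega>)
    have "(k has_integral K (Y \<omega>)) {0<..<Y \<omega>}" using int[OF elim] by (simp add: has_integral_Icc_iff_Ioo)
    then have "(\<integral>\<^sup>+t. ennreal (indicator {0<..<Y \<omega>} t * k t) \<partial>lborel) = ennreal (K (Y \<omega>))"
      by (intro nn_integral_has_integral_lebesgue) (auto intro: k)
    moreover have "ennreal (indicator {0<..} t * k t) * indicator {t. t < Y \<omega>} t = ennreal (indicator {0<..<Y \<omega>} t * k t)" for t
      by (auto split: split_indicator)
    ultimately show ?case by simp
  qed
  also have "\<dots> = (\<integral>\<^sup>+t. \<integral>\<^sup>+\<omega>. ennreal (indicator {0<..} t * k t) * indicator {t. t < Y \<omega>} t \<partial>M \<partial>lborel)"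
  proof -
    interpret pair_sigma_finite lborel M ..
    show ?thesis by (rule Fubini') measurable
  qed
  also have "\<dots> = (\<integral>\<^sup>+t. ennreal (indicator {0<..} t * (k t * h t)) \<partial>lborel)"
  proof (rule nn_integral_cong)
    fix t :: real
    show "(\<integral>\<^sup>+\<omega>. ennreal (indicator {0<..} t * k t) * indicator {t. t < Y \<omega>} t \<partial>M) = ennreal (indicator {0<..} t * (k t * h t))"
    proof (cases "0 < t")
      case True
      have "(\<integral>\<^sup>+\<omega>. ennreal (indicator {0<..} t * k t) * indicator {t. t < Y \<omega>} t \<partial>M) =
        ennreal (k t) * (\<integral>\<^sup>+\<omega>. indicator {\<omega> \<in> space M. t < Y \<omega>} \<omega> \<partial>M)"
        using True by (subst nn_integral_cmult[symmetric]) (auto intro!: nn_integral_cong split: split_indicator)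
      also have "(\<integral>\<^sup>+\<omega>. indicator {\<omega> \<in> space M. t < Y \<omega>} \<omega> \<partial>M) = ennreal (h t)"
        using Y_tail[of t] True by (simp add: h_def emeasure_eq_measure)
      finally show ?thesis using True k by (simp add: ennreal_mult' h_bounds)
    qed simp
  qed
  finally show ?thesis .
qed

lemma layer_cake_expectation:
  assumes [measurable]: "k \<in> borel_measurable borel" "K \<in> borel_measurable borel" and k: "\<And>t. 0 < t \<Longrightarrow> 0 \<le> k t" and K: "\<And>y. 0 < y \<Longrightarrow> 0 \<le> K y"
    and int: "\<And>y. 0 < y \<Longrightarrow> (k has_integral K y) {0..y}"
  shows "expectation (\<lambda>\<omega>. K (Y \<omega>)) = (\<integral>t. indicator {0<..} t * (k t * h t) \<partial>lborel)"
proof -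
  have "expectation (\<lambda>\<omega>. K (Y \<omega>)) = enn2real (\<integral>\<^sup>+\<omega>. ennreal (K (Y \<omega>)) \<partial>M)"
    by (rule integral_eq_nn_integral) (use Y_pos in \<open>auto elim!: eventually_mono intro: K\<close>)
  also have "\<dots> = enn2real (\<integral>\<^sup>+t. ennreal (indicator {0<..} t * (k t * h t)) \<partial>lborel)"
    using layer_cake[OF assms] by simp
  also have "\<dots> = (\<integral>t. indicator {0<..} t * (k t * h t) \<partial>lborel)"
    by (rule integral_eq_nn_integral[symmetric]) (auto split: split_indicator intro!: mult_nonneg_nonneg k h_bounds)
  finally show ?thesis .
qed

section \<open>Laplace transform at small arguments: infinite mean\<close>

definition laplace :: "real \<Rightarrow> real" where "laplace z = expectation (\<lambda>\<omega>. exp (- z * Y \<omega>))"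

lemma integrable_exp: "0 \<le> z \<Longrightarrow> integrable M (\<lambda>\<omega>. exp (- z * Y \<omega>))"
  by (rule integrable_const_bound[where B=1]) (use Y_pos in \<open>auto elim!: eventually_mono\<close>)

lemma one_minus_laplace: "0 \<le> z \<Longrightarrow> 1 - laplace z = expectation (\<lambda>\<omega>. 1 - exp (- z * Y \<omega>))"
  using integrable_exp[of z] by (simp add: laplace_def prob_space)

text \<open>Layer cake for an exponential kernel, followed by the substitution of
  \<open>x * t\<close> for \<open>t\<close>. The large parameter then sits only inside the tail, and
  the transform is seen to depend on the tail alone.\<close>

lemma laplace_tail:
  assumes x: "0 < x"
  shows "1 - laplace (1 / x) = (\<integral>t. indicator {0<..} t * (exp (- t) * h (x * t)) \<partial>lborel)"
proof -
  have "((\<lambda>t. (1 / x) * exp (- (1 / x) * t)) has_integral (1 - exp (- (1 / x) * y))) {0..y}" if "0 < y" for y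
  proof -
    have "((\<lambda>t. (1 / x) * exp (- (1 / x) * t)) has_integral ((- exp (- (1 / x) * y)) - (- exp (- (1 / x) * 0)))) {0..y}"
      using that x by (intro fundamental_theorem_of_calculus)
        (auto intro!: derivative_eq_intros simp flip: has_real_derivative_iff_has_vector_derivative)
    then show ?thesis by simp
  qed
  then have "1 - laplace (1 / x) = (\<integral>t. indicator {0<..} t * ((1 / x) * exp (- (1 / x) * t) * h t) \<partial>lborel)"
    unfolding one_minus_laplace[of "1 / x", OF less_imp_le[OF divide_pos_pos[OF zero_less_one x]]]
    by (intro layer_cake_expectation[where K="\<lambda>y. 1 - exp (- (1 / x) * y)"]) (use x in auto)
  also have "\<dots> = x * (\<integral>t. indicator {0<..} (0 + x * t) * ((1 / x) * exp (- (1 / x) * (0 + x * t)) * h (0 + x * t)) \<partial>lborel)"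
    using x by (subst lborel_integral_real_affine[of x _ 0]) auto
  also have "\<dots> = (\<integral>t. x * (indicator {0<..} (0 + x * t) * ((1 / x) * exp (- (1 / x) * (0 + x * t)) * h (0 + x * t))) \<partial>lborel)"
    by simp
  also have "\<dots> = (\<integral>t. indicator {0<..} t * (exp (- t) * h (x * t)) \<partial>lborel)"
    using x by (intro Bochner_Integration.integral_cong) (auto simp: indicator_def zero_less_mult_iff)
  finally show ?thesis .
qed

text \<open>The rescaled tail converges to \<open>A * t powr (- (a + b))\<close> and is dominated by
  \<open>C\<close> times the same power; against \<open>exp (- t)\<close> this power is integrable
  at 0 because \<open>a + b < 1\<close>, with integral \<open>Gamma (1 - (a + b))\<close>.\<close>

lemma laplace_asymptotics_less_1:
  assumes ab: "a + b < 1"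
  shows "((\<lambda>x. x powr (a + b) * (1 - laplace (1 / x))) \<longlongrightarrow> A * Gamma (1 - (a + b))) at_top"
proof -
  have e: "0 < 1 - (a + b)" using ab by simp
  have GI: "(\<integral>\<^sup>+t. ennreal (indicator {0<..} t * (exp (- t) * t powr (- (a + b)))) \<partial>lborel) = ennreal (Gamma (1 - (a + b)))"
    unfolding Gamma_conv_nn_integral_real[OF e]
  proof (rule nn_integral_cong_AE)
    have "AE t in lborel. t \<noteq> (0::real)" by (rule AE_lborel_singleton)
    then show "AE t in lborel. ennreal (indicator {0<..} t * (exp (- t) * t powr (- (a + b)))) =
      ennreal (indicator {0..} t * t powr ((1 - (a + b)) - 1) / exp t)"
      by eventually_elim (auto simp: exp_minus field_simps split: split_indicator)
  qed
  have hb: "has_bochner_integral lborel (\<lambda>t. indicator {0<..} t * (exp (- t) * t powr (- (a + b)))) (Gamma (1 - (a + b)))"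
    using GI e by (intro has_bochner_integral_nn_integral) (auto intro!: less_imp_le[OF Gamma_real_pos] split: split_indicator)
  have "((\<lambda>x. \<integral>t. indicator {0<..} t * (exp (- t) * (x powr (a + b) * h (x * t))) \<partial>lborel) \<longlongrightarrow>
     (\<integral>t. A * (indicator {0<..} t * (exp (- t) * t powr (- (a + b)))) \<partial>lborel)) at_top"
  proof (rule integral_dominated_convergence_at_top[where w="\<lambda>t. C * (indicator {0<..} t * (exp (- t) * t powr (- (a + b))))"])
    show "integrable lborel (\<lambda>t. C * (indicator {0<..} t * (exp (- t) * t powr (- (a + b)))))"
      using hb by (intro integrable_mult_right) (simp add: has_bochner_integral_iff)
    show "AE t in lborel. ((\<lambda>x. indicator {0<..} t * (exp (- t) * (x powr (a + b) * h (x * t)))) \<longlongrightarrow>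
      A * (indicator {0<..} t * (exp (- t) * t powr (- (a + b))))) at_top"
    proof (rule AE_I2)
      fix t :: real
      show "((\<lambda>x. indicator {0<..} t * (exp (- t) * (x powr (a + b) * h (x * t)))) \<longlongrightarrow>
      A * (indicator {0<..} t * (exp (- t) * t powr (- (a + b))))) at_top"
      proof (cases "0 < t")
        case True
        have "filterlim (\<lambda>x. x * t) at_top at_top"
          using True by (intro filterlim_at_top_mult_tendsto_pos[OF tendsto_const _ filterlim_ident]) auto
        then have "((\<lambda>x. h (x * t) * (x * t) powr (a + b)) \<longlongrightarrow> A) at_top" by (rule filterlim_compose[OF h_asymptotics])
        then have "((\<lambda>x. exp (- t) * (h (x * t) * (x * t) powr (a + b) * t powr (- (a + b)))) \<longlongrightarrow> exp (- t) * (A * t powr (- (a + b)))) at_top"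
          by (intro tendsto_intros)
        moreover have "\<forall>\<^sub>F x in at_top. exp (- t) * (h (x * t) * (x * t) powr (a + b) * t powr (- (a + b))) =
           indicator {0<..} t * (exp (- t) * (x powr (a + b) * h (x * t)))"
          using eventually_gt_at_top[of 0]
        proof eventually_elim
          case (elim x)
          have "(x * t) powr (a + b) * t powr (- (a + b)) = x powr (a + b)"
            using elim True powr_add[of t "a + b" "- (a + b)"] by (simp add: powr_mult)
          then show ?case using True by simp
        qed
        ultimately have "((\<lambda>x. indicator {0<..} t * (exp (- t) * (x powr (a + b) * h (x * t)))) \<longlongrightarrow> exp (- t) * (A * t powr (- (a + b)))) at_top"
          by (rule Lim_transform_eventually)
        then show ?thesis using True by (simp add: mult_ac)
      qed auto
    qed
    show "\<forall>\<^sub>F x in at_top. AE t in lborel. norm (indicator {0<..} t * (exp (- t) * (x powr (a + b) * h (x * t)))) \<le>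
       C * (indicator {0<..} t * (exp (- t) * t powr (- (a + b))))"
      using eventually_gt_at_top[of 0]
    proof eventually_elim
      case (elim x)
      show ?case
      proof (rule AE_I2)
        fix t :: real
        show "norm (indicator {0<..} t * (exp (- t) * (x powr (a + b) * h (x * t)))) \<le>
          C * (indicator {0<..} t * (exp (- t) * t powr (- (a + b))))"
        proof (cases "0 < t")
          case True
          have "x powr (a + b) * h (x * t) \<le> x powr (a + b) * (C * (x * t) powr (- (a + b)))"
            using elim True by (intro mult_left_mono h_upper_bound) auto
          also have "\<dots> = C * t powr (- (a + b))"
            using elim True powr_add[of x "a + b" "- (a + b)"] by (simp add: powr_mult)
          finally have "exp (- t) * (x powr (a + b) * h (x * t)) \<le> exp (- t) * (C * t powr (- (a + b)))"
            by (intro mult_left_mono) auto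
          moreover have "0 \<le> h (x * t)" using elim True h_bounds by simp
          ultimately show ?thesis using True by (simp add: mult_ac)
        qed auto
      qed
    qed
  qed auto
  moreover have "(\<integral>t. A * (indicator {0<..} t * (exp (- t) * t powr (- (a + b)))) \<partial>lborel) = A * Gamma (1 - (a + b))"
    using hb by (simp add: has_bochner_integral_iff)
  moreover have "\<forall>\<^sub>F x in at_top. (\<integral>t. indicator {0<..} t * (exp (- t) * (x powr (a + b) * h (x * t))) \<partial>lborel) = x powr (a + b) * (1 - laplace (1 / x))"
    using eventually_gt_at_top[of 0]
  proof eventually_elim
    case (elim x)
    have "x powr (a + b) * (1 - laplace (1 / x)) = (\<integral>t. x powr (a + b) * (indicator {0<..} t * (exp (- t) * h (x * t))) \<partial>lborel)"
      unfolding laplace_tail[OF elim] by simp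
    also have "\<dots> = (\<integral>t. indicator {0<..} t * (exp (- t) * (x powr (a + b) * h (x * t))) \<partial>lborel)"
      by (intro Bochner_Integration.integral_cong) (auto simp: mult_ac)
    finally show ?case by simp
  qed
  ultimately show ?thesis by (simp only: tendsto_cong)
qed

end

lemma has_integral_truncated:
  fixes k K :: "real \<Rightarrow> real"
  assumes int: "\<And>y. 0 \<le> y \<Longrightarrow> (k has_integral K y) {0..y}" and c: "0 \<le> c" and y: "0 \<le> y"
  shows "((\<lambda>t. if t \<le> c then k t else 0) has_integral K (min y c)) {0..y}"
proof -
  have "((\<lambda>t. if t \<in> {0..min y c} then k t else 0) has_integral K (min y c)) {0..y}"
    using int[of "min y c"] c y by (subst has_integral_restrict) auto
  then show ?thesis by (rule has_integral_cong[THEN iffD1, rotated]) auto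
qed

lemma has_integral_const_Icc: "0 \<le> y \<Longrightarrow> ((\<lambda>_. u) has_integral u * y) {0..y::real}" for u :: real
  using has_integral_const_real[of u 0 y] by (simp add: mult.commute)

section \<open>Finite mean and the critical case\<close>

context product_tail
begin

lemma integrable_Y:
  assumes ab: "1 < a + b"
  shows "integrable M Y"
proof -
  have "(\<integral>\<^sup>+\<omega>. ennreal (Y \<omega>) \<partial>M) = (\<integral>\<^sup>+t. ennreal (indicator {0<..} t * (1 * h t)) \<partial>lborel)"
    by (rule layer_cake) (auto intro: has_integral_const_Icc[of _ 1, simplified])
  also have "\<dots> \<le> (\<integral>\<^sup>+t. (ennreal (indicator {0..1} t) + ennreal C * ennreal (indicator {1..} t * t powr (- (a + b)))) \<partial>lborel)"
  proof (rule nn_integral_mono)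
    fix t :: real
    show "ennreal (indicator {0<..} t * (1 * h t)) \<le> ennreal (indicator {0..1} t) + ennreal C * ennreal (indicator {1..} t * t powr (- (a + b)))"
    proof -
      consider "t \<le> 0" | "0 < t" "t \<le> 1" | "1 < t" by linarith
      then show ?thesis
      proof cases
        case 2
        then have "ennreal (h t) \<le> 1" using h_bounds[of t] by simp
        then show ?thesis using 2 by (simp add: add_increasing2)
      next
        case 3
        then show ?thesis using h_upper_bound[of t] C_pos by (simp add: ennreal_mult'[symmetric] ennreal_leI)
      qed simp
    qed
  qed
  also have "\<dots> = (\<integral>\<^sup>+t. ennreal (indicator {0..1::real} t) \<partial>lborel) + ennreal C * (\<integral>\<^sup>+t. ennreal (indicator {1..} t * t powr (- (a + b))) \<partial>lborel)"
    by (simp add: nn_integral_add nn_integral_cmult)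
  also have "(\<integral>\<^sup>+t. ennreal (indicator {1..} t * t powr (- (a + b))) \<partial>lborel) = ennreal (- (1 powr (- (a + b) + 1)) / (- (a + b) + 1))"
    using ab by (intro nn_integral_has_integral_lebesgue has_integral_powr_to_inf) auto
  also have "(\<integral>\<^sup>+t. ennreal (indicator {0..1::real} t) \<partial>lborel) = 1"
    by (simp add: ennreal_indicator)
  also have "(1::ennreal) + ennreal C * ennreal (- (1 powr (- (a + b) + 1)) / (- (a + b) + 1)) < \<infinity>"
    by (simp add: ennreal_mult_less_top)
  finally show ?thesis
    using Y_pos by (intro integrableI_nonneg) (auto elim!: eventually_mono)
qed

text \<open>The quotients \<open>x * (1 - exp (- (1 / x) * Y \<omega>))\<close> converge to
  \<open>Y \<omega>\<close> and are dominated by it.\<close>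

lemma laplace_asymptotics_greater_1:
  assumes ab: "1 < a + b"
  shows "((\<lambda>x. x * (1 - laplace (1 / x))) \<longlongrightarrow> expectation Y) at_top"
proof -
  have "((\<lambda>x. expectation (\<lambda>\<omega>. x * (1 - exp (- (1 / x) * Y \<omega>)))) \<longlongrightarrow> expectation Y) at_top"
  proof (rule integral_dominated_convergence_at_top[where w=Y])
    show "integrable M Y" using ab by (rule integrable_Y)
    show "AE \<omega> in M. ((\<lambda>x. x * (1 - exp (- (1 / x) * Y \<omega>))) \<longlongrightarrow> Y \<omega>) at_top"
    proof (rule AE_I2)
      fix \<omega>
      show "((\<lambda>x. x * (1 - exp (- (1 / x) * Y \<omega>))) \<longlongrightarrow> Y \<omega>) at_top"
        by real_asymp
    qed
    show "\<forall>\<^sub>F x in at_top. AE \<omega> in M. norm (x * (1 - exp (- (1 / x) * Y \<omega>))) \<le> Y \<omega>"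
      using eventually_gt_at_top[of 0]
    proof eventually_elim
      case (elim x)
      show ?case using Y_pos
      proof eventually_elim
        case (elim \<omega>)
        have "1 + (- (1 / x) * Y \<omega>) \<le> exp (- (1 / x) * Y \<omega>)" by (rule exp_ge_add_one_self)
        then have "x * (1 - exp (- (1 / x) * Y \<omega>)) \<le> x * ((1 / x) * Y \<omega>)"
          using \<open>0 < x\<close> by (intro mult_left_mono) auto
        moreover have "0 \<le> x * (1 - exp (- (1 / x) * Y \<omega>))"
          using \<open>0 < x\<close> elim by (intro mult_nonneg_nonneg) auto
        ultimately show ?case using \<open>0 < x\<close> by simp
      qed
    qed
  qed auto
  moreover have "\<forall>\<^sub>F x in at_top. expectation (\<lambda>\<omega>. x * (1 - exp (- (1 / x) * Y \<omega>))) = x * (1 - laplace (1 / x))"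
    using eventually_gt_at_top[of 0] by eventually_elim (simp add: one_minus_laplace)
  ultimately show ?thesis by (simp only: tendsto_cong)
qed

text \<open>By the layer cake formula this is, for positive \<open>x\<close>, the expectation of the
  minimum of \<open>Y\<close> and \<open>x\<close>.\<close>

definition truncated_mean :: "real \<Rightarrow> real" where
  "truncated_mean x = (\<integral>t. indicator {0<..x} t * h t \<partial>lborel)"

lemma integrable_h_on: "0 \<le> y \<Longrightarrow> integrable lborel (\<lambda>t. indicator {y<..x} t * h t)"
proof (rule Bochner_Integration.integrable_bound)
  show "integrable lborel (indicator {y<..x} :: real \<Rightarrow> real)"
    by (rule integrable_real_indicator, simp, cases "y \<le> x") simp_all
  show "AE t in lborel. norm (indicator {y<..x} t * h t) \<le> norm (indicator {y<..x} t :: real)" if "0 \<le> y"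
    using that h_bounds by (intro AE_I2) (auto split: split_indicator)
qed auto

lemma expectation_min_1:
  assumes u: "0 < u"
  shows "expectation (\<lambda>\<omega>. min (u * Y \<omega>) 1) = u * truncated_mean (1 / u)"
proof -
  have eq: "u * min y (1 / u) = min (u * y) 1" for y using u by (auto simp: min_def field_simps)
  have "((\<lambda>t. if t \<le> 1 / u then u else 0) has_integral u * min y (1 / u)) {0..y}" if "0 < y" for y
    by (rule has_integral_truncated[of "\<lambda>_. u" "\<lambda>y. u * y"]) 
       (use that u has_integral_const_Icc in auto)
  then have "expectation (\<lambda>\<omega>. min (u * Y \<omega>) 1) = (\<integral>t. indicator {0<..} t * ((if t \<le> 1 / u then u else 0) * h t) \<partial>lborel)"
    unfolding eq by (intro layer_cake_expectation[where K="\<lambda>y. min (u * y) 1"]) (use u in auto)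
  also have "\<dots> = (\<integral>t. u * (indicator {0<..1 / u} t * h t) \<partial>lborel)"
    by (intro Bochner_Integration.integral_cong) (auto split: split_indicator)
  finally show ?thesis by (simp add: truncated_mean_def)
qed

text \<open>In the critical case \<open>t * h t \<le> C\<close>, so the density
  \<open>2 * u\<^sup>2 * t * h t\<close> of the truncated second moment is bounded and is integrated
  over an interval of length \<open>1 / u\<close>. No logarithm appears, in contrast to the
  truncated mean.\<close>

lemma expectation_min_square_le:
  assumes u: "0 < u" and ab: "a + b = 1"
  shows "expectation (\<lambda>\<omega>. min ((u * Y \<omega>)\<^sup>2) 1) \<le> 2 * C * u"
proof -
  have eq: "(u * min y (1 / u))\<^sup>2 = min ((u * y)\<^sup>2) 1" if "0 < y" for y
  proof (cases "y \<le> 1 / u")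
    case True
    then have "u * y \<le> 1" using u by (simp add: field_simps)
    then have "(u * y)\<^sup>2 \<le> 1" using u that by (intro power_le_one) auto
    then show ?thesis using True by (simp add: min_def)
  next
    case False
    then have "1 \<le> u * y" using u by (simp add: field_simps)
    then have "1 \<le> (u * y)\<^sup>2" by (intro one_le_power)
    then show ?thesis using False u by (simp add: min_def)
  qed
  have int: "((\<lambda>t. 2 * u\<^sup>2 * t) has_integral (u * y)\<^sup>2) {0..y}" if "0 \<le> y" for y
  proof -
    have "((\<lambda>t. 2 * u\<^sup>2 * t) has_integral ((u * y)\<^sup>2 - (u * 0)\<^sup>2)) {0..y}"
      using that by (intro fundamental_theorem_of_calculus)
       (auto intro!: derivative_eq_intros simp: power2_eq_square simp flip: has_real_derivative_iff_has_vector_derivative)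
    then show ?thesis by simp
  qed
  have "((\<lambda>t. if t \<le> 1 / u then 2 * u\<^sup>2 * t else 0) has_integral min ((u * y)\<^sup>2) 1) {0..y}" if "0 < y" for y
    unfolding eq[OF that, symmetric]
    by (rule has_integral_truncated[of "\<lambda>t. 2 * u\<^sup>2 * t" "\<lambda>y. (u * y)\<^sup>2"]) (use that u int in auto)
  then have "expectation (\<lambda>\<omega>. min ((u * Y \<omega>)\<^sup>2) 1) = (\<integral>t. indicator {0<..} t * ((if t \<le> 1 / u then 2 * u\<^sup>2 * t else 0) * h t) \<partial>lborel)"
    by (intro layer_cake_expectation[where K="\<lambda>y. min ((u * y)\<^sup>2) 1"]) (use u in auto)
  also have "\<dots> \<le> (\<integral>t. indicator {0..1 / u} t * (2 * C * u\<^sup>2) \<partial>lborel)"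
  proof (rule integral_mono')
    show "integrable lborel (\<lambda>t. indicator {0..1 / u} t * (2 * C * u\<^sup>2))" using u by simp
    fix t :: real
    show "indicator {0<..} t * ((if t \<le> 1 / u then 2 * u\<^sup>2 * t else 0) * h t) \<le> indicator {0..1 / u} t * (2 * C * u\<^sup>2)"
    proof (cases "0 < t \<and> t \<le> 1 / u")
      case True
      have "t * h t \<le> t * (C * t powr (- (a + b)))" using True by (intro mult_left_mono h_upper_bound) auto
      also have "\<dots> = C" using True ab by (simp add: powr_minus field_simps)
      finally have "2 * u\<^sup>2 * (t * h t) \<le> 2 * u\<^sup>2 * C" by (intro mult_left_mono) auto
      then show ?thesis using True by (simp add: mult_ac)
    qed (use C_pos in \<open>auto split: split_indicator\<close>)
    show "0 \<le> indicator {0..1 / u} t * (2 * C * u\<^sup>2)" using C_pos by simp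
  qed
  also have "\<dots> = 2 * C * u" using u by (simp add: power2_eq_square)
  finally show ?thesis .
qed

text \<open>A bounded function that agrees with \<open>min y 1\<close> to second order at 0 has the
  same normalized mean up to a bounded error, which is negligible against a logarithm. The factor 2
  in the hypothesis leaves room for the sine, which can differ from 1 by 2.\<close>

lemma expectation_near_truncated_mean:
  assumes ab: "a + b = 1" and u: "0 < u" and [measurable]: "G \<in> borel_measurable borel"
    and G: "\<And>y. 0 < y \<Longrightarrow> \<bar>G y - min y 1\<bar> \<le> 2 * min (y\<^sup>2) 1"
  shows "\<bar>expectation (\<lambda>\<omega>. G (u * Y \<omega>)) / u - truncated_mean (1 / u)\<bar> \<le> 4 * C"
proof -
  have i1: "integrable M (\<lambda>\<omega>. min (u * Y \<omega>) 1)"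
    by (rule integrable_const_bound[where B=1]) (use Y_pos u in \<open>auto elim!: eventually_mono\<close>)
  have i2: "integrable M (\<lambda>\<omega>. min ((u * Y \<omega>)\<^sup>2) 1)"
    by (rule integrable_const_bound[where B=1]) auto
  have Gb: "AE \<omega> in M. \<bar>G (u * Y \<omega>) - min (u * Y \<omega>) 1\<bar> \<le> 2 * min ((u * Y \<omega>)\<^sup>2) 1"
    using Y_pos by eventually_elim (use u G in simp)
  have i3: "integrable M (\<lambda>\<omega>. G (u * Y \<omega>) - min (u * Y \<omega>) 1)"
    by (rule integrable_const_bound[where B=2]) (use Gb in \<open>auto elim!: eventually_mono\<close>)
  have i4: "integrable M (\<lambda>\<omega>. G (u * Y \<omega>))"
    using Bochner_Integration.integrable_add[OF i3 i1] by simp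
  have "\<bar>expectation (\<lambda>\<omega>. G (u * Y \<omega>)) - expectation (\<lambda>\<omega>. min (u * Y \<omega>) 1)\<bar> =
    \<bar>expectation (\<lambda>\<omega>. G (u * Y \<omega>) - min (u * Y \<omega>) 1)\<bar>" using i1 i4 by simp
  also have "\<dots> \<le> expectation (\<lambda>\<omega>. \<bar>G (u * Y \<omega>) - min (u * Y \<omega>) 1\<bar>)" by (rule integral_abs_bound)
  also have "\<dots> \<le> expectation (\<lambda>\<omega>. 2 * min ((u * Y \<omega>)\<^sup>2) 1)"
    using Gb i3 i2 by (intro integral_mono_AE) auto
  also have "\<dots> = 2 * expectation (\<lambda>\<omega>. min ((u * Y \<omega>)\<^sup>2) 1)" by simp
  also have "\<dots> \<le> 2 * (2 * C * u)" using expectation_min_square_le[OF u ab] by (rule mult_left_mono) simp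
  finally have "\<bar>expectation (\<lambda>\<omega>. G (u * Y \<omega>)) - u * truncated_mean (1 / u)\<bar> \<le> u * (4 * C)"
    by (simp add: expectation_min_1[OF u] mult_ac)
  moreover have "expectation (\<lambda>\<omega>. G (u * Y \<omega>)) - u * truncated_mean (1 / u) =
    u * (expectation (\<lambda>\<omega>. G (u * Y \<omega>)) / u - truncated_mean (1 / u))" using u by (simp add: field_simps)
  ultimately show ?thesis using u by (simp add: abs_mult)
qed

text \<open>In the critical case \<open>h t\<close> behaves like \<open>A / t\<close>, whose
  primitive is \<open>A * ln x\<close>.\<close>

lemma truncated_mean_asymptotics:
  assumes ab: "a + b = 1"
  shows "((\<lambda>x. truncated_mean x / ln x) \<longlongrightarrow> A) at_top"
proof (rule tendstoI)
  fix e0 :: real assume e0: "0 < e0"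
  define e where "e = e0 / 2"
  have e: "0 < e" using e0 by (simp add: e_def)
  have "\<forall>\<^sub>F t in at_top. \<bar>h t * t powr (a + b) - A\<bar> < e"
    using tendstoD[OF h_asymptotics e] by (simp add: dist_real_def)
  then obtain T0 where T0: "\<And>t. T0 \<le> t \<Longrightarrow> \<bar>h t * t powr (a + b) - A\<bar> < e"
    by (auto simp: eventually_at_top_linorder)
  define T where "T = max T0 1"
  have T: "1 \<le> T" "\<And>t. T \<le> t \<Longrightarrow> \<bar>h t * t - A\<bar> < e"
  proof -
    show "1 \<le> T" by (simp add: T_def)
    show "\<bar>h t * t - A\<bar> < e" if "T \<le> t" for t using T0[of t] that ab by (auto simp: T_def)
  qed
  \<comment> \<open>Collects what does not grow with \<open>x\<close>: the part of the integral
    before \<open>T\<close>, and the logarithm at the lower end point.\<close>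
  define D where "D = \<bar>truncated_mean T\<bar> + A * ln T"
  have bound: "\<bar>truncated_mean x - A * ln x\<bar> \<le> D + e * ln x" if x: "T \<le> x" for x
  proof -
    have hb: "has_bochner_integral lborel (\<lambda>t. 1 / t * indicator {T..x} t) (ln x - ln T)"
      using x T(1) by (intro has_bochner_integral_FTC_Icc_real)
        (auto intro!: derivative_eq_intros continuous_intros)
    have ae: "AE t in lborel. 1 / t * indicator {T..x} t = indicator {T<..x} t * (1 / t)"
      using AE_lborel_singleton[of T] by eventually_elim (auto split: split_indicator)
    have hb': "has_bochner_integral lborel (\<lambda>t. indicator {T<..x} t * (1 / t)) (ln x - ln T)"
      using hb ae by (subst has_bochner_integral_cong_AE[symmetric]) auto
    have "truncated_mean x = (\<integral>t. indicator {0<..T} t * h t + indicator {T<..x} t * h t \<partial>lborel)"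
      unfolding truncated_mean_def using x T(1)
      by (intro Bochner_Integration.integral_cong) (auto split: split_indicator)
    also have "\<dots> = truncated_mean T + (\<integral>t. indicator {T<..x} t * h t \<partial>lborel)"
      unfolding truncated_mean_def using T(1) by (intro Bochner_Integration.integral_add integrable_h_on) auto
    finally have 1: "truncated_mean x = truncated_mean T + (\<integral>t. indicator {T<..x} t * h t \<partial>lborel)" .
    have "\<bar>(\<integral>t. indicator {T<..x} t * h t \<partial>lborel) - A * (ln x - ln T)\<bar> =
      \<bar>(\<integral>t. indicator {T<..x} t * h t - A * (indicator {T<..x} t * (1 / t)) \<partial>lborel)\<bar>"
    proof -
      have "integrable lborel (\<lambda>t. A * (indicator {T<..x} t * (1 / t)))"
        using hb' by (intro integrable_mult_right) (simp add: has_bochner_integral_iff)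
      then have "(\<integral>t. indicator {T<..x} t * h t - A * (indicator {T<..x} t * (1 / t)) \<partial>lborel) =
        (\<integral>t. indicator {T<..x} t * h t \<partial>lborel) - (\<integral>t. A * (indicator {T<..x} t * (1 / t)) \<partial>lborel)"
        using T(1) by (intro Bochner_Integration.integral_diff integrable_h_on) auto
      also have "(\<integral>t. A * (indicator {T<..x} t * (1 / t)) \<partial>lborel) = A * (ln x - ln T)"
        using hb' unfolding has_bochner_integral_iff integral_mult_right_zero by simp
      finally show ?thesis by simp
    qed
    also have "\<dots> \<le> (\<integral>t. \<bar>indicator {T<..x} t * h t - A * (indicator {T<..x} t * (1 / t))\<bar> \<partial>lborel)"
      by (rule integral_abs_bound)
    also have "\<dots> \<le> (\<integral>t. e * (indicator {T<..x} t * (1 / t)) \<partial>lborel)"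
    proof (rule integral_mono')
      show "integrable lborel (\<lambda>t. e * (indicator {T<..x} t * (1 / t)))"
        using hb' by (intro integrable_mult_right) (simp add: has_bochner_integral_iff)
      fix t :: real
      show "\<bar>indicator {T<..x} t * h t - A * (indicator {T<..x} t * (1 / t))\<bar> \<le> e * (indicator {T<..x} t * (1 / t))"
      proof (cases "T < t \<and> t \<le> x")
        case True
        then have t: "0 < t" using T(1) by simp
        have "h t - A * (1 / t) = (h t * t - A) / t" using t by (simp add: field_simps)
        then have "\<bar>h t - A * (1 / t)\<bar> = \<bar>h t * t - A\<bar> / t" using t by simp
        also have "\<dots> \<le> e / t" using T(2)[of t] True t by (intro divide_right_mono) auto
        finally show ?thesis using True by simp
      qed auto
      show "0 \<le> e * (indicator {T<..x} t * (1 / t))" using e T(1) by (auto split: split_indicator)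
    qed
    also have "\<dots> = e * (ln x - ln T)" using hb' unfolding has_bochner_integral_iff integral_mult_right_zero by simp
    also have "\<dots> \<le> e * ln x" using e T(1) by (intro mult_left_mono) auto
    finally have 2: "\<bar>(\<integral>t. indicator {T<..x} t * h t \<partial>lborel) - A * (ln x - ln T)\<bar> \<le> e * ln x" .
    have "A * (ln x - ln T) = A * ln x - A * ln T" by (simp add: algebra_simps)
    moreover have "0 \<le> A * ln T" using A_pos T(1) by simp
    ultimately show ?thesis using 1 2 unfolding D_def by linarith
  qed
  have "((\<lambda>x. D / ln x) \<longlongrightarrow> 0) at_top" by real_asymp
  then have "\<forall>\<^sub>F x in at_top. D / ln x < e" using e by (rule order_tendstoD(2))
  then show "\<forall>\<^sub>F x in at_top. dist (truncated_mean x / ln x) A < e0"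
    using eventually_ge_at_top[of T] eventually_gt_at_top[of 1]
  proof eventually_elim
    case (elim x)
    have l: "0 < ln x" using elim by simp
    have "truncated_mean x / ln x - A = (truncated_mean x - A * ln x) / ln x" using l by (simp add: field_simps)
    then have "\<bar>truncated_mean x / ln x - A\<bar> = \<bar>truncated_mean x - A * ln x\<bar> / ln x" using l by simp
    also have "\<dots> \<le> (D + e * ln x) / ln x" using bound[of x] elim l by (intro divide_right_mono) auto
    also have "\<dots> = D / ln x + e" using l by (simp add: field_simps)
    also have "\<dots> < e + e" using elim by simp
    finally show ?case by (simp add: dist_real_def e_def)
  qed
qed

lemma abs_sin_minus_min_le: "0 < y \<Longrightarrow> \<bar>sin y - min y 1\<bar> \<le> 2 * min (y\<^sup>2) (1::real)"
proof (cases "y \<le> 1")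
  case True
  assume y: "0 < y"
  have "\<bar>sin y - y\<bar> \<le> y\<^sup>2"
  proof -
    have "\<bar>sin y - y\<bar> * 2 \<le> y\<^sup>2"
      using Maclaurin_sin_bound[of y 2] by (simp add: numeral_2_eq_2 sin_coeff_def)
    moreover have "\<bar>sin y - y\<bar> \<le> \<bar>sin y - y\<bar> * 2" by simp
    ultimately show ?thesis by (rule order_trans[rotated])
  qed
  moreover have "y\<^sup>2 \<le> 1" using True y by (intro power_le_one) auto
  moreover have "0 \<le> y\<^sup>2" by simp
  ultimately show ?thesis using True by (simp add: min_def)
next
  case False
  then have "1 \<le> y\<^sup>2" by (intro one_le_power) auto
  then have m: "min (y\<^sup>2) 1 = 1" "min y 1 = 1" using False by auto
  show ?thesis unfolding m using sin_ge_minus_one[of y] sin_le_one[of y] by linarith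
qed

lemma abs_one_minus_exp_minus_min_le: "0 < y \<Longrightarrow> \<bar>(1 - exp (- y)) - min y 1\<bar> \<le> 2 * min (y\<^sup>2) (1::real)"
proof (cases "y \<le> 1")
  case True
  assume y: "0 < y"
  have 1: "1 + (- y) \<le> exp (- y)" by (rule exp_ge_add_one_self)
  have "1 + y \<le> exp y" by (rule exp_ge_add_one_self)
  then have "exp (- y) \<le> 1 / (1 + y)" using y by (simp add: exp_minus field_simps)
  also have "\<dots> \<le> 1 - y + y\<^sup>2"
  proof -
    have "1 \<le> (1 - y + y\<^sup>2) * (1 + y)" using y by (simp add: algebra_simps power2_eq_square)
    then show ?thesis using y by (simp add: field_simps)
  qed
  finally have "\<bar>(1 - exp (- y)) - y\<bar> \<le> y\<^sup>2" using 1 by simp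
  moreover have "y\<^sup>2 \<le> 1" using True y by (intro power_le_one) auto
  moreover have "0 \<le> y\<^sup>2" by simp
  ultimately show ?thesis using True by (simp add: min_def)
next
  case False
  then have "1 \<le> y\<^sup>2" by (intro one_le_power) auto
  then have m: "min (y\<^sup>2) 1 = 1" "min y 1 = 1" using False by auto
  have "exp (- y) \<le> 1" using False by simp
  then show ?thesis unfolding m using exp_gt_zero[of "- y"] by linarith
qed


text \<open>For \<open>a + b = 1\<close> both the Laplace transform and the sine transform that normalizes the
  time scale are compared with the truncated mean, which grows logarithmically.\<close>

definition sine_mean :: "real \<Rightarrow> real" where
  "sine_mean x = x * expectation (\<lambda>\<omega>. sin (Y \<omega> / x))"

text \<open>The sine mean stays within \<open>4 * C\<close> of the truncated mean at
  \<open>x * k\<close>, and the factor \<open>k\<close> changes the logarithm only by an additive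
  constant.\<close>

lemma sine_mean_asymptotics:
  assumes ab: "a + b = 1" and k: "0 < k"
  shows "((\<lambda>x. sine_mean (x * k) / ln x) \<longlongrightarrow> A) at_top"
proof -
  have lim: "filterlim (\<lambda>x. x * k) at_top at_top"
    using k by (intro filterlim_at_top_mult_tendsto_pos[OF tendsto_const _ filterlim_ident]) auto
  have 1: "((\<lambda>x. truncated_mean (x * k) / ln (x * k)) \<longlongrightarrow> A) at_top"
    by (rule filterlim_compose[OF truncated_mean_asymptotics[OF ab] lim])
  have "((\<lambda>x. ln (x * k) / ln x) \<longlongrightarrow> 1) at_top" using k by real_asymp
  from tendsto_mult[OF 1 this] have 2: "((\<lambda>x. truncated_mean (x * k) / ln (x * k) * (ln (x * k) / ln x)) \<longlongrightarrow> A) at_top"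
    by simp
  have "((\<lambda>x. (sine_mean (x * k) - truncated_mean (x * k)) / ln x) \<longlongrightarrow> 0) at_top"
  proof (rule Lim_null_comparison)
    show "((\<lambda>x. 4 * C / ln x) \<longlongrightarrow> 0) at_top" by real_asymp
    show "\<forall>\<^sub>F x in at_top. norm ((sine_mean (x * k) - truncated_mean (x * k)) / ln x) \<le> 4 * C / ln x"
      using eventually_gt_at_top[of 1]
    proof eventually_elim
      case (elim x)
      have "\<bar>expectation (\<lambda>\<omega>. sin ((1 / (x * k)) * Y \<omega>)) / (1 / (x * k)) - truncated_mean (1 / (1 / (x * k)))\<bar> \<le> 4 * C"
        using elim k by (intro expectation_near_truncated_mean ab abs_sin_minus_min_le) auto
      then have "\<bar>sine_mean (x * k) - truncated_mean (x * k)\<bar> \<le> 4 * C"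
        by (simp add: sine_mean_def mult.commute)
      then have "\<bar>sine_mean (x * k) - truncated_mean (x * k)\<bar> / ln x \<le> 4 * C / ln x"
        using elim by (intro divide_right_mono) auto
      then show ?case using elim by simp
    qed
  qed
  from tendsto_add[OF this 2]
  have "((\<lambda>x. (sine_mean (x * k) - truncated_mean (x * k)) / ln x + truncated_mean (x * k) / ln (x * k) * (ln (x * k) / ln x)) \<longlongrightarrow> A) at_top"
    by simp
  moreover have "\<forall>\<^sub>F x in at_top. (sine_mean (x * k) - truncated_mean (x * k)) / ln x + truncated_mean (x * k) / ln (x * k) * (ln (x * k) / ln x) =
    sine_mean (x * k) / ln x"
    using eventually_gt_at_top[of 1] eventually_gt_at_top[of "1 / k"]
  proof eventually_elim
    case (elim x)
    then have "1 < x * k" using k by (simp add: field_simps)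
    then have "ln (x * k) \<noteq> 0" by simp
    then show ?case by (simp add: diff_divide_distrib)
  qed
  ultimately show ?thesis by (rule Lim_transform_eventually)
qed

lemma laplace_asymptotics_eq_1:
  assumes ab: "a + b = 1"
  shows "((\<lambda>x. x * (1 - laplace (1 / x)) / ln x) \<longlongrightarrow> A) at_top"
proof -
  have "((\<lambda>x. (x * (1 - laplace (1 / x)) - truncated_mean x) / ln x) \<longlongrightarrow> 0) at_top"
  proof (rule Lim_null_comparison)
    show "((\<lambda>x. 4 * C / ln x) \<longlongrightarrow> 0) at_top" by real_asymp
    show "\<forall>\<^sub>F x in at_top. norm ((x * (1 - laplace (1 / x)) - truncated_mean x) / ln x) \<le> 4 * C / ln x"
      using eventually_gt_at_top[of 1]
    proof eventually_elim
      case (elim x)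
      have "\<bar>expectation (\<lambda>\<omega>. 1 - exp (- ((1 / x) * Y \<omega>))) / (1 / x) - truncated_mean (1 / (1 / x))\<bar> \<le> 4 * C"
        using elim by (intro expectation_near_truncated_mean[where G="\<lambda>y. 1 - exp (- y)"] ab abs_one_minus_exp_minus_min_le) auto
      then have "\<bar>x * (1 - laplace (1 / x)) - truncated_mean x\<bar> \<le> 4 * C"
        using elim by (simp add: one_minus_laplace mult.commute)
      then have "\<bar>x * (1 - laplace (1 / x)) - truncated_mean x\<bar> / ln x \<le> 4 * C / ln x"
        using elim by (intro divide_right_mono) auto
      then show ?case using elim by simp
    qed
  qed
  from tendsto_add[OF this truncated_mean_asymptotics[OF ab]]
  show ?thesis by (simp add: diff_divide_distrib)
qed

lemma sine_mean_at_top: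
  assumes ab: "a + b = 1" and k: "0 < k"
  shows "filterlim (\<lambda>x. sine_mean (x * k)) at_top at_top"
proof -
  have "filterlim (\<lambda>x. sine_mean (x * k) / ln x * ln x) at_top at_top"
    by (rule filterlim_tendsto_pos_mult_at_top[OF sine_mean_asymptotics[OF ab k] A_pos ln_at_top])
  moreover have "\<forall>\<^sub>F x in at_top. sine_mean (x * k) / ln x * ln x = sine_mean (x * k)"
    using eventually_gt_at_top[of 1] by eventually_elim simp
  ultimately show ?thesis by (simp only: filterlim_cong[OF refl refl])
qed

text \<open>At \<open>y = x * s / z\<close> the transform gives
  \<open>y * (1 - laplace (1 / y))\<close> of order \<open>A * ln y\<close>. Since \<open>s\<close>
  is of order \<open>A * ln x\<close>, it affects \<open>ln y\<close> only by a lower order term,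
  and the constant \<open>A\<close> cancels; this is why the limiting rate is 1 in the critical
  case.\<close>

lemma laplace_scaling_eq_1:
  assumes ab: "a + b = 1" and k: "0 < k" and z: "0 < z"
  shows "((\<lambda>x. x * (1 - laplace (z / (x * sine_mean (x * k))))) \<longlongrightarrow> z) at_top"
proof -
  define s where "s = (\<lambda>x. sine_mean (x * k))"
  define y where "y = (\<lambda>x. x * s x * (1 / z))"
  have sA: "((\<lambda>x. s x / ln x) \<longlongrightarrow> A) at_top" unfolding s_def by (rule sine_mean_asymptotics[OF ab k])
  have s: "filterlim s at_top at_top" unfolding s_def by (rule sine_mean_at_top[OF ab k])
  have y: "filterlim y at_top at_top"
    unfolding y_def using z
    by (intro filterlim_at_top_mult_tendsto_pos[OF tendsto_const] filterlim_at_top_mult_at_top filterlim_ident s) auto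
  have L: "((\<lambda>x. y x * (1 - laplace (1 / y x)) / ln (y x)) \<longlongrightarrow> A) at_top"
    by (rule filterlim_compose[OF laplace_asymptotics_eq_1[OF ab] y])
  have spos: "\<forall>\<^sub>F x in at_top. 0 < s x" using s by (simp add: filterlim_at_top_dense)
  have ypos: "\<forall>\<^sub>F x in at_top. 1 < y x" using y by (simp add: filterlim_at_top_dense)
  \<comment> \<open>Expansion of \<open>ln (y x) / ln x\<close>: the logarithm of \<open>s\<close>
    is split into that of the convergent ratio \<open>s x / ln x\<close> and an iterated
    logarithm.\<close>
  have "((\<lambda>x. 1 + ln (s x / ln x) * (1 / ln x) + ln (ln x) / ln x - ln z / ln x) \<longlongrightarrow> 1 + ln A * 0 + 0 - 0) at_top"
  proof (intro tendsto_intros sA)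
    show "A \<noteq> 0" using A_pos by simp
    show "((\<lambda>x::real. 1 / ln x) \<longlongrightarrow> 0) at_top" by real_asymp
    show "((\<lambda>x::real. ln (ln x) / ln x) \<longlongrightarrow> 0) at_top" by real_asymp
    show "((\<lambda>x::real. ln z / ln x) \<longlongrightarrow> 0) at_top" by real_asymp
  qed
  moreover have "\<forall>\<^sub>F x in at_top. 1 + ln (s x / ln x) * (1 / ln x) + ln (ln x) / ln x - ln z / ln x = ln (y x) / ln x"
    using spos eventually_gt_at_top[of 1]
  proof eventually_elim
    case (elim x)
    have l: "0 < ln x" using elim by simp
    have "ln (y x) = ln x + ln (s x) - ln z" using elim z by (simp add: y_def ln_mult ln_div)
    moreover have "ln (s x / ln x) = ln (s x) - ln (ln x)" using elim l by (simp add: ln_div)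
    ultimately have "ln (y x) / ln x = (ln x + ln (s x / ln x) + ln (ln x) - ln z) / ln x" by simp
    then show ?case using l by (simp add: add_divide_distrib diff_divide_distrib)
  qed
  ultimately have "((\<lambda>x. ln (y x) / ln x) \<longlongrightarrow> 1 + ln A * 0 + 0 - 0) at_top"
    by (rule Lim_transform_eventually)
  then have Y1: "((\<lambda>x. ln (y x) / ln x) \<longlongrightarrow> 1) at_top" by simp
  have "((\<lambda>x. (y x * (1 - laplace (1 / y x)) / ln (y x)) * (z * (ln (y x) / ln x) / (s x / ln x))) \<longlongrightarrow> A * (z * 1 / A)) at_top"
    using A_pos by (intro tendsto_intros L Y1 sA) auto
  moreover have "\<forall>\<^sub>F x in at_top. (y x * (1 - laplace (1 / y x)) / ln (y x)) * (z * (ln (y x) / ln x) / (s x / ln x)) =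
     x * (1 - laplace (z / (x * s x)))"
    using spos ypos eventually_gt_at_top[of 1]
  proof eventually_elim
    case (elim x)
    have nz: "ln (y x) \<noteq> 0" "ln x \<noteq> 0" using elim by auto
    have 1: "1 / y x = z / (x * s x)" using z by (simp add: y_def)
    have 2: "y x * (z / s x) = x" using z elim by (simp add: y_def)
    have "(y x * p / ln (y x)) * (z * (ln (y x) / ln x) / (s x / ln x)) = (y x * (z / s x)) * p" for p
      using nz by simp
    then show ?case unfolding 1 2 .
  qed
  ultimately have "((\<lambda>x. x * (1 - laplace (z / (x * s x)))) \<longlongrightarrow> A * (z * 1 / A)) at_top"
    by (rule Lim_transform_eventually)
  then show ?thesis using A_pos by (simp add: s_def)
qed

end

section \<open>Weak convergence from Laplace transforms\<close>

text \<open>The logarithm is enclosed by the bounds \<open>1 - 1 / x\<close> and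
  \<open>x - 1\<close>. The same limit serves for Laplace transforms of block sums and for
  characteristic functions of the walk.\<close>

lemma power_tendsto_exp:
  fixes x :: "nat \<Rightarrow> real" and l :: "nat \<Rightarrow> nat"
  assumes x: "(\<lambda>n. real n * (1 - x n)) \<longlonglongrightarrow> \<theta>" and l: "(\<lambda>n. real (l n) / real n) \<longlonglongrightarrow> s"
  shows "(\<lambda>n. x n ^ l n) \<longlonglongrightarrow> exp (- s * \<theta>)"
proof -
  have "(\<lambda>n. (1 / real n) * (real n * (1 - x n))) \<longlonglongrightarrow> 0 * \<theta>"
    by (intro tendsto_mult x lim_1_over_n)
  moreover have "\<forall>\<^sub>F n in sequentially. (1 / real n) * (real n * (1 - x n)) = 1 - x n"
    using eventually_gt_at_top[of 0] by eventually_elim simp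
  ultimately have "(\<lambda>n. 1 - x n) \<longlonglongrightarrow> 0" by (simp only: tendsto_cong mult_zero_left)
  then have "(\<lambda>n. 1 - (1 - x n)) \<longlonglongrightarrow> 1 - 0" by (intro tendsto_diff tendsto_const)
  then have x1: "x \<longlonglongrightarrow> 1" by simp
  then have xpos: "\<forall>\<^sub>F n in sequentially. 0 < x n" by (rule order_tendstoD) simp
  have ln: "(\<lambda>n. real n * ln (x n)) \<longlonglongrightarrow> - \<theta>"
  proof (rule tendsto_sandwich)
    show "(\<lambda>n. - (real n * (1 - x n)) / x n) \<longlonglongrightarrow> - \<theta>"
      using tendsto_divide[OF tendsto_minus[OF x] x1] by simp
    show "(\<lambda>n. - (real n * (1 - x n))) \<longlonglongrightarrow> - \<theta>" using x by (rule tendsto_minus)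
    show "\<forall>\<^sub>F n in sequentially. - (real n * (1 - x n)) / x n \<le> real n * ln (x n)"
      using xpos
    proof eventually_elim
      case (elim n)
      have "ln (1 / x n) \<le> 1 / x n - 1" using elim by (intro ln_le_minus_one) auto
      then have "1 - 1 / x n \<le> ln (x n)" using elim by (simp add: ln_div)
      then have "real n * (1 - 1 / x n) \<le> real n * ln (x n)" by (intro mult_left_mono) auto
      then show ?case using elim by (simp add: field_simps)
    qed
    show "\<forall>\<^sub>F n in sequentially. real n * ln (x n) \<le> - (real n * (1 - x n))"
      using xpos
    proof eventually_elim
      case (elim n)
      have "real n * ln (x n) \<le> real n * (x n - 1)" using elim by (intro mult_left_mono ln_le_minus_one) auto
      then show ?case by (simp add: algebra_simps)
    qed
  qed
  have "(\<lambda>n. exp (real (l n) / real n * (real n * ln (x n)))) \<longlonglongrightarrow> exp (s * (- \<theta>))"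
    by (intro tendsto_intros l ln)
  moreover have "\<forall>\<^sub>F n in sequentially. exp (real (l n) / real n * (real n * ln (x n))) = x n ^ l n"
    using xpos eventually_gt_at_top[of 0]
  proof eventually_elim
    case (elim n)
    have "exp (real (l n) / real n * (real n * ln (x n))) = exp (real (l n) * ln (x n))" using elim by simp
    also have "\<dots> = x n ^ l n" using elim(1) by (simp add: exp_of_nat_mult)
    finally show ?case .
  qed
  ultimately have "(\<lambda>n. x n ^ l n) \<longlonglongrightarrow> exp (s * (- \<theta>))" by (rule Lim_transform_eventually)
  then show ?thesis by simp
qed

text \<open>The values of the Laplace transform at the natural numbers are the moments of \<open>exp (- X)\<close>,
  so their convergence yields the convergence of all continuous functionals of \<open>exp (- X)\<close> by
  polynomial approximation.\<close>

lemma laplace_imp_continuous_functional: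
  fixes X :: "nat \<Rightarrow> 'a \<Rightarrow> real" and X' :: "'b \<Rightarrow> real"
  assumes M: "prob_space M" and N: "prob_space N"
    and X: "\<And>n. X n \<in> borel_measurable M" "\<And>n. AE \<omega> in M. 0 \<le> X n \<omega>"
    and X': "X' \<in> borel_measurable N" "AE \<omega> in N. 0 \<le> X' \<omega>"
    and conv: "\<And>k::nat. (\<lambda>n. \<integral>\<omega>. exp (- real k * X n \<omega>) \<partial>M) \<longlonglongrightarrow> (\<integral>\<omega>. exp (- real k * X' \<omega>) \<partial>N)"
    and \<psi>: "continuous_on {0..1} \<psi>" and [measurable]: "\<psi> \<in> borel_measurable borel"
  shows "(\<lambda>n. \<integral>\<omega>. \<psi> (exp (- X n \<omega>)) \<partial>M) \<longlonglongrightarrow> (\<integral>\<omega>. (\<psi> (exp (- X' \<omega>)) :: real) \<partial>N)"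
proof (rule tendstoI)
  interpret M: prob_space M by fact
  interpret N: prob_space N by fact
  note [measurable] = X(1) X'(1)
  fix e0 :: real assume e0: "0 < e0"
  define e where "e = e0 / 3"
  have e: "0 < e" using e0 by (simp add: e_def)
  obtain g where g: "real_polynomial_function g" "\<And>x. x \<in> {0..1} \<Longrightarrow> \<bar>\<psi> x - g x\<bar> < e"
    by (rule Stone_Weierstrass_real_polynomial_function[of "{0..1::real}" \<psi> e]) (use \<psi> e in auto)
  obtain c d where gs: "g = (\<lambda>x. \<Sum>i\<le>(d::nat). c i * x ^ i)"
    using real_polynomial_function_imp_sum[OF g(1)] by blast
  have [measurable]: "g \<in> borel_measurable borel" unfolding gs by measurable
  have "bounded (\<psi> ` {0..1})" by (intro compact_imp_bounded compact_continuous_image \<psi>) simp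
  then obtain B where "\<forall>x\<in>{0..1}. \<bar>\<psi> x\<bar> \<le> B" by (auto simp: bounded_iff)
  then have B: "\<And>x. x \<in> {0..1} \<Longrightarrow> \<bar>\<psi> x\<bar> \<le> B" by blast
  have expo: "exp (- y) \<in> {0..1}" if "0 \<le> y" for y :: real using that by simp
  have close: "\<bar>(\<integral>\<omega>. \<psi> (exp (- Z \<omega>)) \<partial>P) - (\<Sum>i\<le>d. c i * (\<integral>\<omega>. exp (- real i * Z \<omega>) \<partial>P))\<bar> \<le> e"
    if P: "prob_space P" and [measurable]: "Z \<in> borel_measurable P" and Z: "AE \<omega> in P. 0 \<le> Z \<omega>"
    for P :: "'z measure" and Z
  proof -
    interpret P: prob_space P by fact
    have i1: "integrable P (\<lambda>\<omega>. \<psi> (exp (- Z \<omega>)))"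
    proof (rule P.integrable_const_bound[where B=B])
      show "AE \<omega> in P. norm (\<psi> (exp (- Z \<omega>))) \<le> B"
        using Z by eventually_elim (unfold real_norm_def, intro B expo)
    qed measurable
    have i2: "integrable P (\<lambda>\<omega>. exp (- real i * Z \<omega>))" for i
    proof (rule P.integrable_const_bound[where B=1])
      show "AE \<omega> in P. norm (exp (- real i * Z \<omega>)) \<le> 1"
        using Z by eventually_elim simp
    qed measurable
    have pow: "exp (- y) ^ i = exp (- real i * y)" for i and y :: real
      by (simp add: exp_of_nat_mult[symmetric])
    have i3: "integrable P (\<lambda>\<omega>. g (exp (- Z \<omega>)))"
      unfolding gs pow by (intro Bochner_Integration.integrable_sum integrable_mult_right i2)
    have "(\<Sum>i\<le>d. c i * (\<integral>\<omega>. exp (- real i * Z \<omega>) \<partial>P)) = (\<integral>\<omega>. g (exp (- Z \<omega>)) \<partial>P)"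
      unfolding gs pow using i2 by (subst Bochner_Integration.integral_sum) auto
    then have "\<bar>(\<integral>\<omega>. \<psi> (exp (- Z \<omega>)) \<partial>P) - (\<Sum>i\<le>d. c i * (\<integral>\<omega>. exp (- real i * Z \<omega>) \<partial>P))\<bar> =
      \<bar>(\<integral>\<omega>. \<psi> (exp (- Z \<omega>)) - g (exp (- Z \<omega>)) \<partial>P)\<bar>" using i1 i3 by simp
    also have "\<dots> \<le> (\<integral>\<omega>. \<bar>\<psi> (exp (- Z \<omega>)) - g (exp (- Z \<omega>))\<bar> \<partial>P)" by (rule integral_abs_bound)
    also have "\<dots> \<le> (\<integral>\<omega>. e \<partial>P)"
    proof (rule integral_mono_AE)
      show "AE \<omega> in P. \<bar>\<psi> (exp (- Z \<omega>)) - g (exp (- Z \<omega>))\<bar> \<le> e"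
        using Z by eventually_elim (rule less_imp_le, rule g(2), rule expo)
    qed (use i1 i3 in auto)
    finally show ?thesis by (simp add: P.prob_space)
  qed
  have "(\<lambda>n. \<Sum>i\<le>d. c i * (\<integral>\<omega>. exp (- real i * X n \<omega>) \<partial>M)) \<longlonglongrightarrow> (\<Sum>i\<le>d. c i * (\<integral>\<omega>. exp (- real i * X' \<omega>) \<partial>N))"
    by (intro tendsto_intros conv)
  then have "\<forall>\<^sub>F n in sequentially. dist (\<Sum>i\<le>d. c i * (\<integral>\<omega>. exp (- real i * X n \<omega>) \<partial>M)) (\<Sum>i\<le>d. c i * (\<integral>\<omega>. exp (- real i * X' \<omega>) \<partial>N)) < e"
    using e by (rule tendstoD)
  then show "\<forall>\<^sub>F n in sequentially. dist (\<integral>\<omega>. \<psi> (exp (- X n \<omega>)) \<partial>M) (\<integral>\<omega>. \<psi> (exp (- X' \<omega>)) \<partial>N) < e0"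
  proof eventually_elim
    case (elim n)
    show ?case using elim close[OF M X(1,2), of n] close[OF N X'] unfolding dist_real_def e_def by linarith
  qed
qed

text \<open>Passing to the logarithm keeps the limit away from the boundary point 0, at which the
  inverse of a path is not a continuous functional of its increments.\<close>

lemma laplace_imp_weak_conv_ln:
  fixes X :: "nat \<Rightarrow> 'a \<Rightarrow> real" and X' :: "'b \<Rightarrow> real"
  assumes M: "prob_space M" and N: "prob_space N"
    and X: "\<And>n. X n \<in> borel_measurable M" "\<And>n. AE \<omega> in M. 0 \<le> X n \<omega>" "\<forall>\<^sub>F n in sequentially. AE \<omega> in M. 0 < X n \<omega>"
    and X': "X' \<in> borel_measurable N" "AE \<omega> in N. 0 < X' \<omega>"
    and conv: "\<And>k::nat. (\<lambda>n. \<integral>\<omega>. exp (- real k * X n \<omega>) \<partial>M) \<longlonglongrightarrow> (\<integral>\<omega>. exp (- real k * X' \<omega>) \<partial>N)"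
  shows "weak_conv_m (\<lambda>n. distr M borel (\<lambda>\<omega>. ln (X n \<omega>))) (distr N borel (\<lambda>\<omega>. ln (X' \<omega>)))"
proof -
  interpret M: prob_space M by fact
  interpret N: prob_space N by fact
  note [measurable] = X(1) X'(1)
  have rd: "real_distribution (distr M borel (\<lambda>\<omega>. ln (X n \<omega>)))" for n
    by (rule M.real_distribution_distr) measurable
  have rd': "real_distribution (distr N borel (\<lambda>\<omega>. ln (X' \<omega>)))"
    by (rule N.real_distribution_distr) measurable
  show ?thesis
  proof (rule integral_cts_step_conv_imp_weak_conv[OF rd rd'])
    fix x y :: real assume xy: "x < y"
    define lo hi where "lo = exp (- exp y)" and "hi = exp (- exp x)"
    have lohi: "0 < lo" "lo < hi" "hi < 1" using xy by (auto simp: lo_def hi_def)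
    \<comment> \<open>As a function of \<open>ln v\<close>, the step is constant for
      \<open>v\<close> outside the interval from \<open>exp x\<close> to \<open>exp y\<close>. In
      terms of \<open>u = exp (- v)\<close> clamping to \<open>lo\<close> and \<open>hi\<close>
      therefore preserves its values and removes the singularities of the double logarithm at 0 and
      1.\<close>
    define \<psi> where "\<psi> = (\<lambda>u. cts_step x y (ln (- ln (max lo (min hi u)))))"
    have cts: "continuous_on UNIV (cts_step x y)"
      using cts_step_uniformly_continuous[OF xy] by (rule uniformly_continuous_imp_continuous)
    have clamp: "0 < max lo (min hi u)" "max lo (min hi u) < 1" for u
      using lohi by auto
    have \<psi>c: "continuous_on UNIV \<psi>"
      unfolding \<psi>_def
    proof (rule continuous_on_compose2[OF cts])
      show "continuous_on UNIV (\<lambda>u. ln (- ln (max lo (min hi u))))"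
        using clamp by (intro continuous_intros) (auto simp: less_imp_neq[OF clamp(1), symmetric] ln_less_zero intro!: less_imp_neq)
    qed auto
    have [measurable]: "\<psi> \<in> borel_measurable borel" using \<psi>c by (rule borel_measurable_continuous_onI)
    have [measurable]: "cts_step x y \<in> borel_measurable borel" using cts by (rule borel_measurable_continuous_onI)
    have eq: "\<psi> (exp (- v)) = cts_step x y (ln v)" if v: "0 < v" for v
    proof -
      consider "exp y \<le> v" | "v \<le> exp x" | "exp x < v" "v < exp y" by linarith
      then show ?thesis
      proof cases
        case 1
        then have "exp (- v) \<le> lo" by (simp add: lo_def)
        then have "max lo (min hi (exp (- v))) = lo" using lohi by auto
        moreover have "y \<le> ln v" using 1 v by (simp add: ln_ge_iff)
        ultimately show ?thesis using xy by (simp add: \<psi>_def lo_def cts_step_def)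
      next
        case 2
        then have "hi \<le> exp (- v)" by (simp add: hi_def)
        then have "max lo (min hi (exp (- v))) = hi" using lohi by auto
        moreover have "ln v \<le> x" using 2 v by (metis ln_exp ln_le_cancel_iff exp_gt_zero)
        ultimately show ?thesis using xy by (simp add: \<psi>_def hi_def cts_step_def)
      next
        case 3
        then have "max lo (min hi (exp (- v))) = exp (- v)" by (simp add: lo_def hi_def)
        then show ?thesis by (simp add: \<psi>_def)
      qed
    qed
    have "(\<lambda>n. \<integral>\<omega>. \<psi> (exp (- X n \<omega>)) \<partial>M) \<longlonglongrightarrow> (\<integral>\<omega>. \<psi> (exp (- X' \<omega>)) \<partial>N)"
      by (rule laplace_imp_continuous_functional[OF M N X(1,2) X'(1) _ conv])
        (use X'(2) in \<open>auto elim!: eventually_mono intro: continuous_on_subset[OF \<psi>c]\<close>)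
    moreover have "(\<integral>\<omega>. \<psi> (exp (- X' \<omega>)) \<partial>N) = integral\<^sup>L (distr N borel (\<lambda>\<omega>. ln (X' \<omega>))) (cts_step x y)"
    proof -
      have "(\<integral>\<omega>. \<psi> (exp (- X' \<omega>)) \<partial>N) = (\<integral>\<omega>. cts_step x y (ln (X' \<omega>)) \<partial>N)"
        by (rule integral_cong_AE) (use X'(2) eq in \<open>auto elim!: eventually_mono\<close>)
      then show ?thesis by (subst integral_distr) auto
    qed
    moreover have "\<forall>\<^sub>F n in sequentially. (\<integral>\<omega>. \<psi> (exp (- X n \<omega>)) \<partial>M) = integral\<^sup>L (distr M borel (\<lambda>\<omega>. ln (X n \<omega>))) (cts_step x y)"
      using X(3)
    proof eventually_elim
      case (elim n)
      have "(\<integral>\<omega>. \<psi> (exp (- X n \<omega>)) \<partial>M) = (\<integral>\<omega>. cts_step x y (ln (X n \<omega>)) \<partial>M)"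
        by (rule integral_cong_AE) (use elim eq in \<open>auto elim!: eventually_mono\<close>)
      then show ?case by (subst integral_distr) auto
    qed
    ultimately show "(\<lambda>n. integral\<^sup>L (distr M borel (\<lambda>\<omega>. ln (X n \<omega>))) (cts_step x y)) \<longlonglongrightarrow>
        integral\<^sup>L (distr N borel (\<lambda>\<omega>. ln (X' \<omega>))) (cts_step x y)"
      by (simp only: tendsto_cong)
  qed
qed

section \<open>Sums of independent signs\<close>

lemma (in prob_space) indep_vars_blocks:
  fixes X :: "nat \<Rightarrow> 'a \<Rightarrow> real" and B :: "nat \<Rightarrow> nat set"
  assumes X: "indep_vars (\<lambda>_. borel) X I" and B: "\<And>i. B i \<subseteq> I" "disjoint_family B"
    and F [measurable]: "\<And>i. F i \<in> borel_measurable borel"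
  shows "indep_vars (\<lambda>_. borel) (\<lambda>i \<omega>. F i (\<Sum>j\<in>B i. X j \<omega>) :: real) UNIV"
proof -
  have "indep_vars (\<lambda>i. PiM (B i) (\<lambda>_. borel)) (\<lambda>i \<omega>. restrict (\<lambda>j. X j \<omega>) (B i)) UNIV"
    using X B by (intro indep_vars_restrict) auto
  then have "indep_vars (\<lambda>_. borel) (\<lambda>i \<omega>. F i (\<Sum>j\<in>B i. restrict (\<lambda>j. X j \<omega>) (B i) j)) UNIV"
    by (rule indep_vars_compose2[where Y="\<lambda>i x. F i (\<Sum>j\<in>B i. x j)"]) measurable
  then show ?thesis by simp
qed

lemma (in prob_space) indep_var_blocks:
  fixes X Y :: "nat \<Rightarrow> 'a \<Rightarrow> real" and B :: "nat \<Rightarrow> nat set"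
  assumes XY: "indep_var (PiM I (\<lambda>_. borel)) (\<lambda>\<omega>. \<lambda>k\<in>I. X k \<omega>) (PiM I (\<lambda>_. borel)) (\<lambda>\<omega>. \<lambda>k\<in>I. Y k \<omega>)"
    and B: "\<And>i. B i \<subseteq> I"
    and F [measurable]: "\<And>i. F i \<in> borel_measurable borel" and G [measurable]: "\<And>i. G i \<in> borel_measurable borel"
  shows "indep_var (PiM UNIV (\<lambda>_. borel)) (\<lambda>\<omega> i. F i (\<Sum>j\<in>B i. X j \<omega>) :: real)
    (PiM UNIV (\<lambda>_. borel)) (\<lambda>\<omega> i. G i (\<Sum>j\<in>B i. Y j \<omega>) :: real)"
proof -
  have m: "(\<lambda>x i. H i (\<Sum>j\<in>B i. x j)) \<in> measurable (PiM I (\<lambda>_. borel :: real measure)) (PiM UNIV (\<lambda>_. borel :: real measure))"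
    if [measurable]: "\<And>i. H i \<in> borel_measurable borel" for H :: "nat \<Rightarrow> real \<Rightarrow> real"
  proof (rule measurable_PiM_single')
    fix i
    have [measurable]: "(\<lambda>x. x j) \<in> measurable (PiM I (\<lambda>_. borel :: real measure)) borel" if "j \<in> B i" for j
      using that B[of i] by (intro measurable_component_singleton) auto
    show "(\<lambda>x. H i (\<Sum>j\<in>B i. x j)) \<in> measurable (PiM I (\<lambda>_. borel :: real measure)) borel"
      by measurable
  qed auto
  have r: "(\<Sum>j\<in>B i. (\<lambda>k\<in>I. Z k) j) = (\<Sum>j\<in>B i. Z j)" for i and Z :: "nat \<Rightarrow> real"
    using B[of i] by (intro sum.cong) auto
  show ?thesis
    using indep_var_compose[OF XY m[of F, OF F] m[of G, OF G]] unfolding o_def r .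
qed

locale sign_steps = prob_space M for M :: "'a measure" +
  fixes \<xi> :: "nat \<Rightarrow> 'a \<Rightarrow> real" and p :: real
  assumes \<xi>_indep: "indep_vars (\<lambda>_. borel) \<xi> {1..}"
    and \<xi>_up: "\<And>k. 1 \<le> k \<Longrightarrow> prob {\<omega> \<in> space M. \<xi> k \<omega> = 1} = p"
    and \<xi>_down: "\<And>k. 1 \<le> k \<Longrightarrow> prob {\<omega> \<in> space M. \<xi> k \<omega> = - 1} = 1 - p"
begin

lemma \<xi>_meas [measurable]: "1 \<le> k \<Longrightarrow> \<xi> k \<in> borel_measurable M"
  using \<xi>_indep by (auto simp: indep_vars_def)

lemma \<xi>_AE:
  assumes k: "1 \<le> k"
  shows "AE \<omega> in M. \<xi> k \<omega> = 1 \<or> \<xi> k \<omega> = - 1"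
proof -
  have [measurable]: "\<xi> k \<in> borel_measurable M" using k by (rule \<xi>_meas)
  have "prob ({\<omega> \<in> space M. \<xi> k \<omega> = 1} \<union> {\<omega> \<in> space M. \<xi> k \<omega> = - 1}) = p + (1 - p)"
    by (subst finite_measure_Union) (auto simp: \<xi>_up[OF k] \<xi>_down[OF k])
  also have "{\<omega> \<in> space M. \<xi> k \<omega> = 1} \<union> {\<omega> \<in> space M. \<xi> k \<omega> = - 1} = {\<omega> \<in> space M. \<xi> k \<omega> = 1 \<or> \<xi> k \<omega> = - 1}" by auto
  finally have "prob {\<omega> \<in> space M. \<xi> k \<omega> = 1 \<or> \<xi> k \<omega> = - 1} = 1" by simp
  then show ?thesis by (subst (asm) prob_Collect_eq_1) auto
qed

text \<open>The values lie in a Banach space so as to cover the complex exponentials of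
  characteristic functions.\<close>

lemma expectation_\<xi>_functional:
  fixes g :: "real \<Rightarrow> 'b::{banach, second_countable_topology}"
  assumes k: "1 \<le> k" and [measurable]: "g \<in> borel_measurable borel"
  shows "(\<integral>\<omega>. g (\<xi> k \<omega>) \<partial>M) = p *\<^sub>R g 1 + (1 - p) *\<^sub>R g (- 1)"
proof -
  have [measurable]: "\<xi> k \<in> borel_measurable M" using k by (rule \<xi>_meas)
  let ?A = "{\<omega> \<in> space M. \<xi> k \<omega> = 1}" and ?B = "{\<omega> \<in> space M. \<xi> k \<omega> = - 1}"
  have "(\<integral>\<omega>. g (\<xi> k \<omega>) \<partial>M) = (\<integral>\<omega>. indicator ?A \<omega> *\<^sub>R g 1 + indicator ?B \<omega> *\<^sub>R g (- 1) \<partial>M)"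
  proof (rule integral_cong_AE)
    show "AE \<omega> in M. g (\<xi> k \<omega>) = indicator ?A \<omega> *\<^sub>R g 1 + indicator ?B \<omega> *\<^sub>R g (- 1)"
      using \<xi>_AE[OF k] AE_space by eventually_elim (auto split: split_indicator)
  qed measurable
  also have "\<dots> = measure M ?A *\<^sub>R g 1 + measure M ?B *\<^sub>R g (- 1)"
  proof -
    have "integrable M (indicator ?A :: 'a \<Rightarrow> real)" "integrable M (indicator ?B :: 'a \<Rightarrow> real)"
      by (auto intro!: integrable_const_bound[where B=1])
    then show ?thesis by (simp add: integral_scaleR_left)
  qed
  finally show ?thesis by (simp add: \<xi>_up[OF k] \<xi>_down[OF k])
qed

lemma expectation_\<xi>: "1 \<le> k \<Longrightarrow> expectation (\<xi> k) = 2 * p - 1"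
  using expectation_\<xi>_functional[of k "\<lambda>x. x"] by simp

lemma Hoeffding_sum:
  assumes I: "finite I" "I \<subseteq> {1..}" "I \<noteq> {}" and e: "0 \<le> e"
  shows "prob {\<omega> \<in> space M. e \<le> \<bar>(\<Sum>j\<in>I. \<xi> j \<omega>) - (2 * p - 1) * real (card I)\<bar>} \<le> 2 * exp (- (e\<^sup>2 / (2 * real (card I))))"
    and "prob {\<omega> \<in> space M. (2 * p - 1) * real (card I) + e \<le> (\<Sum>j\<in>I. \<xi> j \<omega>)} \<le> exp (- (e\<^sup>2 / (2 * real (card I))))"
proof -
  have E: "(\<Sum>i\<in>I. expectation (\<xi> i)) = (2 * p - 1) * real (card I)"
    using I(2) by (subst sum.cong[OF refl, of _ _ "\<lambda>_. 2 * p - 1"]) (auto intro!: expectation_\<xi>)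
  interpret H: Hoeffding_ineq M I \<xi> "\<lambda>_. - 1" "\<lambda>_. 1" "(2 * p - 1) * real (card I)"
  proof unfold_locales
    show "finite I" by fact
    show "indep_vars (\<lambda>_. borel) \<xi> I" using \<xi>_indep I(2) by (rule indep_vars_subset)
    show "AE x in M. \<xi> i x \<in> {- 1..1}" if "i \<in> I" for i
    proof -
      have "1 \<le> i" using that I(2) by auto
      from \<xi>_AE[OF this] show ?thesis by eventually_elim auto
    qed
    show "(2 * p - 1) * real (card I) \<equiv> (\<Sum>i\<in>I. expectation (\<xi> i))" using E by simp
  qed
  have c: "0 < card I" using I by (simp add: card_gt_0_iff)
  have s: "(\<Sum>i\<in>I. (1 - (- 1 :: real))\<^sup>2) = 4 * real (card I)" by simp
  have x: "- 2 * e\<^sup>2 / (4 * real (card I)) = - (e\<^sup>2 / (2 * real (card I)))" by simp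
  show "prob {\<omega> \<in> space M. e \<le> \<bar>(\<Sum>j\<in>I. \<xi> j \<omega>) - (2 * p - 1) * real (card I)\<bar>} \<le> 2 * exp (- (e\<^sup>2 / (2 * real (card I))))"
    using H.Hoeffding_ineq_abs_ge[OF e] c unfolding s x by simp
  show "prob {\<omega> \<in> space M. (2 * p - 1) * real (card I) + e \<le> (\<Sum>j\<in>I. \<xi> j \<omega>)} \<le> exp (- (e\<^sup>2 / (2 * real (card I))))"
    using H.Hoeffding_ineq_ge[OF e] c unfolding s x by simp
qed

end

section \<open>Central limit theorem and maximal inequality for the fair walk\<close>

lemma char_normal:
  assumes N: "prob_space N" and s: "0 < s" and W: "distributed N lborel W (normal_density 0 (sqrt s))"
  shows "char (distr N borel W) t = complex_of_real (exp (- (s * t\<^sup>2 / 2)))"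
proof -
  interpret prob_space N by fact
  have [measurable]: "W \<in> borel_measurable N" using W by (auto simp: distributed_def)
  have "distributed N lborel (\<lambda>\<omega>. (W \<omega> - 0) / sqrt s) std_normal_density"
    using normal_standard_normal_convert[of "sqrt s" W 0] s W by simp
  then have d: "distr N borel (\<lambda>\<omega>. W \<omega> / sqrt s) = std_normal_distribution"
    by (simp add: distributed_def cong: distr_cong)
  have "char (distr N borel W) t = (\<integral>\<omega>. iexp (t * W \<omega>) \<partial>N)"
    unfolding char_def by (subst integral_distr) auto
  also have "\<dots> = (\<integral>\<omega>. iexp ((t * sqrt s) * (W \<omega> / sqrt s)) \<partial>N)" using s by simp
  also have "\<dots> = char (distr N borel (\<lambda>\<omega>. W \<omega> / sqrt s)) (t * sqrt s)"
    unfolding char_def by (subst integral_distr) auto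
  also have "\<dots> = complex_of_real (exp (- (s * t\<^sup>2 / 2)))"
    unfolding d char_std_normal_distribution using s by (simp add: power_mult_distrib mult.commute)
  finally show ?thesis .
qed

context sign_steps
begin

text \<open>The characteristic function of a fair sign is the cosine, so that of the sum is a power
  of \<open>cos (t / sqrt n)\<close>, and \<open>n * (1 - cos (t / sqrt n))\<close> tends to half
  the square of \<open>t\<close>. The direct computation accommodates a number of summands that is
  only asymptotically proportional to \<open>n\<close>.\<close>

lemma weak_conv_normalized_sum:
  assumes p: "p = 1/2" and N: "prob_space N"
    and I: "\<And>n. finite (I n)" "\<And>n. I n \<subseteq> {1..}" "(\<lambda>n. real (card (I n)) / real n) \<longlonglongrightarrow> s"
    and s: "0 < s" and W: "distributed N lborel W (normal_density 0 (sqrt s))"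
  shows "weak_conv_m (\<lambda>n. distr M borel (\<lambda>\<omega>. real n powr (- (1/2)) * (\<Sum>j\<in>I n. \<xi> j \<omega>))) (distr N borel W)"
proof (rule levy_continuity)
  interpret N: prob_space N by fact
  have [measurable]: "W \<in> borel_measurable N" using W by (auto simp: distributed_def)
  have [measurable]: "(\<lambda>\<omega>. \<Sum>j\<in>I n. \<xi> j \<omega>) \<in> borel_measurable M" for n
    using I(2)[of n] by (intro borel_measurable_sum \<xi>_meas) auto
  show "real_distribution (distr M borel (\<lambda>\<omega>. real n powr (- (1/2)) * (\<Sum>j\<in>I n. \<xi> j \<omega>)))" for n
    by (rule real_distribution_distr) measurable
  show "real_distribution (distr N borel W)" by (rule N.real_distribution_distr) measurable
  fix t :: real
  have "char (distr M borel (\<lambda>\<omega>. real n powr (- (1/2)) * (\<Sum>j\<in>I n. \<xi> j \<omega>))) t =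
      complex_of_real (cos (t * real n powr (- (1/2))) ^ card (I n))" for n
  proof -
    let ?u = "t * real n powr (- (1/2))"
    have "char (distr M borel (\<lambda>\<omega>. real n powr (- (1/2)) * (\<Sum>j\<in>I n. \<xi> j \<omega>))) t =
       char (distr M borel (\<lambda>\<omega>. \<Sum>j\<in>I n. \<xi> j \<omega>)) ?u"
      unfolding char_def by (simp add: integral_distr mult.assoc)
    also have "\<dots> = (\<Prod>j\<in>I n. char (distr M borel (\<xi> j)) ?u)"
      by (rule char_distr_sum[OF indep_vars_subset[OF \<xi>_indep I(2)]])
    also have "\<dots> = (\<Prod>j\<in>I n. complex_of_real (cos ?u))"
    proof (rule prod.cong)
      fix j assume "j \<in> I n"
      then have j: "1 \<le> j" using I(2) by auto
      have [measurable]: "\<xi> j \<in> borel_measurable M" using j by (rule \<xi>_meas)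
      have "char (distr M borel (\<xi> j)) ?u = (\<integral>\<omega>. iexp (?u * \<xi> j \<omega>) \<partial>M)"
        unfolding char_def by (subst integral_distr) auto
      also have "\<dots> = p *\<^sub>R iexp (?u * 1) + (1 - p) *\<^sub>R iexp (?u * (- 1))"
        by (rule expectation_\<xi>_functional[OF j, of "\<lambda>x. iexp (?u * x)"]) measurable
      also have "\<dots> = complex_of_real (cos ?u)"
        by (simp add: p complex_eq_iff Re_exp Im_exp)
      finally show "char (distr M borel (\<xi> j)) ?u = complex_of_real (cos ?u)" .
    qed simp
    finally show ?thesis by simp
  qed
  moreover have "(\<lambda>n. cos (t * real n powr (- (1/2))) ^ card (I n)) \<longlonglongrightarrow> exp (- s * (t\<^sup>2 / 2))"
  proof (rule power_tendsto_exp[OF _ I(3)])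
    show "(\<lambda>n. real n * (1 - cos (t * real n powr (- (1/2))))) \<longlonglongrightarrow> t\<^sup>2 / 2"
      unfolding power2_eq_square by real_asymp
  qed
  then have "(\<lambda>n. complex_of_real (cos (t * real n powr (- (1/2))) ^ card (I n))) \<longlonglongrightarrow> complex_of_real (exp (- s * (t\<^sup>2 / 2)))"
    by (rule tendsto_of_real)
  ultimately show "(\<lambda>n. char (distr M borel (\<lambda>\<omega>. real n powr (- (1/2)) * (\<Sum>j\<in>I n. \<xi> j \<omega>))) t) \<longlonglongrightarrow> char (distr N borel W) t"
    by (simp add: char_normal[OF N s W])
qed

text \<open>Ottaviani's inequality: at the first time the walk exceeds \<open>2x\<close>, the remaining increment is
  independent of the past and, with probability at least \<open>1/2\<close>, smaller than \<open>x\<close>.\<close>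

lemma maximal_inequality:
  assumes p: "p = 1/2" and x: "0 < x" and L: "0 < L" and small: "4 * exp (- (x\<^sup>2 / (2 * real L))) \<le> 1"
  shows "prob {\<omega> \<in> space M. \<exists>k\<le>L. 2 * x \<le> \<bar>\<Sum>j\<in>{b<..b + k}. \<xi> j \<omega>\<bar>} \<le> 4 * exp (- (x\<^sup>2 / (2 * real L)))"
proof -
  define T where "T = (\<lambda>k \<omega>. \<Sum>j\<in>{b<..b + k}. \<xi> j \<omega>)"
  define R where "R = (\<lambda>k \<omega>. \<Sum>j\<in>{b + k<..b + L}. \<xi> j \<omega>)"
  have [measurable]: "T k \<in> borel_measurable M" "R k \<in> borel_measurable M" for k
    unfolding T_def R_def by (auto intro!: borel_measurable_sum \<xi>_meas)
  have TL: "T L \<omega> = T k \<omega> + R k \<omega>" if "k \<le> L" for k \<omega>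
  proof -
    have "{b<..b + L} = {b<..b + k} \<union> {b + k<..b + L}" using that by auto
    then show ?thesis unfolding T_def R_def by (simp only:) (rule sum.union_disjoint, auto)
  qed
  have tail: "prob {\<omega> \<in> space M. x \<le> \<bar>R k \<omega>\<bar>} \<le> 2 * exp (- (x\<^sup>2 / (2 * real L)))" if k: "k \<le> L" for k
  proof (cases "k = L")
    case True
    then show ?thesis using x by (simp add: R_def)
  next
    case False
    have sub: "{b + k<..b + L} \<subseteq> {1..}" by auto
    have "prob {\<omega> \<in> space M. x \<le> \<bar>R k \<omega>\<bar>} \<le> 2 * exp (- (x\<^sup>2 / (2 * real (card {b + k<..b + L}))))"
      using Hoeffding_sum(1)[OF _ sub, of x] x k False by (simp add: R_def p)
    also have "\<dots> \<le> 2 * exp (- (x\<^sup>2 / (2 * real L)))"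
      using k False by (auto intro!: divide_left_mono mult_pos_pos)
    finally show ?thesis .
  qed
  define A where "A = (\<lambda>k. {\<omega> \<in> space M. 2 * x \<le> \<bar>T k \<omega>\<bar> \<and> (\<forall>i<k. \<bar>T i \<omega>\<bar> < 2 * x)})"
  have [measurable]: "A k \<in> events" for k unfolding A_def by measurable
  have half: "prob (A k) \<le> 2 * prob (A k \<inter> {\<omega> \<in> space M. \<bar>R k \<omega>\<bar> < x})" if k: "k \<le> L" for k
  proof -
    let ?PA = "PiM {b<..b + k} (\<lambda>_. borel :: real measure)" and ?PB = "PiM {b + k<..b + L} (\<lambda>_. borel :: real measure)"
    let ?XA = "\<lambda>\<omega>. restrict (\<lambda>i. \<xi> i \<omega>) {b<..b + k}" and ?XB = "\<lambda>\<omega>. restrict (\<lambda>i. \<xi> i \<omega>) {b + k<..b + L}"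
    let ?SA = "{y \<in> space ?PA. 2 * x \<le> \<bar>\<Sum>j\<in>{b<..b + k}. y j\<bar> \<and> (\<forall>i<k. \<bar>\<Sum>j\<in>{b<..b + i}. y j\<bar> < 2 * x)}"
    let ?SB = "{y \<in> space ?PB. \<bar>\<Sum>j\<in>{b + k<..b + L}. y j\<bar> < x}"
    \<comment> \<open>The event of first passage at \<open>k\<close> depends on the steps up to
      \<open>b + k\<close>, the remainder on later ones.\<close>
    have ind: "indep_var ?PA ?XA ?PB ?XB"
      by (rule indep_var_restrict[OF \<xi>_indep]) auto
    have comp: "(\<lambda>y. \<Sum>j\<in>{b<..b + i}. y j) \<in> borel_measurable ?PA" if "i \<le> k" for i
      using that by (intro borel_measurable_sum measurable_component_singleton) auto
    have [measurable]: "?SA \<in> sets ?PA"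
    proof -
      have [measurable]: "(\<lambda>y. \<Sum>j\<in>{b<..b + k}. y j) \<in> borel_measurable ?PA" by (rule comp) simp
      have [measurable]: "Measurable.pred ?PA (\<lambda>y. i < k \<longrightarrow> \<bar>\<Sum>j\<in>{b<..b + i}. y j\<bar> < 2 * x)" for i
      proof (cases "i < k")
        case True
        then have [measurable]: "(\<lambda>y. \<Sum>j\<in>{b<..b + i}. y j) \<in> borel_measurable ?PA" by (intro comp) simp
        show ?thesis by measurable
      qed simp
      show ?thesis by measurable
    qed
    have [measurable]: "?SB \<in> sets ?PB" by measurable
    have rA: "(\<Sum>j\<in>{b<..b + i}. restrict y {b<..b + k} j) = (\<Sum>j\<in>{b<..b + i}. y j)" if "i \<le> k" for i and y :: "nat \<Rightarrow> real"
      using that by (intro sum.cong) auto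
    have eA: "?XA -` ?SA \<inter> space M = A k"
      unfolding A_def T_def by (auto simp: space_PiM rA)
    have eB: "?XB -` ?SB \<inter> space M = {\<omega> \<in> space M. \<bar>R k \<omega>\<bar> < x}"
      unfolding R_def by (auto simp: space_PiM)
    have "prob (A k \<inter> {\<omega> \<in> space M. \<bar>R k \<omega>\<bar> < x}) = prob ((\<lambda>\<omega>. (?XA \<omega>, ?XB \<omega>)) -` (?SA \<times> ?SB) \<inter> space M)"
      unfolding eA[symmetric] eB[symmetric] by (intro arg_cong[where f=prob]) auto
    also have "\<dots> = prob (?XA -` ?SA \<inter> space M) * prob (?XB -` ?SB \<inter> space M)"
      by (rule indep_varD[OF ind]) measurable
    finally have prod: "prob (A k \<inter> {\<omega> \<in> space M. \<bar>R k \<omega>\<bar> < x}) = prob (A k) * prob {\<omega> \<in> space M. \<bar>R k \<omega>\<bar> < x}"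
      unfolding eA eB .
    have "prob {\<omega> \<in> space M. \<bar>R k \<omega>\<bar> < x} = 1 - prob {\<omega> \<in> space M. x \<le> \<bar>R k \<omega>\<bar>}"
    proof -
      have "{\<omega> \<in> space M. \<bar>R k \<omega>\<bar> < x} = space M - {\<omega> \<in> space M. x \<le> \<bar>R k \<omega>\<bar>}" by auto
      then show ?thesis by (simp add: prob_compl)
    qed
    \<comment> \<open>Assumption \<open>small\<close> says exactly that the Hoeffding bound for the
      remainder is at most 1/2.\<close>
    then have "1/2 \<le> prob {\<omega> \<in> space M. \<bar>R k \<omega>\<bar> < x}" using tail[OF k] small by linarith
    then have "prob (A k) * (1/2) \<le> prob (A k) * prob {\<omega> \<in> space M. \<bar>R k \<omega>\<bar> < x}"
      by (rule mult_left_mono) simp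
    then show ?thesis using prod by simp
  qed
  have disj: "disjoint_family_on A {..L}"
    unfolding disjoint_family_on_def A_def
  proof (intro ballI impI)
    fix m n :: nat assume "m \<noteq> n"
    then consider "m < n" | "n < m" by linarith
    then show "{\<omega> \<in> space M. 2 * x \<le> \<bar>T m \<omega>\<bar> \<and> (\<forall>i<m. \<bar>T i \<omega>\<bar> < 2 * x)} \<inter>
      {\<omega> \<in> space M. 2 * x \<le> \<bar>T n \<omega>\<bar> \<and> (\<forall>i<n. \<bar>T i \<omega>\<bar> < 2 * x)} = {}"
      by cases (auto simp: not_le[symmetric])
  qed
  have "{\<omega> \<in> space M. \<exists>k\<le>L. 2 * x \<le> \<bar>T k \<omega>\<bar>} \<subseteq> (\<Union>k\<in>{..L}. A k)"
  proof
    fix \<omega> assume w: "\<omega> \<in> {\<omega> \<in> space M. \<exists>k\<le>L. 2 * x \<le> \<bar>T k \<omega>\<bar>}"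
    define k where "k = (LEAST k. 2 * x \<le> \<bar>T k \<omega>\<bar>)"
    obtain k0 where k0: "k0 \<le> L" "2 * x \<le> \<bar>T k0 \<omega>\<bar>" using w by auto
    have "2 * x \<le> \<bar>T k \<omega>\<bar>" unfolding k_def using k0(2) by (rule LeastI)
    moreover have "k \<le> L" unfolding k_def using Least_le[of "\<lambda>k. 2 * x \<le> \<bar>T k \<omega>\<bar>" k0] k0 by simp
    moreover have "\<bar>T i \<omega>\<bar> < 2 * x" if "i < k" for i
      using not_less_Least[of i "\<lambda>k. 2 * x \<le> \<bar>T k \<omega>\<bar>"] that unfolding k_def by simp
    ultimately show "\<omega> \<in> (\<Union>k\<in>{..L}. A k)" using w by (auto simp: A_def)
  qed
  then have "prob {\<omega> \<in> space M. \<exists>k\<le>L. 2 * x \<le> \<bar>T k \<omega>\<bar>} \<le> prob (\<Union>k\<in>{..L}. A k)"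
    by (intro finite_measure_mono) auto
  also have "\<dots> = (\<Sum>k\<in>{..L}. prob (A k))"
    using disj by (intro finite_measure_finite_Union) auto
  also have "\<dots> \<le> (\<Sum>k\<in>{..L}. 2 * prob (A k \<inter> {\<omega> \<in> space M. \<bar>R k \<omega>\<bar> < x}))"
    by (intro sum_mono half) auto
  also have "\<dots> = 2 * (\<Sum>k\<in>{..L}. prob (A k \<inter> {\<omega> \<in> space M. \<bar>R k \<omega>\<bar> < x}))" by (simp add: sum_distrib_left)
  also have "(\<Sum>k\<in>{..L}. prob (A k \<inter> {\<omega> \<in> space M. \<bar>R k \<omega>\<bar> < x})) = prob (\<Union>k\<in>{..L}. A k \<inter> {\<omega> \<in> space M. \<bar>R k \<omega>\<bar> < x})"
    using disj by (intro finite_measure_finite_Union[symmetric]) (auto simp: disjoint_family_on_def)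
  \<comment> \<open>A remainder below \<open>x\<close> after passing \<open>2 * x\<close> leaves the
    whole sum, which is \<open>R 0\<close>, above \<open>x\<close> in modulus.\<close>
  also have "\<dots> \<le> prob {\<omega> \<in> space M. x \<le> \<bar>R 0 \<omega>\<bar>}"
  proof (rule finite_measure_mono)
    show "(\<Union>k\<in>{..L}. A k \<inter> {\<omega> \<in> space M. \<bar>R k \<omega>\<bar> < x}) \<subseteq> {\<omega> \<in> space M. x \<le> \<bar>R 0 \<omega>\<bar>}"
    proof
      fix \<omega> assume "\<omega> \<in> (\<Union>k\<in>{..L}. A k \<inter> {\<omega> \<in> space M. \<bar>R k \<omega>\<bar> < x})"
      then obtain k where k: "k \<le> L" "\<omega> \<in> space M" "2 * x \<le> \<bar>T k \<omega>\<bar>" "\<bar>R k \<omega>\<bar> < x" by (auto simp: A_def)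
      have "T L \<omega> = R 0 \<omega>" using TL[of 0 \<omega>] by (simp add: T_def)
      then have "x \<le> \<bar>R 0 \<omega>\<bar>" using TL[OF k(1), of \<omega>] k(3,4) by linarith
      then show "\<omega> \<in> {\<omega> \<in> space M. x \<le> \<bar>R 0 \<omega>\<bar>}" using k(2) by simp
    qed
  qed auto
  also have "\<dots> \<le> 2 * exp (- (x\<^sup>2 / (2 * real L)))" by (rule tail) simp
  finally show ?thesis unfolding T_def by simp
qed

end

section \<open>Piecewise linear approximation of reflected paths\<close>

definition clamp01 :: "real \<Rightarrow> real" where "clamp01 x = max 0 (min 1 x)"

lemma clamp01_bounds: "0 \<le> clamp01 x" "clamp01 x \<le> 1"
  by (auto simp: clamp01_def)

text \<open>The piecewise linear path with value \<open>q i\<close> at the time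
  \<open>\<Sum>k<i. exp (v k)\<close>, constant after the last node. As a sum of clamped ramps it
  involves no case distinction on the cell containing \<open>t\<close>, and joint continuity in
  \<open>q\<close>, \<open>v\<close> and \<open>t\<close> is immediate.\<close>

definition interpolate :: "nat \<Rightarrow> (nat \<Rightarrow> real) \<Rightarrow> (nat \<Rightarrow> real) \<Rightarrow> real \<Rightarrow> real" where
  "interpolate J q v t = q 0 + (\<Sum>i<J. (q (Suc i) - q i) * clamp01 ((t - (\<Sum>k<i. exp (v k))) / exp (v i)))"

text \<open>In cell \<open>j\<close> all earlier ramps are 1 and all later ones 0, so the value is a
  convex combination of \<open>q j\<close> and \<open>q (Suc j)\<close>.\<close>

lemma interpolate_close:
  assumes j: "j < J" and t: "(\<Sum>k<j. exp (v k)) \<le> t" "t \<le> (\<Sum>k<Suc j. exp (v k))"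
    and x: "\<bar>x - q j\<bar> \<le> D" "\<bar>x - q (Suc j)\<bar> \<le> D"
  shows "\<bar>x - interpolate J q v t\<bar> \<le> D"
proof -
  define \<tau> where "\<tau> = (\<lambda>i. \<Sum>k<i. exp (v k))"
  define c where "c = (\<lambda>i. clamp01 ((t - \<tau> i) / exp (v i)))"
  have \<tau>_mono: "\<tau> i \<le> \<tau> k" if "i \<le> k" for i k
    unfolding \<tau>_def using that by (intro sum_mono2) auto
  have Suc: "\<tau> (Suc i) = \<tau> i + exp (v i)" for i by (simp add: \<tau>_def)
  have below: "c i = 1" if "i < j" for i
  proof -
    have "\<tau> i + exp (v i) \<le> t" using \<tau>_mono[of "Suc i" j] that t(1) Suc[of i] by (simp add: \<tau>_def)
    then have "1 \<le> (t - \<tau> i) / exp (v i)" by (simp add: field_simps)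
    then show ?thesis by (simp add: c_def clamp01_def)
  qed
  have above: "c i = 0" if "j < i" for i
  proof -
    have "t \<le> \<tau> i" using \<tau>_mono[of "Suc j" i] that t(2) by (simp add: \<tau>_def)
    then have "(t - \<tau> i) / exp (v i) \<le> 0" by (simp add: divide_nonpos_pos)
    then show ?thesis by (simp add: c_def clamp01_def)
  qed
  have "interpolate J q v t = q 0 + (\<Sum>i<J. (q (Suc i) - q i) * c i)"
    by (simp add: interpolate_def c_def \<tau>_def)
  also have "(\<Sum>i<J. (q (Suc i) - q i) * c i) = (\<Sum>i<Suc j. (q (Suc i) - q i) * c i)"
    using j above by (intro sum.mono_neutral_right) auto
  also have "\<dots> = (\<Sum>i<j. q (Suc i) - q i) + (q (Suc j) - q j) * c j"
    using below by simp
  also have "(\<Sum>i<j. q (Suc i) - q i) = q j - q 0" by (rule sum_lessThan_telescope)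
  finally have eq: "x - interpolate J q v t = (1 - c j) * (x - q j) + c j * (x - q (Suc j))"
    by (simp add: algebra_simps)
  have c01: "0 \<le> c j" "c j \<le> 1" unfolding c_def by (rule clamp01_bounds)+
  have "\<bar>x - interpolate J q v t\<bar> \<le> \<bar>(1 - c j) * (x - q j)\<bar> + \<bar>c j * (x - q (Suc j))\<bar>"
    unfolding eq by (rule abs_triangle_ineq)
  also have "\<dots> \<le> (1 - c j) * D + c j * D"
    using c01 x by (auto simp: abs_mult intro!: add_mono mult_left_mono)
  finally show ?thesis by (simp add: algebra_simps)
qed

section \<open>Discrete and continuous reflection\<close>

lemma exists_grid_cell:
  fixes \<tau> :: "nat \<Rightarrow> 'a::linorder"
  assumes "\<tau> 0 \<le> t" "t < \<tau> J"
  shows "\<exists>j<J. \<tau> j \<le> t \<and> t < \<tau> (Suc j)"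
proof -
  define j where "j = (LEAST j. t < \<tau> (Suc j))"
  have J: "J \<noteq> 0" using assms by (cases J) auto
  then have "t < \<tau> (Suc (J - 1))" using assms(2) by simp
  then have 1: "t < \<tau> (Suc j)" "j \<le> J - 1" unfolding j_def by (auto intro: LeastI Least_le)
  have "\<tau> j \<le> t"
  proof (cases j)
    case (Suc i)
    then have "\<not> t < \<tau> (Suc i)" using not_less_Least[of i "\<lambda>j. t < \<tau> (Suc j)"] by (simp add: j_def)
    then show ?thesis using Suc by simp
  qed (use assms in simp)
  then show ?thesis using 1 J by (intro exI[of _ j]) auto
qed

fun lindley :: "(nat \<Rightarrow> real) \<Rightarrow> nat \<Rightarrow> real" where
  "lindley u 0 = 0"
| "lindley u (Suc j) = max 0 (lindley u j + u j)"

text \<open>Subtracting \<open>f (g i)\<close> from Lindley's recursion leaves the running maximum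
  \<open>m i\<close> of \<open>- f\<close> over the grid, a discrete version of the supremum in
  \<open>reflection\<close>, from which it differs by at most the oscillation. The worst case is the
  right end of the cell: 2 oscillations for \<open>f\<close> and 1 for the supremum.\<close>

lemma reflection_close_to_lindley:
  fixes f :: "real \<Rightarrow> real" and g :: "nat \<Rightarrow> real"
  assumes g: "g 0 = 0" "\<And>i. i \<le> j \<Longrightarrow> g i \<le> g (Suc i)" and f0: "f 0 = 0"
    and osc: "\<And>i x. i \<le> j \<Longrightarrow> g i \<le> x \<Longrightarrow> x \<le> g (Suc i) \<Longrightarrow> \<bar>f x - f (g i)\<bar> \<le> \<Delta>"
    and s: "g j \<le> s" "s \<le> g (Suc j)" and u: "\<And>i. i \<le> j \<Longrightarrow> u i = f (g (Suc i)) - f (g i)"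
  shows "\<bar>reflection f s - lindley u j\<bar> \<le> 3 * \<Delta>" "\<bar>reflection f s - lindley u (Suc j)\<bar> \<le> 3 * \<Delta>"
proof -
  define m where "m = (\<lambda>i. lindley u i - f (g i))"
  have m0: "m 0 = 0" using g(1) f0 by (simp add: m_def)
  have mS: "m (Suc i) = max (m i) (- f (g (Suc i)))" if "i \<le> j" for i
    using u[OF that] by (simp add: m_def max_def)
  have g_mono: "g i \<le> g k" if "i \<le> k" "k \<le> Suc j" for i k
    using that(1,2) by (induction k rule: dec_induct) (auto intro: order_trans g(2))
  have m_nonneg: "0 \<le> m k" if "k \<le> Suc j" for k
    using that by (induction k) (auto simp: m0 mS)
  have m_mono: "m i \<le> m k" if "i \<le> k" "k \<le> Suc j" for i k
    using that(1,2) by (induction k rule: dec_induct) (auto simp: mS)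
  have m_ge: "- f (g k) \<le> m k" if "k \<le> Suc j" for k
    using that by (cases k) (auto simp: m0 mS g(1) f0)
  have \<Delta>: "0 \<le> \<Delta>" using osc[of j "g j"] g(2)[of j] by simp
  let ?F = "\<lambda>x. max (- f x) 0"
  define S where "S = (SUP x\<in>{0..s}. ?F x)"
  have s0: "0 \<le> s" using g_mono[of 0 j] g(1) s(1) by simp
  have upper: "?F x \<le> m j + \<Delta>" if x: "x \<in> {0..s}" for x
  proof -
    obtain i where i: "i \<le> j" "g i \<le> x" "x \<le> g (Suc i)"
    proof (cases "x < g (Suc j)")
      case True
      then obtain i where "i < Suc j" "g i \<le> x \<and> x < g (Suc i)"
        using exists_grid_cell[of g x "Suc j"] x g(1) by auto
      then show ?thesis using that[of i] by simp
    next
      case False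
      then show ?thesis using that[of j] x s g(2)[of j] by simp
    qed
    have "- f x \<le> - f (g i) + \<Delta>" using osc[OF i] by linarith
    also have "\<dots> \<le> m i + \<Delta>" using m_ge[of i] i(1) by simp
    also have "\<dots> \<le> m j + \<Delta>" using m_mono[of i j] i(1) by simp
    finally show ?thesis using m_nonneg[of j] \<Delta> by simp
  qed
  have bdd: "bdd_above (?F ` {0..s})" by (rule bdd_aboveI2) (rule upper)
  have S_upper: "S \<le> m j + \<Delta>" unfolding S_def using s0 by (intro cSUP_least upper) auto
  have S_lower: "m k \<le> S" if "k \<le> j" for k
    using that
  proof (induction k)
    case 0
    have "?F 0 \<le> S" unfolding S_def using s0 by (intro cSUP_upper bdd) auto
    then show ?case by (simp add: m0 f0)
  next
    case (Suc k)
    have "0 \<le> g (Suc k)" "g (Suc k) \<le> s"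
      using g_mono[of 0 "Suc k"] g_mono[of "Suc k" j] Suc.prems g(1) s(1) by auto
    then have "?F (g (Suc k)) \<le> S" unfolding S_def by (intro cSUP_upper bdd) auto
    then show ?case using Suc by (simp add: mS)
  qed
  have refl: "reflection f s = f s + S" by (simp add: reflection_def S_def)
  have o1: "\<bar>f s - f (g j)\<bar> \<le> \<Delta>" using osc[of j s] s by simp
  have o2: "\<bar>f (g (Suc j)) - f (g j)\<bar> \<le> \<Delta>" using osc[of j "g (Suc j)"] g(2)[of j] by simp
  have l: "lindley u j = f (g j) + m j" "lindley u (Suc j) = f (g (Suc j)) + m (Suc j)"
    by (simp_all only: m_def)
  have m2: "m j \<le> m (Suc j)" "m (Suc j) \<le> m j + \<Delta>"
    using mS[of j] o2 m_ge[of j] \<Delta> by auto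
  show "\<bar>reflection f s - lindley u j\<bar> \<le> 3 * \<Delta>"
    unfolding refl l using o1 S_upper S_lower[of j] \<Delta> by linarith
  show "\<bar>reflection f s - lindley u (Suc j)\<bar> \<le> 3 * \<Delta>"
    unfolding refl l using o1 o2 S_upper S_lower[of j] m2 \<Delta> by linarith
qed

lemma continuous_on_interpolate:
  assumes q: "\<And>i. continuous_on UNIV (\<lambda>z. q z i)" and v: "\<And>i. continuous_on UNIV (\<lambda>z. v z i)"
  shows "continuous_on A (\<lambda>(z, t). interpolate J (q z) (v z) t)"
proof -
  have q': "continuous_on A (\<lambda>x. q (fst x) i)" and v': "continuous_on A (\<lambda>x. v (fst x) i)" for i
    by (auto intro!: continuous_on_compose2[OF q] continuous_on_compose2[OF v] continuous_intros)
  show ?thesis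
    unfolding split_beta' interpolate_def clamp01_def
    by (intro continuous_intros q' v') auto
qed

lemma continuous_on_lindley:
  assumes "\<And>i. continuous_on A (\<lambda>z. u z i)"
  shows "continuous_on A (\<lambda>z. lindley (u z) j)"
  by (induction j) (auto intro!: continuous_intros assms)

lemma continuous_on_component:
  "continuous_on UNIV (\<lambda>z :: (nat \<Rightarrow> real) \<times> (nat \<Rightarrow> real). fst z i)"
  "continuous_on UNIV (\<lambda>z :: (nat \<Rightarrow> real) \<times> (nat \<Rightarrow> real). snd z i)"
  by (rule continuous_on_product_then_coordinatewise, rule continuous_on_fst continuous_on_snd, rule continuous_on_id)+

text \<open>The two pathwise conditions make the set in \<open>renewal_count\<close> finite for
  every \<open>t\<close>, so that \<open>Max\<close> is a genuine maximum. Everything in this locale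
  is deterministic.\<close>

locale renewal_path =
  fixes Y :: "nat \<Rightarrow> 'a \<Rightarrow> real" and \<omega> :: 'a
  assumes Y_pos: "\<And>k. 1 \<le> k \<Longrightarrow> 0 < Y k \<omega>"
    and arrivals_unbounded: "\<And>x. \<exists>k. x < (\<Sum>j=1..k. Y j \<omega>)"
begin

definition S :: "nat \<Rightarrow> real" where "S k = (\<Sum>j=1..k. Y j \<omega>)"

lemma S_0: "S 0 = 0" by (simp add: S_def)

lemma strict_mono_S: "strict_mono S"
  unfolding strict_mono_Suc_iff S_def using Y_pos by simp

lemma S_le_iff: "S i \<le> S k \<longleftrightarrow> i \<le> k" "S i < S k \<longleftrightarrow> i < k"
  using strict_mono_S by (auto simp: strict_mono_less_eq strict_mono_less)

lemma renewal_count_eq: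
  assumes "S k \<le> t" "t < S (Suc k)"
  shows "renewal_count Y \<omega> t = k"
proof -
  have "{k. (\<Sum>j=1..k. Y j \<omega>) \<le> t} = {..k}"
  proof (intro set_eqI iffI)
    fix i assume "i \<in> {k. (\<Sum>j=1..k. Y j \<omega>) \<le> t}"
    then have "S i \<le> t" by (simp add: S_def)
    then have "S i < S (Suc k)" using assms by simp
    then show "i \<in> {..k}" by (simp add: S_le_iff)
  next
    fix i assume "i \<in> {..k}"
    then have "S i \<le> S k" by (simp add: S_le_iff)
    then have "S i \<le> t" using assms by simp
    then show "i \<in> {k. (\<Sum>j=1..k. Y j \<omega>) \<le> t}" by (simp add: S_def)
  qed
  then show ?thesis unfolding renewal_count_def by (simp only:) (rule Max_eqI, auto)
qed

lemma renewal_count_exists: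
  assumes "0 \<le> t"
  shows "S (renewal_count Y \<omega> t) \<le> t \<and> t < S (Suc (renewal_count Y \<omega> t))"
proof -
  obtain J where "t < S J" using arrivals_unbounded[of t] by (auto simp: S_def)
  then obtain k where "S k \<le> t \<and> t < S (Suc k)"
    using exists_grid_cell[of S t J] assms S_0 by auto
  then show ?thesis using renewal_count_eq[of k t] by simp
qed

lemma renewal_count_between:
  assumes "0 \<le> t" "S b \<le> t" "t \<le> S b'"
  shows "b \<le> renewal_count Y \<omega> t" "renewal_count Y \<omega> t \<le> b'"
proof -
  have k: "S (renewal_count Y \<omega> t) \<le> t" "t < S (Suc (renewal_count Y \<omega> t))"
    using renewal_count_exists[OF assms(1)] by auto
  have "S b < S (Suc (renewal_count Y \<omega> t))" using assms(2) k(2) by simp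
  then show "b \<le> renewal_count Y \<omega> t" by (simp add: S_le_iff)
  have "S (renewal_count Y \<omega> t) \<le> S b'" using assms(3) k(1) by simp
  then show "renewal_count Y \<omega> t \<le> b'" by (simp add: S_le_iff)
qed

lemma renewal_count_S: "renewal_count Y \<omega> (S k) = k"
  by (rule renewal_count_eq) (auto simp: S_le_iff)

lemma renewal_walk_0: "renewal_walk \<xi> Y \<omega> 0 = 0"
  using renewal_count_S[of 0] by (simp add: renewal_walk_def S_0)

lemma renewal_count_locally_constant:
  assumes "0 \<le> t"
  shows "\<forall>\<^sub>F s in at_right t. renewal_count Y \<omega> s = renewal_count Y \<omega> t"
    and "0 < t \<Longrightarrow> \<exists>k. \<forall>\<^sub>F s in at_left t. renewal_count Y \<omega> s = k"
proof -
  define k where "k = renewal_count Y \<omega> t"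
  have k: "S k \<le> t" "t < S (Suc k)" using renewal_count_exists[OF assms] by (auto simp: k_def)
  have "\<forall>\<^sub>F s in at_right t. s \<in> {t<..<S (Suc k)}" using k(2) by (rule eventually_at_right_real)
  then show "\<forall>\<^sub>F s in at_right t. renewal_count Y \<omega> s = renewal_count Y \<omega> t"
    by eventually_elim (use k in \<open>auto simp: k_def[symmetric] intro!: renewal_count_eq\<close>)
  assume t: "0 < t"
  show "\<exists>k. \<forall>\<^sub>F s in at_left t. renewal_count Y \<omega> s = k"
  proof (cases "S k < t")
    case True
    have "\<forall>\<^sub>F s in at_left t. s \<in> {S k<..<t}" using True by (rule eventually_at_left_real)
    then show ?thesis
      by (intro exI[of _ k], elim eventually_mono) (use k in \<open>auto intro!: renewal_count_eq\<close>)
  next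
    case False
    then have tk: "t = S k" using k by simp
    then obtain i where i: "k = Suc i" using t S_0 by (cases k) auto
    have "S i < t" using tk i by (simp add: S_le_iff)
    then have "\<forall>\<^sub>F s in at_left t. s \<in> {S i<..<t}" by (rule eventually_at_left_real)
    then show ?thesis
      by (intro exI[of _ i], elim eventually_mono) (use tk i in \<open>auto intro!: renewal_count_eq\<close>)
  qed
qed

end

section \<open>Blocks of steps\<close>

lemma lindley_scale: "0 \<le> a \<Longrightarrow> a * lindley u j = lindley (\<lambda>i. a * u i) j"
proof (induction j)
  case (Suc j)
  have "a * lindley u (Suc j) = max (a * 0) (a * (lindley u j + u j))"
    using Suc.prems by (simp add: max_mult_distrib_left)
  then show ?case using Suc by (simp add: distrib_left)
qed simp

text \<open>Rounding down the multiples of \<open>n / m\<close> yields consecutive blocks whose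
  lengths differ from \<open>n / m\<close> by less than one, without assuming that \<open>m\<close>
  divides \<open>n\<close>.\<close>

definition block :: "nat \<Rightarrow> nat \<Rightarrow> nat \<Rightarrow> nat set" where
  "block m n i = {(n * i) div m <.. (n * Suc i) div m}"

definition block_sum :: "nat \<Rightarrow> nat \<Rightarrow> nat \<Rightarrow> (nat \<Rightarrow> real) \<Rightarrow> real" where
  "block_sum m n i x = (\<Sum>j\<in>block m n i. x j)"

lemma block_end_mono: "i \<le> k \<Longrightarrow> (n * i) div m \<le> (n * k) div (m::nat)"
  by (intro div_le_mono) simp

lemma block_end_bounds:
  assumes "0 < m"
  shows "real ((n * i) div m) \<le> real n * real i / real m" "real n * real i / real m - 1 \<le> real ((n * i) div m)"
proof -
  have "m * ((n * i) div m) \<le> n * i" by (rule times_div_less_eq_dividend)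
  then have 1: "real m * real ((n * i) div m) \<le> real n * real i"
    by (simp only: of_nat_mult[symmetric] of_nat_le_iff)
  have "n * i \<le> m * ((n * i) div m) + m"
    using mod_less_divisor[OF assms, of "n * i"] mult_div_mod_eq[of m "n * i"] by linarith
  then have 2: "real n * real i \<le> real m * real ((n * i) div m) + real m"
    by (simp only: of_nat_mult[symmetric] of_nat_add[symmetric] of_nat_le_iff)
  show "real ((n * i) div m) \<le> real n * real i / real m"
    using 1 assms by (simp add: field_simps)
  show "real n * real i / real m - 1 \<le> real ((n * i) div m)"
    using 2 assms by (simp add: field_simps)
qed

lemma block_end_strict:
  assumes "0 < m" "m \<le> n"
  shows "(n * i) div m < (n * Suc i) div m"
proof -
  have "Suc ((n * i) div m) = (n * i + m) div m" using assms by simp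
  also have "\<dots> \<le> (n * Suc i) div m" using assms by (intro div_le_mono) simp
  finally show ?thesis by simp
qed

lemma sum_greaterThanAtMost_eq:
  fixes x :: "nat \<Rightarrow> real"
  assumes "b \<le> k"
  shows "(\<Sum>j\<in>{b<..k}. x j) = (\<Sum>j=1..k. x j) - (\<Sum>j=1..b. x j)"
proof -
  have "{1..k} = {1..b} \<union> {b<..k}" using assms by auto
  then have "(\<Sum>j=1..k. x j) = (\<Sum>j=1..b. x j) + (\<Sum>j\<in>{b<..k}. x j)"
    by (simp only:) (rule sum.union_disjoint, auto)
  then show ?thesis by simp
qed

lemma block_sum_eq: "block_sum m n i x = (\<Sum>j=1..(n * Suc i) div m. x j) - (\<Sum>j=1..(n * i) div m. x j)"
  unfolding block_sum_def block_def by (rule sum_greaterThanAtMost_eq[OF block_end_mono]) simp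

lemma finite_block: "finite (block m n i)"
  by (simp add: block_def)

lemma block_subset: "block m n i \<subseteq> {1..}"
  by (auto simp: block_def)

lemma disjoint_family_block: "disjoint_family (block m n)"
proof -
  have "block m n i \<inter> block m n k = {}" if "i < k" for i k
    using block_end_mono[of "Suc i" k n m] that by (auto simp: block_def simp del: mult_Suc_right)
  then show ?thesis
    unfolding disjoint_family_on_def by (metis Int_commute linorder_neqE_nat)
qed

lemma card_block: "0 < m \<Longrightarrow> (\<lambda>n. real (card (block m n i)) / real n) \<longlonglongrightarrow> 1 / real m"
proof -
  assume m: "0 < m"
  have lim: "(\<lambda>n. real ((n * k) div m) / real n) \<longlonglongrightarrow> real k / real m" for k
  proof (rule tendsto_sandwich)
    show "(\<lambda>n. real k / real m - 1 / real n) \<longlonglongrightarrow> real k / real m"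
      using tendsto_diff[OF tendsto_const lim_1_over_n, of "real k / real m"] by simp
    show "(\<lambda>n. real k / real m) \<longlonglongrightarrow> real k / real m" by (rule tendsto_const)
    show "\<forall>\<^sub>F n in sequentially. real k / real m - 1 / real n \<le> real ((n * k) div m) / real n"
      using eventually_gt_at_top[of 0]
    proof eventually_elim
      case (elim n)
      then have "(real n * real k / real m - 1) / real n \<le> real ((n * k) div m) / real n"
        using block_end_bounds(2)[OF m, of n k] by (intro divide_right_mono) auto
      then show ?case using elim by (simp add: diff_divide_distrib)
    qed
    show "\<forall>\<^sub>F n in sequentially. real ((n * k) div m) / real n \<le> real k / real m"
      using eventually_gt_at_top[of 0]
    proof eventually_elim
      case (elim n)
      then have "real ((n * k) div m) / real n \<le> (real n * real k / real m) / real n"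
        using block_end_bounds(1)[OF m, of n k] by (intro divide_right_mono) auto
      then show ?case using elim by simp
    qed
  qed
  have "real (card (block m n i)) / real n = real ((n * Suc i) div m) / real n - real ((n * i) div m) / real n" for n
    using block_end_mono[of i "Suc i" n m] by (simp add: block_def of_nat_diff diff_divide_distrib)
  then have "(\<lambda>n. real (card (block m n i)) / real n) \<longlonglongrightarrow> real (Suc i) / real m - real i / real m"
    by (simp only:) (intro tendsto_diff lim)
  moreover have "real (Suc i) / real m - real i / real m = 1 / real m" by (simp add: diff_divide_distrib[symmetric])
  ultimately show ?thesis by simp
qed

section \<open>Queue paths compared with functions of the block sums\<close>

context renewal_path
begin

text \<open>For \<open>m \<le> n\<close> no block is empty, so the block sums are positive, the
  exponential undoes the logarithm, and the sum telescopes: the nodes of the interpolation are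
  rescaled arrival times.\<close>

lemma sum_exp_ln_block:
  assumes m: "0 < m" "m \<le> n" and c: "0 < c"
  shows "(\<Sum>k<i. exp (ln (block_sum m n k (\<lambda>j. Y j \<omega>) / c))) = S ((n * i) div m) / c"
proof -
  have b: "block_sum m n k (\<lambda>j. Y j \<omega>) = S ((n * Suc k) div m) - S ((n * k) div m)" for k
    unfolding block_sum_eq S_def ..
  have "0 < block_sum m n k (\<lambda>j. Y j \<omega>)" for k
    unfolding b using block_end_strict[OF m, of k] by (simp add: S_le_iff)
  then have "(\<Sum>k<i. exp (ln (block_sum m n k (\<lambda>j. Y j \<omega>) / c))) = (\<Sum>k<i. S ((n * Suc k) div m) - S ((n * k) div m)) / c"
    using c by (simp add: b sum_divide_distrib)
  also have "\<dots> = (S ((n * i) div m) - S ((n * 0) div m)) / c"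
    by (subst sum_lessThan_telescope[of "\<lambda>k. S ((n * k) div m)"]) (rule refl)
  finally show ?thesis by (simp add: S_0)
qed

text \<open>The grid consists of the arrival times at the block ends. Between two of them the count
  runs through one block, so oscillation of the walk in time is oscillation of its partial sums
  within the block.\<close>

lemma scaled_queue_close_reflected:
  fixes \<xi> :: "nat \<Rightarrow> 'a \<Rightarrow> real"
  assumes m: "0 < m" "m \<le> n" and c: "0 < c" and a: "0 \<le> a"
    and osc: "\<And>i k. i < J \<Longrightarrow> (n * i) div m \<le> k \<Longrightarrow> k \<le> (n * Suc i) div m \<Longrightarrow>
       a * \<bar>\<Sum>j\<in>{(n * i) div m<..k}. \<xi> j \<omega>\<bar> \<le> \<Delta>"
    and t: "0 \<le> t" "t < S ((n * J) div m) / c"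
  shows "\<bar>a * renewal_queue \<xi> Y \<omega> (c * t) -
    interpolate J (lindley (\<lambda>i. a * block_sum m n i (\<lambda>j. \<xi> j \<omega>))) (\<lambda>i. ln (block_sum m n i (\<lambda>j. Y j \<omega>) / c)) t\<bar> \<le> 3 * \<Delta>"
proof (cases "a = 0")
  case True
  have "lindley (\<lambda>i. 0) j = 0" for j by (induction j) auto
  moreover have "0 \<le> \<Delta>" using osc[of 0 0] t S_0 True by (cases J) auto
  ultimately show ?thesis using True by (simp add: interpolate_def)
next
  case False
  then have a: "0 < a" using a by simp
  define b where "b = (\<lambda>i. (n * i) div m)"
  define g where "g = (\<lambda>i. S (b i))"
  define f where "f = renewal_walk \<xi> Y \<omega>"
  define r where "r = (\<lambda>k. \<Sum>j=1..k. \<xi> j \<omega>)"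
  define u where "u = (\<lambda>i. block_sum m n i (\<lambda>j. \<xi> j \<omega>))"
  have g0: "g 0 = 0" by (simp add: g_def b_def S_0)
  have g_mono: "g i \<le> g (Suc i)" for i
    unfolding g_def b_def S_le_iff by (rule block_end_mono) simp
  have g_nonneg: "0 \<le> g i" for i using S_le_iff(1)[of 0 "b i"] by (simp add: g_def S_0)
  have fr: "f x = r (renewal_count Y \<omega> x)" for x by (simp add: f_def renewal_walk_def r_def)
  have fg: "f (g i) = r (b i)" for i by (simp add: fr g_def renewal_count_S)
  have ct: "0 \<le> c * t" "c * t < g J" using t c by (auto simp: g_def b_def field_simps)
  then obtain j where j: "j < J" "g j \<le> c * t" "c * t < g (Suc j)"
    using exists_grid_cell[of g "c * t" J] g0 by auto
  have osc': "\<bar>f x - f (g i)\<bar> \<le> \<Delta> / a" if "i \<le> j" "g i \<le> x" "x \<le> g (Suc i)" for i x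
  proof -
    have "0 \<le> x" using g_nonneg[of i] that by simp
    then have k: "b i \<le> renewal_count Y \<omega> x" "renewal_count Y \<omega> x \<le> b (Suc i)"
      using renewal_count_between[of x "b i" "b (Suc i)"] that by (auto simp: g_def)
    then have "a * \<bar>r (renewal_count Y \<omega> x) - r (b i)\<bar> \<le> \<Delta>"
      using osc[of i "renewal_count Y \<omega> x"] that(1) j(1)
      unfolding b_def r_def by (simp add: sum_greaterThanAtMost_eq del: mult_Suc_right)
    then show ?thesis using a by (simp add: fr[of x] fg field_simps)
  qed
  have ueq: "u i = f (g (Suc i)) - f (g i)" for i
    by (simp add: u_def fg block_sum_eq r_def b_def)
  have "\<bar>reflection f (c * t) - lindley u j\<bar> \<le> 3 * (\<Delta> / a)" "\<bar>reflection f (c * t) - lindley u (Suc j)\<bar> \<le> 3 * (\<Delta> / a)"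
    using reflection_close_to_lindley[of g j f "\<Delta> / a" "c * t" u] g0 g_mono osc' j ueq renewal_walk_0[of \<xi>]
    by (auto simp: f_def)
  then have "a * \<bar>reflection f (c * t) - lindley u j\<bar> \<le> 3 * \<Delta>" "a * \<bar>reflection f (c * t) - lindley u (Suc j)\<bar> \<le> 3 * \<Delta>"
    using a by (auto simp: field_simps)
  then have cl: "\<bar>a * reflection f (c * t) - lindley (\<lambda>i. a * u i) j\<bar> \<le> 3 * \<Delta>"
      "\<bar>a * reflection f (c * t) - lindley (\<lambda>i. a * u i) (Suc j)\<bar> \<le> 3 * \<Delta>"
    unfolding lindley_scale[OF less_imp_le[OF a], symmetric] using a
    by (simp_all add: abs_mult right_diff_distrib[symmetric] del: lindley.simps)
  show ?thesis
    unfolding renewal_queue_def f_def[symmetric] u_def[symmetric]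
  proof (rule interpolate_close[OF j(1)])
    show "(\<Sum>k<j. exp (ln (block_sum m n k (\<lambda>j. Y j \<omega>) / c))) \<le> t"
      unfolding sum_exp_ln_block[OF m c] using j(2) c by (simp add: g_def b_def field_simps)
    show "t \<le> (\<Sum>k<Suc j. exp (ln (block_sum m n k (\<lambda>j. Y j \<omega>) / c)))"
      unfolding sum_exp_ln_block[OF m c] using j(3) c by (simp add: g_def b_def field_simps)
  qed (use cl in \<open>simp_all add: u_def[abs_def]\<close>)
qed

text \<open>A walk within \<open>e * real n\<close> of a nondecreasing line never falls below
  \<open>- e * real n\<close>, so reflection adds no more than that. The count divided by
  \<open>n\<close> lies in the mesh cell up to the rounding error \<open>1 / real n\<close>.\<close>

lemma scaled_queue_close_drift:
  fixes \<xi> :: "nat \<Rightarrow> 'a \<Rightarrow> real"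
  assumes m: "0 < m" "m \<le> n" and c: "0 < c" and d: "0 \<le> d"
    and walk: "\<And>k. k \<le> (n * J) div m \<Longrightarrow> \<bar>(\<Sum>j=1..k. \<xi> j \<omega>) - d * real k\<bar> \<le> e * real n"
    and t: "0 \<le> t" "t < S ((n * J) div m) / c"
  shows "\<bar>renewal_queue \<xi> Y \<omega> (c * t) / real n -
    interpolate J (\<lambda>i. d * (real i / real m)) (\<lambda>i. ln (block_sum m n i (\<lambda>j. Y j \<omega>) / c)) t\<bar> \<le> 2 * e + d * (1 / real m + 1 / real n)"
proof -
  define b where "b = (\<lambda>i. (n * i) div m)"
  define f where "f = renewal_walk \<xi> Y \<omega>"
  have n: "0 < real n" using m by simp
  have e0: "0 \<le> e * real n" using walk[of 0] by simp
  have ct: "0 \<le> c * t" "c * t < S (b J)" using t c by (auto simp: b_def field_simps)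
  then obtain j where j: "j < J" "S (b j) \<le> c * t" "c * t < S (b (Suc j))"
    using exists_grid_cell[of "\<lambda>i. S (b i)" "c * t" J] S_0 by (auto simp: b_def)
  have fw: "\<bar>f x - d * real (renewal_count Y \<omega> x)\<bar> \<le> e * real n" if "0 \<le> x" "x \<le> c * t" for x
  proof -
    have "renewal_count Y \<omega> x \<le> b J" using renewal_count_between(2)[of x 0 "b J"] that ct(2) S_0 by simp
    then show ?thesis using walk by (simp add: f_def renewal_walk_def b_def)
  qed
  let ?F = "\<lambda>x. max (- f x) 0"
  have Fb: "?F x \<le> e * real n" if "x \<in> {0..c * t}" for x
  proof -
    have "0 \<le> d * real (renewal_count Y \<omega> x)" using d by simp
    then show ?thesis using fw[of x] that e0 by auto
  qed
  define K where "K = (SUP x\<in>{0..c * t}. ?F x)"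
  have K: "K \<le> e * real n" "0 \<le> K"
  proof -
    show "K \<le> e * real n" unfolding K_def using ct(1) by (intro cSUP_least Fb) auto
    have "?F 0 \<le> K" unfolding K_def using ct(1) Fb by (intro cSUP_upper bdd_aboveI2[of _ _ "e * real n"]) auto
    then show "0 \<le> K" by simp
  qed
  define k where "k = renewal_count Y \<omega> (c * t)"
  have q: "\<bar>reflection f (c * t) - d * real k\<bar> \<le> 2 * (e * real n)"
    using fw[of "c * t"] ct(1) K by (simp add: reflection_def K_def[symmetric] k_def)
  have kb: "b j \<le> k" "k \<le> b (Suc j)"
    using renewal_count_between[of "c * t" "b j" "b (Suc j)"] ct j by (auto simp: k_def)
  have k1: "real n * real j / real m - 1 \<le> real k" using block_end_bounds(2)[OF m(1), of n j] kb(1) by (simp add: b_def)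
  have k2: "real k \<le> real n * real (Suc j) / real m" using block_end_bounds(1)[OF m(1), of n "Suc j"] kb(2) by (simp add: b_def)
  have kn1: "real j / real m - 1 / real n \<le> real k / real n"
    using divide_right_mono[OF k1, of "real n"] n by (simp add: diff_divide_distrib)
  have kn2: "real k / real n \<le> real (Suc j) / real m"
    using divide_right_mono[OF k2, of "real n"] n by simp
  have Sj: "real (Suc j) / real m = real j / real m + 1 / real m" by (simp add: add_divide_distrib)
  have pos: "0 \<le> 1 / real m" "0 \<le> 1 / real n" by auto
  have "\<bar>real k / real n - real j / real m\<bar> \<le> 1 / real m + 1 / real n"
    "\<bar>real k / real n - real (Suc j) / real m\<bar> \<le> 1 / real m + 1 / real n"
    using kn1 kn2 pos unfolding Sj by linarith+
  then have dk: "\<bar>d * (real k / real n) - d * (real j / real m)\<bar> \<le> d * (1 / real m + 1 / real n)"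
    "\<bar>d * (real k / real n) - d * (real (Suc j) / real m)\<bar> \<le> d * (1 / real m + 1 / real n)"
    using d by (simp_all only: right_diff_distrib[symmetric] abs_mult abs_of_nonneg mult_left_mono)
  have "\<bar>reflection f (c * t) / real n - d * (real k / real n)\<bar> = \<bar>reflection f (c * t) - d * real k\<bar> / real n"
    using n by (simp add: diff_divide_distrib[symmetric])
  also have "\<dots> \<le> 2 * (e * real n) / real n" using q n by (intro divide_right_mono) auto
  finally have qn: "\<bar>reflection f (c * t) / real n - d * (real k / real n)\<bar> \<le> 2 * e" using n by simp
  show ?thesis
    unfolding renewal_queue_def f_def[symmetric]
  proof (rule interpolate_close[OF j(1)])
    show "(\<Sum>k<j. exp (ln (block_sum m n k (\<lambda>j. Y j \<omega>) / c))) \<le> t"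
      unfolding sum_exp_ln_block[OF m c] using j(2) c by (simp add: b_def field_simps)
    show "t \<le> (\<Sum>k<Suc j. exp (ln (block_sum m n k (\<lambda>j. Y j \<omega>) / c)))"
      unfolding sum_exp_ln_block[OF m c] using j(3) c by (simp add: b_def field_simps)
  qed (use qn dk in linarith)+
qed

text \<open>The count takes each value up to its current one, so the supremum over time is a maximum
  over finitely many partial sums.\<close>

lemma renewal_queue_eq:
  assumes t: "0 \<le> t"
  shows "renewal_queue \<xi> Y \<omega> t = (\<Sum>j=1..renewal_count Y \<omega> t. \<xi> j \<omega>) +
    Max ((\<lambda>i. max (- (\<Sum>j=1..i. \<xi> j \<omega>)) 0) ` {..renewal_count Y \<omega> t})"
proof -
  define k where "k = renewal_count Y \<omega> t"
  have kt: "S k \<le> t" using renewal_count_exists[OF t] by (simp add: k_def)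
  have "renewal_count Y \<omega> ` {0..t} = {..k}"
  proof (intro equalityI subsetI)
    fix i assume "i \<in> renewal_count Y \<omega> ` {0..t}"
    then obtain s where s: "0 \<le> s" "s \<le> t" "i = renewal_count Y \<omega> s" by auto
    have "S i \<le> s" using renewal_count_exists[OF s(1)] s(3) by simp
    then have "S i \<le> t" using s(2) by simp
    then have "S i < S (Suc k)" using renewal_count_exists[OF t] by (simp add: k_def)
    then show "i \<in> {..k}" by (simp add: S_le_iff)
  next
    fix i assume "i \<in> {..k}"
    then have "S i \<le> t" using kt S_le_iff(1)[of i k] by simp
    moreover have "0 \<le> S i" using S_le_iff(1)[of 0 i] S_0 by simp
    ultimately show "i \<in> renewal_count Y \<omega> ` {0..t}"
      using renewal_count_S[of i] by (intro image_eqI[of _ _ "S i"]) auto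
  qed
  then have "(\<lambda>s. max (- renewal_walk \<xi> Y \<omega> s) 0) ` {0..t} = (\<lambda>i. max (- (\<Sum>j=1..i. \<xi> j \<omega>)) 0) ` {..k}"
    unfolding renewal_walk_def by (metis (no_types, lifting) image_cong image_image)
  then show ?thesis
    unfolding renewal_queue_def reflection_def by (simp add: k_def renewal_walk_def cSup_eq_Max)
qed

text \<open>The queue is a function of the count, and the count is constant on a one-sided
  neighbourhood of each point: on the right with its own value, on the left with some value.\<close>

lemma renewal_queue_cadlag:
  assumes c: "0 < c"
  shows "(\<lambda>t. a * renewal_queue \<xi> Y \<omega> (c * t)) \<in> cadlag"
proof -
  define H where "H = (\<lambda>k. a * ((\<Sum>j=1..k. \<xi> j \<omega>) + Max ((\<lambda>i. max (- (\<Sum>j=1..i. \<xi> j \<omega>)) 0) ` {..k})))"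
  have eq: "a * renewal_queue \<xi> Y \<omega> (c * t) = H (renewal_count Y \<omega> (c * t))" if "0 \<le> t" for t
    using renewal_queue_eq[of "c * t" \<xi>] that c by (simp add: H_def)
  have right: "filterlim (\<lambda>s. c * s) (at_right (c * t)) (at_right t)" for t
    unfolding filterlim_at
  proof
    show "\<forall>\<^sub>F s in at_right t. c * s \<in> {c * t<..} \<and> c * s \<noteq> c * t"
      using eventually_at_right_less[of t] by eventually_elim (use c in auto)
  qed (intro tendsto_intros)
  have left: "filterlim (\<lambda>s. c * s) (at_left (c * t)) (at_left t)" for t
    unfolding filterlim_at
  proof
    have "\<forall>\<^sub>F s in at_left t. s \<in> {t - 1<..<t}" by (rule eventually_at_left_real) simp
    then show "\<forall>\<^sub>F s in at_left t. c * s \<in> {..<c * t} \<and> c * s \<noteq> c * t"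
      by eventually_elim (use c in auto)
  qed (intro tendsto_intros)
  show ?thesis
    unfolding cadlag_def
  proof (intro CollectI conjI allI impI)
    fix t :: real assume t: "0 \<le> t"
    have "\<forall>\<^sub>F s in at_right (c * t). renewal_count Y \<omega> s = renewal_count Y \<omega> (c * t)"
      using t c by (intro renewal_count_locally_constant(1)) auto
    then have "\<forall>\<^sub>F s in at_right t. renewal_count Y \<omega> (c * s) = renewal_count Y \<omega> (c * t)"
      using right by (rule eventually_compose_filterlim)
    then have "\<forall>\<^sub>F s in at_right t. a * renewal_queue \<xi> Y \<omega> (c * s) = a * renewal_queue \<xi> Y \<omega> (c * t)"
      using eventually_at_right_less[of t] by eventually_elim (use t in \<open>simp add: eq\<close>)
    then show "((\<lambda>s. a * renewal_queue \<xi> Y \<omega> (c * s)) \<longlongrightarrow> a * renewal_queue \<xi> Y \<omega> (c * t)) (at_right t)"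
      by (rule tendsto_eventually)
  next
    fix t :: real assume t: "0 < t"
    obtain k where "\<forall>\<^sub>F s in at_left (c * t). renewal_count Y \<omega> s = k"
      using renewal_count_locally_constant(2)[of "c * t"] t c by auto
    then have "\<forall>\<^sub>F s in at_left t. renewal_count Y \<omega> (c * s) = k"
      using left by (rule eventually_compose_filterlim)
    moreover have "\<forall>\<^sub>F s in at_left t. s \<in> {0<..<t}" using t by (rule eventually_at_left_real)
    ultimately have "\<forall>\<^sub>F s in at_left t. a * renewal_queue \<xi> Y \<omega> (c * s) = H k"
      by eventually_elim (simp add: eq)
    then show "\<exists>l. ((\<lambda>s. a * renewal_queue \<xi> Y \<omega> (c * s)) \<longlongrightarrow> l) (at_left t)"
      by (intro exI[of _ "H k"] tendsto_eventually)
  qed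
qed

end

section \<open>Inverse subordinators\<close>

lemma (in prob_space) indep_var_cong_AE:
  assumes XY: "indep_var S X T Y" and Y': "random_variable T Y'" and ae: "AE \<omega> in M. Y \<omega> = Y' \<omega>"
  shows "indep_var S X T Y'"
proof -
  have rv: "random_variable S X" "random_variable T Y"
    and d: "distr M S X \<Otimes>\<^sub>M distr M T Y = distr M (S \<Otimes>\<^sub>M T) (\<lambda>x. (X x, Y x))"
    using XY by (auto simp: indep_var_distribution_eq)
  have "distr M T Y' = distr M T Y"
    using ae rv Y' by (intro distr_cong_AE) (auto elim!: eventually_mono)
  moreover have "distr M (S \<Otimes>\<^sub>M T) (\<lambda>x. (X x, Y' x)) = distr M (S \<Otimes>\<^sub>M T) (\<lambda>x. (X x, Y x))"
    using ae rv Y' by (intro distr_cong_AE) (auto elim!: eventually_mono)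
  ultimately show ?thesis using d rv Y' by (simp add: indep_var_distribution_eq)
qed

lemma (in prob_space) indep_vars_UNIV_nat:
  assumes "\<And>n::nat. indep_vars M' X {..<n}"
  shows "indep_vars M' X UNIV"
proof -
  let ?F = "\<lambda>i. {X i -` A \<inter> space M |A. A \<in> sets (M' i)}"
  have 1: "random_variable (M' i) (X i)" for i
    using assms[of "Suc i"] by (auto simp: indep_vars_def2)
  have "indep_sets ?F J" if "finite J" for J
  proof -
    obtain n where "J \<subseteq> {..<n}" using finite_nat_iff_bounded \<open>finite J\<close> by auto
    moreover have "indep_sets ?F {..<n}" using assms[of n] by (simp add: indep_vars_def2)
    ultimately show ?thesis by (rule indep_sets_mono_index)
  qed
  then have "indep_sets ?F UNIV" by (subst indep_sets_finite_index_sets) auto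
  then show ?thesis using 1 by (simp add: indep_vars_def2)
qed

text \<open>Chernoff bound for small values. It makes explicit Laplace transforms sufficient for
  growth of the subordinator and of the arrival times.\<close>

lemma (in prob_space) prob_le_exp:
  assumes [measurable]: "X \<in> borel_measurable M" and nn: "AE \<omega> in M. 0 \<le> X \<omega>"
  shows "prob {\<omega> \<in> space M. X \<omega> \<le> x} \<le> exp x * expectation (\<lambda>\<omega>. exp (- X \<omega>))"
proof -
  have i: "integrable M (\<lambda>\<omega>. exp (- X \<omega>))"
    by (rule integrable_const_bound[where B=1]) (use nn in \<open>auto elim!: eventually_mono\<close>)
  let ?A = "{\<omega> \<in> space M. X \<omega> \<le> x}"
  have "prob ?A = expectation (indicator ?A)" by simp
  also have "\<dots> \<le> expectation (\<lambda>\<omega>. exp x * exp (- X \<omega>))"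
  proof (rule integral_mono)
    show "integrable M (indicator ?A :: 'a \<Rightarrow> real)" by (rule integrable_const_bound[where B=1]) auto
    fix \<omega>
    have "1 \<le> exp x * exp (- X \<omega>)" if "X \<omega> \<le> x" using that by (simp add: exp_add[symmetric])
    then show "indicator ?A \<omega> \<le> exp x * exp (- X \<omega>)" by (auto split: split_indicator)
  qed (use i in simp)
  finally show ?thesis by simp
qed

text \<open>Common interface of the stable subordinator and, for index 1, of the identity. The
  inverse is described by the equivalence of \<open>L \<omega> t \<le> s\<close> and
  \<open>t \<le> \<sigma> \<omega> s\<close> instead of a least element.\<close>

locale subordinator_inverse = prob_space N for N :: "'b measure" +
  fixes \<sigma> L :: "'b \<Rightarrow> real \<Rightarrow> real" and a :: real
  assumes a_pos: "0 < a"
    and \<sigma>_meas: "\<And>t. 0 \<le> t \<Longrightarrow> (\<lambda>\<omega>. \<sigma> \<omega> t) \<in> borel_measurable N"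
    and \<sigma>_0: "AE \<omega> in N. \<sigma> \<omega> 0 = 0"
    and \<sigma>_mono: "AE \<omega> in N. mono_on {0..} (\<sigma> \<omega>)"
    and \<sigma>_indep: "independent_increments N \<sigma>"
    and \<sigma>_laplace: "\<And>s h z. 0 \<le> s \<Longrightarrow> 0 \<le> h \<Longrightarrow> 0 \<le> z \<Longrightarrow>
       expectation (\<lambda>\<omega>. exp (- z * (\<sigma> \<omega> (s + h) - \<sigma> \<omega> s))) = exp (- h * z powr a)"
    and L_le_iff: "AE \<omega> in N. \<forall>t\<ge>0. 0 \<le> L \<omega> t \<and> (\<forall>s\<ge>0. L \<omega> t \<le> s \<longleftrightarrow> t \<le> \<sigma> \<omega> s)"

text \<open>Staying below level \<open>k\<close> at all times \<open>n\<close> has probability at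
  most \<open>exp (k - n)\<close> for every \<open>n\<close>, hence 0.\<close>

lemma (in prob_space) AE_unbounded_of_laplace:
  fixes \<sigma> :: "'a \<Rightarrow> real \<Rightarrow> real"
  assumes [measurable]: "\<And>t. 0 \<le> t \<Longrightarrow> (\<lambda>\<omega>. \<sigma> \<omega> t) \<in> borel_measurable M"
    and nn: "\<And>t. 0 \<le> t \<Longrightarrow> AE \<omega> in M. 0 \<le> \<sigma> \<omega> t"
    and lap: "\<And>t. 0 \<le> t \<Longrightarrow> expectation (\<lambda>\<omega>. exp (- \<sigma> \<omega> t)) = exp (- t)"
  shows "AE \<omega> in M. \<forall>x. \<exists>n::nat. x < \<sigma> \<omega> (real n)"
proof -
  have "AE \<omega> in M. \<exists>n::nat. real k < \<sigma> \<omega> (real n)" for k :: nat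
  proof -
    let ?A = "{\<omega> \<in> space M. \<forall>n::nat. \<sigma> \<omega> (real n) \<le> real k}"
    have [measurable]: "(\<lambda>\<omega>. \<sigma> \<omega> (real n)) \<in> borel_measurable M" for n by (rule assms(1)) simp
    have bound: "prob ?A \<le> exp (real k) * exp (- real n)" for n
    proof -
      have "prob ?A \<le> prob {\<omega> \<in> space M. \<sigma> \<omega> (real n) \<le> real k}"
        by (intro finite_measure_mono) auto
      also have "\<dots> \<le> exp (real k) * expectation (\<lambda>\<omega>. exp (- \<sigma> \<omega> (real n)))"
        by (intro prob_le_exp nn) auto
      finally show ?thesis by (simp add: lap)
    qed
    have "(\<lambda>n. exp (real k) * exp (- real n)) \<longlonglongrightarrow> 0" by real_asymp
    from LIMSEQ_le_const[OF this] bound have "prob ?A \<le> 0" by blast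
    then have "prob ?A = 0" using measure_nonneg[of M ?A] by linarith
    then have "AE \<omega> in M. \<not> (\<forall>n::nat. \<sigma> \<omega> (real n) \<le> real k)"
      by (subst (asm) prob_Collect_eq_0) auto
    then show ?thesis by eventually_elim (simp add: not_le)
  qed
  then have "AE \<omega> in M. \<forall>k::nat. \<exists>n::nat. real k < \<sigma> \<omega> (real n)" by (simp add: AE_all_countable)
  then show ?thesis
  proof eventually_elim
    case (elim \<omega>)
    show ?case
    proof
      fix x
      obtain k :: nat where "x \<le> real k" using real_arch_simple by blast
      moreover obtain n :: nat where "real k < \<sigma> \<omega> (real n)" using elim by blast
      ultimately show "\<exists>n::nat. x < \<sigma> \<omega> (real n)" by (intro exI[of _ n]) simp
    qed
  qed
qed

text \<open>Unboundedness makes the set under \<open>LEAST\<close> nonempty, and right continuity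
  shows that its infimum belongs to it.\<close>

lemma subordinator_inverse_of_inverse_stable:
  assumes "prob_space N" and a: "0 < a" and inv: "inverse_stable_subordinator N a L"
  shows "\<exists>\<sigma>. subordinator_inverse N \<sigma> L a"
proof -
  interpret prob_space N by fact
  obtain \<sigma> where \<sigma>: "stable_subordinator N a \<sigma>"
    and L: "AE \<omega> in N. \<forall>t\<ge>0. L \<omega> t = (LEAST s. 0 \<le> s \<and> t \<le> \<sigma> \<omega> s)"
    using inv by (auto simp: inverse_stable_subordinator_def)
  have meas: "(\<lambda>\<omega>. \<sigma> \<omega> t) \<in> borel_measurable N" if "0 \<le> t" for t
    using \<sigma> that by (auto simp: stable_subordinator_def levy_process_def)
  have zero: "AE \<omega> in N. \<sigma> \<omega> 0 = 0" and cad: "AE \<omega> in N. \<sigma> \<omega> \<in> cadlag"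
    and ind: "independent_increments N \<sigma>" and mono: "AE \<omega> in N. mono_on {0..} (\<sigma> \<omega>)"
    and lap: "\<And>t z. 0 \<le> t \<Longrightarrow> 0 \<le> z \<Longrightarrow> (\<integral>\<omega>. exp (- z * \<sigma> \<omega> t) \<partial>N) = exp (- t * z powr a)"
    and stat: "\<And>s h. 0 \<le> s \<Longrightarrow> 0 \<le> h \<Longrightarrow> distr N borel (\<lambda>\<omega>. \<sigma> \<omega> (s + h) - \<sigma> \<omega> s) = distr N borel (\<lambda>\<omega>. \<sigma> \<omega> h)"
    using \<sigma> by (auto simp: stable_subordinator_def levy_process_def)
  have nn: "AE \<omega> in N. 0 \<le> \<sigma> \<omega> t" if "0 \<le> t" for t
    using zero mono by eventually_elim (use that in \<open>auto dest: mono_onD[of _ _ 0 t]\<close>)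
  have unb: "AE \<omega> in N. \<forall>x. \<exists>n::nat. x < \<sigma> \<omega> (real n)"
  proof (rule AE_unbounded_of_laplace[OF meas nn])
    show "expectation (\<lambda>\<omega>. exp (- \<sigma> \<omega> t)) = exp (- t)" if "0 \<le> t" for t
      using lap[of t 1] that by simp
  qed
  have "subordinator_inverse N \<sigma> L a"
  proof
    fix s h z :: real assume shz: "0 \<le> s" "0 \<le> h" "0 \<le> z"
    have [measurable]: "(\<lambda>\<omega>. \<sigma> \<omega> (s + h)) \<in> borel_measurable N" "(\<lambda>\<omega>. \<sigma> \<omega> s) \<in> borel_measurable N"
      "(\<lambda>\<omega>. \<sigma> \<omega> h) \<in> borel_measurable N" using shz by (auto intro: meas)
    have "expectation (\<lambda>\<omega>. exp (- z * (\<sigma> \<omega> (s + h) - \<sigma> \<omega> s))) =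
      (\<integral>x. exp (- z * x) \<partial>distr N borel (\<lambda>\<omega>. \<sigma> \<omega> (s + h) - \<sigma> \<omega> s))"
      by (subst integral_distr) auto
    also have "\<dots> = (\<integral>x. exp (- z * x) \<partial>distr N borel (\<lambda>\<omega>. \<sigma> \<omega> h))" using stat shz by simp
    also have "\<dots> = expectation (\<lambda>\<omega>. exp (- z * \<sigma> \<omega> h))" by (subst integral_distr) auto
    finally show "expectation (\<lambda>\<omega>. exp (- z * (\<sigma> \<omega> (s + h) - \<sigma> \<omega> s))) = exp (- h * z powr a)"
      using lap shz by simp
  next
    show "AE \<omega> in N. \<forall>t\<ge>0. 0 \<le> L \<omega> t \<and> (\<forall>s\<ge>0. L \<omega> t \<le> s \<longleftrightarrow> t \<le> \<sigma> \<omega> s)"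
      using L cad mono unb
    proof eventually_elim
      case (elim \<omega>)
      show ?case
      proof (intro allI impI)
        fix t :: real assume t: "0 \<le> t"
        define B where "B = {s. 0 \<le> s \<and> t \<le> \<sigma> \<omega> s}"
        obtain n :: nat where "t < \<sigma> \<omega> (real n)" using elim(4) by blast
        then have Bne: "B \<noteq> {}" unfolding B_def by (intro ex_in_conv[THEN iffD1] exI[of _ "real n"]) simp
        have Bbdd: "bdd_below B" by (rule bdd_belowI[of _ 0]) (simp add: B_def)
        define i where "i = Inf B"
        have i0: "0 \<le> i" unfolding i_def using Bne by (intro cInf_greatest) (auto simp: B_def)
        have up: "t \<le> \<sigma> \<omega> s" if "i < s" for s
        proof -
          have "\<exists>x\<in>B. x < s" using that cInf_less_iff[OF Bne Bbdd, of s] by (simp add: i_def)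
          then obtain x where x: "x \<in> B" "x < s" by blast
          then have "\<sigma> \<omega> x \<le> \<sigma> \<omega> s" using elim(3) by (auto simp: B_def intro: mono_onD)
          then show ?thesis using x by (auto simp: B_def)
        qed
        have "(\<sigma> \<omega> \<longlongrightarrow> \<sigma> \<omega> i) (at_right i)" using elim(2) i0 by (auto simp: cadlag_def)
        then have "t \<le> \<sigma> \<omega> i"
        proof (rule tendsto_lowerbound)
          show "\<forall>\<^sub>F s in at_right i. t \<le> \<sigma> \<omega> s"
            using eventually_at_right_less[of i] by eventually_elim (rule up)
        qed simp
        then have "(LEAST s. 0 \<le> s \<and> t \<le> \<sigma> \<omega> s) = i"
          using i0 Bbdd by (intro Least_equality) (auto simp: i_def B_def intro!: cInf_lower)
        then have Li: "L \<omega> t = i" using elim(1) t by simp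
        have "i \<le> s \<longleftrightarrow> t \<le> \<sigma> \<omega> s" if s: "0 \<le> s" for s
        proof
          assume "i \<le> s"
          then have "\<sigma> \<omega> i \<le> \<sigma> \<omega> s" using elim(3) i0 s by (auto intro: mono_onD)
          then show "t \<le> \<sigma> \<omega> s" using \<open>t \<le> \<sigma> \<omega> i\<close> by simp
        next
          assume "t \<le> \<sigma> \<omega> s"
          then show "i \<le> s" unfolding i_def using s Bbdd by (intro cInf_lower) (auto simp: B_def)
        qed
        then show "0 \<le> L \<omega> t \<and> (\<forall>s\<ge>0. L \<omega> t \<le> s \<longleftrightarrow> t \<le> \<sigma> \<omega> s)" using Li i0 by simp
      qed
    qed
  qed (use a meas zero mono ind in auto)
  then show ?thesis by blast
qed

lemma subordinator_inverse_identity: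
  assumes "prob_space N" and L: "\<forall>\<omega>\<in>space N. \<forall>t\<ge>0. L \<omega> t = t"
  shows "subordinator_inverse N (\<lambda>_ t. t) L 1"
proof -
  interpret prob_space N by fact
  \<comment> \<open>The law of a constant vector is a product of point masses, so the deterministic
    increments of the identity are independent.\<close>
  have const: "indep_vars (\<lambda>_. borel) (\<lambda>i _. c i) {..<n}" for c :: "nat \<Rightarrow> real" and n :: nat
  proof (cases "n = 0")
    case True
    then show ?thesis by (simp add: indep_vars_def2 indep_sets_def)
  next
    case False
    have "distr N (PiM {..<n} (\<lambda>_. borel)) (\<lambda>x. \<lambda>i\<in>{..<n}. c i) = return (PiM {..<n} (\<lambda>_. borel)) (\<lambda>i\<in>{..<n}. c i)"
      by (rule distr_const) (simp add: space_PiM)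
    also have "\<dots> = PiM {..<n} (\<lambda>i. return borel (c i))"
      by (subst PiM_return) auto
    also have "\<dots> = PiM {..<n} (\<lambda>i. distr N borel (\<lambda>_. c i))"
      by (intro PiM_cong) (auto simp: distr_const)
    finally show ?thesis using False
      by (subst indep_vars_iff_distr_eq_PiM[where M'="\<lambda>_. borel" and X="\<lambda>i _. c i"]) auto
  qed
  show ?thesis
  proof
    show "independent_increments N (\<lambda>_ t. t)"
      unfolding independent_increments_def using const by auto
    show "AE \<omega> in N. \<forall>t\<ge>0. 0 \<le> L \<omega> t \<and> (\<forall>s\<ge>0. (L \<omega> t \<le> s) = (t \<le> s))"
      using L by (intro AE_I2) auto
  qed (auto simp: prob_space mono_on_def)
qed

section \<open>Strict growth and the location of the inverse\<close>

context subordinator_inverse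
begin

lemma \<sigma>_nonneg_increment: "AE \<omega> in N. \<forall>s t. 0 \<le> s \<longrightarrow> s \<le> t \<longrightarrow> \<sigma> \<omega> s \<le> \<sigma> \<omega> t"
  using \<sigma>_mono by eventually_elim (auto intro: mono_onD)

lemma \<sigma>_unbounded: "AE \<omega> in N. \<forall>x. \<exists>n::nat. x < \<sigma> \<omega> (real n)"
proof (rule AE_unbounded_of_laplace[OF \<sigma>_meas])
  show nn: "AE \<omega> in N. 0 \<le> \<sigma> \<omega> t" if "0 \<le> t" for t
    using \<sigma>_0 \<sigma>_mono by eventually_elim (use that in \<open>auto dest: mono_onD[of _ _ 0 t]\<close>)
  show "expectation (\<lambda>\<omega>. exp (- \<sigma> \<omega> t)) = exp (- t)" if t: "0 \<le> t" for t
  proof -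
    have [measurable]: "(\<lambda>\<omega>. \<sigma> \<omega> t) \<in> borel_measurable N" "(\<lambda>\<omega>. \<sigma> \<omega> 0) \<in> borel_measurable N"
      using t by (auto intro: \<sigma>_meas)
    have "expectation (\<lambda>\<omega>. exp (- \<sigma> \<omega> t)) = expectation (\<lambda>\<omega>. exp (- 1 * (\<sigma> \<omega> (0 + t) - \<sigma> \<omega> 0)))"
      by (rule integral_cong_AE) (use \<sigma>_0 in \<open>auto elim!: eventually_mono\<close>)
    then show ?thesis using \<sigma>_laplace[of 0 t 1] t by simp
  qed
qed

text \<open>A vanishing increment would keep its Laplace transform away from 0, while
  \<open>exp (- (t - s) * z powr a)\<close> tends to 0 as \<open>z\<close> grows.\<close>

lemma \<sigma>_increment_pos:
  assumes "0 \<le> s" "s < t"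
  shows "AE \<omega> in N. \<sigma> \<omega> s < \<sigma> \<omega> t"
proof -
  have [measurable]: "(\<lambda>\<omega>. \<sigma> \<omega> t) \<in> borel_measurable N" "(\<lambda>\<omega>. \<sigma> \<omega> s) \<in> borel_measurable N"
    using assms by (auto intro: \<sigma>_meas)
  let ?A = "{\<omega> \<in> space N. \<sigma> \<omega> t \<le> \<sigma> \<omega> s}"
  have "prob ?A \<le> exp (- (t - s) * real n powr a)" for n
  proof -
    have "prob ?A \<le> prob {\<omega> \<in> space N. real n * (\<sigma> \<omega> t - \<sigma> \<omega> s) \<le> 0}"
      by (intro finite_measure_mono) (auto simp: mult_nonneg_nonpos)
    also have "\<dots> \<le> exp 0 * expectation (\<lambda>\<omega>. exp (- (real n * (\<sigma> \<omega> t - \<sigma> \<omega> s))))"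
      by (intro prob_le_exp) (use \<sigma>_nonneg_increment assms in \<open>auto elim!: eventually_mono\<close>)
    also have "\<dots> = exp (- (t - s) * real n powr a)"
      using \<sigma>_laplace[of s "t - s" "real n"] assms by simp
    finally show ?thesis .
  qed
  moreover have "(\<lambda>n. exp (- (t - s) * real n powr a)) \<longlonglongrightarrow> 0"
    using assms a_pos by real_asymp
  ultimately have "prob ?A \<le> 0" by (intro LIMSEQ_le_const[of _ 0]) auto
  then have "prob ?A = 0" using measure_nonneg[of N ?A] by linarith
  then have "AE \<omega> in N. \<not> \<sigma> \<omega> t \<le> \<sigma> \<omega> s" by (subst (asm) prob_Collect_eq_0) auto
  then show ?thesis by eventually_elim simp
qed

text \<open>The exceptional null sets are united over pairs of rationals; monotonicity extends the
  strict inequality to all times.\<close>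

lemma \<sigma>_strict_mono: "AE \<omega> in N. \<forall>s t. 0 \<le> s \<longrightarrow> s < t \<longrightarrow> \<sigma> \<omega> s < \<sigma> \<omega> t"
proof -
  have "AE \<omega> in N. \<forall>q\<in>\<rat>. \<forall>r\<in>\<rat>. 0 \<le> q \<longrightarrow> q < r \<longrightarrow> \<sigma> \<omega> q < \<sigma> \<omega> r"
  proof (subst AE_ball_countable[OF countable_rat], intro ballI, subst AE_ball_countable[OF countable_rat], intro ballI)
    fix q r :: real
    show "AE \<omega> in N. 0 \<le> q \<longrightarrow> q < r \<longrightarrow> \<sigma> \<omega> q < \<sigma> \<omega> r"
    proof (cases "0 \<le> q \<and> q < r")
      case True
      then show ?thesis using \<sigma>_increment_pos[of q r] by (auto elim!: eventually_mono)
    qed auto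
  qed
  then show ?thesis using \<sigma>_nonneg_increment
  proof eventually_elim
    case (elim \<omega>)
    show ?case
    proof (intro allI impI)
      fix s t :: real assume st: "0 \<le> s" "s < t"
      obtain q where q: "q \<in> \<rat>" "s < q" "q < t" using Rats_dense_in_real[OF st(2)] by blast
      obtain r where r: "r \<in> \<rat>" "q < r" "r < t" using Rats_dense_in_real[OF q(3)] by blast
      have "\<sigma> \<omega> s \<le> \<sigma> \<omega> q" "\<sigma> \<omega> q < \<sigma> \<omega> r" "\<sigma> \<omega> r \<le> \<sigma> \<omega> t" using elim st q r by auto
      then show "\<sigma> \<omega> s < \<sigma> \<omega> t" by linarith
    qed
  qed
qed

text \<open>The lower bound is where strict growth enters: \<open>L \<omega> x < s\<close> would
  give \<open>x \<le> \<sigma> \<omega> (L \<omega> x) < \<sigma> \<omega> s \<le>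
  x\<close>.\<close>

lemma L_cell: "AE \<omega> in N. \<forall>x\<ge>0. \<forall>s r. 0 \<le> s \<longrightarrow> s \<le> r \<longrightarrow> \<sigma> \<omega> s \<le> x \<longrightarrow> x \<le> \<sigma> \<omega> r \<longrightarrow> s \<le> L \<omega> x \<and> L \<omega> x \<le> r"
  using L_le_iff \<sigma>_strict_mono
proof eventually_elim
  case (elim \<omega>)
  show ?case
  proof (intro allI impI)
    fix x s r :: real assume x: "0 \<le> x" "0 \<le> s" "s \<le> r" "\<sigma> \<omega> s \<le> x" "x \<le> \<sigma> \<omega> r"
    have L0: "0 \<le> L \<omega> x" using elim(1) x(1) by blast
    have "L \<omega> x \<le> r" using elim(1) x by auto
    moreover have "\<not> L \<omega> x < s"
    proof
      assume "L \<omega> x < s"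
      then have "\<sigma> \<omega> (L \<omega> x) < \<sigma> \<omega> s" using elim(2) L0 by blast
      moreover have "x \<le> \<sigma> \<omega> (L \<omega> x)" using elim(1) x(1) L0 by blast
      ultimately show False using x(4) by simp
    qed
    ultimately show "s \<le> L \<omega> x \<and> L \<omega> x \<le> r" by simp
  qed
qed

text \<open>Since \<open>L x \<le> s\<close> iff \<open>x \<le> \<sigma> s\<close>, the set of all such \<open>x \<ge> 0\<close> has length \<open>\<sigma> s\<close>, which is
  the limit of the Riemann sums below. Being a measurable function of the path of \<open>L\<close>, the
  subordinator inherits the independence of \<open>W\<close>.\<close>

definition recover :: "real \<Rightarrow> (real \<Rightarrow> real) \<Rightarrow> real" where
  "recover s l = lim (\<lambda>k. (\<Sum>i=1..Suc k * Suc k. if l (real i / real (Suc k)) \<le> s then 1 else 0) / real (Suc k))"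

lemma recover_measurable [measurable]: "recover s \<in> borel_measurable (PiM {0..} (\<lambda>_. borel))"
proof -
  have [measurable]: "(\<lambda>l. l (real i / real (Suc k))) \<in> borel_measurable (PiM {0..} (\<lambda>_. borel))" for i k
    by (intro measurable_component_singleton) auto
  show ?thesis unfolding recover_def[abs_def] by measurable
qed

lemma recover_L:
  assumes s: "0 \<le> s"
  shows "AE \<omega> in N. recover s (restrict (L \<omega>) {0..}) = \<sigma> \<omega> s"
  using L_le_iff \<sigma>_0 \<sigma>_nonneg_increment
proof eventually_elim
  case (elim \<omega>)
  have \<sigma>s: "0 \<le> \<sigma> \<omega> s" using elim s by (metis order_refl)
  define y where "y = \<sigma> \<omega> s"
  have sum: "(\<Sum>i=1..Suc k * Suc k. if restrict (L \<omega>) {0..} (real i / real (Suc k)) \<le> s then 1 else 0) =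
     min (real (Suc k * Suc k)) (real_of_int \<lfloor>real (Suc k) * y\<rfloor>)" for k
  proof -
    have iff: "restrict (L \<omega>) {0..} (real i / real (Suc k)) \<le> s \<longleftrightarrow> i \<le> nat \<lfloor>real (Suc k) * y\<rfloor>" for i
    proof -
      have "restrict (L \<omega>) {0..} (real i / real (Suc k)) \<le> s \<longleftrightarrow> real i / real (Suc k) \<le> y"
        using elim(1) s by (simp add: y_def)
      also have "\<dots> \<longleftrightarrow> real i \<le> real (Suc k) * y" by (simp add: pos_divide_le_eq mult.commute)
      also have "\<dots> \<longleftrightarrow> i \<le> nat \<lfloor>real (Suc k) * y\<rfloor>" using \<sigma>s by (simp add: y_def le_nat_iff le_floor_iff)
      finally show ?thesis .
    qed
    have "(\<Sum>i=1..Suc k * Suc k. if restrict (L \<omega>) {0..} (real i / real (Suc k)) \<le> s then 1 else 0 :: real) =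
      real (card {i \<in> {1..Suc k * Suc k}. i \<le> nat \<lfloor>real (Suc k) * y\<rfloor>})"
      unfolding iff by (subst sum.inter_filter[symmetric]) auto
    also have "{i \<in> {1..Suc k * Suc k}. i \<le> nat \<lfloor>real (Suc k) * y\<rfloor>} = {1..min (Suc k * Suc k) (nat \<lfloor>real (Suc k) * y\<rfloor>)}"
      by auto
    also have "real (card \<dots>) = min (real (Suc k * Suc k)) (real_of_int \<lfloor>real (Suc k) * y\<rfloor>)"
    proof -
      have "real (card {1..min p q}) = min (real p) (real q)" for p q :: nat by (simp add: min_def)
      moreover have "real (nat \<lfloor>real (Suc k) * y\<rfloor>) = real_of_int \<lfloor>real (Suc k) * y\<rfloor>"
        using \<sigma>s by (simp add: y_def)
      ultimately show ?thesis by simp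
    qed
    finally show ?thesis .
  qed
  have "(\<lambda>k. min (real (Suc k * Suc k)) (real_of_int \<lfloor>real (Suc k) * y\<rfloor>) / real (Suc k)) \<longlonglongrightarrow> y"
  proof (rule Lim_transform_eventually)
    show "(\<lambda>k. real_of_int \<lfloor>real (Suc k) * y\<rfloor> / real (Suc k)) \<longlonglongrightarrow> y"
    proof (rule tendsto_sandwich)
      show "(\<lambda>k. y - 1 / real (Suc k)) \<longlonglongrightarrow> y" by real_asymp
      show "(\<lambda>k. y) \<longlonglongrightarrow> y" by simp
      show "\<forall>\<^sub>F k in sequentially. y - 1 / real (Suc k) \<le> real_of_int \<lfloor>real (Suc k) * y\<rfloor> / real (Suc k)"
      proof (intro always_eventually allI)
        fix k
        have "real (Suc k) * y - 1 \<le> real_of_int \<lfloor>real (Suc k) * y\<rfloor>" by linarith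
        then have "(real (Suc k) * y - 1) / real (Suc k) \<le> real_of_int \<lfloor>real (Suc k) * y\<rfloor> / real (Suc k)"
          by (intro divide_right_mono) auto
        then show "y - 1 / real (Suc k) \<le> real_of_int \<lfloor>real (Suc k) * y\<rfloor> / real (Suc k)"
          by (simp add: diff_divide_distrib del: of_nat_Suc)
      qed
      show "\<forall>\<^sub>F k in sequentially. real_of_int \<lfloor>real (Suc k) * y\<rfloor> / real (Suc k) \<le> y"
      proof (intro always_eventually allI)
        fix k
        have "real_of_int \<lfloor>real (Suc k) * y\<rfloor> / real (Suc k) \<le> real (Suc k) * y / real (Suc k)"
          by (intro divide_right_mono) auto
        then show "real_of_int \<lfloor>real (Suc k) * y\<rfloor> / real (Suc k) \<le> y" by (simp del: of_nat_Suc)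
      qed
    qed
    \<comment> \<open>The grid with spacing \<open>1 / real (Suc k)\<close> ends at
      \<open>real (Suc k)\<close>; once this exceeds \<open>y\<close>, the number of grid points
      counted is the rounded value.\<close>
    obtain K :: nat where K: "y \<le> real K" using real_arch_simple by blast
    show "\<forall>\<^sub>F k in sequentially. real_of_int \<lfloor>real (Suc k) * y\<rfloor> / real (Suc k) =
       min (real (Suc k * Suc k)) (real_of_int \<lfloor>real (Suc k) * y\<rfloor>) / real (Suc k)"
      using eventually_ge_at_top[of K]
    proof eventually_elim
      case (elim k)
      have "real (Suc k) * y \<le> real (Suc k) * real (Suc k)" using K elim by (intro mult_left_mono) auto
      then have "real_of_int \<lfloor>real (Suc k) * y\<rfloor> \<le> real (Suc k * Suc k)"
        using of_int_floor_le[of "real (Suc k) * y"] by (simp only: of_nat_mult)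
      then show ?case by (simp only: min_absorb2)
    qed
  qed
  then show ?case unfolding recover_def sum y_def[symmetric] by (rule limI)
qed

end

section \<open>The renewal Mittag-Leffler queue\<close>

locale mittag_leffler_queue = sign_steps M \<xi> p + F: mittag_leffler_survival \<alpha> lam f + G: mittag_leffler_survival \<beta> mu g
  for M :: "'a measure" and \<xi> p \<alpha> lam f \<beta> mu g +
  fixes Y :: "nat \<Rightarrow> 'a \<Rightarrow> real"
  assumes Y_indep: "indep_vars (\<lambda>_. borel) Y {1..}"
    and Y_tail: "\<And>k t. 1 \<le> k \<Longrightarrow> 0 \<le> t \<Longrightarrow> prob {\<omega> \<in> space M. t < Y k \<omega>} = f t * g t"
    and \<xi>_Y_indep: "indep_var (PiM {1..} (\<lambda>_. borel)) (\<lambda>\<omega>. \<lambda>k\<in>{1..}. \<xi> k \<omega>)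
       (PiM {1..} (\<lambda>_. borel)) (\<lambda>\<omega>. \<lambda>k\<in>{1..}. Y k \<omega>)"
begin

lemma Y_meas [measurable]: "1 \<le> k \<Longrightarrow> Y k \<in> borel_measurable M"
  using Y_indep by (auto simp: indep_vars_def)

lemma product_tail_Y: "1 \<le> k \<Longrightarrow> product_tail M \<alpha> lam f \<beta> mu g (Y k)"
  by unfold_locales (auto intro: Y_meas simp: Y_tail)

sublocale Y: product_tail M \<alpha> lam f \<beta> mu g "Y (Suc 0)"
  by (rule product_tail_Y) simp

abbreviation \<L> :: "real \<Rightarrow> real" where "\<L> \<equiv> Y.laplace"

text \<open>All waiting times share one tail, and the transform is determined by the tail; the
  double reciprocal brings \<open>z\<close> into the form of \<open>laplace_tail\<close>.\<close>

lemma expectation_exp_Y: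
  assumes k: "1 \<le> k" and z: "0 \<le> z"
  shows "expectation (\<lambda>\<omega>. exp (- z * Y k \<omega>)) = \<L> z"
proof (cases "z = 0")
  case True
  then show ?thesis by (simp add: Y.laplace_def prob_space)
next
  case False
  interpret Yk: product_tail M \<alpha> lam f \<beta> mu g "Y k" using k by (rule product_tail_Y)
  have "1 - Yk.laplace (1 / (1 / z)) = 1 - \<L> (1 / (1 / z))"
    using z False by (subst Yk.laplace_tail, simp, subst Y.laplace_tail) auto
  then show ?thesis by (simp add: Yk.laplace_def)
qed

lemma sum_Y_meas [measurable]: "I \<subseteq> {1..} \<Longrightarrow> (\<lambda>\<omega>. \<Sum>j\<in>I. Y j \<omega>) \<in> borel_measurable M"
  by (intro borel_measurable_sum Y_meas) auto

lemma AE_Y_pos: "AE \<omega> in M. \<forall>k\<ge>1. 0 < Y k \<omega>"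
proof -
  have "AE \<omega> in M. 1 \<le> k \<longrightarrow> 0 < Y k \<omega>" for k
  proof (cases "1 \<le> k")
    case True
    then interpret Yk: product_tail M \<alpha> lam f \<beta> mu g "Y k" by (rule product_tail_Y)
    show ?thesis using Yk.Y_pos by eventually_elim simp
  qed simp
  then show ?thesis by (simp add: AE_all_countable)
qed

lemma AE_sum_Y_nonneg: "I \<subseteq> {1..} \<Longrightarrow> AE \<omega> in M. 0 \<le> (\<Sum>j\<in>I. Y j \<omega>)"
  using AE_Y_pos by eventually_elim (auto intro!: sum_nonneg intro: less_imp_le)

lemma laplace_sum_Y:
  assumes I: "finite I" "I \<subseteq> {1..}" and z: "0 \<le> z"
  shows "expectation (\<lambda>\<omega>. exp (- z * (\<Sum>j\<in>I. Y j \<omega>))) = \<L> z ^ card I"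
proof -
  have ind: "indep_vars (\<lambda>_. borel) (\<lambda>j \<omega>. exp (- z * Y j \<omega>)) I"
    by (rule indep_vars_compose2[OF indep_vars_subset[OF Y_indep I(2)]]) measurable
  have int: "integrable M (\<lambda>\<omega>. exp (- z * Y j \<omega>))" if "j \<in> I" for j
  proof -
    have "1 \<le> j" using that I(2) by auto
    then interpret Yk: product_tail M \<alpha> lam f \<beta> mu g "Y j" by (rule product_tail_Y)
    show ?thesis using z by (rule Yk.integrable_exp)
  qed
  have "expectation (\<lambda>\<omega>. exp (- z * (\<Sum>j\<in>I. Y j \<omega>))) = expectation (\<lambda>\<omega>. \<Prod>j\<in>I. exp (- z * Y j \<omega>))"
    using I(1) by (simp add: sum_distrib_left exp_sum)
  also have "\<dots> = (\<Prod>j\<in>I. expectation (\<lambda>\<omega>. exp (- z * Y j \<omega>)))"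
    by (rule indep_vars_lebesgue_integral[OF I(1) ind int])
  also have "\<dots> = (\<Prod>j\<in>I. \<L> z)"
    using I(2) z by (intro prod.cong expectation_exp_Y) auto
  finally show ?thesis by simp
qed

lemma laplace_bounds: "0 < \<L> 1" "\<L> 1 < 1"
proof -
  have Ypos: "AE \<omega> in M. 0 < Y (Suc 0) \<omega>" by (rule Y.Y_pos)
  have i: "integrable M (\<lambda>\<omega>. exp (- 1 * Y (Suc 0) \<omega>))" by (rule Y.integrable_exp) simp
  have "\<L> 1 \<noteq> 0"
  proof
    assume "\<L> 1 = 0"
    then have "AE \<omega> in M. exp (- 1 * Y (Suc 0) \<omega>) = 0"
      using integral_nonneg_eq_0_iff_AE[OF i] by (simp add: Y.laplace_def)
    then have "AE \<omega> in M. False" by eventually_elim simp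
    then show False by simp
  qed
  moreover have "0 \<le> \<L> 1" unfolding Y.laplace_def by (rule integral_nonneg_AE) simp
  ultimately show "0 < \<L> 1" by simp
  have i1: "integrable M (\<lambda>\<omega>. 1 - exp (- 1 * Y (Suc 0) \<omega>))" using i by simp
  have nn: "AE \<omega> in M. 0 \<le> 1 - exp (- 1 * Y (Suc 0) \<omega>)" using Ypos by eventually_elim simp
  have "expectation (\<lambda>\<omega>. 1 - exp (- 1 * Y (Suc 0) \<omega>)) \<noteq> 0"
  proof
    assume "expectation (\<lambda>\<omega>. 1 - exp (- 1 * Y (Suc 0) \<omega>)) = 0"
    then have "AE \<omega> in M. 1 - exp (- 1 * Y (Suc 0) \<omega>) = 0"
      using integral_nonneg_eq_0_iff_AE[OF i1 nn] by simp
    then have "AE \<omega> in M. False" using Ypos by eventually_elim simp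
    then show False by simp
  qed
  moreover have "0 \<le> expectation (\<lambda>\<omega>. 1 - exp (- 1 * Y (Suc 0) \<omega>))" using nn by (rule integral_nonneg_AE)
  ultimately show "\<L> 1 < 1" using Y.one_minus_laplace[of 1] by simp
qed

text \<open>The waiting times may have infinite mean, so a linear lower bound is obtained from the
  Chernoff bound and Borel-Cantelli rather than from a law of large numbers.\<close>

lemma arrivals_linear: "\<exists>c>0. AE \<omega> in M. \<forall>\<^sub>F k in sequentially. c * real k < (\<Sum>j=1..k. Y j \<omega>)"
proof -
  \<comment> \<open>Half the exponential decay rate of \<open>\<L> 1 ^ k\<close>, so that the
    Chernoff bound \<open>(exp c * \<L> 1) ^ k\<close> is still geometric, with ratio
    \<open>exp (- c)\<close>.\<close>
  define c where "c = - ln (\<L> 1) / 2"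
  have c: "0 < c" using laplace_bounds by (simp add: c_def ln_less_zero)
  define q where "q = exp c * \<L> 1"
  have "exp c * exp (- (2 * c)) = exp (- c)" by (simp add: exp_add[symmetric])
  moreover have "exp (- (2 * c)) = \<L> 1" using laplace_bounds by (simp add: c_def)
  ultimately have q: "0 < q" "q < 1" using c laplace_bounds by (auto simp: q_def)
  let ?A = "\<lambda>k. {\<omega> \<in> space M. (\<Sum>j=1..k. Y j \<omega>) \<le> c * real k}"
  have [measurable]: "(\<lambda>\<omega>. \<Sum>j=1..k. Y j \<omega>) \<in> borel_measurable M" for k by (rule sum_Y_meas) auto
  have bound: "prob (?A k) \<le> q ^ k" for k
  proof -
    have "prob (?A k) \<le> exp (c * real k) * expectation (\<lambda>\<omega>. exp (- (\<Sum>j=1..k. Y j \<omega>)))"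
      by (rule prob_le_exp) (auto intro!: AE_sum_Y_nonneg)
    also have "expectation (\<lambda>\<omega>. exp (- (\<Sum>j=1..k. Y j \<omega>))) = \<L> 1 ^ k"
      using laplace_sum_Y[of "{1..k}" 1] by simp
    also have "exp (c * real k) = exp c ^ k" using exp_of_nat_mult[of k c] by (simp add: mult.commute)
    finally show ?thesis by (simp add: q_def power_mult_distrib)
  qed
  have "summable (\<lambda>k. q ^ k)" using q by (intro summable_geometric) simp
  moreover have "norm (prob (?A k)) \<le> q ^ k" if "0 \<le> k" for k using bound[of k] by simp
  ultimately have "summable (\<lambda>k. prob (?A k))" by (rule summable_comparison_test')
  then have "AE \<omega> in M. \<forall>\<^sub>F k in sequentially. \<omega> \<in> space M - ?A k"
    by (intro borel_cantelli_AE1) (auto simp: emeasure_eq_measure)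
  then have "AE \<omega> in M. \<forall>\<^sub>F k in sequentially. c * real k < (\<Sum>j=1..k. Y j \<omega>)"
    by eventually_elim (auto elim!: eventually_mono simp: not_le)
  then show ?thesis using c by blast
qed

lemma AE_renewal_path: "AE \<omega> in M. renewal_path Y \<omega>"
proof -
  obtain c where c: "0 < c" "AE \<omega> in M. \<forall>\<^sub>F k in sequentially. c * real k < (\<Sum>j=1..k. Y j \<omega>)"
    using arrivals_linear by blast
  show ?thesis using c(2) AE_Y_pos
  proof eventually_elim
    case (elim \<omega>)
    show ?case
    proof
      show "0 < Y k \<omega>" if "1 \<le> k" for k using elim that by blast
      fix x
      have "\<forall>\<^sub>F k in sequentially. x \<le> c * real k" using c(1) by real_asymp
      with elim(1) have "\<forall>\<^sub>F k in sequentially. x < (\<Sum>j=1..k. Y j \<omega>)" by eventually_elim simp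
      then show "\<exists>k. x < (\<Sum>j=1..k. Y j \<omega>)" using eventually_happens'[OF sequentially_bot] by blast
    qed
  qed
qed

section \<open>Time scale and limiting rate in the three regimes\<close>

definition scale :: "nat \<Rightarrow> real" where "scale n = real n * time_scale M \<alpha> \<beta> lam mu Y n"

definition rate :: real where "rate = limit_rate M \<alpha> \<beta> lam mu Y"

definition index :: real where "index = min (\<alpha> + \<beta>) 1"

lemma scale_eq_less_1: "\<alpha> + \<beta> < 1 \<Longrightarrow> 0 < n \<Longrightarrow> scale n = real n powr (1 / (\<alpha> + \<beta>))"
proof -
  assume ab: "\<alpha> + \<beta> < 1" and n: "0 < n"
  have "1 \<le> 1 / (\<alpha> + \<beta>)" using ab F.a G.a by (simp add: field_simps)
  then have "scale n = real n powr 1 * real n powr (1 / (\<alpha> + \<beta>) - 1)"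
    using ab n by (simp add: scale_def time_scale_def)
  also have "\<dots> = real n powr (1 / (\<alpha> + \<beta>))" by (simp only: powr_add[symmetric]) simp
  finally show ?thesis .
qed

lemma scale_eq_greater_1: "1 < \<alpha> + \<beta> \<Longrightarrow> scale n = real n"
proof -
  assume ab: "1 < \<alpha> + \<beta>"
  have "1 / (\<alpha> + \<beta>) \<le> 1" using ab by simp
  then show ?thesis using ab by (cases "n = 0") (simp_all add: scale_def time_scale_def max_def)
qed

definition sine_rate :: real where "sine_rate = sin (pi * \<alpha>) / (2 * lam * mu)"

lemma sine_rate_pos: "0 < sine_rate"
proof -
  have "0 < sin (pi * \<alpha>)" using F.a by (intro sin_gt_zero) auto
  then show ?thesis using F.l G.l by (simp add: sine_rate_def)
qed

lemma scale_eq_1: "\<alpha> + \<beta> = 1 \<Longrightarrow> scale n = real n * Y.sine_mean (real n * sine_rate)"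
proof -
  assume ab: "\<alpha> + \<beta> = 1"
  have eq: "2 * lam * mu * Y (Suc 0) \<omega> / (real n * sin (pi * \<alpha>)) = Y (Suc 0) \<omega> / (real n * sine_rate)" for \<omega>
    using F.l G.l by (simp add: sine_rate_def field_simps)
  show ?thesis
    unfolding scale_def time_scale_def Y.sine_mean_def One_nat_def eq using ab by (simp add: sine_rate_def)
qed

lemma scale_at_top: "filterlim scale at_top sequentially"
proof -
  consider "\<alpha> + \<beta> < 1" | "1 < \<alpha> + \<beta>" | "\<alpha> + \<beta> = 1" by linarith
  then show ?thesis
  proof cases
    case 1
    have "filterlim (\<lambda>n. real n powr (1 / (\<alpha> + \<beta>))) at_top sequentially"
      using F.a G.a by real_asymp
    moreover have "\<forall>\<^sub>F n in sequentially. real n powr (1 / (\<alpha> + \<beta>)) = scale n"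
      using eventually_gt_at_top[of 0] by eventually_elim (simp add: scale_eq_less_1[OF 1])
    ultimately show ?thesis by (simp only: filterlim_cong[OF refl refl])
  next
    case 2
    show ?thesis unfolding scale_eq_greater_1[OF 2, abs_def] by (rule filterlim_real_sequentially)
  next
    case 3
    have "filterlim (\<lambda>n. real n * Y.sine_mean (real n * sine_rate)) at_top sequentially"
      by (intro filterlim_at_top_mult_at_top filterlim_real_sequentially
        filterlim_compose[OF Y.sine_mean_at_top[OF 3 sine_rate_pos] filterlim_real_sequentially])
    then show ?thesis unfolding scale_eq_1[OF 3, abs_def] .
  qed
qed

text \<open>For the vanishing of the queue any polynomial bound suffices. In the critical case the
  crude bound of the sine by 1 gives a multiple of the square of \<open>n\<close>.\<close>

lemma scale_polynomial: "\<exists>D. \<forall>\<^sub>F n in sequentially. scale n \<le> real n powr D"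
proof -
  consider "\<alpha> + \<beta> < 1" | "1 < \<alpha> + \<beta>" | "\<alpha> + \<beta> = 1" by linarith
  then show ?thesis
  proof cases
    case 1
    then show ?thesis
      by (intro exI[of _ "1 / (\<alpha> + \<beta>)"] eventually_mono[OF eventually_gt_at_top[of 0]]) (simp add: scale_eq_less_1)
  next
    case 2
    then show ?thesis by (intro exI[of _ 1] always_eventually) (simp add: scale_eq_greater_1)
  next
    case 3
    have "\<forall>\<^sub>F n in sequentially. real n * (real n * sine_rate) \<le> real n powr 3"
      using sine_rate_pos by real_asymp
    moreover have "scale n \<le> real n * (real n * sine_rate)" for n
    proof -
      have "expectation (\<lambda>\<omega>. sin (Y (Suc 0) \<omega> / (real n * sine_rate))) \<le> expectation (\<lambda>\<omega>. 1)"
        by (intro integral_mono integrable_const_bound[where B=1]) auto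
      then have "(real n * sine_rate) * expectation (\<lambda>\<omega>. sin (Y (Suc 0) \<omega> / (real n * sine_rate))) \<le> (real n * sine_rate) * 1"
        using sine_rate_pos by (intro mult_left_mono) (auto simp: prob_space)
      then show ?thesis unfolding scale_eq_1[OF 3] Y.sine_mean_def by (intro mult_left_mono) auto
    qed
    ultimately show ?thesis by (intro exI[of _ 3]) (auto elim!: eventually_mono intro: order_trans)
  qed
qed

lemma rate_pos: "0 < rate"
proof -
  consider "\<alpha> + \<beta> < 1" | "1 < \<alpha> + \<beta>" | "\<alpha> + \<beta> = 1" by linarith
  then show ?thesis
  proof cases
    case 1
    have "0 < Gamma (1 - \<alpha> - \<beta>)" using 1 by (intro Gamma_real_pos) simp
    then have "0 < lam * mu * Gamma (1 - \<alpha>) * Gamma (1 - \<beta>) / Gamma (1 - \<alpha> - \<beta>)"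
      by (intro divide_pos_pos mult_pos_pos F.l G.l F.Gamma_pos G.Gamma_pos)
    then have "0 < (lam * mu * Gamma (1 - \<alpha>) * Gamma (1 - \<beta>) / Gamma (1 - \<alpha> - \<beta>)) powr (1 / (\<alpha> + \<beta>))"
      unfolding powr_gt_zero by (rule less_imp_neq[symmetric])
    then show ?thesis using 1 by (simp only: rate_def limit_rate_def if_True)
  next
    case 2
    have "expectation (Y (Suc 0)) \<noteq> 0"
    proof
      assume "expectation (Y (Suc 0)) = 0"
      then have "AE \<omega> in M. Y (Suc 0) \<omega> = 0"
        using integral_nonneg_eq_0_iff_AE[OF Y.integrable_Y[OF 2] eventually_mono[OF Y.Y_pos less_imp_le]] by blast
      then have "AE \<omega> in M. False" using Y.Y_pos by eventually_elim simp
      then show False by simp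
    qed
    moreover have "0 \<le> expectation (Y (Suc 0))" using Y.Y_pos by (intro integral_nonneg_AE) (auto elim!: eventually_mono)
    ultimately show ?thesis using 2 by (simp add: rate_def limit_rate_def)
  qed (simp add: rate_def limit_rate_def)
qed

text \<open>The regimes merge here: the limit is the Laplace exponent, at \<open>z\<close>, of the
  subordinator of index \<open>index\<close> divided by \<open>rate\<close>.\<close>

lemma laplace_scaling:
  assumes z: "0 < z"
  shows "(\<lambda>n. real n * (1 - \<L> (z / scale n))) \<longlonglongrightarrow> (z / rate) powr index"
proof -
  have spos: "\<forall>\<^sub>F n in sequentially. 0 < scale n" using scale_at_top by (simp add: filterlim_at_top_dense)
  have lim: "filterlim (\<lambda>n. scale n * (1 / z)) at_top sequentially"
    using z by (intro filterlim_at_top_mult_tendsto_pos[OF tendsto_const _ scale_at_top]) auto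
  consider "\<alpha> + \<beta> < 1" | "1 < \<alpha> + \<beta>" | "\<alpha> + \<beta> = 1" by linarith
  then show ?thesis
  proof cases
    case 1
    let ?s = "\<alpha> + \<beta>"
    have s: "0 < ?s" using F.a G.a by simp
    have "((\<lambda>n. z powr ?s * ((scale n * (1 / z)) powr ?s * (1 - \<L> (1 / (scale n * (1 / z)))))) \<longlongrightarrow> z powr ?s * (Y.A * Gamma (1 - ?s))) sequentially"
      by (intro tendsto_intros filterlim_compose[OF Y.laplace_asymptotics_less_1[OF 1] lim])
    moreover have "\<forall>\<^sub>F n in sequentially. z powr ?s * ((scale n * (1 / z)) powr ?s * (1 - \<L> (1 / (scale n * (1 / z))))) = real n * (1 - \<L> (z / scale n))"
      using spos eventually_gt_at_top[of 0]
    proof eventually_elim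
      case (elim n)
      have "z powr ?s * (scale n * (1 / z)) powr ?s = scale n powr ?s" using z elim by (simp add: powr_mult powr_divide)
      also have "\<dots> = real n" using elim s scale_eq_less_1[OF 1 elim(2)] by (simp add: powr_powr)
      finally have "z powr ?s * (scale n * (1 / z)) powr ?s = real n" .
      then show ?case by (simp add: mult.assoc[symmetric])
    qed
    ultimately have "(\<lambda>n. real n * (1 - \<L> (z / scale n))) \<longlonglongrightarrow> z powr ?s * (Y.A * Gamma (1 - ?s))"
      by (rule Lim_transform_eventually)
    moreover have "(z / rate) powr index = z powr ?s * (Y.A * Gamma (1 - ?s))"
    proof -
      have G: "0 < Gamma (1 - ?s)" using 1 by (intro Gamma_real_pos) simp
      \<comment> \<open>This is the rate raised to the power \<alpha> + \<beta>, and the reciprocal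
        of the constant in the Laplace asymptotics.\<close>
      define B where "B = lam * mu * Gamma (1 - \<alpha>) * Gamma (1 - \<beta>) / Gamma (1 - ?s)"
      have B: "0 < B" using G F.l G.l F.Gamma_pos G.Gamma_pos by (simp add: B_def)
      have "rate = B powr (1 / ?s)" using 1 by (simp add: rate_def limit_rate_def B_def diff_diff_eq)
      then have "rate powr ?s = B" using s B by (simp add: powr_powr)
      then have "(z / rate) powr ?s = z powr ?s / B" using z rate_pos by (simp add: powr_divide)
      also have "1 / B = Y.A * Gamma (1 - ?s)" by (simp add: B_def Y.A_def)
      then have "z powr ?s / B = z powr ?s * (Y.A * Gamma (1 - ?s))" by (simp add: divide_inverse)
      finally show ?thesis using 1 by (simp add: index_def)
    qed
    ultimately show ?thesis by simp
  next
    case 2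
    have "((\<lambda>n. z * ((scale n * (1 / z)) * (1 - \<L> (1 / (scale n * (1 / z)))))) \<longlongrightarrow> z * expectation (Y (Suc 0))) sequentially"
      by (intro tendsto_intros filterlim_compose[OF Y.laplace_asymptotics_greater_1[OF 2] lim])
    moreover have "z * ((scale n * (1 / z)) * (1 - \<L> (1 / (scale n * (1 / z))))) = real n * (1 - \<L> (z / scale n))" for n
      using z by (simp add: scale_eq_greater_1[OF 2])
    moreover have "(z / rate) powr index = z * expectation (Y (Suc 0))"
    proof -
      have "rate = 1 / expectation (Y (Suc 0))" using 2 by (simp add: rate_def limit_rate_def)
      moreover have "0 < z / rate" using z rate_pos by simp
      ultimately show ?thesis using 2 by (simp add: index_def)
    qed
    ultimately show ?thesis by simp
  next
    case 3
    have "((\<lambda>n. real n * (1 - \<L> (z / (real n * Y.sine_mean (real n * sine_rate))))) \<longlonglongrightarrow> z)"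
      by (rule filterlim_compose[OF Y.laplace_scaling_eq_1[OF 3 sine_rate_pos z] filterlim_real_sequentially])
    then show ?thesis using 3 z by (simp add: scale_eq_1[OF 3] rate_def limit_rate_def index_def)
  qed
qed

lemma laplace_blocks:
  assumes I: "\<And>n. finite (I n)" "\<And>n. I n \<subseteq> {1..}" "(\<lambda>n. real (card (I n)) / real n) \<longlonglongrightarrow> s" and z: "0 \<le> z"
  shows "(\<lambda>n. expectation (\<lambda>\<omega>. exp (- z * ((\<Sum>j\<in>I n. Y j \<omega>) / scale n)))) \<longlonglongrightarrow> exp (- s * (z / rate) powr index)"
proof (cases "z = 0")
  case True
  then show ?thesis by (simp add: prob_space)
next
  case False
  then have z: "0 < z" using z by simp
  have spos: "\<forall>\<^sub>F n in sequentially. 0 < scale n" using scale_at_top by (simp add: filterlim_at_top_dense)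
  have "(\<lambda>n. \<L> (z / scale n) ^ card (I n)) \<longlonglongrightarrow> exp (- s * (z / rate) powr index)"
    by (rule power_tendsto_exp[OF laplace_scaling[OF z] I(3)])
  moreover have "\<forall>\<^sub>F n in sequentially. \<L> (z / scale n) ^ card (I n) = expectation (\<lambda>\<omega>. exp (- z * ((\<Sum>j\<in>I n. Y j \<omega>) / scale n)))"
    using spos
  proof eventually_elim
    case (elim n)
    then show ?case using laplace_sum_Y[OF I(1,2), of "z / scale n" n] z by simp
  qed
  ultimately show ?thesis by (rule Lim_transform_eventually)
qed

text \<open>Shows that \<open>n * Suc m\<close> steps outlast any fixed time window with high
  probability: the Chernoff bound tends in \<open>n\<close> to
  \<open>exp T * exp (- real (Suc m) * (1 / rate) powr index)\<close>, which is small for large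
  \<open>m\<close>.\<close>

lemma horizon_unlikely:
  assumes \<rho>: "0 < \<rho>"
  shows "\<forall>\<^sub>F m in sequentially. \<forall>\<^sub>F n in sequentially.
    prob {\<omega> \<in> space M. (\<Sum>j=1..n * Suc m. Y j \<omega>) / scale n \<le> T} \<le> \<rho>"
proof -
  have "(\<lambda>m. exp T * exp (- real (Suc m) * (1 / rate) powr index)) \<longlonglongrightarrow> 0"
  proof -
    have "(\<lambda>m. exp T * exp (- real (Suc m) * \<theta>)) \<longlonglongrightarrow> 0" if "0 < \<theta>" for \<theta> :: real
      using that by real_asymp
    moreover have "0 < (1 / rate) powr index" using rate_pos by simp
    ultimately show ?thesis by blast
  qed
  then have "\<forall>\<^sub>F m in sequentially. exp T * exp (- real (Suc m) * (1 / rate) powr index) < \<rho>"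
    using \<rho> by (rule order_tendstoD(2))
  then show ?thesis
  proof eventually_elim
    case (elim m)
    have c: "(\<lambda>n. real (card {1..n * Suc m}) / real n) \<longlonglongrightarrow> real (Suc m)"
    proof (rule tendsto_eventually)
      show "\<forall>\<^sub>F n in sequentially. real (card {1..n * Suc m}) / real n = real (Suc m)"
        using eventually_gt_at_top[of 0] by eventually_elim (simp add: field_simps)
    qed
    have "(\<lambda>n. exp T * expectation (\<lambda>\<omega>. exp (- 1 * ((\<Sum>j=1..n * Suc m. Y j \<omega>) / scale n)))) \<longlonglongrightarrow>
       exp T * exp (- real (Suc m) * (1 / rate) powr index)"
      by (intro tendsto_intros laplace_blocks c) auto
    then have "\<forall>\<^sub>F n in sequentially. exp T * expectation (\<lambda>\<omega>. exp (- 1 * ((\<Sum>j=1..n * Suc m. Y j \<omega>) / scale n))) < \<rho>"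
      using elim by (rule order_tendstoD(2))
    moreover have "\<forall>\<^sub>F n in sequentially. 0 < scale n" using scale_at_top by (simp add: filterlim_at_top_dense)
    ultimately show ?case
    proof eventually_elim
      case (elim n)
      have [measurable]: "(\<lambda>\<omega>. \<Sum>j=1..n * Suc m. Y j \<omega>) \<in> borel_measurable M" by (rule sum_Y_meas) auto
      have "prob {\<omega> \<in> space M. (\<Sum>j=1..n * Suc m. Y j \<omega>) / scale n \<le> T} \<le>
        exp T * expectation (\<lambda>\<omega>. exp (- ((\<Sum>j=1..n * Suc m. Y j \<omega>) / scale n)))"
      proof (rule prob_le_exp)
        have "AE \<omega> in M. 0 \<le> (\<Sum>j=1..n * Suc m. Y j \<omega>)" by (rule AE_sum_Y_nonneg) auto
        then show "AE \<omega> in M. 0 \<le> (\<Sum>j=1..n * Suc m. Y j \<omega>) / scale n"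
          by eventually_elim (use elim(2) in simp)
      qed measurable
      then show ?case using elim(1) by simp
    qed
  qed
qed

subsection \<open>Downward drift\<close>

text \<open>With downward drift the reflected walk at step \<open>k\<close> exceeds \<open>x\<close> only if one of \<open>k + 1\<close>
  increments does; hence it is eventually below any power of \<open>k\<close>.\<close>

definition walk :: "'a \<Rightarrow> nat \<Rightarrow> real" where "walk \<omega> k = (\<Sum>j=1..k. \<xi> j \<omega>)"

definition reflected_walk :: "'a \<Rightarrow> nat \<Rightarrow> real" where
  "reflected_walk \<omega> k = walk \<omega> k + Max ((\<lambda>i. max (- walk \<omega> i) 0) ` {..k})"

text \<open>Evaluate at the index of the maximum; if the alternative 0 wins there, index 0 serves
  instead, as the walk starts at 0.\<close>

lemma reflected_walk_attained:
  "\<exists>i\<le>k. reflected_walk \<omega> k = (\<Sum>j\<in>{i<..k}. \<xi> j \<omega>)"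
proof -
  have "Max ((\<lambda>i. max (- walk \<omega> i) 0) ` {..k}) \<in> (\<lambda>i. max (- walk \<omega> i) 0) ` {..k}"
    by (rule Max_in) auto
  then obtain i where i: "Max ((\<lambda>i. max (- walk \<omega> i) 0) ` {..k}) = max (- walk \<omega> i) 0" "i \<in> {..k}"
    by (rule imageE)
  have w0: "walk \<omega> 0 = 0" by (simp add: walk_def)
  define i' where "i' = (if 0 \<le> - walk \<omega> i then i else 0)"
  have "i' \<le> k" "max (- walk \<omega> i) 0 = - walk \<omega> i'" using i(2) w0 by (auto simp: i'_def)
  then show ?thesis
    using i(1) by (intro exI[of _ i']) (simp add: reflected_walk_def walk_def sum_greaterThanAtMost_eq)
qed

lemma reflected_walk_nonneg: "0 \<le> reflected_walk \<omega> k"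
proof -
  have "max (- walk \<omega> k) 0 \<le> Max ((\<lambda>i. max (- walk \<omega> i) 0) ` {..k})" by (rule Max_ge) auto
  then show ?thesis by (simp add: reflected_walk_def)
qed

lemma reflected_walk_tail:
  assumes p: "p < 1/2" and x: "0 < x"
  shows "prob {\<omega> \<in> space M. x \<le> reflected_walk \<omega> k} \<le> real (Suc k) * exp (- (2 * (1 - 2 * p) * x))"
proof -
  define c where "c = 1 - 2 * p"
  have c: "0 < c" using p by (simp add: c_def)
  let ?E = "\<lambda>i. {\<omega> \<in> space M. x \<le> (\<Sum>j\<in>{i<..k}. \<xi> j \<omega>)}"
  have [measurable]: "(\<lambda>\<omega>. \<Sum>j\<in>{i<..k}. \<xi> j \<omega>) \<in> borel_measurable M" for i
    by (intro borel_measurable_sum \<xi>_meas) auto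
  have E: "prob (?E i) \<le> exp (- (2 * c * x))" if i: "i \<le> k" for i
  proof (cases "i = k")
    case True
    then show ?thesis using x by simp
  next
    case False
    define l where "l = real (card {i<..k})"
    have l: "0 < l" using i False by (simp add: l_def)
    have sub: "{i<..k} \<subseteq> {1..}" by auto
    \<comment> \<open>To reach the level \<open>x\<close> in \<open>l\<close> steps the increment
      must also make up for the expected loss \<open>c * l\<close>.\<close>
    have "prob {\<omega> \<in> space M. (2 * p - 1) * l + (x + c * l) \<le> (\<Sum>j\<in>{i<..k}. \<xi> j \<omega>)} \<le> exp (- ((x + c * l)\<^sup>2 / (2 * l)))"
      unfolding l_def using i False x c by (intro Hoeffding_sum(2) sub) (auto intro!: add_nonneg_nonneg)
    also have "(2 * p - 1) * l + (x + c * l) = x" by (simp add: c_def algebra_simps)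
    \<comment> \<open>The inequality between arithmetic and geometric mean yields an exponent
      independent of the number \<open>l\<close> of steps.\<close>
    also have "2 * c * x \<le> (x + c * l)\<^sup>2 / (2 * l)"
    proof -
      have "0 \<le> (x - c * l)\<^sup>2" by simp
      then have "4 * (c * x * l) \<le> (x + c * l)\<^sup>2" by (simp add: power2_eq_square algebra_simps)
      then show ?thesis using l by (simp add: field_simps)
    qed
    then have "exp (- ((x + c * l)\<^sup>2 / (2 * l))) \<le> exp (- (2 * c * x))" by simp
    finally show ?thesis .
  qed
  have "prob {\<omega> \<in> space M. x \<le> reflected_walk \<omega> k} \<le> prob (\<Union>i\<in>{..k}. ?E i)"
  proof (rule finite_measure_mono)
    show "{\<omega> \<in> space M. x \<le> reflected_walk \<omega> k} \<subseteq> (\<Union>i\<in>{..k}. ?E i)"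
    proof
      fix \<omega> assume w: "\<omega> \<in> {\<omega> \<in> space M. x \<le> reflected_walk \<omega> k}"
      obtain i where "i \<le> k" "reflected_walk \<omega> k = (\<Sum>j\<in>{i<..k}. \<xi> j \<omega>)"
        using reflected_walk_attained by blast
      then show "\<omega> \<in> (\<Union>i\<in>{..k}. ?E i)" using w by auto
    qed
  qed auto
  also have "\<dots> \<le> (\<Sum>i\<in>{..k}. prob (?E i))" by (rule finite_measure_subadditive_finite) auto
  also have "\<dots> \<le> (\<Sum>i\<in>{..k}. exp (- (2 * c * x)))" by (intro sum_mono E) auto
  finally show ?thesis by (simp add: c_def)
qed

lemma reflected_walk_measurable [measurable]: "(\<lambda>\<omega>. reflected_walk \<omega> k) \<in> borel_measurable M"
proof -
  have [measurable]: "(\<lambda>\<omega>. walk \<omega> i) \<in> borel_measurable M" for i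
    unfolding walk_def by (intro borel_measurable_sum \<xi>_meas) auto
  show ?thesis unfolding reflected_walk_def[abs_def] by measurable
qed

lemma reflected_walk_subpolynomial:
  assumes p: "p < 1/2" and e: "0 < e"
  shows "AE \<omega> in M. \<forall>\<^sub>F k in sequentially. reflected_walk \<omega> k < real k powr e"
proof -
  let ?A = "\<lambda>k. {\<omega> \<in> space M. real k powr e \<le> reflected_walk \<omega> k}"
  define c where "c = 2 * (1 - 2 * p)"
  have c: "0 < c" using p by (simp add: c_def)
  have "\<forall>\<^sub>F k in sequentially. real (Suc k) * exp (- (c * real k powr e)) \<le> real k powr (- 2)"
    using c e by real_asymp
  then have "\<forall>\<^sub>F k in sequentially. norm (prob (?A k)) \<le> real k powr (- 2)"
    using eventually_gt_at_top[of 0]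
  proof eventually_elim
    case (elim k)
    have "prob (?A k) \<le> real (Suc k) * exp (- (c * real k powr e))"
      using reflected_walk_tail[OF p, of "real k powr e" k] elim(2) by (simp add: c_def)
    then show ?case using elim(1) by simp
  qed
  moreover have "summable (\<lambda>k. real k powr (- 2))" by (subst summable_real_powr_iff) simp
  ultimately have "summable (\<lambda>k. prob (?A k))" by (rule summable_comparison_test_ev)
  then have "AE \<omega> in M. \<forall>\<^sub>F k in sequentially. \<omega> \<in> space M - ?A k"
    by (intro borel_cantelli_AE1) (auto simp: emeasure_eq_measure)
  then show ?thesis by eventually_elim (auto elim!: eventually_mono simp: not_le)
qed

lemma renewal_queue_reflected_walk:
  assumes "renewal_path Y \<omega>" "0 \<le> t"
  shows "renewal_queue \<xi> Y \<omega> t = reflected_walk \<omega> (renewal_count Y \<omega> t)"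
  using renewal_path.renewal_queue_eq[OF assms, of \<xi>] by (simp add: reflected_walk_def walk_def)

text \<open>The finitely many exceptional indices go into an additive constant, so that an estimate
  for large indices can be applied at an arbitrary count.\<close>

lemma eventually_below_imp_bounded:
  fixes u v :: "nat \<Rightarrow> real"
  assumes "\<forall>\<^sub>F k in sequentially. u k < v k"
  shows "\<exists>B\<ge>0. \<forall>k. u k \<le> B + \<bar>v k\<bar>"
proof -
  obtain K where K: "\<And>k. K \<le> k \<Longrightarrow> u k < v k" using assms by (auto simp: eventually_sequentially)
  define B where "B = (\<Sum>k<K. \<bar>u k\<bar>)"
  have "u k \<le> B + \<bar>v k\<bar>" for k
  proof (cases "K \<le> k")
    case True
    have "0 \<le> B" by (simp add: B_def sum_nonneg)
    then show ?thesis using K[OF True] by simp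
  next
    case False
    then have "\<bar>u k\<bar> \<le> B" unfolding B_def by (intro member_le_sum) auto
    then show ?thesis by simp
  qed
  then show ?thesis by (intro exI[of _ B]) (auto simp: B_def sum_nonneg)
qed

text \<open>Up to time \<open>scale n * T\<close> the count is at most of order
  \<open>real n powr D'\<close>, and the reflected walk at count \<open>k\<close> at most of order
  \<open>real k powr e\<close>.\<close>

theorem vanishing:
  assumes p: "p < 1/2" and \<delta>: "0 < \<delta>"
  shows "AE_locally_uniformly_vanishing M (scaled_queue M \<alpha> \<beta> lam mu \<xi> Y \<delta>)"
proof -
  obtain D where D: "\<forall>\<^sub>F n in sequentially. scale n \<le> real n powr D" using scale_polynomial by blast
  define D' where "D' = max D 1"
  have D': "0 < D'" "\<forall>\<^sub>F n in sequentially. scale n \<le> real n powr D'"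
  proof -
    show "\<forall>\<^sub>F n in sequentially. scale n \<le> real n powr D'"
      using D eventually_ge_at_top[of 1]
    proof eventually_elim
      case (elim n)
      have "real n powr D \<le> real n powr D'" using elim(2) by (intro powr_mono) (auto simp: D'_def)
      then show ?case using elim(1) by simp
    qed
  qed (simp add: D'_def)
  \<comment> \<open>With this exponent the queue is of order at most
    \<open>real n powr (\<delta> / 2)\<close>, which the factor
    \<open>real n powr (- \<delta>)\<close> beats.\<close>
  define e where "e = \<delta> / (2 * D')"
  have e: "0 < e" "D' * e = \<delta> / 2" using D' \<delta> by (auto simp: e_def)
  obtain c where c: "0 < c" "AE \<omega> in M. \<forall>\<^sub>F k in sequentially. c * real k < (\<Sum>j=1..k. Y j \<omega>)"
    using arrivals_linear by blast
  have spos: "\<forall>\<^sub>F n in sequentially. 0 < scale n" using scale_at_top by (simp add: filterlim_at_top_dense)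
  show ?thesis
    unfolding AE_locally_uniformly_vanishing_def
    using reflected_walk_subpolynomial[OF p e(1)] c(2) AE_renewal_path
  proof eventually_elim
    case (elim \<omega>)
    interpret renewal_path Y \<omega> by (rule elim(3))
    obtain B where B: "0 \<le> B" "\<And>k. reflected_walk \<omega> k \<le> B + \<bar>real k powr e\<bar>"
      using eventually_below_imp_bounded[OF elim(1)] by blast
    obtain B' where B': "0 \<le> B'" "\<And>k. c * real k \<le> B' + \<bar>S k\<bar>"
      using eventually_below_imp_bounded[OF elim(2)] unfolding S_def by blast
    have count: "real (renewal_count Y \<omega> t) \<le> (B' + t) / c" if "0 \<le> t" for t
    proof -
      have "S (renewal_count Y \<omega> t) \<le> t" using renewal_count_exists[OF that] by simp
      moreover have "0 \<le> S (renewal_count Y \<omega> t)" using S_le_iff(1)[of 0] S_0 by simp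
      ultimately have "c * real (renewal_count Y \<omega> t) \<le> B' + t" using B'(2)[of "renewal_count Y \<omega> t"] by simp
      then show ?thesis using c(1) by (simp add: field_simps)
    qed
    show ?case
    proof (intro allI impI)
      fix T :: real assume T: "0 \<le> T"
      define bound where "bound = (\<lambda>n. real n powr (- \<delta>) * (B + ((B' + real n powr D' * T) / c) powr e))"
      have bnd: "\<forall>\<^sub>F n in sequentially. \<forall>t\<in>{0..T}. 0 \<le> scaled_queue M \<alpha> \<beta> lam mu \<xi> Y \<delta> n \<omega> t \<and> scaled_queue M \<alpha> \<beta> lam mu \<xi> Y \<delta> n \<omega> t \<le> bound n"
        using spos D'(2)
      proof eventually_elim
        case (elim n)
        show ?case
        proof
          fix t assume t: "t \<in> {0..T}"
          have st: "0 \<le> scale n * t" using elim t by simp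
          have eq: "scaled_queue M \<alpha> \<beta> lam mu \<xi> Y \<delta> n \<omega> t = real n powr (- \<delta>) * reflected_walk \<omega> (renewal_count Y \<omega> (scale n * t))"
            using renewal_queue_reflected_walk[OF renewal_path_axioms st] by (simp add: scaled_queue_def scale_def)
          have "scale n * t \<le> real n powr D' * T" using elim t by (intro mult_mono) auto
          then have "real (renewal_count Y \<omega> (scale n * t)) \<le> (B' + real n powr D' * T) / c"
            using count[OF st] divide_right_mono[of "B' + scale n * t" "B' + real n powr D' * T" c] c(1) by simp
          then have "real (renewal_count Y \<omega> (scale n * t)) powr e \<le> ((B' + real n powr D' * T) / c) powr e"
            using e(1) by (intro powr_mono2) auto
          then have "reflected_walk \<omega> (renewal_count Y \<omega> (scale n * t)) \<le> B + ((B' + real n powr D' * T) / c) powr e"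
            using B(2)[of "renewal_count Y \<omega> (scale n * t)"] by simp
          then show "0 \<le> scaled_queue M \<alpha> \<beta> lam mu \<xi> Y \<delta> n \<omega> t \<and> scaled_queue M \<alpha> \<beta> lam mu \<xi> Y \<delta> n \<omega> t \<le> bound n"
            unfolding eq bound_def using reflected_walk_nonneg by (auto intro!: mult_left_mono)
        qed
      qed
      have "bound \<longlonglongrightarrow> 0"
      proof -
        define H where "H = ((B' + T) / c) powr e"
        have "\<forall>\<^sub>F n in sequentially. norm (bound n) \<le> real n powr (- \<delta>) * B + H * real n powr (- (\<delta> / 2))"
          using eventually_ge_at_top[of 1]
        proof eventually_elim
          case (elim n)
          have n1: "1 \<le> real n powr D'" using elim D'(1) by (simp add: ge_one_powr_ge_zero)
          have "B' + real n powr D' * T \<le> real n powr D' * (B' + T)"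
            using mult_right_mono[OF n1 B'(1)] by (simp add: algebra_simps)
          then have "(B' + real n powr D' * T) / c \<le> real n powr D' * ((B' + T) / c)"
            using divide_right_mono[of _ _ c] c(1) by force
          then have "((B' + real n powr D' * T) / c) powr e \<le> (real n powr D' * ((B' + T) / c)) powr e"
            using e(1) B'(1) T c(1) by (intro powr_mono2) auto
          also have "\<dots> = real n powr (\<delta> / 2) * H"
            using powr_mult[of "real n powr D'" "(B' + T) / c" e] B'(1) T c(1) unfolding powr_powr e(2) H_def by simp
          finally have "real n powr (- \<delta>) * ((B' + real n powr D' * T) / c) powr e \<le> real n powr (- \<delta>) * (real n powr (\<delta> / 2) * H)"
            by (intro mult_left_mono) auto
          also have "\<dots> = H * real n powr (- (\<delta> / 2))"
            using powr_add[of "real n" "- \<delta>" "\<delta> / 2"] by (simp add: mult_ac)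
          finally have "bound n \<le> real n powr (- \<delta>) * B + H * real n powr (- (\<delta> / 2))"
            by (simp add: bound_def distrib_left)
          moreover have "0 \<le> bound n" using B(1) by (simp add: bound_def)
          ultimately show ?case by simp
        qed
        moreover have "(\<lambda>n. real n powr (- \<delta>) * B + H * real n powr (- (\<delta> / 2))) \<longlonglongrightarrow> 0"
        proof -
          have "(\<lambda>n. real n powr (- \<delta>) * B + H * real n powr (- (\<delta> / 2))) \<longlonglongrightarrow> 0 * B + H * 0"
            using \<delta> by (intro tendsto_intros) real_asymp+
          then show ?thesis by simp
        qed
        ultimately show ?thesis by (rule Lim_null_comparison)
      qed
      then have lim: "(\<lambda>n. ereal (bound n)) \<longlonglongrightarrow> 0" by (simp add: zero_ereal_def)
      show "(\<lambda>n. SUP t\<in>{0..T}. ereal (scaled_queue M \<alpha> \<beta> lam mu \<xi> Y \<delta> n \<omega> t)) \<longlonglongrightarrow> 0"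
      proof (rule tendsto_sandwich[OF _ _ tendsto_const lim])
        show "\<forall>\<^sub>F n in sequentially. 0 \<le> (SUP t\<in>{0..T}. ereal (scaled_queue M \<alpha> \<beta> lam mu \<xi> Y \<delta> n \<omega> t))"
          using bnd
        proof eventually_elim
          case (elim n)
          have "0 \<le> ereal (scaled_queue M \<alpha> \<beta> lam mu \<xi> Y \<delta> n \<omega> 0)" using elim T by simp
          also have "\<dots> \<le> (SUP t\<in>{0..T}. ereal (scaled_queue M \<alpha> \<beta> lam mu \<xi> Y \<delta> n \<omega> t))"
            using T by (intro SUP_upper) auto
          finally show ?case .
        qed
        show "\<forall>\<^sub>F n in sequentially. (SUP t\<in>{0..T}. ereal (scaled_queue M \<alpha> \<beta> lam mu \<xi> Y \<delta> n \<omega> t)) \<le> ereal (bound n)"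
          using bnd by eventually_elim (auto intro!: SUP_least)
      qed
    qed
  qed
qed

end

section \<open>Joint convergence of the increments\<close>

locale queue_limit = mittag_leffler_queue M \<xi> p \<alpha> lam f \<beta> mu g Y + N: subordinator_inverse N \<sigma> L "min (\<alpha> + \<beta>) 1"
  for M :: "'a measure" and \<xi> p \<alpha> lam f \<beta> mu g Y and N :: "'b measure" and \<sigma> L +
  fixes W :: "'b \<Rightarrow> real \<Rightarrow> real"
  assumes W: "standard_brownian_motion N W"
    and W_L_indep: "independent_processes N W L"
begin

text \<open>In the critical case the mean of the sine is known to be positive only for large
  \<open>n\<close>; the default value 1 keeps the rescaled block sums nonnegative almost surely for
  all \<open>n\<close>.\<close>

definition positive_scale :: "nat \<Rightarrow> real" where
  "positive_scale n = (if 0 < scale n then scale n else 1)"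

lemma positive_scale: "0 < positive_scale n" "\<forall>\<^sub>F n in sequentially. 0 < scale n \<and> positive_scale n = scale n"
proof -
  show "0 < positive_scale n" by (simp add: positive_scale_def)
  have "\<forall>\<^sub>F n in sequentially. 0 < scale n" using scale_at_top by (simp add: filterlim_at_top_dense)
  then show "\<forall>\<^sub>F n in sequentially. 0 < scale n \<and> positive_scale n = scale n"
    by eventually_elim (simp add: positive_scale_def)
qed

definition walk_increment :: "nat \<Rightarrow> nat \<Rightarrow> nat \<Rightarrow> 'a \<Rightarrow> real" where
  "walk_increment m n i \<omega> = real n powr (- (1/2)) * block_sum (Suc m) n i (\<lambda>j. \<xi> j \<omega>)"

definition ln_time_increment :: "nat \<Rightarrow> nat \<Rightarrow> nat \<Rightarrow> 'a \<Rightarrow> real" where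
  "ln_time_increment m n i \<omega> = ln (block_sum (Suc m) n i (\<lambda>j. Y j \<omega>) / positive_scale n)"

definition mesh_point :: "nat \<Rightarrow> nat \<Rightarrow> real" where
  "mesh_point m i = real i / real (Suc m)"

definition brownian_increment :: "nat \<Rightarrow> nat \<Rightarrow> 'b \<Rightarrow> real" where
  "brownian_increment m i \<omega> = W \<omega> (mesh_point m (Suc i)) - W \<omega> (mesh_point m i)"

definition ln_subordinator_increment :: "nat \<Rightarrow> nat \<Rightarrow> 'b \<Rightarrow> real" where
  "ln_subordinator_increment m i \<omega> = ln ((\<sigma> \<omega> (mesh_point m (Suc i)) - \<sigma> \<omega> (mesh_point m i)) / rate)"

lemma mesh_point: "0 \<le> mesh_point m i" "mesh_point m i < mesh_point m (Suc i)"
    "mesh_point m (Suc i) = mesh_point m i + 1 / real (Suc m)" "mesh_point m 0 = 0"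
  by (auto simp: mesh_point_def divide_strict_right_mono add_divide_distrib)

lemma W_meas: "0 \<le> t \<Longrightarrow> (\<lambda>\<omega>. W \<omega> t) \<in> borel_measurable N"
  using W by (simp add: standard_brownian_motion_def)

lemma brownian_increment_meas [measurable]: "brownian_increment m i \<in> borel_measurable N"
  unfolding brownian_increment_def[abs_def] by (intro borel_measurable_diff W_meas mesh_point)

lemma ln_subordinator_increment_meas [measurable]: "ln_subordinator_increment m i \<in> borel_measurable N"
proof -
  have [measurable]: "(\<lambda>\<omega>. \<sigma> \<omega> (mesh_point m i)) \<in> borel_measurable N" for i by (intro N.\<sigma>_meas mesh_point)
  show ?thesis unfolding ln_subordinator_increment_def[abs_def] by measurable
qed

section \<open>Weak convergence of the increments\<close>

lemma increments_indep:
  assumes X: "independent_increments N X" and [measurable]: "F \<in> borel_measurable borel"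
  shows "N.indep_vars (\<lambda>_. borel) (\<lambda>i \<omega>. F (X \<omega> (mesh_point m (Suc i)) - X \<omega> (mesh_point m i)) :: real) UNIV"
proof -
  have "N.indep_vars (\<lambda>_. borel) (\<lambda>i \<omega>. X \<omega> (mesh_point m (Suc i)) - X \<omega> (mesh_point m i)) {..<n}" for n
    using X[unfolded independent_increments_def, rule_format, of "mesh_point m" n]
      mesh_point(1)[of m 0] less_imp_le[OF mesh_point(2)[of m]] by blast
  then have "N.indep_vars (\<lambda>_. borel) (\<lambda>i \<omega>. X \<omega> (mesh_point m (Suc i)) - X \<omega> (mesh_point m i)) UNIV"
    by (rule N.indep_vars_UNIV_nat)
  then show ?thesis by (rule N.indep_vars_compose2[where Y="\<lambda>_. F"]) measurable
qed

text \<open>Independence is given for \<open>W\<close> and \<open>L\<close>. The increments of the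
  subordinator are replaced by those of \<open>recover\<close>, measurable functionals of the path
  of \<open>L\<close> that agree with them almost surely.\<close>

lemma brownian_subordinator_indep:
  assumes [measurable]: "F \<in> borel_measurable borel"
  shows "N.indep_var (PiM UNIV (\<lambda>_. borel)) (\<lambda>\<omega> i. F (brownian_increment m i \<omega>) :: real)
     (PiM UNIV (\<lambda>_. borel)) (\<lambda>\<omega> i. ln_subordinator_increment m i \<omega>)"
proof (rule N.indep_var_cong_AE)
  let ?P = "PiM {0..} (\<lambda>_. borel :: real measure)"
  let ?w = "\<lambda>x i. F (x (mesh_point m (Suc i)) - x (mesh_point m i))"
  let ?v = "\<lambda>l i. ln ((N.recover (mesh_point m (Suc i)) l - N.recover (mesh_point m i) l) / rate)"
  have [measurable]: "(\<lambda>x. x (mesh_point m i)) \<in> borel_measurable ?P" for i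
    using mesh_point(1) by (intro measurable_component_singleton) auto
  have w: "?w \<in> measurable ?P (PiM UNIV (\<lambda>_. borel))"
    by (rule measurable_PiM_single') auto
  have v: "?v \<in> measurable ?P (PiM UNIV (\<lambda>_. borel))"
    by (rule measurable_PiM_single') auto
  have "N.indep_var ?P (\<lambda>\<omega>. restrict (W \<omega>) {0..}) ?P (\<lambda>\<omega>. restrict (L \<omega>) {0..})"
    using W_L_indep by (simp add: independent_processes_def)
  from N.indep_var_compose[OF this w v]
  show "N.indep_var (PiM UNIV (\<lambda>_. borel)) (\<lambda>\<omega> i. F (brownian_increment m i \<omega>))
     (PiM UNIV (\<lambda>_. borel)) (\<lambda>\<omega>. ?v (restrict (L \<omega>) {0..}))"
    using mesh_point(1) by (simp add: o_def brownian_increment_def)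
  show "(\<lambda>\<omega> i. ln_subordinator_increment m i \<omega>) \<in> measurable N (PiM UNIV (\<lambda>_. borel))"
    by (rule measurable_PiM_single') auto
  have "AE \<omega> in N. \<forall>i. N.recover (mesh_point m i) (restrict (L \<omega>) {0..}) = \<sigma> \<omega> (mesh_point m i)"
    unfolding AE_all_countable by (intro allI N.recover_L mesh_point)
  then show "AE \<omega> in N. ?v (restrict (L \<omega>) {0..}) = (\<lambda>i. ln_subordinator_increment m i \<omega>)"
    by eventually_elim (simp add: ln_subordinator_increment_def)
qed

lemma block_sum_meas:
  "(\<lambda>\<omega>. block_sum m n i (\<lambda>j. \<xi> j \<omega>)) \<in> borel_measurable M"
  "(\<lambda>\<omega>. block_sum m n i (\<lambda>j. Y j \<omega>)) \<in> borel_measurable M"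
  unfolding block_sum_def using block_subset[of m n i]
  by (auto intro!: borel_measurable_sum \<xi>_meas Y_meas)

lemma walk_increment_meas [measurable]: "walk_increment m n i \<in> borel_measurable M"
  unfolding walk_increment_def[abs_def] using block_sum_meas(1) by measurable

lemma ln_time_increment_meas [measurable]: "ln_time_increment m n i \<in> borel_measurable M"
  unfolding ln_time_increment_def[abs_def] using block_sum_meas(2) by measurable

text \<open>A block holds about \<open>n / real (Suc m)\<close> waiting times, so the limiting
  transform at \<open>k\<close> is
  \<open>exp (- (1 / real (Suc m)) * (real k / rate) powr index)\<close>, that of a rescaled
  increment of the subordinator over one mesh cell.\<close>

lemma weak_conv_ln_time_increment:
  "weak_conv_m (\<lambda>n. distr M borel (ln_time_increment m n i)) (distr N borel (ln_subordinator_increment m i))"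
  unfolding ln_time_increment_def[abs_def] ln_subordinator_increment_def[abs_def]
proof (rule laplace_imp_weak_conv_ln)
  show "prob_space M" "prob_space N" by unfold_locales
  note [measurable] = block_sum_meas(2)
  show "(\<lambda>\<omega>. block_sum (Suc m) n i (\<lambda>j. Y j \<omega>) / positive_scale n) \<in> borel_measurable M" for n
    by measurable
  show "AE \<omega> in M. 0 \<le> block_sum (Suc m) n i (\<lambda>j. Y j \<omega>) / positive_scale n" for n
    using AE_sum_Y_nonneg[OF block_subset[of "Suc m" n i]]
    by eventually_elim (simp add: block_sum_def less_imp_le[OF positive_scale(1)])
  show "\<forall>\<^sub>F n in sequentially. AE \<omega> in M. 0 < block_sum (Suc m) n i (\<lambda>j. Y j \<omega>) / positive_scale n"
    using eventually_ge_at_top[of "Suc m"]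
  proof eventually_elim
    case (elim n)
    have ne: "block (Suc m) n i \<noteq> {}"
      using block_end_strict[of "Suc m" n i] elim by (auto simp: block_def simp del: mult_Suc_right)
    show ?case using AE_Y_pos
    proof eventually_elim
      case (elim \<omega>)
      have "0 < (\<Sum>j\<in>block (Suc m) n i. Y j \<omega>)"
        using ne elim block_subset[of "Suc m" n i] by (intro sum_pos finite_block) auto
      then show ?case by (simp add: block_sum_def positive_scale(1))
    qed
  qed
  have [measurable]: "(\<lambda>\<omega>. \<sigma> \<omega> (mesh_point m i)) \<in> borel_measurable N" for i by (intro N.\<sigma>_meas mesh_point)
  show "(\<lambda>\<omega>. (\<sigma> \<omega> (mesh_point m (Suc i)) - \<sigma> \<omega> (mesh_point m i)) / rate) \<in> borel_measurable N"
    by measurable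
  show "AE \<omega> in N. 0 < (\<sigma> \<omega> (mesh_point m (Suc i)) - \<sigma> \<omega> (mesh_point m i)) / rate"
    using N.\<sigma>_increment_pos[OF mesh_point(1,2), of m i] by eventually_elim (simp add: rate_pos)
  fix k :: nat
  have "(\<integral>\<omega>. exp (- real k * ((\<sigma> \<omega> (mesh_point m (Suc i)) - \<sigma> \<omega> (mesh_point m i)) / rate)) \<partial>N) =
    exp (- (1 / real (Suc m)) * (real k / rate) powr index)"
    using N.\<sigma>_laplace[of "mesh_point m i" "1 / real (Suc m)" "real k / rate"] mesh_point(1,3)[of m i] rate_pos
    by (simp add: index_def)
  moreover have "(\<lambda>n. expectation (\<lambda>\<omega>. exp (- real k * ((\<Sum>j\<in>block (Suc m) n i. Y j \<omega>) / scale n)))) \<longlonglongrightarrow>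
    exp (- (1 / real (Suc m)) * (real k / rate) powr index)"
    by (rule laplace_blocks[OF finite_block block_subset card_block]) auto
  then have "(\<lambda>n. \<integral>\<omega>. exp (- real k * (block_sum (Suc m) n i (\<lambda>j. Y j \<omega>) / positive_scale n)) \<partial>M) \<longlonglongrightarrow>
    exp (- (1 / real (Suc m)) * (real k / rate) powr index)"
  proof (rule Lim_transform_eventually)
    show "\<forall>\<^sub>F n in sequentially. expectation (\<lambda>\<omega>. exp (- real k * ((\<Sum>j\<in>block (Suc m) n i. Y j \<omega>) / scale n))) =
      expectation (\<lambda>\<omega>. exp (- real k * (block_sum (Suc m) n i (\<lambda>j. Y j \<omega>) / positive_scale n)))"
      using positive_scale(2) by eventually_elim (simp add: block_sum_def)
  qed
  ultimately show "(\<lambda>n. \<integral>\<omega>. exp (- real k * (block_sum (Suc m) n i (\<lambda>j. Y j \<omega>) / positive_scale n)) \<partial>M) \<longlonglongrightarrow>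
    (\<integral>\<omega>. exp (- real k * ((\<sigma> \<omega> (mesh_point m (Suc i)) - \<sigma> \<omega> (mesh_point m i)) / rate)) \<partial>N)"
    by (simp only:)
qed

text \<open>The function \<open>F\<close> lets both regimes share the statement: the identity for p
  = 1/2, and multiplication by 0 for p > 1/2, where the normalized space increments have no
  limit.\<close>

lemma increments_converge:
  fixes F :: "real \<Rightarrow> real" and \<phi> :: "(nat \<Rightarrow> real) \<times> (nat \<Rightarrow> real) \<Rightarrow> real"
  assumes F [measurable]: "F \<in> borel_measurable borel"
    and conv: "\<And>i. weak_conv_m (\<lambda>n. distr M borel (\<lambda>\<omega>. F (walk_increment m n i \<omega>))) (distr N borel (\<lambda>\<omega>. F (brownian_increment m i \<omega>)))"
    and \<phi>: "continuous_on UNIV \<phi>" "bounded (range \<phi>)"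
  shows "(\<lambda>n. \<integral>\<omega>. \<phi> (\<lambda>i. F (walk_increment m n i \<omega>), \<lambda>i. ln_time_increment m n i \<omega>) \<partial>M) \<longlonglongrightarrow>
    (\<integral>\<omega>. \<phi> (\<lambda>i. F (brownian_increment m i \<omega>), \<lambda>i. ln_subordinator_increment m i \<omega>) \<partial>N)"
proof (rule weak_conv_pair_indep_vars[OF _ _ _ _ _ _ _ _ conv _ \<phi>])
  show "prob_space M" "prob_space N" by unfold_locales
  show "indep_vars (\<lambda>_. borel) (\<lambda>i \<omega>. F (walk_increment m n i \<omega>)) UNIV" for n
    unfolding walk_increment_def block_sum_def
    by (rule indep_vars_blocks[OF \<xi>_indep block_subset disjoint_family_block, of "\<lambda>_ x. F (real n powr (- (1/2)) * x)"]) measurable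
  show "indep_vars (\<lambda>_. borel) (ln_time_increment m n) UNIV" for n
    unfolding ln_time_increment_def[abs_def] block_sum_def
    by (rule indep_vars_blocks[OF Y_indep block_subset disjoint_family_block, of "\<lambda>_ x. ln (x / positive_scale n)"]) measurable
  show "indep_var (PiM UNIV (\<lambda>_. borel)) (\<lambda>\<omega> i. F (walk_increment m n i \<omega>))
     (PiM UNIV (\<lambda>_. borel)) (\<lambda>\<omega> i. ln_time_increment m n i \<omega>)" for n
    unfolding walk_increment_def ln_time_increment_def block_sum_def
    by (rule indep_var_blocks[OF \<xi>_Y_indep block_subset, of "\<lambda>_ x. F (real n powr (- (1/2)) * x)" "\<lambda>_ x. ln (x / positive_scale n)"]) measurable
  show "N.indep_vars (\<lambda>_. borel) (\<lambda>i \<omega>. F (brownian_increment m i \<omega>)) UNIV"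
    unfolding brownian_increment_def using W
    by (intro increments_indep) (auto simp: standard_brownian_motion_def)
  show "N.indep_vars (\<lambda>_. borel) (ln_subordinator_increment m) UNIV"
    unfolding ln_subordinator_increment_def[abs_def]
    using increments_indep[OF N.\<sigma>_indep, of "\<lambda>x. ln (x / rate)" m] by simp
  show "N.indep_var (PiM UNIV (\<lambda>_. borel)) (\<lambda>\<omega> i. F (brownian_increment m i \<omega>))
     (PiM UNIV (\<lambda>_. borel)) (\<lambda>\<omega> i. ln_subordinator_increment m i \<omega>)"
    by (rule brownian_subordinator_indep) measurable
  show "weak_conv_m (\<lambda>n. distr M borel (ln_time_increment m n i)) (distr N borel (ln_subordinator_increment m i))" for i
    by (rule weak_conv_ln_time_increment)
qed

text \<open>That many cells of width \<open>1 / real (Suc m)\<close> reach the mesh time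
  \<open>real (Suc m)\<close>, so the horizon grows while the mesh is refined.\<close>

definition cells :: "nat \<Rightarrow> nat" where "cells m = Suc m * Suc m"

lemma cells_block_end: "(n * cells m) div Suc m = n * Suc m"
proof -
  have "n * cells m = (n * Suc m) * Suc m" by (simp only: cells_def mult.assoc)
  then show ?thesis by (simp only:) (rule nonzero_mult_div_cancel_right, simp)
qed

lemma mesh_point_cells: "mesh_point m (cells m) = real (Suc m)"
  unfolding mesh_point_def cells_def of_nat_mult by (rule nonzero_mult_div_cancel_right) simp

text \<open>Puts the null set of irregular paths and the event of an early horizon into one
  measurable exceptional set.\<close>

lemma path_exception:
  assumes \<rho>: "0 < \<rho>"
  shows "\<forall>\<^sub>F m in sequentially. \<forall>\<^sub>F n in sequentially. \<exists>E\<in>sets M. measure M E \<le> \<rho> \<and>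
    (\<forall>\<omega>\<in>space M - E. renewal_path Y \<omega> \<and> T < (\<Sum>j=1..n * Suc m. Y j \<omega>) / scale n)"
proof -
  obtain A where A: "A \<in> null_sets M" "{\<omega> \<in> space M. \<not> renewal_path Y \<omega>} \<subseteq> A"
    using AE_renewal_path by (auto simp: eventually_ae_filter)
  show ?thesis
    using horizon_unlikely[OF \<rho>, of T]
  proof (rule eventually_mono, elim eventually_mono)
    fix m n
    assume *: "prob {\<omega> \<in> space M. (\<Sum>j=1..n * Suc m. Y j \<omega>) / scale n \<le> T} \<le> \<rho>"
    let ?B = "{\<omega> \<in> space M. (\<Sum>j=1..n * Suc m. Y j \<omega>) / scale n \<le> T}"
    have [measurable]: "(\<lambda>\<omega>. \<Sum>j=1..n * Suc m. Y j \<omega>) \<in> borel_measurable M" by (rule sum_Y_meas) auto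
    have B: "?B \<in> sets M" by measurable
    show "\<exists>E\<in>sets M. measure M E \<le> \<rho> \<and>
      (\<forall>\<omega>\<in>space M - E. renewal_path Y \<omega> \<and> T < (\<Sum>j=1..n * Suc m. Y j \<omega>) / scale n)"
    proof (intro bexI[of _ "?B \<union> A"] conjI ballI)
      show "measure M (?B \<union> A) \<le> \<rho>" using measure_Un_null_set[OF B A(1)] * by simp
      show "?B \<union> A \<in> sets M" using B A(1) by blast
    qed (use A(2) in \<open>auto simp: not_le\<close>)
  qed
qed

lemma X_cadlag: "\<forall>\<^sub>F n in sequentially. AE \<omega> in M. scaled_queue M \<alpha> \<beta> lam mu \<xi> Y \<delta> n \<omega> \<in> cadlag"
  using positive_scale(2)
proof eventually_elim
  case (elim n)
  show ?case using AE_renewal_path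
  proof eventually_elim
    case (elim \<omega>)
    then interpret renewal_path Y \<omega> .
    have "(\<lambda>t. real n powr (- \<delta>) * renewal_queue \<xi> Y \<omega> (scale n * t)) \<in> cadlag"
      using \<open>0 < scale n \<and> positive_scale n = scale n\<close> by (intro renewal_queue_cadlag) simp
    then show ?case by (simp add: scaled_queue_def[abs_def] scale_def)
  qed
qed

text \<open>The nodes are \<open>\<sigma> \<omega> (mesh_point m j) / rate\<close>, so a time in
  cell \<open>j\<close> has its inverse \<open>L \<omega> (rate * t)\<close> in the corresponding
  mesh cell. One number \<open>n0\<close> with \<open>rate * T < \<sigma> \<omega> (real n0)\<close>
  bounds the inverse and tells how fine the mesh, hence how long its horizon, has to be.\<close>

lemma ln_subordinator_cell:
  "AE \<omega> in N. \<forall>T\<ge>0. \<exists>n0::nat. \<forall>m\<ge>n0. \<forall>t\<in>{0..T}. \<exists>j<cells m.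
     (\<Sum>k<j. exp (ln_subordinator_increment m k \<omega>)) \<le> t \<and> t \<le> (\<Sum>k<Suc j. exp (ln_subordinator_increment m k \<omega>)) \<and>
     mesh_point m j \<le> L \<omega> (rate * t) \<and> L \<omega> (rate * t) \<le> mesh_point m (Suc j) \<and> L \<omega> (rate * t) \<le> real n0"
  using N.\<sigma>_strict_mono N.\<sigma>_0 N.\<sigma>_unbounded N.L_cell
proof eventually_elim
  case (elim \<omega>)
  have strict: "\<sigma> \<omega> s < \<sigma> \<omega> t" if "0 \<le> s" "s < t" for s t using elim(1) that by blast
  have sum: "(\<Sum>k<j. exp (ln_subordinator_increment m k \<omega>)) = \<sigma> \<omega> (mesh_point m j) / rate" for j m
  proof -
    have "exp (ln_subordinator_increment m k \<omega>) = (\<sigma> \<omega> (mesh_point m (Suc k)) - \<sigma> \<omega> (mesh_point m k)) / rate" for k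
      using strict[OF mesh_point(1,2)] rate_pos by (simp add: ln_subordinator_increment_def)
    then have "(\<Sum>k<j. exp (ln_subordinator_increment m k \<omega>)) = (\<Sum>k<j. \<sigma> \<omega> (mesh_point m (Suc k)) - \<sigma> \<omega> (mesh_point m k)) / rate"
      by (simp add: sum_divide_distrib)
    also have "(\<Sum>k<j. \<sigma> \<omega> (mesh_point m (Suc k)) - \<sigma> \<omega> (mesh_point m k)) = \<sigma> \<omega> (mesh_point m j) - \<sigma> \<omega> (mesh_point m 0)"
      by (rule sum_lessThan_telescope)
    finally show ?thesis using elim(2) by (simp add: mesh_point(4))
  qed
  show ?case
  proof (intro allI impI)
    fix T :: real assume T: "0 \<le> T"
    obtain n0 :: nat where n0: "rate * T < \<sigma> \<omega> (real n0)" using elim(3) by blast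
    show "\<exists>n0::nat. \<forall>m\<ge>n0. \<forall>t\<in>{0..T}. \<exists>j<cells m.
     (\<Sum>k<j. exp (ln_subordinator_increment m k \<omega>)) \<le> t \<and> t \<le> (\<Sum>k<Suc j. exp (ln_subordinator_increment m k \<omega>)) \<and>
     mesh_point m j \<le> L \<omega> (rate * t) \<and> L \<omega> (rate * t) \<le> mesh_point m (Suc j) \<and> L \<omega> (rate * t) \<le> real n0"
    proof (rule exI[of _ n0], intro allI impI ballI)
      fix m t assume m: "n0 \<le> m" and t: "t \<in> {0..T}"
      have x: "0 \<le> rate * t" "rate * t \<le> rate * T" using t rate_pos by auto
      have "\<sigma> \<omega> (real n0) < \<sigma> \<omega> (mesh_point m (cells m))"
        unfolding mesh_point_cells using m by (intro strict) auto
      then have "rate * t < \<sigma> \<omega> (mesh_point m (cells m))" using x n0 by simp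
      then obtain j where j: "j < cells m" "\<sigma> \<omega> (mesh_point m j) \<le> rate * t" "rate * t < \<sigma> \<omega> (mesh_point m (Suc j))"
        using exists_grid_cell[of "\<lambda>j. \<sigma> \<omega> (mesh_point m j)" "rate * t" "cells m"] x elim(2) by (auto simp: mesh_point(4))
      have "mesh_point m j \<le> L \<omega> (rate * t) \<and> L \<omega> (rate * t) \<le> mesh_point m (Suc j)"
        using elim(4) x(1) j mesh_point(1,2)[of m j] by (meson less_imp_le)
      moreover have "L \<omega> (rate * t) \<le> real n0"
      proof -
        have "\<sigma> \<omega> 0 \<le> rate * t" "rate * t \<le> \<sigma> \<omega> (real n0)" using elim(2) x n0 by auto
        then show ?thesis using elim(4) x(1) of_nat_0_le_iff[of n0] by blast
      qed
      moreover have "\<sigma> \<omega> (mesh_point m j) / rate \<le> t" "t \<le> \<sigma> \<omega> (mesh_point m (Suc j)) / rate"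
        using j rate_pos by (auto simp: field_simps)
      ultimately show "\<exists>j<cells m.
        (\<Sum>k<j. exp (ln_subordinator_increment m k \<omega>)) \<le> t \<and> t \<le> (\<Sum>k<Suc j. exp (ln_subordinator_increment m k \<omega>)) \<and>
        mesh_point m j \<le> L \<omega> (rate * t) \<and> L \<omega> (rate * t) \<le> mesh_point m (Suc j) \<and> L \<omega> (rate * t) \<le> real n0"
        using j(1) unfolding sum by (intro exI[of _ j]) simp
    qed
  qed
qed

section \<open>Limits of the scaled queue\<close>

lemma scaled_queue_eq:
  "scaled_queue M \<alpha> \<beta> lam mu \<xi> Y \<delta> n \<omega> t = real n powr (- \<delta>) * renewal_queue \<xi> Y \<omega> (scale n * t)"
  by (simp add: scaled_queue_def scale_def)

text \<open>Union bound over the steps up to \<open>n * Suc m\<close>: each Hoeffding bound decays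
  exponentially in \<open>n\<close>, while their number grows linearly.\<close>

lemma walk_close_to_drift:
  assumes e: "0 < e"
  shows "\<forall>\<^sub>F n in sequentially. \<exists>E\<in>sets M. measure M E \<le> e \<and>
    (\<forall>\<omega>\<in>space M - E. \<forall>k\<le>n * Suc m. \<bar>(\<Sum>j=1..k. \<xi> j \<omega>) - (2 * p - 1) * real k\<bar> \<le> e * real n)"
proof -
  have "(\<lambda>n. real (n * Suc m) * (2 * exp (- (e\<^sup>2 * real n / (2 * real (Suc m)))))) \<longlonglongrightarrow> 0"
  proof -
    have "(\<lambda>n. real n * K * (2 * exp (- (\<theta> * real n)))) \<longlonglongrightarrow> 0" if "0 < \<theta>" "0 < K" for \<theta> K :: real
      using that by real_asymp
    from this[of "e\<^sup>2 / (2 * real (Suc m))" "real (Suc m)"]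
    have "(\<lambda>n. real n * real (Suc m) * (2 * exp (- (e\<^sup>2 / (2 * real (Suc m)) * real n)))) \<longlonglongrightarrow> 0" using e by simp
    then show ?thesis unfolding of_nat_mult times_divide_eq_left .
  qed
  then have "\<forall>\<^sub>F n in sequentially. real (n * Suc m) * (2 * exp (- (e\<^sup>2 * real n / (2 * real (Suc m))))) < e"
    using e by (rule order_tendstoD(2))
  then show ?thesis using eventually_gt_at_top[of 0]
  proof eventually_elim
    case (elim n)
    define Bad where "Bad = (\<lambda>k. {\<omega> \<in> space M. e * real n \<le> \<bar>(\<Sum>j\<in>{1..k}. \<xi> j \<omega>) - (2 * p - 1) * real (card {1..k})\<bar>})"
    have [measurable]: "(\<lambda>\<omega>. \<Sum>j\<in>{1..k}. \<xi> j \<omega>) \<in> borel_measurable M" for k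
      by (intro borel_measurable_sum \<xi>_meas) auto
    have Bad: "Bad k \<in> sets M" for k unfolding Bad_def by measurable
    have n: "0 < real n" using elim(2) by simp
    have tail: "prob (Bad k) \<le> 2 * exp (- (e\<^sup>2 * real n / (2 * real (Suc m))))" if k: "k \<in> {1..n * Suc m}" for k
    proof -
      have "prob (Bad k) \<le> 2 * exp (- ((e * real n)\<^sup>2 / (2 * real (card {1..k}))))"
        unfolding Bad_def using k e by (intro Hoeffding_sum(1)) auto
      also have "e\<^sup>2 * real n / (2 * real (Suc m)) \<le> (e * real n)\<^sup>2 / (2 * real (card {1..k}))"
      proof -
        have "real k \<le> real n * real (Suc m)" using k by (simp only: of_nat_mult[symmetric] of_nat_le_iff) simp
        then have "(e * real n)\<^sup>2 / (2 * (real n * real (Suc m))) \<le> (e * real n)\<^sup>2 / (2 * real k)"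
          using k by (intro divide_left_mono) (auto intro!: mult_pos_pos n)
        moreover have "(e * real n)\<^sup>2 / (2 * (real n * real (Suc m))) = e\<^sup>2 * real n / (2 * real (Suc m))"
          using n by (simp add: power2_eq_square del: of_nat_Suc)
        ultimately show ?thesis by simp
      qed
      then have "2 * exp (- ((e * real n)\<^sup>2 / (2 * real (card {1..k})))) \<le> 2 * exp (- (e\<^sup>2 * real n / (2 * real (Suc m))))"
        by simp
      finally show ?thesis .
    qed
    show ?case
    proof (intro bexI[of _ "\<Union>k\<in>{1..n * Suc m}. Bad k"] conjI ballI allI impI)
      have "prob (\<Union>k\<in>{1..n * Suc m}. Bad k) \<le> (\<Sum>k\<in>{1..n * Suc m}. prob (Bad k))"
        by (rule finite_measure_subadditive_finite) (use Bad in auto)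
      also have "\<dots> \<le> (\<Sum>k\<in>{1..n * Suc m}. 2 * exp (- (e\<^sup>2 * real n / (2 * real (Suc m)))))"
        by (rule sum_mono) (rule tail)
      also have "\<dots> = real (n * Suc m) * (2 * exp (- (e\<^sup>2 * real n / (2 * real (Suc m)))))" by simp
      finally show "prob (\<Union>k\<in>{1..n * Suc m}. Bad k) \<le> e" using elim(1) by linarith
      show "(\<Union>k\<in>{1..n * Suc m}. Bad k) \<in> sets M" using Bad by auto
      fix \<omega> k assume w: "\<omega> \<in> space M - (\<Union>k\<in>{1..n * Suc m}. Bad k)" and k: "k \<le> n * Suc m"
      show "\<bar>(\<Sum>j=1..k. \<xi> j \<omega>) - (2 * p - 1) * real k\<bar> \<le> e * real n"
      proof (cases "k = 0")
        case False
        then have "\<omega> \<notin> Bad k" using w k by auto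
        then show ?thesis using w by (auto simp: Bad_def)
      qed (use e n in simp)
    qed
  qed
qed

theorem drift_limit:
  assumes p: "1/2 < p"
  shows "converges_in_distribution_U M (scaled_queue M \<alpha> \<beta> lam mu \<xi> Y 1) N
    (\<lambda>\<omega> t. (2 * p - 1) * L \<omega> (rate * t))"
proof -
  define d where "d = 2 * p - 1"
  have d: "0 < d" using p by (simp add: d_def)
  interpret path_approximation M N "scaled_queue M \<alpha> \<beta> lam mu \<xi> Y 1" "\<lambda>\<omega> t. d * L \<omega> (rate * t)"
    "\<lambda>m n \<omega>. (\<lambda>i. 0 * walk_increment m n i \<omega>, \<lambda>i. ln_time_increment m n i \<omega>)"
    "\<lambda>m \<omega>. (\<lambda>i. 0 * brownian_increment m i \<omega>, \<lambda>i. ln_subordinator_increment m i \<omega>)"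
    "\<lambda>m z. interpolate (cells m) (\<lambda>i. d * mesh_point m i) (snd z)"
  proof (unfold_locales)
    show "(\<lambda>\<omega>. (\<lambda>i. 0 * walk_increment m n i \<omega>, \<lambda>i. ln_time_increment m n i \<omega>)) \<in> borel_measurable M" for m n
      by (intro borel_measurable_Pair measurable_coordinatewise_then_product) auto
    show "(\<lambda>\<omega>. (\<lambda>i. 0 * brownian_increment m i \<omega>, \<lambda>i. ln_subordinator_increment m i \<omega>)) \<in> borel_measurable N" for m
      by (intro borel_measurable_Pair measurable_coordinatewise_then_product) auto
    show "(\<lambda>n. \<integral>\<omega>. \<phi> (\<lambda>i. 0 * walk_increment m n i \<omega>, \<lambda>i. ln_time_increment m n i \<omega>) \<partial>M) \<longlonglongrightarrow>
      (\<integral>\<omega>. (\<phi> (\<lambda>i. 0 * brownian_increment m i \<omega>, \<lambda>i. ln_subordinator_increment m i \<omega>) :: real) \<partial>N)"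
      if "continuous_on UNIV \<phi>" "bounded (range \<phi>)" for \<phi> :: "(nat \<Rightarrow> real) \<times> (nat \<Rightarrow> real) \<Rightarrow> real" and m
    proof (rule increments_converge[of "\<lambda>x. 0 * x", OF _ _ that])
      have "distr M borel (\<lambda>_. 0 :: real) = distr N borel (\<lambda>_. 0)" by simp
      then show "weak_conv_m (\<lambda>n. distr M borel (\<lambda>\<omega>. 0 * walk_increment m n i \<omega>)) (distr N borel (\<lambda>\<omega>. 0 * brownian_increment m i \<omega>))" for i
        by (simp add: weak_conv_m_def weak_conv_def)
    qed simp
    show "continuous_on (UNIV \<times> {0..}) (\<lambda>(z :: (nat \<Rightarrow> real) \<times> (nat \<Rightarrow> real), t). interpolate (cells m) (\<lambda>i. d * mesh_point m i) (snd z) t)" for m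
      by (rule continuous_on_interpolate) (auto intro: continuous_on_component)
    show "\<forall>\<^sub>F n in sequentially. AE \<omega> in M. scaled_queue M \<alpha> \<beta> lam mu \<xi> Y 1 n \<omega> \<in> cadlag" by (rule X_cadlag)
  next
    fix \<rho> :: real assume \<rho>: "0 < \<rho>"
    \<comment> \<open>Error budget: twice \<rho>/4 from the walk, \<rho>/4 from the mesh width and
      \<rho>/4 from rounding the block ends.\<close>
    have mesh: "\<forall>\<^sub>F m in sequentially. d * (1 / real (Suc m)) < \<rho> / 4"
    proof -
      have "(\<lambda>m. d * (1 / real (Suc m))) \<longlonglongrightarrow> 0" by real_asymp
      then show ?thesis using \<rho> by (intro order_tendstoD(2)) auto
    qed
    have step: "\<forall>\<^sub>F n in sequentially. d * (1 / real n) < \<rho> / 4"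
    proof -
      have "(\<lambda>n. d * (1 / real n)) \<longlonglongrightarrow> 0" by real_asymp
      then show ?thesis using \<rho> by (intro order_tendstoD(2)) auto
    qed
    show "\<forall>\<^sub>F m in sequentially. \<forall>\<^sub>F n in sequentially. \<exists>E\<in>sets M. measure M E \<le> \<rho> \<and>
      (\<forall>\<omega>\<in>space M - E. uniformly_close \<rho> (scaled_queue M \<alpha> \<beta> lam mu \<xi> Y 1 n \<omega>)
        (interpolate (cells m) (\<lambda>i. d * mesh_point m i) (snd (\<lambda>i. 0 * walk_increment m n i \<omega>, \<lambda>i. ln_time_increment m n i \<omega>))))"
      using mesh path_exception[of "\<rho> / 4" "1 / \<rho>", OF divide_pos_pos[OF \<rho> zero_less_numeral]]
    proof eventually_elim
      case (elim m)
      show ?case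
        using elim(2) walk_close_to_drift[of "\<rho> / 4" m, OF divide_pos_pos[OF \<rho> zero_less_numeral]] positive_scale(2) step eventually_ge_at_top[of "Suc m"]
      proof eventually_elim
        case (elim n)
        then obtain E1 E2 where E1: "E1 \<in> sets M" "measure M E1 \<le> \<rho> / 4"
          "\<And>\<omega>. \<omega> \<in> space M - E1 \<Longrightarrow> renewal_path Y \<omega> \<and> 1 / \<rho> < (\<Sum>j=1..n * Suc m. Y j \<omega>) / scale n"
          and E2: "E2 \<in> sets M" "measure M E2 \<le> \<rho> / 4"
          "\<And>\<omega> k. \<omega> \<in> space M - E2 \<Longrightarrow> k \<le> n * Suc m \<Longrightarrow> \<bar>(\<Sum>j=1..k. \<xi> j \<omega>) - d * real k\<bar> \<le> \<rho> / 4 * real n"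
          unfolding d_def by blast
        show ?case
        proof (intro bexI[of _ "E1 \<union> E2"] conjI ballI)
          show "E1 \<union> E2 \<in> sets M" using E1 E2 by blast
          have "measure M (E1 \<union> E2) \<le> measure M E1 + measure M E2" using E1(1) E2(1) by (rule measure_Un_le)
          then show "measure M (E1 \<union> E2) \<le> \<rho>" using E1(2) E2(2) \<rho> by linarith
          fix \<omega> assume w: "\<omega> \<in> space M - (E1 \<union> E2)"
          interpret renewal_path Y \<omega> using E1(3) w by blast
          have hor: "1 / \<rho> < S ((n * cells m) div Suc m) / scale n"
            unfolding cells_block_end S_def using E1(3) w by blast
          have n: "0 < n" using elim(5) by simp
          show "uniformly_close \<rho> (scaled_queue M \<alpha> \<beta> lam mu \<xi> Y 1 n \<omega>)
            (interpolate (cells m) (\<lambda>i. d * mesh_point m i) (snd (\<lambda>i. 0 * walk_increment m n i \<omega>, \<lambda>i. ln_time_increment m n i \<omega>)))"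
            unfolding uniformly_close_def
          proof
            fix t assume t: "t \<in> {0..1 / \<rho>}"
            have "\<bar>renewal_queue \<xi> Y \<omega> (scale n * t) / real n -
              interpolate (cells m) (\<lambda>i. d * (real i / real (Suc m))) (\<lambda>i. ln (block_sum (Suc m) n i (\<lambda>j. Y j \<omega>) / scale n)) t\<bar>
              \<le> 2 * (\<rho> / 4) + d * (1 / real (Suc m) + 1 / real n)"
            proof (rule scaled_queue_close_drift)
              show "\<bar>(\<Sum>j=1..k. \<xi> j \<omega>) - d * real k\<bar> \<le> \<rho> / 4 * real n" if "k \<le> (n * cells m) div Suc m" for k
                using E2(3)[of \<omega> k] w that unfolding cells_block_end by blast
            qed (use elim d t hor in auto)
            also have "\<dots> \<le> \<rho>" using \<open>d * (1 / real (Suc m)) < \<rho> / 4\<close> elim(4) unfolding distrib_left by linarith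
            also have "renewal_queue \<xi> Y \<omega> (scale n * t) / real n = scaled_queue M \<alpha> \<beta> lam mu \<xi> Y 1 n \<omega> t"
              using n by (simp add: scaled_queue_eq powr_minus_divide)
            finally show "\<bar>scaled_queue M \<alpha> \<beta> lam mu \<xi> Y 1 n \<omega> t -
              interpolate (cells m) (\<lambda>i. d * mesh_point m i) (snd (\<lambda>i. 0 * walk_increment m n i \<omega>, \<lambda>i. ln_time_increment m n i \<omega>)) t\<bar> \<le> \<rho>"
              using elim(3) by (simp add: ln_time_increment_def mesh_point_def)
          qed
        qed
      qed
    qed
  next
    show "AE \<omega> in N. \<forall>\<rho>>0. \<forall>\<^sub>F m in sequentially. uniformly_close \<rho> (\<lambda>t. d * L \<omega> (rate * t))
      (interpolate (cells m) (\<lambda>i. d * mesh_point m i) (snd (\<lambda>i. 0 * brownian_increment m i \<omega>, \<lambda>i. ln_subordinator_increment m i \<omega>)))"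
      using ln_subordinator_cell
    proof eventually_elim
      case (elim \<omega>)
      show ?case
      proof (intro allI impI)
        fix \<rho> :: real assume \<rho>: "0 < \<rho>"
        have "0 \<le> 1 / \<rho>" using \<rho> by simp
        with elim obtain n0 :: nat where n0: "\<forall>m\<ge>n0. \<forall>t\<in>{0..1 / \<rho>}. \<exists>j<cells m.
     (\<Sum>k<j. exp (ln_subordinator_increment m k \<omega>)) \<le> t \<and> t \<le> (\<Sum>k<Suc j. exp (ln_subordinator_increment m k \<omega>)) \<and>
     mesh_point m j \<le> L \<omega> (rate * t) \<and> L \<omega> (rate * t) \<le> mesh_point m (Suc j) \<and> L \<omega> (rate * t) \<le> real n0"
          by blast
        have "(\<lambda>m. d * (1 / real (Suc m))) \<longlonglongrightarrow> 0" by real_asymp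
        then have "\<forall>\<^sub>F m in sequentially. d * (1 / real (Suc m)) < \<rho>" using \<rho> by (intro order_tendstoD(2)) auto
        then show "\<forall>\<^sub>F m in sequentially. uniformly_close \<rho> (\<lambda>t. d * L \<omega> (rate * t))
          (interpolate (cells m) (\<lambda>i. d * mesh_point m i) (snd (\<lambda>i. 0 * brownian_increment m i \<omega>, \<lambda>i. ln_subordinator_increment m i \<omega>)))"
          using eventually_ge_at_top[of n0]
        proof eventually_elim
          case (elim m)
          show ?case
            unfolding uniformly_close_def snd_conv
          proof
            fix t assume t: "t \<in> {0..1 / \<rho>}"
            obtain j where j: "j < cells m" "(\<Sum>k<j. exp (ln_subordinator_increment m k \<omega>)) \<le> t"
              "t \<le> (\<Sum>k<Suc j. exp (ln_subordinator_increment m k \<omega>))"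
              "mesh_point m j \<le> L \<omega> (rate * t)" "L \<omega> (rate * t) \<le> mesh_point m (Suc j)"
              using n0[rule_format, OF elim(2) t] by blast
            have "\<bar>L \<omega> (rate * t) - mesh_point m j\<bar> \<le> 1 / real (Suc m)" "\<bar>L \<omega> (rate * t) - mesh_point m (Suc j)\<bar> \<le> 1 / real (Suc m)"
              using j(4,5) mesh_point(3)[of m j] by linarith+
            then have "d * \<bar>L \<omega> (rate * t) - mesh_point m j\<bar> \<le> \<rho>" "d * \<bar>L \<omega> (rate * t) - mesh_point m (Suc j)\<bar> \<le> \<rho>"
              using mult_left_mono[of _ "1 / real (Suc m)" d] d elim(1) by (meson less_imp_le order_trans)+
            then have "\<bar>d * L \<omega> (rate * t) - d * mesh_point m j\<bar> \<le> \<rho>" "\<bar>d * L \<omega> (rate * t) - d * mesh_point m (Suc j)\<bar> \<le> \<rho>"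
              using d by (simp_all add: abs_mult right_diff_distrib[symmetric])
            then show "\<bar>d * L \<omega> (rate * t) - interpolate (cells m) (\<lambda>i. d * mesh_point m i) (\<lambda>i. ln_subordinator_increment m i \<omega>) t\<bar> \<le> \<rho>"
              by (rule interpolate_close[OF j(1,2,3)])
          qed
        qed
      qed
    qed
  qed
  show ?thesis using converges_in_distribution by (simp add: d_def)
qed

text \<open>The number of blocks is only quadratic in \<open>Suc m\<close>, while the maximal
  inequality for one block decays exponentially in \<open>Suc m\<close>, uniformly in large
  \<open>n\<close>.\<close>

lemma walk_oscillation:
  assumes p: "p = 1/2" and \<rho>: "0 < \<rho>"
  shows "\<forall>\<^sub>F m in sequentially. \<forall>\<^sub>F n in sequentially. \<exists>E\<in>sets M. measure M E \<le> \<rho> \<and>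
    (\<forall>\<omega>\<in>space M - E. \<forall>i k. i < cells m \<longrightarrow> (n * i) div Suc m \<le> k \<longrightarrow> k \<le> (n * Suc i) div Suc m \<longrightarrow>
      real n powr (- (1/2)) * \<bar>\<Sum>j\<in>{(n * i) div Suc m<..k}. \<xi> j \<omega>\<bar> \<le> \<rho>)"
proof -
  \<comment> \<open>With level \<open>x\<close> equal to half of
    \<open>\<rho> * sqrt (real n)\<close> and block length at most
    \<open>2 * real n / real (Suc m)\<close>, the exponent \<open>x\<^sup>2 / (2 * real ?L)\<close>
    is at least this constant times \<open>real (Suc m)\<close>.\<close>
  define \<theta> where "\<theta> = \<rho>\<^sup>2 / 16"
  have \<theta>: "0 < \<theta>" using \<rho> by (simp add: \<theta>_def)
  have "(\<lambda>m. 4 * exp (- (\<theta> * real (Suc m)))) \<longlonglongrightarrow> 0" using \<theta> by real_asymp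
  then have 1: "\<forall>\<^sub>F m in sequentially. 4 * exp (- (\<theta> * real (Suc m))) < 1" by (rule order_tendstoD(2)) simp
  have "(\<lambda>m. real (Suc m) * real (Suc m) * (4 * exp (- (\<theta> * real (Suc m))))) \<longlonglongrightarrow> 0" using \<theta> by real_asymp
  then have 2: "\<forall>\<^sub>F m in sequentially. real (Suc m) * real (Suc m) * (4 * exp (- (\<theta> * real (Suc m)))) < \<rho>"
    by (rule order_tendstoD(2)) (rule \<rho>)
  show ?thesis using 1 2
  proof eventually_elim
    case m: (elim m)
    show ?case using eventually_ge_at_top[of "Suc m"]
    proof eventually_elim
      case n: (elim n)
      define b where "b = (\<lambda>i. (n * i) div Suc m)"
      define x where "x = \<rho> / 2 * sqrt (real n)"
      define Bad where "Bad = (\<lambda>i. {\<omega> \<in> space M. \<exists>k\<le>b (Suc i) - b i. 2 * x \<le> \<bar>\<Sum>j\<in>{b i<..b i + k}. \<xi> j \<omega>\<bar>})"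
      have n0: "0 < real n" using n by simp
      have x: "0 < x" "x\<^sup>2 = \<rho>\<^sup>2 / 4 * real n" using \<rho> n0 by (auto simp: x_def power_mult_distrib power_divide)
      have [measurable]: "(\<lambda>\<omega>. \<Sum>j\<in>{b i<..b i + k}. \<xi> j \<omega>) \<in> borel_measurable M" for i k
        by (intro borel_measurable_sum \<xi>_meas) auto
      have Bad: "Bad i \<in> sets M" for i unfolding Bad_def by measurable
      have tail: "prob (Bad i) \<le> 4 * exp (- (\<theta> * real (Suc m)))" for i
      proof -
        let ?L = "b (Suc i) - b i"
        have lt: "b i < b (Suc i)" unfolding b_def by (rule block_end_strict) (use n in auto)
        have "real ?L = real (b (Suc i)) - real (b i)" using lt by simp
        also have "\<dots> \<le> real n * real (Suc i) / real (Suc m) - (real n * real i / real (Suc m) - 1)"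
          unfolding b_def by (intro diff_mono block_end_bounds) simp_all
        also have "\<dots> = real n / real (Suc m) + 1"
          by (simp add: diff_divide_distrib[symmetric] distrib_left del: of_nat_Suc) (simp add: algebra_simps diff_divide_distrib[symmetric])
        also have "\<dots> \<le> 2 * real n / real (Suc m)"
        proof -
          have "1 \<le> real n / real (Suc m)" using n by (subst pos_le_divide_eq) auto
          then show ?thesis unfolding mult_2 add_divide_distrib by (rule add_left_mono)
        qed
        finally have L: "real ?L * real (Suc m) \<le> 2 * real n" by (simp add: field_simps)
        have "\<theta> * real (Suc m) * (2 * real ?L) \<le> \<theta> * 2 * (2 * real n)"
          using mult_left_mono[OF L, of "\<theta> * 2"] \<theta> by (simp only: mult_ac)
        also have "\<dots> = x\<^sup>2" by (simp add: x(2) \<theta>_def)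
        finally have le: "\<theta> * real (Suc m) \<le> x\<^sup>2 / (2 * real ?L)"
          using lt by (subst pos_le_divide_eq) auto
        have "prob (Bad i) \<le> 4 * exp (- (x\<^sup>2 / (2 * real ?L)))"
          unfolding Bad_def
        proof (rule maximal_inequality[OF p x(1)])
          show "4 * exp (- (x\<^sup>2 / (2 * real ?L))) \<le> 1"
            using le m(1) by (meson exp_le_cancel_iff neg_le_iff_le mult_left_mono less_imp_le order_trans zero_le_numeral)
        qed (use lt in simp)
        also have "\<dots> \<le> 4 * exp (- (\<theta> * real (Suc m)))" using le by simp
        finally show ?thesis .
      qed
      show ?case
      proof (rule bexI[of _ "\<Union>i<cells m. Bad i"], intro conjI ballI allI impI)
        have "prob (\<Union>i<cells m. Bad i) \<le> (\<Sum>i<cells m. prob (Bad i))"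
          by (rule finite_measure_subadditive_finite) (use Bad in auto)
        also have "\<dots> \<le> (\<Sum>i<cells m. 4 * exp (- (\<theta> * real (Suc m))))" by (rule sum_mono) (rule tail)
        also have "\<dots> = real (Suc m) * real (Suc m) * (4 * exp (- (\<theta> * real (Suc m))))"
          unfolding sum_constant card_lessThan cells_def of_nat_mult ..
        finally show "prob (\<Union>i<cells m. Bad i) \<le> \<rho>" using m(2) by linarith
        show "(\<Union>i<cells m. Bad i) \<in> sets M" using Bad by auto
        fix \<omega> i k assume w: "\<omega> \<in> space M - (\<Union>i<cells m. Bad i)" and i: "i < cells m"
          and k: "(n * i) div Suc m \<le> k" "k \<le> (n * Suc i) div Suc m"
        have bk: "b i + (k - b i) = k" "k - b i \<le> b (Suc i) - b i"
          using k unfolding b_def by (simp_all only: le_add_diff_inverse diff_le_mono)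
        have "\<omega> \<notin> Bad i" "\<omega> \<in> space M" using w i by auto
        then have "\<not> 2 * x \<le> \<bar>\<Sum>j\<in>{b i<..b i + (k - b i)}. \<xi> j \<omega>\<bar>" using bk(2) unfolding Bad_def by blast
        then have "\<bar>\<Sum>j\<in>{b i<..k}. \<xi> j \<omega>\<bar> \<le> \<rho> * sqrt (real n)" unfolding bk(1) x_def by simp
        then have "real n powr (- (1/2)) * \<bar>\<Sum>j\<in>{b i<..k}. \<xi> j \<omega>\<bar> \<le> real n powr (- (1/2)) * (\<rho> * sqrt (real n))"
          by (rule mult_left_mono) simp
        also have "\<dots> = \<rho>" using n0 by (simp add: powr_minus_divide powr_half_sqrt)
        finally show "real n powr (- (1/2)) * \<bar>\<Sum>j\<in>{(n * i) div Suc m<..k}. \<xi> j \<omega>\<bar> \<le> \<rho>" by (simp only: b_def)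
      qed
    qed
  qed
qed

lemma reflected_motion_close:
  assumes W: "continuous_on {0..} w" "w 0 = 0" and \<rho>: "0 < \<rho>"
  shows "\<forall>\<^sub>F m in sequentially. \<forall>j s. mesh_point m j \<le> s \<longrightarrow> s \<le> mesh_point m (Suc j) \<longrightarrow> s \<le> x \<longrightarrow>
    \<bar>reflection w s - lindley (\<lambda>i. w (mesh_point m (Suc i)) - w (mesh_point m i)) j\<bar> \<le> \<rho> \<and>
    \<bar>reflection w s - lindley (\<lambda>i. w (mesh_point m (Suc i)) - w (mesh_point m i)) (Suc j)\<bar> \<le> \<rho>"
proof -
  \<comment> \<open>The mesh cell containing a time up to \<open>x\<close> may end beyond
    \<open>x\<close>, but by no more than the mesh width, which is at most 1.\<close>
  have "uniformly_continuous_on {0..x + 1} w"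
    by (intro compact_uniformly_continuous continuous_on_subset[OF W(1)]) auto
  then obtain d where d: "0 < d" "\<And>s t. s \<in> {0..x + 1} \<Longrightarrow> t \<in> {0..x + 1} \<Longrightarrow> \<bar>s - t\<bar> < d \<Longrightarrow> \<bar>w s - w t\<bar> < \<rho> / 3"
    using \<rho> unfolding uniformly_continuous_on_def dist_real_def by (metis zero_less_divide_iff zero_less_numeral)
  have "(\<lambda>m. 1 / real (Suc m)) \<longlonglongrightarrow> 0" by real_asymp
  then have "\<forall>\<^sub>F m in sequentially. 1 / real (Suc m) < d" using d(1) by (rule order_tendstoD(2))
  then show ?thesis
  proof (eventually_elim, intro allI impI)
    fix m j s assume m: "1 / real (Suc m) < d" and s: "mesh_point m j \<le> s" "s \<le> mesh_point m (Suc j)" "s \<le> x"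
    have osc: "\<bar>w y - w (mesh_point m i)\<bar> \<le> \<rho> / 3"
      if i: "i \<le> j" and y: "mesh_point m i \<le> y" "y \<le> mesh_point m (Suc i)" for i y
    proof -
      have "mesh_point m i \<le> mesh_point m j" using i by (simp add: mesh_point_def divide_right_mono)
      moreover have "1 / real (Suc m) \<le> 1" by simp
      ultimately have "y \<in> {0..x + 1}" "mesh_point m i \<in> {0..x + 1}" "\<bar>y - mesh_point m i\<bar> < d"
        using s y m mesh_point(1)[of m i] mesh_point(3)[of m i] unfolding atLeastAtMost_iff by linarith+
      from d(2)[OF this] show ?thesis by simp
    qed
    show "\<bar>reflection w s - lindley (\<lambda>i. w (mesh_point m (Suc i)) - w (mesh_point m i)) j\<bar> \<le> \<rho> \<and>
      \<bar>reflection w s - lindley (\<lambda>i. w (mesh_point m (Suc i)) - w (mesh_point m i)) (Suc j)\<bar> \<le> \<rho>"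
      using reflection_close_to_lindley[where g="mesh_point m" and \<Delta>="\<rho> / 3" and f=w and j=j and s=s
          and u="\<lambda>i. w (mesh_point m (Suc i)) - w (mesh_point m i)",
          OF mesh_point(4) less_imp_le[OF mesh_point(2)] W(2) osc s(1,2) refl] by simp
  qed
qed

theorem reflected_limit:
  assumes p: "p = 1/2"
  shows "converges_in_distribution_U M (scaled_queue M \<alpha> \<beta> lam mu \<xi> Y (1/2)) N
    (\<lambda>\<omega> t. reflection (W \<omega>) (L \<omega> (rate * t)))"
proof -
  interpret path_approximation M N "scaled_queue M \<alpha> \<beta> lam mu \<xi> Y (1/2)" "\<lambda>\<omega> t. reflection (W \<omega>) (L \<omega> (rate * t))"
    "\<lambda>m n \<omega>. (\<lambda>i. walk_increment m n i \<omega>, \<lambda>i. ln_time_increment m n i \<omega>)"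
    "\<lambda>m \<omega>. (\<lambda>i. brownian_increment m i \<omega>, \<lambda>i. ln_subordinator_increment m i \<omega>)"
    "\<lambda>m z. interpolate (cells m) (lindley (fst z)) (snd z)"
  proof (unfold_locales)
    show "(\<lambda>\<omega>. (\<lambda>i. walk_increment m n i \<omega>, \<lambda>i. ln_time_increment m n i \<omega>)) \<in> borel_measurable M" for m n
      by (intro borel_measurable_Pair measurable_coordinatewise_then_product) auto
    show "(\<lambda>\<omega>. (\<lambda>i. brownian_increment m i \<omega>, \<lambda>i. ln_subordinator_increment m i \<omega>)) \<in> borel_measurable N" for m
      by (intro borel_measurable_Pair measurable_coordinatewise_then_product) auto
    show "(\<lambda>n. \<integral>\<omega>. \<phi> (\<lambda>i. walk_increment m n i \<omega>, \<lambda>i. ln_time_increment m n i \<omega>) \<partial>M) \<longlonglongrightarrow>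
      (\<integral>\<omega>. (\<phi> (\<lambda>i. brownian_increment m i \<omega>, \<lambda>i. ln_subordinator_increment m i \<omega>) :: real) \<partial>N)"
      if "continuous_on UNIV \<phi>" "bounded (range \<phi>)" for \<phi> :: "(nat \<Rightarrow> real) \<times> (nat \<Rightarrow> real) \<Rightarrow> real" and m
    proof (rule increments_converge[of "\<lambda>x. x", OF _ _ that])
      fix i
      have "distributed N lborel (\<lambda>\<omega>. W \<omega> t - W \<omega> s) (normal_density 0 (sqrt (t - s)))" if "0 \<le> s" "s < t" for s t
        using W that unfolding standard_brownian_motion_def by blast
      from this[OF mesh_point(1,2)]
      have "distributed N lborel (brownian_increment m i) (normal_density 0 (sqrt (mesh_point m (Suc i) - mesh_point m i)))"
        unfolding brownian_increment_def[abs_def] .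
      also have "mesh_point m (Suc i) - mesh_point m i = 1 / real (Suc m)" unfolding mesh_point(3)[of m i] by simp
      finally show "weak_conv_m (\<lambda>n. distr M borel (\<lambda>\<omega>. walk_increment m n i \<omega>)) (distr N borel (\<lambda>\<omega>. brownian_increment m i \<omega>))"
        unfolding walk_increment_def block_sum_def
        by (intro weak_conv_normalized_sum[OF p N.prob_space_axioms finite_block block_subset card_block]) auto
    qed simp
    show "continuous_on (UNIV \<times> {0..}) (\<lambda>(z :: (nat \<Rightarrow> real) \<times> (nat \<Rightarrow> real), t). interpolate (cells m) (lindley (fst z)) (snd z) t)" for m
      by (rule continuous_on_interpolate) (intro continuous_on_lindley continuous_on_component)+
    show "\<forall>\<^sub>F n in sequentially. AE \<omega> in M. scaled_queue M \<alpha> \<beta> lam mu \<xi> Y (1/2) n \<omega> \<in> cadlag" by (rule X_cadlag)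
  next
    fix \<rho> :: real assume \<rho>: "0 < \<rho>"
    show "\<forall>\<^sub>F m in sequentially. \<forall>\<^sub>F n in sequentially. \<exists>E\<in>sets M. measure M E \<le> \<rho> \<and>
      (\<forall>\<omega>\<in>space M - E. uniformly_close \<rho> (scaled_queue M \<alpha> \<beta> lam mu \<xi> Y (1/2) n \<omega>)
        (interpolate (cells m) (lindley (fst (\<lambda>i. walk_increment m n i \<omega>, \<lambda>i. ln_time_increment m n i \<omega>)))
          (snd (\<lambda>i. walk_increment m n i \<omega>, \<lambda>i. ln_time_increment m n i \<omega>))))"
      \<comment> \<open>Thirds, because comparison with Lindley's recursion triples the oscillation;
        the two exceptional events together have probability at most two thirds of \<rho>.\<close>
      using walk_oscillation[OF p, of "\<rho> / 3", OF divide_pos_pos[OF \<rho> zero_less_numeral]]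
        path_exception[of "\<rho> / 3" "1 / \<rho>", OF divide_pos_pos[OF \<rho> zero_less_numeral]]
    proof eventually_elim
      case (elim m)
      show ?case
        using elim(1,2) positive_scale(2) eventually_ge_at_top[of "Suc m"]
      proof eventually_elim
        case (elim n)
        obtain E1 where E1: "E1 \<in> sets M" "measure M E1 \<le> \<rho> / 3"
          "\<And>\<omega>. \<omega> \<in> space M - E1 \<Longrightarrow> renewal_path Y \<omega> \<and> 1 / \<rho> < (\<Sum>j=1..n * Suc m. Y j \<omega>) / scale n"
          using elim(2) by blast
        obtain E2 where E2: "E2 \<in> sets M" "measure M E2 \<le> \<rho> / 3"
          "\<And>\<omega> i k. \<omega> \<in> space M - E2 \<Longrightarrow> i < cells m \<Longrightarrow> (n * i) div Suc m \<le> k \<Longrightarrow> k \<le> (n * Suc i) div Suc m \<Longrightarrow>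
             real n powr (- (1/2)) * \<bar>\<Sum>j\<in>{(n * i) div Suc m<..k}. \<xi> j \<omega>\<bar> \<le> \<rho> / 3"
          using elim(1) by blast
        show ?case
        proof (rule bexI[of _ "E1 \<union> E2"], intro conjI ballI)
          show "E1 \<union> E2 \<in> sets M" using E1 E2 by blast
          have "measure M (E1 \<union> E2) \<le> measure M E1 + measure M E2" using E1(1) E2(1) by (rule measure_Un_le)
          then show "measure M (E1 \<union> E2) \<le> \<rho>" using E1(2) E2(2) \<rho> by linarith
          fix \<omega> assume w: "\<omega> \<in> space M - (E1 \<union> E2)"
          interpret renewal_path Y \<omega> using E1(3) w by blast
          have hor: "1 / \<rho> < S ((n * cells m) div Suc m) / scale n"
            unfolding cells_block_end S_def using E1(3) w by blast
          show "uniformly_close \<rho> (scaled_queue M \<alpha> \<beta> lam mu \<xi> Y (1/2) n \<omega>)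
            (interpolate (cells m) (lindley (fst (\<lambda>i. walk_increment m n i \<omega>, \<lambda>i. ln_time_increment m n i \<omega>)))
              (snd (\<lambda>i. walk_increment m n i \<omega>, \<lambda>i. ln_time_increment m n i \<omega>)))"
            unfolding uniformly_close_def
          proof
            fix t assume t: "t \<in> {0..1 / \<rho>}"
            have "\<bar>real n powr (- (1/2)) * renewal_queue \<xi> Y \<omega> (scale n * t) -
              interpolate (cells m) (lindley (\<lambda>i. real n powr (- (1/2)) * block_sum (Suc m) n i (\<lambda>j. \<xi> j \<omega>)))
                (\<lambda>i. ln (block_sum (Suc m) n i (\<lambda>j. Y j \<omega>) / scale n)) t\<bar> \<le> 3 * (\<rho> / 3)"
            proof (rule scaled_queue_close_reflected)
              show "real n powr (- (1/2)) * \<bar>\<Sum>j\<in>{(n * i) div Suc m<..k}. \<xi> j \<omega>\<bar> \<le> \<rho> / 3"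
                if "i < cells m" "(n * i) div Suc m \<le> k" "k \<le> (n * Suc i) div Suc m" for i k
                using E2(3)[OF _ that] w by blast
            qed (use elim t hor in auto)
            then show "\<bar>scaled_queue M \<alpha> \<beta> lam mu \<xi> Y (1/2) n \<omega> t -
              interpolate (cells m) (lindley (fst (\<lambda>i. walk_increment m n i \<omega>, \<lambda>i. ln_time_increment m n i \<omega>)))
              (snd (\<lambda>i. walk_increment m n i \<omega>, \<lambda>i. ln_time_increment m n i \<omega>)) t\<bar> \<le> \<rho>"
              using elim(3) by (simp add: scaled_queue_eq ln_time_increment_def walk_increment_def)
          qed
        qed
      qed
    qed
  next
    have W_paths: "AE \<omega> in N. continuous_on {0..} (W \<omega>)" "AE \<omega> in N. W \<omega> 0 = 0"
      using W by (auto simp: standard_brownian_motion_def)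
    show "AE \<omega> in N. \<forall>\<rho>>0. \<forall>\<^sub>F m in sequentially. uniformly_close \<rho> (\<lambda>t. reflection (W \<omega>) (L \<omega> (rate * t)))
      (interpolate (cells m) (lindley (fst (\<lambda>i. brownian_increment m i \<omega>, \<lambda>i. ln_subordinator_increment m i \<omega>)))
        (snd (\<lambda>i. brownian_increment m i \<omega>, \<lambda>i. ln_subordinator_increment m i \<omega>)))"
      using ln_subordinator_cell W_paths
    proof eventually_elim
      case (elim \<omega>)
      show ?case
      proof (intro allI impI)
        fix \<rho> :: real assume \<rho>: "0 < \<rho>"
        have "0 \<le> 1 / \<rho>" using \<rho> by simp
        with elim(1) obtain n0 :: nat where n0: "\<forall>m\<ge>n0. \<forall>t\<in>{0..1 / \<rho>}. \<exists>j<cells m.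
     (\<Sum>k<j. exp (ln_subordinator_increment m k \<omega>)) \<le> t \<and> t \<le> (\<Sum>k<Suc j. exp (ln_subordinator_increment m k \<omega>)) \<and>
     mesh_point m j \<le> L \<omega> (rate * t) \<and> L \<omega> (rate * t) \<le> mesh_point m (Suc j) \<and> L \<omega> (rate * t) \<le> real n0"
          by blast
        show "\<forall>\<^sub>F m in sequentially. uniformly_close \<rho> (\<lambda>t. reflection (W \<omega>) (L \<omega> (rate * t)))
          (interpolate (cells m) (lindley (fst (\<lambda>i. brownian_increment m i \<omega>, \<lambda>i. ln_subordinator_increment m i \<omega>)))
            (snd (\<lambda>i. brownian_increment m i \<omega>, \<lambda>i. ln_subordinator_increment m i \<omega>)))"
          using reflected_motion_close[OF elim(2,3) \<rho>, of "real n0"] eventually_ge_at_top[of n0]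
        proof eventually_elim
          case (elim m)
          show ?case
            unfolding uniformly_close_def fst_conv snd_conv
          proof
            fix t assume t: "t \<in> {0..1 / \<rho>}"
            obtain j where j: "j < cells m" "(\<Sum>k<j. exp (ln_subordinator_increment m k \<omega>)) \<le> t"
              "t \<le> (\<Sum>k<Suc j. exp (ln_subordinator_increment m k \<omega>))"
              "mesh_point m j \<le> L \<omega> (rate * t)" "L \<omega> (rate * t) \<le> mesh_point m (Suc j)" "L \<omega> (rate * t) \<le> real n0"
              using n0[rule_format, OF elim(2) t] by blast
            have "\<bar>reflection (W \<omega>) (L \<omega> (rate * t)) - lindley (\<lambda>i. brownian_increment m i \<omega>) j\<bar> \<le> \<rho>"
              "\<bar>reflection (W \<omega>) (L \<omega> (rate * t)) - lindley (\<lambda>i. brownian_increment m i \<omega>) (Suc j)\<bar> \<le> \<rho>"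
              using elim(1)[rule_format, OF j(4,5,6)] unfolding brownian_increment_def by blast+
            then show "\<bar>reflection (W \<omega>) (L \<omega> (rate * t)) -
              interpolate (cells m) (lindley (\<lambda>i. brownian_increment m i \<omega>)) (\<lambda>i. ln_subordinator_increment m i \<omega>) t\<bar> \<le> \<rho>"
              by (rule interpolate_close[OF j(1,2,3)])
          qed
        qed
      qed
    qed
  qed
  show ?thesis by (rule converges_in_distribution)
qed

end

lemma (in prob_space) indep_var_deterministic:
  assumes X [measurable]: "X \<in> measurable M S" and y: "y \<in> space T" and Y: "\<And>\<omega>. \<omega> \<in> space M \<Longrightarrow> Y \<omega> = y"
  shows "indep_var S X T Y"
proof -
  have Y_meas [measurable]: "Y \<in> measurable M T"
    using y by (subst measurable_cong[OF Y]) auto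
  interpret X: prob_space "distr M S X" by (rule prob_space_distr) measurable
  interpret Y: prob_space "distr M T Y" by (rule prob_space_distr) measurable
  have "distr M S X \<Otimes>\<^sub>M distr M T Y = distr M (S \<Otimes>\<^sub>M T) (\<lambda>\<omega>. (X \<omega>, Y \<omega>))"
  proof (rule pair_measure_eqI)
    show "sigma_finite_measure (distr M S X)" "sigma_finite_measure (distr M T Y)" by unfold_locales
    show "sets (distr M S X \<Otimes>\<^sub>M distr M T Y) = sets (distr M (S \<Otimes>\<^sub>M T) (\<lambda>\<omega>. (X \<omega>, Y \<omega>)))"
      by (simp cong: sets_pair_measure_cong)
    fix A B assume "A \<in> sets (distr M S X)" "B \<in> sets (distr M T Y)"
    then have [measurable]: "A \<in> sets S" "B \<in> sets T" by auto
    have "Y -` B \<inter> space M = (if y \<in> B then space M else {})"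
      "(\<lambda>\<omega>. (X \<omega>, Y \<omega>)) -` (A \<times> B) \<inter> space M = (if y \<in> B then X -` A \<inter> space M else {})"
      using Y by auto
    then show "emeasure (distr M S X) A * emeasure (distr M T Y) B = emeasure (distr M (S \<Otimes>\<^sub>M T) (\<lambda>\<omega>. (X \<omega>, Y \<omega>))) (A \<times> B)"
      by (simp add: emeasure_distr emeasure_space_1)
  qed
  then show ?thesis by (simp add: indep_var_distribution_eq)
qed

theorem theorem3p4:
  fixes \<alpha> \<beta> lam mu p :: real
    and P :: "'c measure" and X1 X2 :: "'c \<Rightarrow> real"
    and M :: "'a measure" and \<xi> Y :: "nat \<Rightarrow> 'a \<Rightarrow> real"
    and N :: "'b measure" and W L :: "'b \<Rightarrow> real \<Rightarrow> real"
  assumes "0 < \<alpha>" "\<alpha> < 1" "0 < \<beta>" "\<beta> < 1" "0 < lam" "0 < mu"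
    and "prob_space P"
    and "mittag_leffler_distributed P X1 \<alpha> lam" "mittag_leffler_distributed P X2 \<beta> mu"
    and "prob_space.indep_var P borel X1 borel X2"
    and "p = measure P {\<omega> \<in> space P. X1 \<omega> < X2 \<omega>}"
    and "renewal_mittag_leffler_input M \<alpha> \<beta> lam mu p \<xi> Y"
    and "prob_space N"
    and "standard_brownian_motion N W"
    and "\<alpha> + \<beta> < 1 \<Longrightarrow> inverse_stable_subordinator N (\<alpha> + \<beta>) L \<and> independent_processes N W L"
    and "\<alpha> + \<beta> \<ge> 1 \<Longrightarrow> \<forall>\<omega>\<in>space N. \<forall>t\<ge>0. L \<omega> t = t"
  shows "(p > 1/2 \<longrightarrow>
            converges_in_distribution_U
              M (scaled_queue M \<alpha> \<beta> lam mu \<xi> Y 1)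
              N (\<lambda>\<omega> t. (2 * p - 1) * L \<omega> (limit_rate M \<alpha> \<beta> lam mu Y * t))) \<and>
         (p = 1/2 \<longrightarrow>
            converges_in_distribution_U
              M (scaled_queue M \<alpha> \<beta> lam mu \<xi> Y (1/2))
              N (\<lambda>\<omega> t. reflection (W \<omega>) (L \<omega> (limit_rate M \<alpha> \<beta> lam mu Y * t)))) \<and>
         (p < 1/2 \<longrightarrow>
            (\<forall>\<delta>>0. AE_locally_uniformly_vanishing M (scaled_queue M \<alpha> \<beta> lam mu \<xi> Y \<delta>)))"
proof -
  define f where "f = (\<lambda>t. mittag_leffler \<alpha> (- lam * t powr \<alpha>))"
  define g where "g = (\<lambda>t. mittag_leffler \<beta> (- mu * t powr \<beta>))"
  interpret f: mittag_leffler_survival \<alpha> lam f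
    unfolding f_def using assms(1,2,5,7,8) by (intro mittag_leffler_survival_of_distributed)
  interpret g: mittag_leffler_survival \<beta> mu g
    unfolding g_def using assms(3,4,6,7,9) by (intro mittag_leffler_survival_of_distributed)
  interpret mittag_leffler_queue M \<xi> p \<alpha> lam f \<beta> mu g Y
    using assms(12) f.mittag_leffler_survival_axioms g.mittag_leffler_survival_axioms
    unfolding mittag_leffler_queue_def mittag_leffler_queue_axioms_def sign_steps_def sign_steps_axioms_def
      renewal_mittag_leffler_input_def f_def g_def by simp
  \<comment> \<open>If \<alpha> + \<beta> is at least 1, the identity takes the part of the
    subordinator and is its own inverse.\<close>
  have "\<exists>\<sigma>. subordinator_inverse N \<sigma> L (min (\<alpha> + \<beta>) 1)"
  proof (cases "\<alpha> + \<beta> < 1")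
    case True
    with subordinator_inverse_of_inverse_stable[OF assms(13), of "\<alpha> + \<beta>" L] assms(1,3,15)
    show ?thesis by (simp add: min_def)
  next
    case False
    with subordinator_inverse_identity[OF assms(13)] assms(16) show ?thesis by (auto simp: min_def)
  qed
  then obtain \<sigma> where \<sigma>: "subordinator_inverse N \<sigma> L (min (\<alpha> + \<beta>) 1)" ..
  \<comment> \<open>In the regime where \<open>L\<close> is the identity this is not an assumption;
    it holds because a deterministic path is independent of everything.\<close>
  have indep: "independent_processes N W L"
  proof (cases "\<alpha> + \<beta> < 1")
    case False
    interpret N: prob_space N by fact
    show ?thesis
      unfolding independent_processes_def
    proof (rule N.indep_var_deterministic)
      show "(\<lambda>\<omega>. restrict (W \<omega>) {0..}) \<in> measurable N (PiM {0..} (\<lambda>_. borel))"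
        using assms(14) by (intro measurable_restrict) (simp add: standard_brownian_motion_def)
      show "restrict (\<lambda>t. t) {0..} \<in> space (PiM {0..} (\<lambda>_. borel))" by (simp add: space_PiM)
      show "restrict (L \<omega>) {0..} = restrict (\<lambda>t. t) {0..}" if "\<omega> \<in> space N" for \<omega>
        using assms(16) False that by (intro restrict_ext) simp
    qed
  qed (use assms(15) in blast)
  interpret queue_limit M \<xi> p \<alpha> lam f \<beta> mu g Y N \<sigma> L W
    using mittag_leffler_queue_axioms \<sigma> assms(14) indep
    unfolding queue_limit_def queue_limit_axioms_def by blast
  show ?thesis
    using drift_limit reflected_limit vanishing unfolding rate_def by blast
qed

end
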